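(* Let $(E,\overline\nabla)$ be an arbitrary holomorphic bundle on $T_{\theta,\tau}$. (i) $H^0(E)$ and $H^1(E)$ are finite-dimensional. (ii) If $\operatorname{Im}(\tau)<0$, then $\dim H^0(E)-\dim H^1(E)=\deg(E)$. (iii) Equip $E$ with a Hermitian form by choosing an $A_\theta$-module isomorphism of $E$ with a direct sum of copies of a standard bundle module $E_{d,c}(\theta)$, and let $\overline\nabla^*:E\to E$ be the formal adjoint of $\overline\nabla$. Then there are orthogonal decompositions $E=\ker(\overline\nabla)\oplus\overline\nabla^*(E)$ and $E=\ker(\overline\nabla^* )\oplus\overline\nabla(E)$.
   Context: Fix $\theta\in\mathbb R\setminus\mathbb Q$, $\tau\in\mathbb C\setminus\mathbb R$. $A_\theta$ is the algebra of series $\sum a_{m,n}U_1^mU_2^n$ with rapidly decreasing coefficients and $U_1U_2=e^{2\pi i\theta}U_2U_1$, $\delta(\sum a_{m,n}U_1^mU_2^n)=2\pi i\sum(m\tau+n)a_{m,n}U_1^mU_2^n$, $\operatorname{tr}(\sum a_{m,n}U_1^mU_2^n)=a_{0,0}$, $*$ the antilinear anti-involution with $U_i^*=U_i^{-1}$. A holomorphic bundle is a pair $(E,\overline\nabla)$ with $E$ a finitely generated projective right $A_\theta$-module and $\overline\nabla:E\to E$ $\mathbb C$-linear with $\overline\nabla(ea)=\overline\nabla(e)a+e\delta(a)$; $H^0(E)=\ker\overline\nabla$, $H^1(E)=\operatorname{coker}\overline\nabla$. For coprime $(c,d)$ with $c\theta+d>0$: if $c\neq0$, $E_{d,c}(\theta)=\mathcal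 S(\mathbb R\times\mathbb Z/c\mathbb Z)$ with $fU_1(x,\alpha)=f(x-\frac1\mu,\alpha-1)$, $fU_2(x,\alpha)=\exp(2\pi i(x-\frac{\alpha d}{c}))f(x,\alpha)$, $\mu=\frac{c}{c\theta+d}$ (standard holomorphic structures $\overline\nabla_zf=\partial_xf+2\pi i(\tau\mu x+z)f$, $z\in\mathbb C$); $E_{1,0}(\theta)=A_\theta$ (standard structures $\overline\nabla_z(a)=\delta(a)+2\pi iza$). Every finitely generated projective right $A_\theta$-module is isomorphic to some $E_{d,c}(\theta)^{\oplus n}$. $\deg E_{d,c}(\theta)=c$, $\operatorname{rk}E_{d,c}(\theta)=c\theta+d$, extended additively to all finitely generated projective modules (and hence to holomorphic bundles). Hermitian form: on $E_{d,c}(\theta)$, $c\ne0$, $\langle f_1,f_2\rangle=\sum_\alpha\int_{\mathbb R}f_1\overline{f_2}dx$; on $A_\theta$, $\langle a,b\rangle=\operatorname{tr}(ab^* )$; orthogonal sum on direct sums. The formal adjoint $\overline\nabla^*$ satisfies $\langle\overline\nabla e_1,e_2\rangle=\langle e_1,\overline\nabla^*e_2\rangle$ for all $e_1,e_2\in E$ (it exists). *)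

theory Defs
  imports "HOL-Analysis.Analysis"
begin

text \<open>An element sum a(m,n) U1^m U2^n is represented by its coefficient function.\<close>
type_synonym aelt = "int \<times> int \<Rightarrow> complex"

definition rapid :: "aelt \<Rightarrow> bool" where
  "rapid a \<longleftrightarrow> (\<forall>k::nat. \<exists>C. \<forall>m n.
      (1 + \<bar>real_of_int m\<bar> + \<bar>real_of_int n\<bar>) ^ k * cmod (a (m, n)) \<le> C)"

definition Atheta :: "aelt set" where
  "Atheta = {a. rapid a}"

text \<open>Product, using U2^n U1^p = exp(-2 pi i theta n p) U1^p U2^n.\<close>
definition amult :: "real \<Rightarrow> aelt \<Rightarrow> aelt \<Rightarrow> aelt" where
  "amult \<theta> a b = (\<lambda>(r, s). infsum (\<lambda>(m, n). a (m, n) * b (r - m, s - n)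
       * exp (- 2 * pi * \<i> * complex_of_real \<theta> * of_int n * of_int (r - m))) UNIV)"

definition aconst :: "complex \<Rightarrow> aelt" where
  "aconst z = (\<lambda>mn. if mn = (0, 0) then z else 0)"

definition adelta :: "complex \<Rightarrow> aelt \<Rightarrow> aelt" where
  "adelta \<tau> a = (\<lambda>(m, n). 2 * pi * \<i> * (of_int m * \<tau> + of_int n) * a (m, n))"

definition atr :: "aelt \<Rightarrow> complex" where
  "atr a = a (0, 0)"

text \<open>(sum a U1^m U2^n)^* = sum cnj(a) U2^(-n) U1^(-m) = sum cnj(a) exp(-2 pi i theta m n) U1^(-m) U2^(-n).\<close>
definition astar :: "real \<Rightarrow> aelt \<Rightarrow> aelt" where
  "astar \<theta> a = (\<lambda>(m, n). cnj (a (- m, - n)) * exp (- 2 * pi * \<i> * complex_of_real \<theta> * of_int m * of_int n))"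

fun rderivs :: "nat \<Rightarrow> (real \<Rightarrow> complex) \<Rightarrow> real \<Rightarrow> complex" where
  "rderivs 0 f = f"
| "rderivs (Suc k) f = (\<lambda>x. vector_derivative (rderivs k f) (at x))"

definition schwartz :: "(real \<Rightarrow> complex) \<Rightarrow> bool" where
  "schwartz f \<longleftrightarrow>
     (\<forall>k x. (rderivs k f has_vector_derivative rderivs (Suc k) f x) (at x)) \<and>
     (\<forall>k m::nat. \<exists>C. \<forall>x. \<bar>x\<bar> ^ m * cmod (rderivs k f x) \<le> C)"

text \<open>Functions on R x Z/cZ are functions on R x Z that are c-periodic in the second variable.\<close>
definition Edc_carrier :: "int \<Rightarrow> (real \<Rightarrow> int \<Rightarrow> complex) set" where
  "Edc_carrier c = {f. (\<forall>x \<alpha>. f x (\<alpha> + c) = f x \<alpha>) \<and> (\<forall>\<alpha>. schwartz (\<lambda>x. f x \<alpha>))}"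

definition mu :: "real \<Rightarrow> int \<Rightarrow> int \<Rightarrow> real" where
  "mu \<theta> d c = real_of_int c / (real_of_int c * \<theta> + real_of_int d)"

definition Edc_act :: "real \<Rightarrow> int \<Rightarrow> int \<Rightarrow> (real \<Rightarrow> int \<Rightarrow> complex) \<Rightarrow> aelt \<Rightarrow> real \<Rightarrow> int \<Rightarrow> complex" where
  "Edc_act \<theta> d c f a = (\<lambda>x \<alpha>. infsum (\<lambda>(m, n). a (m, n)
      * exp (2 * pi * \<i> * of_int n * complex_of_real (x - real_of_int \<alpha> * real_of_int d / real_of_int c))
      * f (x - real_of_int m / mu \<theta> d c) (\<alpha> - m)) UNIV)"

definition Edc_form :: "int \<Rightarrow> (real \<Rightarrow> int \<Rightarrow> complex) \<Rightarrow> (real \<Rightarrow> int \<Rightarrow> complex) \<Rightarrow> complex" where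
  "Edc_form c f g = (\<Sum>\<alpha>\<in>{0..<\<bar>c\<bar>}. LINT x|lborel. f x \<alpha> * cnj (g x \<alpha>))"

definition EN_carrier :: "int \<Rightarrow> nat \<Rightarrow> (nat \<Rightarrow> real \<Rightarrow> int \<Rightarrow> complex) set" where
  "EN_carrier c n = {F. (\<forall>i<n. F i \<in> Edc_carrier c) \<and> (\<forall>i\<ge>n. F i = (\<lambda>_ _. 0))}"

definition EN_add :: "(nat \<Rightarrow> real \<Rightarrow> int \<Rightarrow> complex) \<Rightarrow> (nat \<Rightarrow> real \<Rightarrow> int \<Rightarrow> complex) \<Rightarrow> nat \<Rightarrow> real \<Rightarrow> int \<Rightarrow> complex" where
  "EN_add F G = (\<lambda>i x \<alpha>. F i x \<alpha> + G i x \<alpha>)"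

definition EN_act :: "real \<Rightarrow> int \<Rightarrow> int \<Rightarrow> (nat \<Rightarrow> real \<Rightarrow> int \<Rightarrow> complex) \<Rightarrow> aelt \<Rightarrow> nat \<Rightarrow> real \<Rightarrow> int \<Rightarrow> complex" where
  "EN_act \<theta> d c F a = (\<lambda>i. Edc_act \<theta> d c (F i) a)"

definition EN_form :: "int \<Rightarrow> nat \<Rightarrow> (nat \<Rightarrow> real \<Rightarrow> int \<Rightarrow> complex) \<Rightarrow> (nat \<Rightarrow> real \<Rightarrow> int \<Rightarrow> complex) \<Rightarrow> complex" where
  "EN_form c n F G = (\<Sum>i<n. Edc_form c (F i) (G i))"

section \<open>E_{1,0}(theta)^{\<oplus>n} = A_theta^n\<close>

definition AN_carrier :: "nat \<Rightarrow> (nat \<Rightarrow> aelt) set" where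
  "AN_carrier n = {F. (\<forall>i<n. F i \<in> Atheta) \<and> (\<forall>i\<ge>n. F i = (\<lambda>_. 0))}"

definition AN_add :: "(nat \<Rightarrow> aelt) \<Rightarrow> (nat \<Rightarrow> aelt) \<Rightarrow> nat \<Rightarrow> aelt" where
  "AN_add F G = (\<lambda>i mn. F i mn + G i mn)"

definition AN_act :: "real \<Rightarrow> (nat \<Rightarrow> aelt) \<Rightarrow> aelt \<Rightarrow> nat \<Rightarrow> aelt" where
  "AN_act \<theta> F a = (\<lambda>i. amult \<theta> (F i) a)"

definition AN_form :: "real \<Rightarrow> nat \<Rightarrow> (nat \<Rightarrow> aelt) \<Rightarrow> (nat \<Rightarrow> aelt) \<Rightarrow> complex" where
  "AN_form \<theta> n F G = (\<Sum>i<n. atr (amult \<theta> (F i) (astar \<theta> (G i))))"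

text \<open>A module E is a type 'e (its carrier is UNIV) with addition and a right action act;
  complex scalars act through the unit: z e = e (z 1).\<close>
definition mod_iso :: "('e::ab_group_add \<Rightarrow> aelt \<Rightarrow> 'e) \<Rightarrow> 'f set \<Rightarrow> ('f \<Rightarrow> 'f \<Rightarrow> 'f)
    \<Rightarrow> ('f \<Rightarrow> aelt \<Rightarrow> 'f) \<Rightarrow> ('e \<Rightarrow> 'f) \<Rightarrow> bool" where
  "mod_iso act T addT actT \<phi> \<longleftrightarrow> bij_betw \<phi> UNIV T \<and>
     (\<forall>x y. \<phi> (x + y) = addT (\<phi> x) (\<phi> y)) \<and>
     (\<forall>x. \<forall>a\<in>Atheta. \<phi> (act x a) = actT (\<phi> x) a)"

definition hol_struct :: "complex \<Rightarrow> ('e::ab_group_add \<Rightarrow> aelt \<Rightarrow> 'e) \<Rightarrow> ('e \<Rightarrow> 'e) \<Rightarrow> bool" where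
  "hol_struct \<tau> act nb \<longleftrightarrow>
     (\<forall>x y. nb (x + y) = nb x + nb y) \<and>
     (\<forall>z x. nb (act x (aconst z)) = act (nb x) (aconst z)) \<and>
     (\<forall>e. \<forall>a\<in>Atheta. nb (act e a) = act (nb e) a + act e (adelta \<tau> a))"

definition cspan :: "('e::ab_group_add \<Rightarrow> aelt \<Rightarrow> 'e) \<Rightarrow> 'e set \<Rightarrow> 'e set" where
  "cspan act B = {\<Sum>b\<in>t. act b (aconst (r b)) | t r. finite t \<and> t \<subseteq> B}"

definition fin_dim :: "('e::ab_group_add \<Rightarrow> aelt \<Rightarrow> 'e) \<Rightarrow> 'e set \<Rightarrow> bool" where
  "fin_dim act V \<longleftrightarrow> (\<exists>B. B \<subseteq> V \<and> finite B \<and> V \<subseteq> cspan act B)"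

definition fdim :: "('e::ab_group_add \<Rightarrow> aelt \<Rightarrow> 'e) \<Rightarrow> 'e set \<Rightarrow> nat" where
  "fdim act V = (LEAST k. \<exists>B. B \<subseteq> V \<and> finite B \<and> card B = k \<and> V \<subseteq> cspan act B)"

definition fin_codim :: "('e::ab_group_add \<Rightarrow> aelt \<Rightarrow> 'e) \<Rightarrow> 'e set \<Rightarrow> bool" where
  "fin_codim act W \<longleftrightarrow> (\<exists>B. finite B \<and> cspan act (B \<union> W) = UNIV)"

definition codim :: "('e::ab_group_add \<Rightarrow> aelt \<Rightarrow> 'e) \<Rightarrow> 'e set \<Rightarrow> nat" where
  "codim act W = (LEAST k. \<exists>B. finite B \<and> card B = k \<and> cspan act (B \<union> W) = UNIV)"

definition orth_decomp :: "('e::ab_group_add \<Rightarrow> 'e \<Rightarrow> complex) \<Rightarrow> 'e set \<Rightarrow> 'e set \<Rightarrow> bool" where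
  "orth_decomp h K W \<longleftrightarrow> (\<forall>k\<in>K. \<forall>w\<in>W. h k w = 0) \<and> K \<inter> W = {0} \<and>
     (\<forall>e. \<exists>k\<in>K. \<exists>w\<in>W. e = k + w)"

end

theory Submission
  imports Defs
begin

text \<open>
  Every standard operator \<open>\<partial> + \<kappa> x\<close> on Schwartz space, and \<open>\<delta>\<close> on \<open>A\<close>, has an explicit right inverse
  up to rank one which gains one order in a scale of seminorms, so it is Fredholm with index
  1 for \<open>Re \<kappa> > 0\<close>, \<open>-1\<close> for \<open>Re \<kappa> < 0\<close>, and 0 for \<open>\<delta>\<close>.
  An arbitrary holomorphic structure differs from a direct sum of standard ones by an \<open>A\<close>-linear map \<open>T\<close>.
  A finite frame of the module, built from a partition of unity and Fourier series, shows that \<open>T\<close> is bounded in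
  the weakest seminorm; iterated commutators with \<open>x\<close> and \<open>\<partial>\<close> propagate this to the whole scale.
  By a Rellich-type approximation \<open>T\<close> is a small perturbation of a finite rank map relative to the right inverse,
  and neither changes the index; a Neumann series does the rest.

  The formal adjoint is minus a holomorphic structure for the conjugate of \<open>\<tau>\<close>, hence Fredholm of
  opposite index. Since the kernel of each of the two operators is orthogonal to the image of the other,
  comparing dimensions forces both orthogonal decompositions.
\<close>

section \<open>Fredholm operators on abstract vector spaces\<close>

text \<open>Schwartz space is not a Banach space, so the Banach space theorems on closed ranges and
  stability of the index do not apply. Kernel and cokernel are therefore treated by linear algebra
  alone, and analysis enters only through estimates. Two choices make these suffice. The right
  inverse gains an order, so contraction in the weakest seminorm is enough for a Neumann series. And
  that seminorm is a sup norm on the Schwartz modules because an A-linear map is known only through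
  a frame: the Fourier series that occur there resum to functions bounded by sup \<open>|f|\<close>,
  while the sums of their coefficients are not. The sign of the index comes from
  \<open>\<kappa> = 2 * pi * \<i> * \<tau> * \<mu>\<close>: its real part is
  \<open>- 2 * pi * Im \<tau> * \<mu>\<close>, which for \<open>Im \<tau> < 0\<close> has the sign
  of c because \<open>c * \<theta> + d > 0\<close>. A sum of n copies of the module consists of
  \<open>n * |c|\<close> copies of Schwartz space, each of index \<open>sgn c\<close>, and this is
  the degree \<open>n * c\<close>. The constant z of the standard structures needs no care, being
  one of the A-linear perturbations.\<close>

locale vspace = vector_space scale for scale :: "'a::field \<Rightarrow> 'b::ab_group_add \<Rightarrow> 'b"
begin

text \<open>The domain is cut down to W while the target stays the whole space, so that the index
  can be tracked when W changes by one dimension. B spans an algebraic complement of the image; no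
  topology enters.\<close>

definition fred_on :: "('b \<Rightarrow> 'b) \<Rightarrow> 'b set \<Rightarrow> int \<Rightarrow> bool" where
  "fred_on L W k \<longleftrightarrow> (\<exists>A B. finite A \<and> independent A \<and> span A = {w \<in> W. L w = 0} \<and>
     finite B \<and> independent B \<and> span B \<inter> L ` W = {0} \<and>
     (\<forall>v. \<exists>x\<in>span B. \<exists>w\<in>W. v = x + L w) \<and> k = int (card A) - int (card B))"

lemma fred_onI:
  assumes "finite A" "independent A" "span A = {w \<in> W. L w = 0}"
    "finite B" "independent B" "\<And>x w. x \<in> span B \<Longrightarrow> w \<in> W \<Longrightarrow> x = L w \<Longrightarrow> x = 0"
    "\<And>v. \<exists>x\<in>span B. \<exists>w\<in>W. v = x + L w" "k = int (card A) - int (card B)"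
    "0 \<in> W" "L 0 = 0"
  shows "fred_on L W k"
  unfolding fred_on_def
proof (intro exI conjI)
  have "0 \<in> L ` W" using assms(9,10) by (metis imageI)
  then show "span B \<inter> L ` W = {0}"
    using assms(6) span_zero by blast
qed (use assms in auto)

lemma mem_span_insert_subspace:
  assumes "subspace W"
  shows "x \<in> span (insert v W) \<longleftrightarrow> (\<exists>w\<in>W. \<exists>c. x = w + scale c v)"
proof -
  have "span W = W" using assms by simp
  then show ?thesis
    unfolding span_breakdown_eq
    by (metis add.commute add_diff_cancel_left' diff_add_cancel)
qed

text \<open>Either \<open>L v\<close> already lies in the image of W, and then v corrected by a
  preimage is a new kernel vector, or it does not, and then the image absorbs one dimension of the
  complement. Both cases raise the index by one.\<close>

lemma fred_on_insert:
  assumes L: "module_hom scale scale L" and W: "subspace W" and v: "v \<notin> W" and F: "fred_on L W k"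
  shows "fred_on L (span (insert v W)) (k + 1)"
proof -
  interpret L: module_hom scale scale L by fact
  let ?W = "span (insert v W)"
  note memW = mem_span_insert_subspace[OF W, of _ v]
  have W0: "0 \<in> W" using W by (rule subspace_0)
  have sub: "W \<subseteq> ?W" by (meson subset_insertI span_superset subset_trans)
  obtain A B where AB: "finite A" "independent A" "span A = {w \<in> W. L w = 0}"
    "finite B" "independent B" "span B \<inter> L ` W = {0}"
    "\<And>v. \<exists>x\<in>span B. \<exists>w\<in>W. v = x + L w" "k = int (card A) - int (card B)"
    using F unfolding fred_on_def by blast
  show ?thesis
  proof (cases "L v \<in> L ` W")
    case True
    then obtain w0 where w0: "w0 \<in> W" "L v = L w0" by auto
    define u where "u = v - w0"
    have Lu: "L u = 0" by (simp add: u_def w0 L.diff)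
    have vu: "v = w0 + u" by (simp add: u_def)
    have uW: "u \<notin> W" using v w0 W vu subspace_add by metis
    have uA: "u \<notin> span A" using uW AB(3) by auto
    show ?thesis
    proof (rule fred_onI[of "insert u A" _ _ B])
      show "independent (insert u A)" using uA AB(2) by (simp add: independent_insert)
      show "span (insert u A) = {w \<in> ?W. L w = 0}"
      proof (intro set_eqI iffI)
        fix x assume "x \<in> span (insert u A)"
        then obtain c where "x - scale c u \<in> span A" unfolding span_breakdown_eq by blast
        then have 1: "x - scale c u \<in> W" "L (x - scale c u) = 0" using AB(3) by auto
        then have "L x = 0" by (simp add: L.diff L.scale Lu)
        moreover have "x = ((x - scale c u) - scale c w0) + scale c v"
          by (simp add: u_def algebra_simps)
        then have "x \<in> ?W" unfolding memW using 1(1) w0(1) W subspace_diff subspace_scale by metis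
        ultimately show "x \<in> {w \<in> ?W. L w = 0}" by simp
      next
        fix x assume "x \<in> {w \<in> ?W. L w = 0}"
        then obtain w c where x: "w \<in> W" "x = w + scale c v" "L x = 0" unfolding mem_Collect_eq memW by blast
        have "x - scale c u = w + scale c w0" using x by (simp add: u_def algebra_simps)
        then have "x - scale c u \<in> W" using x(1) w0(1) W subspace_add subspace_scale by metis
        moreover have "L (x - scale c u) = 0" using x by (simp add: L.diff L.scale Lu)
        ultimately show "x \<in> span (insert u A)" using AB(3) unfolding span_breakdown_eq by blast
      qed
      fix x w assume x: "x \<in> span B" "w \<in> ?W" "x = L w"
      then obtain w' c where "w' \<in> W" "w = w' + scale c v" using memW by blast
      then have "L w = L (w' + scale c w0)" by (simp add: L.add L.scale w0)
      moreover have "w' + scale c w0 \<in> W" using \<open>w' \<in> W\<close> w0 W subspace_add subspace_scale by metis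
      ultimately show "x = 0" using x AB(6) by auto
    next
      fix y show "\<exists>x\<in>span B. \<exists>w\<in>?W. y = x + L w" using AB(7)[of y] sub by blast
    next
      have "u \<notin> A" using uA span_base by blast
      then show "k + 1 = int (card (insert u A)) - int (card B)" using AB by simp
    qed (use AB(1,2,4,5) subsetD[OF sub W0] W0 L.zero in simp_all)
  next
    case False
    obtain b w0 where b: "b \<in> span B" "w0 \<in> W" "L v = b + L w0" using AB(7) by metis
    have b0: "b \<noteq> 0" using False b by auto
    have bi: "independent {b}" using b0 by (simp add: dependent_single)
    have bs: "{b} \<subseteq> span B" using b by simp
    \<comment> \<open>A basis of the complement is needed that contains b, the component of
      \<open>L v\<close> outside the image; deleting b from it leaves a basis of a complement of the
      larger image.\<close>
    obtain C where C: "{b} \<subseteq> C" "C \<subseteq> span B" "independent C" "span B \<subseteq> span C"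
      by (rule maximal_independent_subset_extend[OF bs bi])
    have Cspan: "span C = span B" using C(2,4) span_mono span_span by (metis subset_antisym)
    have Cf: "finite C" using independent_span_bound[OF AB(4) C(3) C(2)] by simp
    have Cc: "card C = card B"
      using independent_span_bound[OF AB(4) C(3) C(2)] independent_span_bound[OF Cf AB(5)]
        Cspan span_superset by (metis le_antisym)
    define B' where "B' = C - {b}"
    have C_eq: "C = insert b B'" using C(1) B'_def by auto
    have bB': "b \<notin> B'" by (simp add: B'_def)
    have bsp: "b \<notin> span B'" using C(3) C_eq bB' independent_insert by metis
    have B'i: "independent B'" using C(3) B'_def independent_mono by blast
    have B'sub: "span B' \<subseteq> span B" using Cspan span_mono[of B' C] C_eq by blast
    show ?thesis
    proof (rule fred_onI[of A _ _ B'])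
      show "span A = {w \<in> ?W. L w = 0}"
      proof -
        have "w \<in> W" if w: "w \<in> ?W" "L w = 0" for w
        proof -
          obtain w' c where w': "w' \<in> W" "w = w' + scale c v" using w memW by blast
          have "c = 0"
          proof (rule ccontr)
            assume c: "c \<noteq> 0"
            have "scale c (L v) = L (- w')" using w w' by (simp add: L.add L.scale L.neg eq_neg_iff_add_eq_0 add.commute)
            then have "scale (inverse c) (scale c (L v)) = L (scale (inverse c) (- w'))" by (simp only: L.scale)
            then have "L v = L (scale (inverse c) (- w'))" using c by simp
            moreover have "scale (inverse c) (- w') \<in> W" using w' W subspace_neg subspace_scale by metis
            ultimately show False using False by blast
          qed
          then show ?thesis using w' by simp
        qed
        then show ?thesis using AB(3) sub by auto
      qed
      fix x w assume x: "x \<in> span B'" "w \<in> ?W" "x = L w"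
      then obtain w' c where w': "w' \<in> W" "w = w' + scale c v" using memW by blast
      then have e: "x - scale c b = L (w' + scale c w0)" using x b by (simp add: L.add L.scale algebra_simps)
      have "w' + scale c w0 \<in> W" using w' b W subspace_add subspace_scale by metis
      moreover have "x - scale c b \<in> span B" using x(1) B'sub b(1) span_diff span_scale by blast
      ultimately have z: "x - scale c b = 0" using e AB(6) by auto
      have "c = 0"
      proof (rule ccontr)
        assume c: "c \<noteq> 0"
        have "b = scale (inverse c) x" using z c by simp
        then have "b \<in> span B'" using x(1) span_scale by blast
        then show False using bsp by simp
      qed
      then show "x = 0" using z by simp
    next
      fix y
      obtain x w where y: "x \<in> span B" "w \<in> W" "y = x + L w" using AB(7) by blast
      then have "x \<in> span (insert b B')" using Cspan C_eq by simp
      then obtain c where c: "x - scale c b \<in> span B'" unfolding span_breakdown_eq by blast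
      have "y = (x - scale c b) + L ((w - scale c w0) + scale c v)"
        using y b by (simp add: L.add L.scale L.diff algebra_simps)
      moreover have "(w - scale c w0) + scale c v \<in> ?W" unfolding memW using y b W subspace_diff subspace_scale by metis
      ultimately show "\<exists>x\<in>span B'. \<exists>w\<in>?W. y = x + L w" using c by blast
    next
      have "card C = Suc (card B')" using C_eq bB' Cf by (metis card_insert_disjoint finite_insert)
      then show "k + 1 = int (card A) - int (card B')" using AB Cc by simp
    qed (use AB(1,2) subsetD[OF sub W0] Cf B'i B'_def L.zero in simp_all)
  qed
qed

text \<open>The same alternative read backwards: if some kernel vector lies outside W, the kernel
  shrinks by one; otherwise \<open>L v\<close> is lost from the image and joins the
  complement.\<close>

lemma fred_on_remove:
  assumes L: "module_hom scale scale L" and W: "subspace W" and v: "v \<notin> W"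
    and F: "fred_on L (span (insert v W)) k"
  shows "fred_on L W (k - 1)"
proof -
  interpret L: module_hom scale scale L by fact
  let ?W = "span (insert v W)"
  note memW = mem_span_insert_subspace[OF W, of _ v]
  have W0: "0 \<in> W" using W by (rule subspace_0)
  have sub: "W \<subseteq> ?W" by (meson subset_insertI span_superset subset_trans)
  have vW: "v \<in> ?W" by (simp add: span_base)
  obtain A B where AB: "finite A" "independent A" "span A = {w \<in> ?W. L w = 0}"
    "finite B" "independent B" "span B \<inter> L ` ?W = {0}"
    "\<And>v. \<exists>x\<in>span B. \<exists>w\<in>?W. v = x + L w" "k = int (card A) - int (card B)"
    using F unfolding fred_on_def by blast
  show ?thesis
  proof (cases "span A \<subseteq> W")
    case False
    then obtain w0 where w0: "w0 \<in> ?W" "L w0 = 0" "w0 \<notin> W" using AB(3) by auto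
    obtain w1 c1 where w1: "w1 \<in> W" "w0 = w1 + scale c1 v" using w0(1) memW by blast
    have c1: "c1 \<noteq> 0" using w1 w0(3) by auto
    have veq: "v = scale (inverse c1) (w0 - w1)" using w1 c1 by simp
    \<comment> \<open>The kernel vector w0 takes over from v as the direction transversal to W.
      Since L kills it, W has the same image as the larger space.\<close>
    have split: "\<exists>w\<in>W. \<exists>c. x = w + scale c w0" if "x \<in> ?W" for x
    proof -
      obtain w c where wc: "w \<in> W" "x = w + scale c v" using \<open>x \<in> ?W\<close> memW by blast
      have "x = (w - scale (c * inverse c1) w1) + scale (c * inverse c1) w0"
        using wc by (subst wc(2), subst veq) (simp add: scale_right_diff_distrib algebra_simps)
      then show ?thesis using wc w1 W subspace_diff subspace_scale by metis
    qed
    let ?K = "{w \<in> W. L w = 0}"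
    have K: "subspace ?K" using W W0
      by (auto simp: subspace_def L.add L.scale)
    obtain A0 where A0: "A0 \<subseteq> ?K" "independent A0" "?K \<subseteq> span A0"
      using maximal_independent_subset by blast
    have spA0: "span A0 = ?K" using A0 K by (metis span_minimal subset_antisym)
    have w0A: "w0 \<notin> span A0" using w0 spA0 by auto
    have ind: "independent (insert w0 A0)" using w0A A0(2) by (simp add: independent_insert)
    have spI: "span (insert w0 A0) = span A"
    proof (intro set_eqI iffI)
      fix x assume "x \<in> span (insert w0 A0)"
      then obtain c where "x - scale c w0 \<in> ?K" unfolding span_breakdown_eq spA0 by blast
      then have "x - scale c w0 \<in> span A" using AB(3) sub by auto
      moreover have "scale c w0 \<in> span A" using AB(3) w0 by (intro span_scale) auto
      ultimately show "x \<in> span A" using span_add by fastforce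
    next
      fix x assume x: "x \<in> span A"
      then obtain w c where wc: "w \<in> W" "x = w + scale c w0" using split AB(3) by blast
      have "L x = 0" using x AB(3) by auto
      then have "L w = 0" using wc w0 by (simp add: L.add L.scale)
      then have "x - scale c w0 \<in> span A0" using wc spA0 by simp
      then show "x \<in> span (insert w0 A0)" unfolding span_breakdown_eq by blast
    qed
    have sA: "insert w0 A0 \<subseteq> span A" using span_superset[of "insert w0 A0"] unfolding spI .
    have fA0: "finite (insert w0 A0)" using independent_span_bound[OF AB(1) ind sA] by simp
    have cA: "card (insert w0 A0) = card A"
      using independent_span_bound[OF AB(1) ind sA] independent_span_bound[OF fA0 AB(2)] spI span_superset
      by (metis le_antisym)
    have "w0 \<notin> A0" using w0A span_base by blast
    then have cA': "card A = Suc (card A0)" using cA fA0 by simp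
    show ?thesis
    proof (rule fred_onI[of A0 _ _ B])
      fix y
      obtain x w where y: "x \<in> span B" "w \<in> ?W" "y = x + L w" using AB(7) by blast
      obtain w' c where wc: "w' \<in> W" "w = w' + scale c w0" using split y(2) by blast
      then have "L w = L w'" using w0 by (simp add: L.add L.scale)
      then show "\<exists>x\<in>span B. \<exists>w\<in>W. y = x + L w" using y wc by auto
    qed (use AB(4,5,6,8) subsetD[OF sub] W0 fA0 A0(2) spA0 cA' L.zero in auto)
  next
    case True
    have nr: "L v \<noteq> L w" if "w \<in> W" for w
    proof
      assume "L v = L w"
      then have "L (v - w) = 0" by (simp add: L.diff)
      moreover have "v - w \<in> ?W" using vW sub that span_diff by blast
      ultimately have "v - w \<in> W" using True AB(3) by blast
      then have "(v - w) + w \<in> W" using that W subspace_add by blast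
      then show False using v by simp
    qed
    have Lvn: "L v \<notin> span B" using AB(6) vW nr[OF W0] by auto
    show ?thesis
    proof (rule fred_onI[of A _ _ "insert (L v) B"])
      show "span A = {w \<in> W. L w = 0}" using True AB(3) sub by auto
      show "independent (insert (L v) B)" using Lvn AB(5) by (simp add: independent_insert)
      fix x w assume x: "x \<in> span (insert (L v) B)" "w \<in> W" "x = L w"
      then obtain c where c: "x - scale c (L v) \<in> span B" unfolding span_breakdown_eq by blast
      have "x - scale c (L v) = L (w - scale c v)" using x by (simp add: L.diff L.scale)
      moreover have "w - scale c v \<in> ?W" using x vW sub span_diff span_scale by blast
      ultimately have z: "x - scale c (L v) = 0" using c AB(6) by auto
      have "c = 0"
      proof (rule ccontr)
        assume c0: "c \<noteq> 0"
        have "L v = scale (inverse c) x" using z c0 by simp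
        then have "L v = L (scale (inverse c) w)" using x by (simp add: L.scale)
        then show False using nr x(2) W subspace_scale by blast
      qed
      then show "x = 0" using z by simp
    next
      fix y
      obtain x w where y: "x \<in> span B" "w \<in> ?W" "y = x + L w" using AB(7) by blast
      obtain w' c where wc: "w' \<in> W" "w = w' + scale c v" using memW y(2) by blast
      have "y = (x + scale c (L v)) + L w'" using y wc by (simp add: L.add L.scale)
      moreover have "x + scale c (L v) \<in> span (insert (L v) B)"
        using y(1) by (auto simp: span_breakdown_eq intro!: exI[of _ c])
      ultimately show "\<exists>x\<in>span (insert (L v) B). \<exists>w\<in>W. y = x + L w" using wc by blast
    next
      have "L v \<notin> B" using Lvn span_base by blast
      then show "k - 1 = int (card A) - int (card (insert (L v) B))" using AB by simp
    qed (use AB(1,2,4,5) subsetD[OF sub W0] W0 L.zero in simp_all)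
  qed
qed

lemma fred_on_cong:
  assumes "\<And>w. w \<in> W \<Longrightarrow> L w = L' w" shows "fred_on L W k \<longleftrightarrow> fred_on L' W k"
proof -
  have "{w \<in> W. L w = 0} = {w \<in> W. L' w = 0}" using assms by auto
  moreover have "L ` W = L' ` W" using assms by auto
  moreover have "(\<exists>w\<in>W. v = x + L w) = (\<exists>w\<in>W. v = x + L' w)" for x v using assms by auto
  ultimately show ?thesis unfolding fred_on_def by presburger
qed

text \<open>On the hyperplane where l vanishes the two operators agree. Restricting L to it costs
  one unit of index, and extending the perturbed operator back to the whole space returns
  it.\<close>

lemma fred_rank_one:
  assumes L: "module_hom scale scale L" and F: "fred_on L UNIV k"
    and l: "\<And>x y. l (x + y) = l x + l y" "\<And>c x. l (scale c x) = c * l x"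
  shows "fred_on (\<lambda>x. L x + scale (l x) r) UNIV k"
proof (cases "\<exists>v. l v \<noteq> 0")
  case True
  interpret L: module_hom scale scale L by fact
  let ?L = "\<lambda>x. L x + scale (l x) r"
  have L': "module_hom scale scale ?L"
    by unfold_locales (auto simp: L.add L.scale l scale_left_distrib algebra_simps)
  obtain v0 where v0: "l v0 \<noteq> 0" using True by blast
  define W where "W = {x. l x = 0}"
  have W: "subspace W" unfolding W_def subspace_def using l(2)[of 0 0] by (auto simp: l)
  have v0W: "v0 \<notin> W" using v0 by (simp add: W_def)
  have ml: "l (x - y) = l x - l y" for x y using l(1)[of "x - y" y] by simp
  have "x \<in> span (insert v0 W)" for x
  proof -
    have "x = (x - scale (l x / l v0) v0) + scale (l x / l v0) v0" by simp
    moreover have "x - scale (l x / l v0) v0 \<in> W" using v0 by (simp add: W_def ml l)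
    ultimately show ?thesis unfolding mem_span_insert_subspace[OF W] by blast
  qed
  then have U: "span (insert v0 W) = UNIV" by blast
  have "fred_on L W (k - 1)" using fred_on_remove[OF L W v0W] F U by simp
  then have "fred_on ?L W (k - 1)"
    by (subst fred_on_cong[of _ _ L]) (auto simp: W_def)
  from fred_on_insert[OF L' W v0W this] show ?thesis using U by simp
qed (use F in auto)

text \<open>Linearity is carried along in the conclusion because the induction, and later the second
  of two successive perturbations, take it as a premise.\<close>

lemma fred_finite_rank:
  assumes L: "module_hom scale scale L" and F: "fred_on L UNIV k" and J: "finite J"
    and l: "\<And>j x y. j \<in> J \<Longrightarrow> l j (x + y) = l j x + l j y" "\<And>j c x. j \<in> J \<Longrightarrow> l j (scale c x) = c * l j x"
  shows "fred_on (\<lambda>x. L x + (\<Sum>j\<in>J. scale (l j x) (r j))) UNIV k \<and>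
     module_hom scale scale (\<lambda>x. L x + (\<Sum>j\<in>J. scale (l j x) (r j)))"
  using J l
proof (induction J rule: finite_induct)
  case empty then show ?case using L F by simp
next
  case (insert i J)
  let ?M = "\<lambda>x. L x + (\<Sum>j\<in>J. scale (l j x) (r j))"
  have IH: "fred_on ?M UNIV k" "module_hom scale scale ?M" using insert by auto
  interpret M: module_hom scale scale ?M by (rule IH(2))
  have e: "(\<lambda>x. L x + (\<Sum>j\<in>insert i J. scale (l j x) (r j))) = (\<lambda>x. ?M x + scale (l i x) (r i))"
    using insert by (auto simp: algebra_simps)
  have "module_hom scale scale (\<lambda>x. ?M x + scale (l i x) (r i))"
    using M.add M.scale insert.prems by unfold_locales (simp_all add: scale_left_distrib scale_right_distrib)
  moreover have "fred_on (\<lambda>x. ?M x + scale (l i x) (r i)) UNIV k"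
    by (rule fred_rank_one) (use IH insert.prems in auto)
  ultimately show ?case unfolding e by blast
qed

lemma fred_comp_bij:
  assumes F: "fred_on L UNIV k" and U: "module_hom scale scale U" and bij: "bij U"
  shows "fred_on (\<lambda>x. L (U x)) UNIV k"
proof -
  interpret U: module_hom scale scale U by fact
  obtain A B where AB: "finite A" "independent A" "span A = {w. L w = 0}"
    "finite B" "independent B" "span B \<inter> range L = {0}"
    "\<And>v. \<exists>x\<in>span B. \<exists>w. v = x + L w" "k = int (card A) - int (card B)"
    using F unfolding fred_on_def by auto
  have iU: "module_hom scale scale (inv U)"
    using bij by unfold_locales (metis U.add U.scale bij_inv_eq_iff)+
  interpret I: module_hom scale scale "inv U" by fact
  have inj: "inj (inv U)" using bij bij_imp_bij_inv bij_is_inj by blast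
  interpret vp: vector_space_pair scale scale by unfold_locales
  have 1: "independent (inv U ` A)"
    using vp.linear_independent_injective_image[of "inv U" A] AB(2) inj iU
    by (meson linear_def subset_UNIV inj_on_subset vp.vector_space_pair_axioms Vector_Spaces.linear.intro vector_space_axioms)
  have 2: "span (inv U ` A) = {w. L (U w) = 0}"
  proof -
    have "span (inv U ` A) = inv U ` span A" by (simp add: I.span_image)
    also have "\<dots> = {w. L (U w) = 0}"
    proof (intro set_eqI iffI)
      fix w assume "w \<in> {w. L (U w) = 0}"
      then have "U w \<in> span A" using AB(3) by simp
      moreover have "w = inv U (U w)" using bij by (simp add: bij_is_inj)
      ultimately show "w \<in> inv U ` span A" by (rule rev_image_eqI)
    next
      fix w assume "w \<in> inv U ` span A"
      then obtain a where a: "a \<in> span A" "w = inv U a" by blast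
      have "U w = a" using a(2) bij by (simp add: bij_is_surj surj_f_inv_f)
      then show "w \<in> {w. L (U w) = 0}" using a(1) AB(3) by simp
    qed
    finally show ?thesis .
  qed
  have 3: "card (inv U ` A) = card A" using inj by (metis card_image inj_on_subset subset_UNIV)
  have 4: "range (\<lambda>x. L (U x)) = range L" using bij by (metis bij_is_surj image_image)
  have 5: "\<exists>x\<in>span B. \<exists>w. v = x + L (U w)" for v using AB(7)[of v] bij by (metis bij_pointE)
  show ?thesis unfolding fred_on_def
    by (rule exI[of _ "inv U ` A"], rule exI[of _ B]) (use AB 1 2 3 4 5 in auto)
qed

section \<open>Comparison of complements, and orthogonal decompositions\<close>

text \<open>Replacing each element of C by a representative modulo W in \<open>span B\<close>
  extends to a linear map on \<open>span C\<close>. It is injective: two vectors with the same value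
  differ by an element of \<open>span C\<close> that lies in W.\<close>

lemma card_complement_le:
  assumes C: "independent C" "finite C" "span C \<inter> W = {0}" and W: "subspace W"
    and B: "finite B" "\<And>v. \<exists>x\<in>span B. \<exists>w\<in>W. v = x + w"
  shows "card C \<le> card B"
proof -
  interpret vp: vector_space_pair scale scale by unfold_locales
  obtain f where f: "\<And>v. f v \<in> span B" "\<And>v. v - f v \<in> W"
    using B(2) by (metis add_diff_cancel_left')
  obtain g where g: "Vector_Spaces.linear scale scale g" "\<And>x. x \<in> C \<Longrightarrow> g x = f x"
    using vp.linear_independent_extend[OF C(1), of f] by blast
  interpret g: Vector_Spaces.linear scale scale g by fact
  have gW: "x - g x \<in> W \<and> g x \<in> span B" if "x \<in> span C" for x
    using that
  proof (induction rule: span_induct_alt)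
    case base then show ?case using W subspace_0 span_zero by simp
  next
    case (step c x y)
    have "(scale c x + y) - g (scale c x + y) = scale c (x - g x) + (y - g y)"
      by (simp add: g.add g.scale algebra_simps)
    then show ?case using step W f g(2) by (metis g.add g.scale span_add span_scale subspace_add subspace_scale)
  qed
  have inj: "inj_on g (span C)"
  proof (rule inj_onI)
    fix x y assume xy: "x \<in> span C" "y \<in> span C" "g x = g y"
    have "x - y \<in> span C" using xy span_diff by blast
    moreover have "x - y = (x - g x) - (y - g y)" using xy by simp
    then have "x - y \<in> W" using gW xy W subspace_diff by metis
    ultimately have "x - y = 0" using C(3) by blast
    then show "x = y" by simp
  qed
  have "independent (g ` C)" using vp.linear_independent_injective_image[OF g(1) C(1)] inj by blast
  moreover have "g ` C \<subseteq> span B" using gW span_base by blast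
  ultimately have "card (g ` C) \<le> card B" using independent_span_bound[OF B(1)] by blast
  moreover have "card (g ` C) = card C" using inj span_superset by (metis card_image inj_on_subset)
  ultimately show ?thesis by simp
qed

text \<open>If some v were not reached, C enlarged by v would still be independent and meet W only
  in 0, one element too many for \<open>card_complement_le\<close>.\<close>

lemma complement_of_card:
  assumes C: "independent C" "finite C" "span C \<inter> W = {0}" and W: "subspace W"
    and B: "finite B" "\<And>v. \<exists>x\<in>span B. \<exists>w\<in>W. v = x + w" and le: "card B \<le> card C"
  shows "\<exists>x\<in>span C. \<exists>w\<in>W. v = x + w"
proof (rule ccontr)
  assume n: "\<not> ?thesis"
  have vC: "v \<notin> span C" using n W subspace_0 by (metis add.right_neutral)
  have "span (insert v C) \<inter> W = {0}"
  proof -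
    have "x = 0" if x: "x \<in> span (insert v C)" "x \<in> W" for x
    proof -
      obtain c where c: "x - scale c v \<in> span C" using x unfolding span_breakdown_eq by blast
      have "c = 0"
      proof (rule ccontr)
        assume c0: "c \<noteq> 0"
        have "v = scale (- inverse c) (x - scale c v) + scale (inverse c) x"
          using c0 by (simp add: scale_right_diff_distrib)
        moreover have "scale (- inverse c) (x - scale c v) \<in> span C" using c by (rule span_scale)
        moreover have "scale (inverse c) x \<in> W" using x(2) W subspace_scale by blast
        ultimately show False using n by blast
      qed
      then show ?thesis using c x C(3) by auto
    qed
    then show ?thesis using W subspace_0 span_zero by blast
  qed
  then have "card (insert v C) \<le> card B"
    using card_complement_le[of "insert v C" W B] C W B vC by (simp add: independent_insert)
  moreover have "v \<notin> C" using vC span_base by blast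
  ultimately show False using le C(2) by simp
qed

text \<open>If \<open>x = M y\<close> and \<open>L x = 0\<close> then
  \<open>h x x = h (L x) y = 0\<close>, so each kernel meets the image of the other operator
  trivially. This bounds the kernel dimensions by codimensions, the opposite indices turn the bounds
  into equalities, and a kernel of the right dimension is a full complement.\<close>

lemma orthogonal_complements:
  assumes L: "module_hom scale scale L" and M: "module_hom scale scale M"
    and FL: "fred_on L UNIV k" and FM: "fred_on M UNIV (- k)"
    and h: "\<And>x y. h (L x) y = h x (M y)" and h0: "\<And>x. h x x = (0::complex) \<Longrightarrow> x = 0"
      "\<And>y. h 0 y = 0" "\<And>x. h x 0 = 0"
  shows "orth_decomp h {e. L e = 0} (range M)"
    "\<lbrakk>\<And>x y. h y x = cnj (h x y)\<rbrakk> \<Longrightarrow> orth_decomp h {e. M e = 0} (range L)"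
proof -
  interpret L: module_hom scale scale L by fact
  interpret M: module_hom scale scale M by fact
  obtain A B where AB: "finite A" "independent A" "span A = {w. L w = 0}"
    "finite B" "independent B" "span B \<inter> range L = {0}"
    "\<And>v. \<exists>x\<in>span B. \<exists>w. v = x + L w" "k = int (card A) - int (card B)"
    using FL unfolding fred_on_def by auto
  obtain A' B' where AB': "finite A'" "independent A'" "span A' = {w. M w = 0}"
    "finite B'" "independent B'" "span B' \<inter> range M = {0}"
    "\<And>v. \<exists>x\<in>span B'. \<exists>w. v = x + M w" "- k = int (card A') - int (card B')"
    using FM unfolding fred_on_def by auto
  have sL: "subspace (range L)" by (rule L.subspace_image) simp
  have sM: "subspace (range M)" by (rule M.subspace_image) simp
  have iA: "span A \<inter> range M = {0}"
  proof -
    have "x = 0" if "L x = 0" "x = M y" for x y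
    proof (rule h0(1))
      have "h x x = h (L x) y" unfolding h using that(2) by (rule arg_cong)
      then show "h x x = 0" unfolding that(1) h0(2) .
    qed
    then have "x = 0" if "x \<in> span A" "x \<in> range M" for x using that AB(3) by blast
    moreover have "0 \<in> span A" "0 \<in> range M" by (rule span_zero, rule subspace_0[OF sM])
    ultimately show ?thesis by blast
  qed
  have iA': "span A' \<inter> range L = {0}"
  proof -
    have "x = 0" if "M x = 0" "x = L y" for x y
    proof (rule h0(1))
      have "h x x = h (L y) x" using that(2) by (rule arg_cong)
      then show "h x x = 0" unfolding h that(1) h0(3) .
    qed
    then have "x = 0" if "x \<in> span A'" "x \<in> range L" for x using that AB'(3) by blast
    moreover have "0 \<in> span A'" "0 \<in> range L" by (rule span_zero, rule subspace_0[OF sL])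
    ultimately show ?thesis by blast
  qed
  have BL: "\<exists>x\<in>span B. \<exists>w\<in>range L. v = x + w" for v using AB(7)[of v] by blast
  have BM: "\<exists>x\<in>span B'. \<exists>w\<in>range M. v = x + w" for v using AB'(7)[of v] by blast
  have 1: "card A' \<le> card B" by (rule card_complement_le[OF AB'(2,1) iA' sL AB(4) BL])
  have 2: "card A \<le> card B'" by (rule card_complement_le[OF AB(2,1) iA sM AB'(4) BM])
  \<comment> \<open>The two index equations add up to
    \<open>card A + card A' = card B + card B'\<close>, so neither of the inequalities 1 and 2 can
    be strict.\<close>
  have 3: "card B \<le> card A'" "card B' \<le> card A" using 1 2 AB(8) AB'(8) by linarith+
  have d1: "\<exists>x\<in>span A. \<exists>w\<in>range M. v = x + w" for v
    by (rule complement_of_card[OF AB(2,1) iA sM AB'(4) BM 3(2)])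
  have d2: "\<exists>x\<in>span A'. \<exists>w\<in>range L. v = x + w" for v
    by (rule complement_of_card[OF AB'(2,1) iA' sL AB(4) BL 3(1)])
  show "orth_decomp h {e. L e = 0} (range M)"
    unfolding orth_decomp_def
  proof (intro conjI ballI allI)
    fix k w assume "k \<in> {e. L e = 0}" "w \<in> range M"
    then obtain y where "L k = 0" "w = M y" by blast
    then show "h k w = 0" using h[of k y] h0(2) by simp
  qed (use iA d1 AB(3) in auto)
  show "orth_decomp h {e. M e = 0} (range L)" if "\<And>x y. h y x = cnj (h x y)"
  proof -
    have "h x (L y) = 0" if "M x = 0" for x y
      using h[of y x] that h0 \<open>\<And>x y. h y x = cnj (h x y)\<close> by (metis complex_cnj_zero)
    then show ?thesis
      unfolding orth_decomp_def using iA' d2 AB'(3) by auto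
  qed
qed

end

lemma cspan_eq_span:
  assumes "vspace (\<lambda>z e. act e (aconst z))"
  shows "cspan act B = module.span (\<lambda>z e. act e (aconst z)) B"
proof -
  interpret vspace "\<lambda>z e. act e (aconst z)" by fact
  show ?thesis unfolding cspan_def span_explicit ..
qed

text \<open>The bases supplied by \<open>fred_on\<close> attain the minima in \<open>fdim\<close>
  and \<open>codim\<close>. Minimality is the exchange lemma for the kernel and
  \<open>card_complement_le\<close> for the cokernel.\<close>

lemma fred_on_imp_index:
  assumes V: "vspace (\<lambda>z e. act e (aconst z))"
    and L: "module_hom (\<lambda>z e. act e (aconst z)) (\<lambda>z e. act e (aconst z)) L"
    and F: "vspace.fred_on (\<lambda>z e. act e (aconst z)) L UNIV k"
  shows "fin_dim act {e. L e = 0}" "fin_codim act (range L)"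
    "int (fdim act {e. L e = 0}) - int (codim act (range L)) = k"
proof -
  interpret vspace "\<lambda>z e. act e (aconst z)" by fact
  interpret L: module_hom "\<lambda>z e. act e (aconst z)" "\<lambda>z e. act e (aconst z)" L by fact
  note cs = cspan_eq_span[OF V]
  obtain A B where AB: "finite A" "independent A" "span A = {w. L w = 0}"
    "finite B" "independent B" "span B \<inter> range L = {0}"
    "\<And>v. \<exists>x\<in>span B. \<exists>w. v = x + L w" "k = int (card A) - int (card B)"
    using F unfolding fred_on_def by auto
  have sL: "subspace (range L)" by (rule L.subspace_image) simp
  have A1: "A \<subseteq> {e. L e = 0}" "{e. L e = 0} \<subseteq> cspan act A"
    using AB(3) span_superset cs by auto
  show "fin_dim act {e. L e = 0}" unfolding fin_dim_def using A1 AB(1) by blast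
  have sp: "span (C \<union> range L) = UNIV \<longleftrightarrow> (\<forall>v. \<exists>x\<in>span C. \<exists>w\<in>range L. v = x + w)" for C
  proof -
    have "span (range L) = range L" using sL by simp
    then have "span (C \<union> range L) = {x + w |x w. x \<in> span C \<and> w \<in> range L}" by (simp only: span_Un)
    then show ?thesis by blast
  qed
  have B1: "cspan act (B \<union> range L) = UNIV" unfolding cs sp using AB(7) by blast
  show "fin_codim act (range L)" unfolding fin_codim_def using B1 AB(4) by blast
  have "fdim act {e. L e = 0} = card A" unfolding fdim_def
  proof (rule Least_equality)
    show "\<exists>B. B \<subseteq> {e. L e = 0} \<and> finite B \<and> card B = card A \<and> {e. L e = 0} \<subseteq> cspan act B"
      using A1 AB(1) by blast
    fix y assume "\<exists>B. B \<subseteq> {e. L e = 0} \<and> finite B \<and> card B = y \<and> {e. L e = 0} \<subseteq> cspan act B"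
    then obtain C where "finite C" "card C = y" "{e. L e = 0} \<subseteq> span C" using cs by auto
    then show "card A \<le> y" using independent_span_bound[OF _ AB(2), of C] A1 by auto
  qed
  moreover have "codim act (range L) = card B" unfolding codim_def
  proof (rule Least_equality)
    show "\<exists>C. finite C \<and> card C = card B \<and> cspan act (C \<union> range L) = UNIV"
      using B1 AB(4) by blast
    fix y assume "\<exists>C. finite C \<and> card C = y \<and> cspan act (C \<union> range L) = UNIV"
    then obtain C where "finite C" "card C = y" "span (C \<union> range L) = UNIV" using cs by auto
    then show "card B \<le> y" using card_complement_le[OF AB(5,4,6) sL, of C] sp by auto
  qed
  ultimately show "int (fdim act {e. L e = 0}) - int (codim act (range L)) = k" using AB(8) by simp
qed

section \<open>Scales of seminorms and elliptic models\<close>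

text \<open>Completeness is asked in a weak form that still lets a Neumann series be summed: a
  series that converges absolutely in every seminorm has a sum with respect to the weakest
  one.\<close>

locale frechet_scale = vspace s for s :: "complex \<Rightarrow> 'e \<Rightarrow> 'e::ab_group_add" +
  fixes p :: "nat \<Rightarrow> 'e \<Rightarrow> real"
  assumes p_nonneg: "0 \<le> p k x"
    and p_add: "p k (x + y) \<le> p k x + p k y"
    and p_scale: "p k (s c x) = cmod c * p k x"
    and p_Suc: "p k x \<le> p (Suc k) x"
    and p0_eq_0: "p 0 x = 0 \<Longrightarrow> x = 0"
    and p_complete: "(\<And>k. summable (\<lambda>j. p k (u j))) \<Longrightarrow> \<exists>x. (\<lambda>N. p 0 (x - (\<Sum>j<N. u j))) \<longlonglongrightarrow> 0"
begin

lemma p_zero [simp]: "p k 0 = 0"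
  using p_scale[of k 0 0] by simp

lemma p_minus: "p k (- x) = p k x"
  using p_scale[of k "-1" x] by simp

lemma p_diff: "p k (x - y) \<le> p k x + p k y"
  using p_add[of k x "- y"] by (simp add: p_minus)

lemma p_sum: "p k (\<Sum>j\<in>J. f j) \<le> (\<Sum>j\<in>J. p k (f j))"
proof (induction J rule: infinite_finite_induct)
  case (insert x F)
  then show ?case using p_add[of k "f x" "sum f F"] by simp
qed simp_all

text \<open>Smoothing by one order upgrades the contraction in \<open>p 0\<close> to geometric decay of the iterates in every \<open>p k\<close>.\<close>
lemma neumann_bij:
  assumes K: "module_hom s s K" and K0: "\<And>x. p 0 (K x) \<le> p 0 x / 2"
    and K1: "\<And>k. \<exists>C. \<forall>x. p (Suc k) (K x) \<le> C * p k x"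
  shows "bij (\<lambda>x. x + K x)"
proof (rule bijI)
  interpret K: module_hom s s K by fact
  show "inj (\<lambda>x. x + K x)"
  proof (rule injI)
    fix x y assume "x + K x = y + K y"
    then have "x - y = - K (x - y)" by (simp add: K.diff algebra_simps)
    then have "p 0 (x - y) \<le> p 0 (x - y) / 2" using K0[of "x - y"] by (metis p_minus)
    then have "p 0 (x - y) = 0" using p_nonneg[of 0 "x - y"] by linarith
    then show "x = y" using p0_eq_0 by fastforce
  qed
  show "surj (\<lambda>x. x + K x)"
    unfolding surj_def
  proof (intro allI)
    fix v
    have iter: "\<exists>C\<ge>0. \<forall>j. p k ((K ^^ j) v) \<le> C * (1/2) ^ j" for k
    proof (induction k)
      case 0
      have "p 0 ((K ^^ j) v) \<le> p 0 v * (1/2) ^ j" for j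
      proof (induction j)
        case (Suc j) then show ?case using K0[of "(K ^^ j) v"] by simp
      qed simp
      then show ?case using p_nonneg by blast
    next
      case (Suc k)
      then obtain C where C: "C \<ge> 0" "\<And>j. p k ((K ^^ j) v) \<le> C * (1/2) ^ j" by blast
      obtain C' where C': "\<And>x. p (Suc k) (K x) \<le> C' * p k x" using K1 by blast
      \<comment> \<open>The factor 2 pays for the shift of exponent between j and its predecessor i;
        the first summand covers \<open>j = 0\<close>.\<close>
      define M where "M = p (Suc k) v + 2 * \<bar>C'\<bar> * C"
      have "p (Suc k) ((K ^^ j) v) \<le> M * (1/2) ^ j" for j
      proof (cases j)
        case 0 then show ?thesis using C(1) by (simp add: M_def)
      next
        case (Suc i)
        have "p (Suc k) ((K ^^ j) v) \<le> C' * p k ((K ^^ i) v)" using C' Suc by simp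
        also have "\<dots> \<le> \<bar>C'\<bar> * p k ((K ^^ i) v)" by (intro mult_right_mono) (auto simp: p_nonneg)
        also have "\<dots> \<le> \<bar>C'\<bar> * (C * (1/2) ^ i)" by (intro mult_left_mono C) auto
        also have "\<dots> = (2 * \<bar>C'\<bar> * C) * (1/2) ^ j" by (simp add: Suc)
        also have "\<dots> \<le> M * (1/2) ^ j" using p_nonneg[of "Suc k" v] unfolding M_def by (intro mult_right_mono) auto
        finally show ?thesis .
      qed
      moreover have "M \<ge> 0" using C(1) p_nonneg[of "Suc k" v] by (simp add: M_def)
      ultimately show ?case by blast
    qed
    define u where "u j = s ((-1) ^ j) ((K ^^ j) v)" for j
    have pu: "p k (u j) = p k ((K ^^ j) v)" for k j by (simp add: u_def p_scale norm_power)
    have "summable (\<lambda>j. p k (u j))" for k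
    proof -
      obtain C where C: "\<And>j. p k ((K ^^ j) v) \<le> C * (1/2) ^ j" using iter by blast
      have "summable (\<lambda>j. C * (1/2::real) ^ j)" by (intro summable_mult summable_geometric) simp
      moreover have "norm (p k (u j)) \<le> C * (1/2) ^ j" for j
        using C[of j] p_nonneg[of k "u j"] pu[of k j] by simp
      ultimately show ?thesis by (rule summable_comparison_test')
    qed
    from p_complete[OF this] obtain x where x: "(\<lambda>N. p 0 (x - (\<Sum>j<N. u j))) \<longlonglongrightarrow> 0" by blast
    obtain C where C: "\<And>j. p 0 ((K ^^ j) v) \<le> C * (1/2) ^ j" using iter by blast
    have tele: "(\<Sum>j<N. u j) + K (\<Sum>j<N. u j) = v - u N" for N
    proof (induction N)
      case 0 then show ?case by (simp add: u_def)
    next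
      case (Suc N)
      have "K (u N) = - u (Suc N)" by (simp add: u_def K.scale)
      then have "(\<Sum>j<Suc N. u j) + K (\<Sum>j<Suc N. u j) = ((\<Sum>j<N. u j) + K (\<Sum>j<N. u j)) + u N - u (Suc N)"
        by (simp add: K.add algebra_simps)
      then show ?case using Suc by simp
    qed
    have bound: "p 0 (x + K x - v) \<le> 2 * p 0 (x - (\<Sum>j<N. u j)) + C * (1/2) ^ N" for N
    proof -
      let ?S = "\<Sum>j<N. u j"
      have e: "x + K x - v = ((x - ?S) + K (x - ?S)) - u N"
        using tele[of N] by (simp add: K.diff algebra_simps)
      have "p 0 (x + K x - v) \<le> p 0 (x - ?S) + p 0 (K (x - ?S)) + p 0 (u N)"
        unfolding e using p_diff[of 0 "(x - ?S) + K (x - ?S)" "u N"] p_add[of 0 "x - ?S" "K (x - ?S)"] by linarith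
      then show ?thesis using K0[of "x - ?S"] C[of N] pu[of 0 N] p_nonneg[of 0 "x - ?S"] by linarith
    qed
    have "(\<lambda>N. 2 * p 0 (x - (\<Sum>j<N. u j)) + C * (1/2) ^ N) \<longlonglongrightarrow> 2 * 0 + C * 0"
      by (intro tendsto_intros x LIMSEQ_power_zero) auto
    then have "p 0 (x + K x - v) \<le> 0" using bound by (intro LIMSEQ_le_const) auto
    then have "p 0 (x + K x - v) = 0" using p_nonneg[of 0] by (simp add: antisym)
    then have "x + K x - v = 0" by (rule p0_eq_0)
    then have "v = x + K x" by simp
    then show "\<exists>x. v = x + K x" ..
  qed
qed

text \<open>Compactness of the passage from \<open>p 1\<close> to \<open>p 0\<close>, expressed
  through finite-rank approximations of the identity so that no notion of compact operator is
  required.\<close>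

definition finite_rank_approx :: "'j set \<Rightarrow> ('j \<Rightarrow> 'e \<Rightarrow> complex) \<Rightarrow> ('j \<Rightarrow> 'e) \<Rightarrow> real \<Rightarrow> real \<Rightarrow> bool" where
  "finite_rank_approx J l r C \<epsilon> \<longleftrightarrow> finite J \<and> (\<forall>j\<in>J. \<forall>x y. l j (x + y) = l j x + l j y) \<and>
     (\<forall>j\<in>J. \<forall>c x. l j (s c x) = c * l j x) \<and> (\<forall>j\<in>J. \<forall>x. cmod (l j x) \<le> C * p 0 x) \<and>
     (\<forall>x. p 0 (x - (\<Sum>j\<in>J. s (l j x) (r j))) \<le> \<epsilon> * p 1 x)"

text \<open>The identity behind it is D + T = D (1 + G T) + finite rank, because D G is the identity
  up to finite rank. G T gains one order, so after removal of a further finite-rank part it becomes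
  a K to which \<open>neumann_bij\<close> applies.\<close>

lemma fred_bounded_perturbation:
  assumes D: "module_hom s s D" and G: "module_hom s s G" and T: "module_hom s s T"
    and DG: "\<And>x. D (G x) = x - (\<Sum>j\<in>J0. s (l0 j x) (r0 j))"
    and J0: "finite J0" "\<And>j x y. j \<in> J0 \<Longrightarrow> l0 j (x + y) = l0 j x + l0 j y" "\<And>j c x. j \<in> J0 \<Longrightarrow> l0 j (s c x) = c * l0 j x"
    and Tb: "\<And>k. \<exists>C. \<forall>x. p k (T x) \<le> C * p k x"
    and Gb: "\<And>k. \<exists>C. \<forall>x. p (Suc k) (G x) \<le> C * p k x"
    and rellich: "\<And>\<epsilon>. \<epsilon> > 0 \<Longrightarrow> \<exists>(J :: 'j set) l r C. finite_rank_approx J l r C \<epsilon>"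
    and F: "fred_on D UNIV k"
  shows "fred_on (\<lambda>x. D x + T x) UNIV k"
proof -
  interpret D: module_hom s s D by fact
  interpret G: module_hom s s G by fact
  interpret T: module_hom s s T by fact
  have Tb': "\<exists>C\<ge>0. \<forall>x. p k (T x) \<le> C * p k x" for k
    using Tb[of k] p_nonneg by (metis abs_ge_self abs_ge_zero mult_right_mono order_trans)
  have Gb': "\<exists>C\<ge>0. \<forall>x. p (Suc k) (G x) \<le> C * p k x" for k
    using Gb[of k] p_nonneg by (metis abs_ge_self abs_ge_zero mult_right_mono order_trans)
  have GTb: "\<exists>C\<ge>0. \<forall>x. p (Suc k) (G (T x)) \<le> C * p k x" for k
  proof -
    obtain C C' where "C \<ge> 0" "\<And>x. p k (T x) \<le> C * p k x" "C' \<ge> 0" "\<And>x. p (Suc k) (G x) \<le> C' * p k x"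
      using Tb'[of k] Gb'[of k] by blast
    then have "p (Suc k) (G (T x)) \<le> (C' * C) * p k x" for x
      by (metis mult.assoc mult_left_mono order_trans)
    then show ?thesis using \<open>C \<ge> 0\<close> \<open>C' \<ge> 0\<close> by (meson mult_nonneg_nonneg)
  qed
  obtain C1 where C1: "C1 \<ge> 0" "\<And>x. p 1 (G (T x)) \<le> C1 * p 0 x" using GTb[of 0] by auto
  \<comment> \<open>Makes \<open>\<epsilon> * C1 \<le> 1 / 2\<close>, the contraction factor that
    the Neumann series needs.\<close>
  define \<epsilon> where "\<epsilon> = 1 / (2 * (C1 + 1))"
  have eps: "\<epsilon> > 0" using C1 by (simp add: \<epsilon>_def)
  obtain J :: "'j set" and l r C where "finite_rank_approx J l r C \<epsilon>" using rellich[OF eps] by blast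
  then have J: "finite J" "\<And>j x y. j \<in> J \<Longrightarrow> l j (x + y) = l j x + l j y"
      "\<And>j c x. j \<in> J \<Longrightarrow> l j (s c x) = c * l j x" "\<And>j x. j \<in> J \<Longrightarrow> cmod (l j x) \<le> C * p 0 x"
      "\<And>x. p 0 (x - (\<Sum>j\<in>J. s (l j x) (r j))) \<le> \<epsilon> * p 1 x"
    unfolding finite_rank_approx_def by blast+
  define K where "K x = G (T x) - (\<Sum>j\<in>J. s (l j (G (T x))) (r j))" for x
  have Klin: "module_hom s s K"
  proof unfold_locales
    show "K (x + y) = K x + K y" for x y
      by (simp add: K_def T.add G.add J scale_left_distrib sum.distrib algebra_simps cong: sum.cong)
    show "K (s c x) = s c (K x)" for c x
      by (simp add: K_def T.scale G.scale J scale_right_diff_distrib scale_sum_right cong: sum.cong)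
  qed
  have K0: "p 0 (K x) \<le> p 0 x / 2" for x
  proof -
    have "p 0 (K x) \<le> \<epsilon> * p 1 (G (T x))" unfolding K_def by (rule J)
    also have "\<dots> \<le> \<epsilon> * (C1 * p 0 x)" using eps C1 by (intro mult_left_mono) auto
    also have "\<dots> = (\<epsilon> * C1) * p 0 x" by simp
    also have "\<dots> \<le> (1/2) * p 0 x" using C1 by (intro mult_right_mono p_nonneg) (auto simp: \<epsilon>_def field_simps)
    finally show ?thesis by simp
  qed
  have K1: "\<exists>C. \<forall>x. p (Suc k) (K x) \<le> C * p k x" for k
  proof -
    obtain C2 where C2: "C2 \<ge> 0" "\<And>x. p (Suc k) (G (T x)) \<le> C2 * p k x" using GTb by blast
    have pk0: "p 0 x \<le> p k x" for x by (induction k) (auto intro: order_trans[OF _ p_Suc])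
    have GT0: "p 0 (G (T x)) \<le> C1 * p k x" for x
      using C1(2)[of x] p_Suc[of 0 "G (T x)"] mult_left_mono[OF pk0[of x] C1(1)] by simp
    define M where "M = C2 + (\<Sum>j\<in>J. \<bar>C\<bar> * C1 * p (Suc k) (r j))"
    have "p (Suc k) (K x) \<le> M * p k x" for x
    proof -
      have "p (Suc k) (K x) \<le> p (Suc k) (G (T x)) + (\<Sum>j\<in>J. p (Suc k) (s (l j (G (T x))) (r j)))"
        using p_diff[of "Suc k" "G (T x)" "\<Sum>j\<in>J. s (l j (G (T x))) (r j)"]
          p_sum[of "Suc k" "\<lambda>j. s (l j (G (T x))) (r j)" J] unfolding K_def by linarith
      also have "\<dots> \<le> C2 * p k x + (\<Sum>j\<in>J. (\<bar>C\<bar> * C1 * p (Suc k) (r j)) * p k x)"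
      proof (intro add_mono C2 sum_mono)
        fix j assume j: "j \<in> J"
        have "cmod (l j (G (T x))) \<le> C * p 0 (G (T x))" by (rule J(4)[OF j])
        also have "\<dots> \<le> \<bar>C\<bar> * p 0 (G (T x))" by (intro mult_right_mono p_nonneg) auto
        also have "\<dots> \<le> \<bar>C\<bar> * (C1 * p k x)" by (intro mult_left_mono GT0) auto
        finally have "cmod (l j (G (T x))) * p (Suc k) (r j) \<le> (\<bar>C\<bar> * (C1 * p k x)) * p (Suc k) (r j)"
          by (intro mult_right_mono p_nonneg)
        then show "p (Suc k) (s (l j (G (T x))) (r j)) \<le> (\<bar>C\<bar> * C1 * p (Suc k) (r j)) * p k x"
          by (simp add: p_scale mult_ac)
      qed
      also have "\<dots> = M * p k x" by (simp add: M_def distrib_right sum_distrib_right)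
      finally show ?thesis .
    qed
    then show ?thesis by blast
  qed
  have bij: "bij (\<lambda>x. x + K x)" by (rule neumann_bij[OF Klin K0 K1])
  interpret K: module_hom s s K by fact
  have U: "module_hom s s (\<lambda>x. x + K x)"
    by unfold_locales (simp_all add: K.add K.scale scale_right_distrib)
  have DU: "module_hom s s (\<lambda>x. D (x + K x))"
    by unfold_locales (simp_all add: K.add K.scale D.add D.scale scale_right_distrib)
  have F1: "fred_on (\<lambda>x. D (x + K x)) UNIV k" by (rule fred_comp_bij[OF F U bij])
  have F2: "fred_on (\<lambda>x. D (x + K x) + (\<Sum>j\<in>J. s (l j (G (T x))) (D (r j)))) UNIV k \<and>
     module_hom s s (\<lambda>x. D (x + K x) + (\<Sum>j\<in>J. s (l j (G (T x))) (D (r j))))"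
    using J by (intro fred_finite_rank[OF DU F1 J(1)]) (simp_all add: T.add G.add T.scale G.scale)
  have F3: "fred_on (\<lambda>x. (D (x + K x) + (\<Sum>j\<in>J. s (l j (G (T x))) (D (r j)))) + (\<Sum>j\<in>J0. s (l0 j (T x)) (r0 j))) UNIV k"
    using J0 by (intro conjunct1[OF fred_finite_rank[OF conjunct2[OF F2] conjunct1[OF F2] J0(1)]])
      (simp_all add: T.add T.scale)
  \<comment> \<open>K is G T minus a finite-rank map, and D G is the identity minus a finite-rank
    map; the two sums put back exactly what was removed.\<close>
  have "(D (x + K x) + (\<Sum>j\<in>J. s (l j (G (T x))) (D (r j)))) + (\<Sum>j\<in>J0. s (l0 j (T x)) (r0 j)) = D x + T x" for x
    by (simp add: K_def D.add D.diff DG D.sum D.scale algebra_simps)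
  then show ?thesis using F3 by simp
qed

end

section \<open>Elliptic models and their finite direct sums\<close>

definition carrier_approx :: "('b \<Rightarrow> complex) set \<Rightarrow> (nat \<Rightarrow> ('b \<Rightarrow> complex) \<Rightarrow> real) \<Rightarrow> nat set \<Rightarrow>
    (nat \<Rightarrow> ('b \<Rightarrow> complex) \<Rightarrow> complex) \<Rightarrow> (nat \<Rightarrow> 'b \<Rightarrow> complex) \<Rightarrow> real \<Rightarrow> real \<Rightarrow> bool" where
  "carrier_approx S q J l r C \<epsilon> \<longleftrightarrow> finite J \<and> (\<forall>j\<in>J. r j \<in> S) \<and>
     (\<forall>j\<in>J. \<forall>f\<in>S. \<forall>h\<in>S. l j (\<lambda>x. f x + h x) = l j f + l j h) \<and>
     (\<forall>j\<in>J. \<forall>f\<in>S. \<forall>c. l j (\<lambda>x. c * f x) = c * l j f) \<and>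
     (\<forall>j\<in>J. \<forall>f\<in>S. cmod (l j f) \<le> C * q 0 f) \<and>
     (\<forall>f\<in>S. q 0 (\<lambda>x. f x - (\<Sum>j\<in>J. l j f * r j x)) \<le> \<epsilon> * q 1 f)"

lemma carrier_approxI:
  fixes A :: "'a set"
  assumes A: "finite A" and r: "\<And>a. a \<in> A \<Longrightarrow> r a \<in> S"
    and l: "\<And>a f h. a \<in> A \<Longrightarrow> f \<in> S \<Longrightarrow> h \<in> S \<Longrightarrow> l a (\<lambda>x. f x + h x) = l a f + l a h"
      "\<And>a f c. a \<in> A \<Longrightarrow> f \<in> S \<Longrightarrow> l a (\<lambda>x. c * f x) = c * l a f"
      "\<And>a f. a \<in> A \<Longrightarrow> f \<in> S \<Longrightarrow> cmod (l a f) \<le> C * q 0 f"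
    and approx: "\<And>f. f \<in> S \<Longrightarrow> q 0 (\<lambda>x. f x - (\<Sum>a\<in>A. l a f * r a x)) \<le> \<epsilon> * q 1 f"
  shows "\<exists>J l r C. carrier_approx S q J l r C \<epsilon>"
proof -
  obtain b where b: "bij_betw b {0..<card A} A" using ex_bij_betw_nat_finite[OF A] by blast
  have bA: "b j \<in> A" if "j \<in> {0..<card A}" for j using b that by (metis bij_betwE)
  have "carrier_approx S q {0..<card A} (\<lambda>j. l (b j)) (\<lambda>j. r (b j)) C \<epsilon>"
    unfolding carrier_approx_def
  proof (intro conjI ballI allI)
    fix f assume "f \<in> S"
    have "(\<Sum>j\<in>{0..<card A}. l (b j) f * r (b j) x) = (\<Sum>a\<in>A. l a f * r a x)" for x
      by (rule sum.reindex_bij_betw[OF b])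
    then show "q 0 (\<lambda>x. f x - (\<Sum>j\<in>{0..<card A}. l (b j) f * r (b j) x)) \<le> \<epsilon> * q 1 f"
      using approx[OF \<open>f \<in> S\<close>] by simp
  qed (simp_all add: bA r l)
  then show ?thesis by blast
qed

text \<open>\<open>g\<close> is a right inverse of \<open>d\<close> up to the rank one term
  \<open>\<l> f * \<rho>\<close>; \<open>\<gamma>\<close> spans the kernel and \<open>\<rho>\<close>
  a complement of the image. Either may be the zero function, which then stands for a trivial kernel
  or cokernel, so that the indices 1, -1 and 0 fall under the same axioms.\<close>

locale elliptic_model =
  fixes S :: "('b \<Rightarrow> complex) set" and q :: "nat \<Rightarrow> ('b \<Rightarrow> complex) \<Rightarrow> real"
    and d g :: "('b \<Rightarrow> complex) \<Rightarrow> 'b \<Rightarrow> complex" and \<gamma> \<rho> :: "'b \<Rightarrow> complex" and \<l> :: "('b \<Rightarrow> complex) \<Rightarrow> complex"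
  assumes S_0: "(\<lambda>_. 0) \<in> S"
    and S_add: "f \<in> S \<Longrightarrow> h \<in> S \<Longrightarrow> (\<lambda>x. f x + h x) \<in> S"
    and S_scale: "f \<in> S \<Longrightarrow> (\<lambda>x. c * f x) \<in> S"
    and q_nonneg: "f \<in> S \<Longrightarrow> 0 \<le> q k f"
    and q_add: "f \<in> S \<Longrightarrow> h \<in> S \<Longrightarrow> q k (\<lambda>x. f x + h x) \<le> q k f + q k h"
    and q_scale: "f \<in> S \<Longrightarrow> q k (\<lambda>x. c * f x) = cmod c * q k f"
    and q_Suc: "f \<in> S \<Longrightarrow> q k f \<le> q (Suc k) f"
    and q0_eq_0: "f \<in> S \<Longrightarrow> q 0 f = 0 \<Longrightarrow> f = (\<lambda>_. 0)"
    and q_complete: "(\<And>j. u j \<in> S) \<Longrightarrow> (\<And>k. summable (\<lambda>j. q k (u j))) \<Longrightarrow>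
       \<exists>f\<in>S. (\<lambda>N. q 0 (\<lambda>x. f x - (\<Sum>j<N. u j x))) \<longlonglongrightarrow> 0"
    and q_rellich: "\<epsilon> > 0 \<Longrightarrow> \<exists>J l r C. carrier_approx S q J l r C \<epsilon>"
    and d_S: "f \<in> S \<Longrightarrow> d f \<in> S"
    and d_add: "f \<in> S \<Longrightarrow> h \<in> S \<Longrightarrow> d (\<lambda>x. f x + h x) = (\<lambda>x. d f x + d h x)"
    and d_scale: "f \<in> S \<Longrightarrow> d (\<lambda>x. c * f x) = (\<lambda>x. c * d f x)"
    and g_S: "f \<in> S \<Longrightarrow> g f \<in> S"
    and g_add: "f \<in> S \<Longrightarrow> h \<in> S \<Longrightarrow> g (\<lambda>x. f x + h x) = (\<lambda>x. g f x + g h x)"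
    and g_scale: "f \<in> S \<Longrightarrow> g (\<lambda>x. c * f x) = (\<lambda>x. c * g f x)"
    and g_bound: "\<exists>C. \<forall>f\<in>S. q (Suc k) (g f) \<le> C * q k f"
    and l_add: "f \<in> S \<Longrightarrow> h \<in> S \<Longrightarrow> \<l> (\<lambda>x. f x + h x) = \<l> f + \<l> h"
    and l_scale: "f \<in> S \<Longrightarrow> \<l> (\<lambda>x. c * f x) = c * \<l> f"
    and \<gamma>_S: "\<gamma> \<in> S" and \<rho>_S: "\<rho> \<in> S"
    and dg: "f \<in> S \<Longrightarrow> d (g f) = (\<lambda>x. f x - \<l> f * \<rho> x)"
    and d_ker: "f \<in> S \<Longrightarrow> d f = (\<lambda>_. 0) \<longleftrightarrow> (\<exists>c. f = (\<lambda>x. c * \<gamma> x))"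
    and d_coker: "f \<in> S \<Longrightarrow> d f = (\<lambda>x. c * \<rho> x) \<Longrightarrow> d f = (\<lambda>_. 0)"
begin

definition index :: int where
  "index = (if \<gamma> = (\<lambda>_. 0) then 0 else 1) - (if \<rho> = (\<lambda>_. 0) then 0 else 1)"

lemma d_0: "d (\<lambda>_. 0) = (\<lambda>_. 0)"
  using d_ker[OF S_0] by (metis mult_zero_left)

end

text \<open>The module remains an abstract type, identified by its coordinates \<open>comp\<close>
  with the I-indexed families in S. The module isomorphism of the theorem can thus be plugged in
  directly.\<close>

locale elliptic_sum = elliptic_model S q d g \<gamma> \<rho> \<l> + vspace s
  for S :: "('b \<Rightarrow> complex) set" and q d g \<gamma> \<rho> \<l> and s :: "complex \<Rightarrow> 'e \<Rightarrow> 'e::ab_group_add" +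
  fixes I :: "'i set" and comp :: "'e \<Rightarrow> 'i \<Rightarrow> 'b \<Rightarrow> complex"
  assumes I: "finite I"
    and comp_S: "i \<in> I \<Longrightarrow> comp e i \<in> S"
    and comp_add: "i \<in> I \<Longrightarrow> comp (e + e') i = (\<lambda>x. comp e i x + comp e' i x)"
    and comp_scale: "i \<in> I \<Longrightarrow> comp (s c e) i = (\<lambda>x. c * comp e i x)"
    and comp_inj: "(\<And>i. i \<in> I \<Longrightarrow> comp e i = comp e' i) \<Longrightarrow> e = e'"
    and comp_surj: "(\<And>i. i \<in> I \<Longrightarrow> f i \<in> S) \<Longrightarrow> \<exists>e. \<forall>i\<in>I. comp e i = f i"
begin

definition mk :: "('i \<Rightarrow> 'b \<Rightarrow> complex) \<Rightarrow> 'e" where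
  "mk f = (SOME e. \<forall>i\<in>I. comp e i = f i)"

lemma comp_mk: "(\<And>i. i \<in> I \<Longrightarrow> f i \<in> S) \<Longrightarrow> i \<in> I \<Longrightarrow> comp (mk f) i = f i"
  using someI_ex[OF comp_surj[of f]] unfolding mk_def by blast

definition lift :: "(('b \<Rightarrow> complex) \<Rightarrow> 'b \<Rightarrow> complex) \<Rightarrow> 'e \<Rightarrow> 'e" where
  "lift h e = mk (\<lambda>i. h (comp e i))"

lemma comp_lift: "(\<And>f. f \<in> S \<Longrightarrow> h f \<in> S) \<Longrightarrow> i \<in> I \<Longrightarrow> comp (lift h e) i = h (comp e i)"
  unfolding lift_def by (subst comp_mk) (auto simp: comp_S)

definition single :: "'i \<Rightarrow> ('b \<Rightarrow> complex) \<Rightarrow> 'e" where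
  "single i f = mk (\<lambda>j. if j = i then f else (\<lambda>_. 0))"

lemma comp_single: "f \<in> S \<Longrightarrow> j \<in> I \<Longrightarrow> comp (single i f) j = (if j = i then f else (\<lambda>_. 0))"
  unfolding single_def by (subst comp_mk) (auto simp: S_0)

lemma comp_0: "i \<in> I \<Longrightarrow> comp 0 i = (\<lambda>_. 0)"
  using comp_scale[of i 0 0] by simp

lemma comp_diff: "i \<in> I \<Longrightarrow> comp (e - e') i = (\<lambda>x. comp e i x - comp e' i x)"
  using comp_add[of i "e - e'" e'] by (simp add: fun_eq_iff)

lemma comp_sum: "i \<in> I \<Longrightarrow> comp (\<Sum>j\<in>J. f j) i = (\<lambda>x. \<Sum>j\<in>J. comp (f j) i x)"
  by (induction J rule: infinite_finite_induct) (auto simp: comp_0 comp_add)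

definition P :: "nat \<Rightarrow> 'e \<Rightarrow> real" where
  "P k e = (\<Sum>i\<in>I. q k (comp e i))"

lemma q_le_P: "i \<in> I \<Longrightarrow> q k (comp e i) \<le> P k e"
  unfolding P_def using I comp_S by (intro member_le_sum) (auto simp: q_nonneg)

sublocale frechet_scale s P
proof unfold_locales
  fix k x y c
  show "0 \<le> P k x" unfolding P_def by (intro sum_nonneg q_nonneg comp_S)
  show "P k (x + y) \<le> P k x + P k y"
    unfolding P_def sum.distrib[symmetric] by (intro sum_mono) (simp add: comp_add q_add comp_S)
  show "P k (s c x) = cmod c * P k x"
    unfolding P_def sum_distrib_left by (intro sum.cong) (simp_all add: comp_scale q_scale comp_S)
  show "P k x \<le> P (Suc k) x" unfolding P_def by (intro sum_mono q_Suc comp_S)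
  show "x = 0" if "P 0 x = 0"
  proof (rule comp_inj)
    fix i assume i: "i \<in> I"
    have "q 0 (comp x i) \<le> 0" using q_le_P[OF i, of 0 x] that by simp
    then have "q 0 (comp x i) = 0" using q_nonneg[OF comp_S[OF i], of 0 x] by simp
    then show "comp x i = comp 0 i" using q0_eq_0 comp_S i by (simp add: comp_0)
  qed
next
  fix u assume u: "\<And>k. summable (\<lambda>j. P k (u j))"
  have "\<exists>f\<in>S. (\<lambda>N. q 0 (\<lambda>x. f x - (\<Sum>j<N. comp (u j) i x))) \<longlonglongrightarrow> 0" if i: "i \<in> I" for i
  proof (rule q_complete)
    show "summable (\<lambda>j. q k (comp (u j) i))" for k
      using u[of k] by (rule summable_comparison_test[rotated])
        (use i in \<open>auto simp: q_nonneg comp_S intro!: q_le_P\<close>)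
  qed (use comp_S i in auto)
  then have "\<forall>i\<in>I. \<exists>f. f \<in> S \<and> (\<lambda>N. q 0 (\<lambda>x. f x - (\<Sum>j<N. comp (u j) i x))) \<longlonglongrightarrow> 0" by blast
  from bchoice[OF this] obtain f where "\<forall>i\<in>I. f i \<in> S \<and> (\<lambda>N. q 0 (\<lambda>x. f i x - (\<Sum>j<N. comp (u j) i x))) \<longlonglongrightarrow> 0" ..
  then have f: "\<And>i. i \<in> I \<Longrightarrow> f i \<in> S"
     "\<And>i. i \<in> I \<Longrightarrow> (\<lambda>N. q 0 (\<lambda>x. f i x - (\<Sum>j<N. comp (u j) i x))) \<longlonglongrightarrow> 0" by simp_all
  have "P 0 (mk f - (\<Sum>j<N. u j)) = (\<Sum>i\<in>I. q 0 (\<lambda>x. f i x - (\<Sum>j<N. comp (u j) i x)))" for N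
    unfolding P_def by (intro sum.cong) (simp_all add: comp_diff comp_mk f comp_sum)
  moreover have "(\<lambda>N. \<Sum>i\<in>I. q 0 (\<lambda>x. f i x - (\<Sum>j<N. comp (u j) i x))) \<longlonglongrightarrow> (\<Sum>i\<in>I. 0)"
    by (intro tendsto_sum f)
  ultimately have "(\<lambda>N. P 0 (mk f - (\<Sum>j<N. u j))) \<longlonglongrightarrow> 0" by simp
  then show "\<exists>x. (\<lambda>N. P 0 (x - (\<Sum>j<N. u j))) \<longlonglongrightarrow> 0" by (rule exI)
qed

lemma lift_hom:
  assumes "\<And>f. f \<in> S \<Longrightarrow> h f \<in> S" "\<And>f f'. f \<in> S \<Longrightarrow> f' \<in> S \<Longrightarrow> h (\<lambda>x. f x + f' x) = (\<lambda>x. h f x + h f' x)"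
    "\<And>f c. f \<in> S \<Longrightarrow> h (\<lambda>x. c * f x) = (\<lambda>x. c * h f x)"
  shows "module_hom s s (lift h)"
  by unfold_locales (auto intro!: comp_inj simp: comp_lift comp_add comp_scale assms comp_S)

text \<open>Used twice: with \<open>\<gamma>\<close> it gives a basis of the kernel, with
  \<open>\<rho>\<close> a basis of a complement of the image. The zero function yields the empty
  basis.\<close>

lemma single_family:
  assumes f: "f \<in> S"
  defines "B \<equiv> if f = (\<lambda>_. 0) then {} else (\<lambda>i. single i f) ` I"
  shows "finite B" "independent B" "span B = {e. \<forall>i\<in>I. \<exists>c. comp e i = (\<lambda>x. c * f x)}"
    "int (card B) = int (card I) * (if f = (\<lambda>_. 0) then 0 else 1)"
proof -
  show fB: "finite B" using I by (simp add: B_def)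
  have inj: "inj_on (\<lambda>i. single i f) I" if "f \<noteq> (\<lambda>_. 0)"
    by (rule inj_onI) (use that comp_single[OF f] in metis)
  show "int (card B) = int (card I) * (if f = (\<lambda>_. 0) then 0 else 1)"
    using inj by (simp add: B_def card_image)
  have cs: "comp (\<Sum>j\<in>I. s (c j) (single j f)) i = (\<lambda>x. c i * f x)" if "i \<in> I" for c i
    using that I by (simp add: comp_sum comp_scale comp_single f if_distrib if_distribR cong: if_cong)
  have sumB: "(\<Sum>v\<in>B. s (u v) v) = (\<Sum>i\<in>I. s (u (single i f)) (single i f))" if "f \<noteq> (\<lambda>_. 0)" for u
    unfolding B_def using that by (simp add: sum.reindex[OF inj])
  show "independent B"
  proof (cases "f = (\<lambda>_. 0)")
    case False
    then obtain x0 where x0: "f x0 \<noteq> 0" by blast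
    show ?thesis
    proof
      assume "dependent B"
      then obtain u v where u: "v \<in> B" "u v \<noteq> 0" "(\<Sum>v\<in>B. s (u v) v) = 0"
        using dependent_finite[OF fB] by blast
      obtain i where i: "i \<in> I" "v = single i f" using u(1) False by (auto simp: B_def)
      have "(\<lambda>x. u v * f x) = (\<lambda>_. 0)"
        using cs[OF i(1), of "\<lambda>i. u (single i f)"] u(3) sumB[OF False] i comp_0 by simp
      then show False using u(2) x0 by (metis mult_eq_0_iff)
    qed
  next
    case True
    then have "B = {}" unfolding B_def by (rule if_P)
    then show ?thesis using independent_empty by simp
  qed
  show "span B = {e. \<forall>i\<in>I. \<exists>c. comp e i = (\<lambda>x. c * f x)}"
  proof (cases "f = (\<lambda>_. 0)")
    case True
    then have "span B = {0}" by (simp add: B_def)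
    moreover have "e = 0" if "\<forall>i\<in>I. \<exists>c. comp e i = (\<lambda>x. c * f x)" for e
      by (rule comp_inj) (use that True in \<open>simp add: comp_0\<close>)
    ultimately show ?thesis using True by (auto simp: comp_0)
  next
    case False
    show ?thesis
    proof (intro set_eqI iffI)
      fix e assume "e \<in> span B"
      then obtain u where "e = (\<Sum>v\<in>B. s (u v) v)" using span_finite[OF fB] by auto
      then show "e \<in> {e. \<forall>i\<in>I. \<exists>c. comp e i = (\<lambda>x. c * f x)}" using sumB[OF False] cs by auto
    next
      fix e assume "e \<in> {e. \<forall>i\<in>I. \<exists>c. comp e i = (\<lambda>x. c * f x)}"
      then obtain c where c: "\<And>i. i \<in> I \<Longrightarrow> comp e i = (\<lambda>x. c i * f x)" using bchoice[of I "\<lambda>i c. comp e i = (\<lambda>x. c * f x)"] by auto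
      have "e = (\<Sum>j\<in>I. s (c j) (single j f))" by (rule comp_inj) (simp add: cs c)
      moreover have "single j f \<in> span B" if "j \<in> I" for j using that False by (auto simp: B_def intro: span_base)
      ultimately show "e \<in> span B" by (simp add: span_sum span_scale)
    qed
  qed
qed

lemma fred_lift_d: "fred_on (lift d) UNIV (int (card I) * index)"
proof -
  define A where "A = (if \<gamma> = (\<lambda>_. 0) then {} else (\<lambda>i. single i \<gamma>) ` I)"
  define B where "B = (if \<rho> = (\<lambda>_. 0) then {} else (\<lambda>i. single i \<rho>) ` I)"
  note A = single_family[OF \<gamma>_S, folded A_def] and B = single_family[OF \<rho>_S, folded B_def]
  have cd: "comp (lift d e) i = d (comp e i)" if "i \<in> I" for e i using that by (simp add: comp_lift d_S)
  show ?thesis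
  proof (rule fred_onI[of A _ _ B])
    show "span A = {w \<in> UNIV. lift d w = 0}"
    proof -
      have "lift d w = 0 \<longleftrightarrow> (\<forall>i\<in>I. d (comp w i) = (\<lambda>_. 0))" for w
        using cd[of _ w] comp_0 comp_inj[of "lift d w" 0] by metis
      then show ?thesis unfolding A(3) using d_ker comp_S by auto
    qed
    fix x w assume x: "x \<in> span B" "x = lift d w"
    show "x = 0"
    proof (rule comp_inj)
      fix i assume i: "i \<in> I"
      obtain c where "comp x i = (\<lambda>y. c * \<rho> y)" using x i B(3) by auto
      then show "comp x i = comp 0 i" using d_coker[of "comp w i" c] cd[OF i, of w] x comp_S i by (simp add: comp_0)
    qed
  next
    fix v
    \<comment> \<open>The defect of the coordinatewise right inverse; by \<open>dg\<close> it is a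
      multiple of \<open>\<rho>\<close> in each coordinate.\<close>
    define x where "x = v - lift d (lift g v)"
    have "comp x i = (\<lambda>y. \<l> (comp v i) * \<rho> y)" if "i \<in> I" for i
      using that by (simp add: x_def comp_diff cd comp_lift g_S dg comp_S)
    then have "x \<in> span B" unfolding B(3) by blast
    moreover have "v = x + lift d (lift g v)" by (simp add: x_def)
    ultimately show "\<exists>x\<in>span B. \<exists>w\<in>UNIV. v = x + lift d w" by blast
  next
    show "lift d 0 = 0" by (rule comp_inj) (simp add: cd comp_0 d_0)
  qed (use A B in \<open>auto simp: index_def\<close>)
qed

theorem fred_index:
  assumes T: "module_hom s s T" "\<And>k. \<exists>C. \<forall>x. P k (T x) \<le> C * P k x"
    and D: "\<And>e i. i \<in> I \<Longrightarrow> comp (D e) i = (\<lambda>x. d (comp e i) x + comp (T e) i x)"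
  shows "fred_on D UNIV (int (card I) * index)"
proof -
  have "fred_on (\<lambda>x. lift d x + T x) UNIV (int (card I) * index)"
  proof (rule fred_bounded_perturbation[where G = "lift g" and ?J0.0 = I and ?l0.0 = "\<lambda>i e. \<l> (comp e i)" and ?r0.0 = "\<lambda>i. single i \<rho>"])
    show "module_hom s s (lift d)" by (intro lift_hom d_S d_add d_scale)
    show "module_hom s s (lift g)" by (intro lift_hom g_S g_add g_scale)
    show "lift d (lift g x) = x - (\<Sum>j\<in>I. s (\<l> (comp x j)) (single j \<rho>))" for x
    proof (rule comp_inj)
      fix i assume i: "i \<in> I"
      have "comp (\<Sum>j\<in>I. s (\<l> (comp x j)) (single j \<rho>)) i = (\<lambda>y. \<l> (comp x i) * \<rho> y)"
        using i I by (simp add: comp_sum comp_scale comp_single \<rho>_S if_distrib if_distribR cong: if_cong)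
      then show "comp (lift d (lift g x)) i = comp (x - (\<Sum>j\<in>I. s (\<l> (comp x j)) (single j \<rho>))) i"
        using i by (simp add: comp_diff comp_lift d_S g_S dg comp_S)
    qed
    show "\<exists>C. \<forall>x. P (Suc k) (lift g x) \<le> C * P k x" for k
    proof -
      obtain C where "\<And>f. f \<in> S \<Longrightarrow> q (Suc k) (g f) \<le> C * q k f" using g_bound by blast
      then have "P (Suc k) (lift g x) \<le> C * P k x" for x
        unfolding P_def sum_distrib_left by (intro sum_mono) (simp add: comp_lift g_S comp_S)
      then show ?thesis by blast
    qed
    fix \<epsilon> :: real assume "\<epsilon> > 0"
    then obtain J l r C where "carrier_approx S q J l r C \<epsilon>" using q_rellich by blast
    then have J: "finite J" "\<And>j. j \<in> J \<Longrightarrow> r j \<in> S"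
       "\<And>j f h. j \<in> J \<Longrightarrow> f \<in> S \<Longrightarrow> h \<in> S \<Longrightarrow> l j (\<lambda>x. f x + h x) = l j f + l j h"
       "\<And>j f c. j \<in> J \<Longrightarrow> f \<in> S \<Longrightarrow> l j (\<lambda>x. c * f x) = c * l j f"
       "\<And>j f. j \<in> J \<Longrightarrow> f \<in> S \<Longrightarrow> cmod (l j f) \<le> C * q 0 f"
       "\<And>f. f \<in> S \<Longrightarrow> q 0 (\<lambda>x. f x - (\<Sum>j\<in>J. l j f * r j x)) \<le> \<epsilon> * q 1 f"
      unfolding carrier_approx_def by blast+
    \<comment> \<open>Every coordinate uses the same approximation of the model, so functionals and
      vectors are indexed by pairs.\<close>
    define L where "L ji e = l (fst ji) (comp e (snd ji))" for ji :: "nat \<times> 'i" and e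
    define R where "R ji = single (snd ji) (r (fst ji))" for ji :: "nat \<times> 'i"
    have "finite_rank_approx (J \<times> I) L R \<bar>C\<bar> \<epsilon>"
      unfolding finite_rank_approx_def
    proof (intro conjI ballI allI)
      show "finite (J \<times> I)" using J I by simp
      fix ji x y c assume ji: "ji \<in> J \<times> I"
      then have m: "fst ji \<in> J" "snd ji \<in> I" by auto
      show "L ji (x + y) = L ji x + L ji y" using m by (simp add: L_def comp_add J comp_S)
      show "L ji (s c x) = c * L ji x" using m by (simp add: L_def comp_scale J comp_S)
      have "cmod (L ji x) \<le> C * q 0 (comp x (snd ji))" unfolding L_def using m J comp_S by blast
      also have "\<dots> \<le> \<bar>C\<bar> * q 0 (comp x (snd ji))" using m by (intro mult_right_mono q_nonneg comp_S) auto
      also have "\<dots> \<le> \<bar>C\<bar> * P 0 x" using m by (intro mult_left_mono q_le_P) auto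
      finally show "cmod (L ji x) \<le> \<bar>C\<bar> * P 0 x" .
    next
      fix x
      have "comp (\<Sum>ji\<in>J \<times> I. s (L ji x) (R ji)) i = (\<lambda>y. \<Sum>j\<in>J. l j (comp x i) * r j y)" if i: "i \<in> I" for i
      proof -
        have "comp (\<Sum>ji\<in>J \<times> I. s (L ji x) (R ji)) i = (\<lambda>y. \<Sum>ji\<in>J \<times> I. L ji x * (if i = snd ji then r (fst ji) y else 0))"
          using i J(2) by (auto simp: comp_sum comp_scale R_def comp_single fun_eq_iff intro!: sum.cong)
        also have "\<dots> = (\<lambda>y. \<Sum>j\<in>J. \<Sum>i'\<in>I. if i = i' then l j (comp x i') * r j y else 0)"
          by (auto simp: sum.cartesian_product L_def fun_eq_iff intro!: sum.cong)
        also have "\<dots> = (\<lambda>y. \<Sum>j\<in>J. l j (comp x i) * r j y)" using i I by simp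
        finally show ?thesis .
      qed
      then show "P 0 (x - (\<Sum>ji\<in>J \<times> I. s (L ji x) (R ji))) \<le> \<epsilon> * P 1 x"
        unfolding P_def sum_distrib_left by (intro sum_mono) (use J(6) comp_S in \<open>simp add: comp_diff\<close>)
    qed
    then show "\<exists>(J :: (nat \<times> 'i) set) l r C. finite_rank_approx J l r C \<epsilon>" by blast
  qed (use T I fred_lift_d in \<open>auto simp: comp_add comp_scale l_add l_scale comp_S\<close>)
  moreover have "lift d x + T x = D x" for x
    by (rule comp_inj) (simp add: D comp_add comp_lift d_S)
  ultimately show ?thesis by simp
qed

end

section \<open>Schwartz functions\<close>

definition derivs :: "(real \<Rightarrow> complex) \<Rightarrow> (real \<Rightarrow> complex) \<Rightarrow> bool" where
  "derivs f f' \<longleftrightarrow> (\<forall>x. (f has_vector_derivative f' x) (at x))"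

definition vd :: "(real \<Rightarrow> complex) \<Rightarrow> real \<Rightarrow> complex" where
  "vd f = (\<lambda>x. vector_derivative f (at x))"

lemma rderivs_Suc [simp]: "rderivs (Suc k) f = vd (rderivs k f)"
  by (simp add: vd_def)

declare rderivs.simps(2) [simp del]

lemma derivs_vd: "derivs f f' \<Longrightarrow> vd f = f'"
  by (auto simp: derivs_def vd_def intro: vector_derivative_at)

lemma derivs_add: "derivs f f' \<Longrightarrow> derivs g g' \<Longrightarrow> derivs (\<lambda>x. f x + g x) (\<lambda>x. f' x + g' x)"
  by (auto simp: derivs_def intro: has_vector_derivative_add)

lemma derivs_cmult: "derivs f f' \<Longrightarrow> derivs (\<lambda>x. c * f x) (\<lambda>x. c * f' x)"
  by (auto simp: derivs_def intro: has_vector_derivative_mult_right)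

lemma derivs_mult: "derivs f f' \<Longrightarrow> derivs g g' \<Longrightarrow> derivs (\<lambda>x. f x * g x) (\<lambda>x. f x * g' x + f' x * g x)"
  by (auto simp: derivs_def intro: has_vector_derivative_mult)

lemma derivs_of_real: "(\<And>x. (f has_real_derivative f' x) (at x)) \<Longrightarrow> derivs (\<lambda>x. of_real (f x)) (\<lambda>x. of_real (f' x))"
  by (auto simp: derivs_def intro: has_vector_derivative_of_real)

lemma derivs_ident: "derivs (\<lambda>x. of_real x) (\<lambda>_. 1)"
  using derivs_of_real[of "\<lambda>x. x" "\<lambda>_. 1"] by simp

lemma derivs_xmult: "derivs f f' \<Longrightarrow> derivs (\<lambda>x. of_real x * f x) (\<lambda>x. of_real x * f' x + f x)"
  using derivs_mult[OF derivs_ident] by simp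

lemma derivs_affine:
  assumes "derivs f f'" shows "derivs (\<lambda>x. f (a * x + b)) (\<lambda>x. of_real a * f' (a * x + b))"
  unfolding derivs_def
proof
  fix x
  have "((\<lambda>x. a * x + b) has_vector_derivative a) (at x)"
    by (rule has_real_derivative_iff_has_vector_derivative[THEN iffD1]) (auto intro!: derivative_eq_intros)
  from vector_diff_chain_at[OF this, of f] assms
  show "((\<lambda>x. f (a * x + b)) has_vector_derivative of_real a * f' (a * x + b)) (at x)"
    by (simp add: derivs_def o_def scaleR_conv_of_real)
qed

lemma derivs_continuous: "derivs f f' \<Longrightarrow> continuous_on A f"
  unfolding derivs_def by (rule continuous_at_imp_continuous_on) (blast intro: has_vector_derivative_continuous)

lemma derivs_cong: "derivs f f' \<Longrightarrow> f' = g' \<Longrightarrow> derivs f g'"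
  by simp

lemma derivs_zero_const:
  assumes "derivs f (\<lambda>_. 0)" shows "f x = f y"
proof -
  obtain c where "\<And>x. x \<in> UNIV \<Longrightarrow> f x = c"
    using has_vector_derivative_zero_constant[of UNIV f] assms by (auto simp: derivs_def)
  then show ?thesis by simp
qed

lemma derivs_unique:
  assumes "derivs f h" "derivs g h" "f a = g a" shows "f = g"
proof
  fix x
  have "derivs (\<lambda>x. f x + (-1) * g x) (\<lambda>x. 0)"
    using derivs_add[OF assms(1) derivs_cmult[OF assms(2), of "-1"]] by simp
  from derivs_zero_const[OF this, of x a] show "f x = g x" using assms(3) by simp
qed

definition smooth :: "(real \<Rightarrow> complex) \<Rightarrow> bool" where
  "smooth f \<longleftrightarrow> (\<forall>k. derivs (rderivs k f) (rderivs (Suc k) f))"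

definition rapid_decay :: "(real \<Rightarrow> complex) \<Rightarrow> bool" where
  "rapid_decay f \<longleftrightarrow> (\<forall>m. \<exists>C. \<forall>x. \<bar>x\<bar> ^ m * cmod (f x) \<le> C)"

lemma schwartz_altdef: "schwartz f \<longleftrightarrow> smooth f \<and> (\<forall>k. rapid_decay (rderivs k f))"
  unfolding schwartz_def smooth_def rapid_decay_def derivs_def by blast

lemma rderivs_shift: "rderivs (Suc k) f = rderivs k (vd f)"
  by (induction k) auto

text \<open>This spares all formulas for k-th derivatives: to see that a function is smooth or
  Schwartz it is enough to exhibit a class containing it that is stable under
  differentiation.\<close>

lemma rderivs_coinduct:
  assumes "X f" "\<And>f. X f \<Longrightarrow> \<exists>f'. X f' \<and> derivs f f'"
  shows "X (rderivs k f) \<and> derivs (rderivs k f) (rderivs (Suc k) f)"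
proof -
  have step: "X (vd h) \<and> derivs h (vd h)" if "X h" for h
    using assms(2)[OF that] derivs_vd by auto
  have "X (rderivs k f)" by (induction k) (use assms(1) step in auto)
  with step show ?thesis by simp
qed

lemma smooth_coinduct:
  assumes "X f" "\<And>f. X f \<Longrightarrow> \<exists>f'. X f' \<and> derivs f f'"
  shows "smooth f"
  using rderivs_coinduct[of X, OF assms] unfolding smooth_def by blast

lemma schwartz_coinduct:
  assumes "X f" "\<And>f. X f \<Longrightarrow> \<exists>f'. X f' \<and> derivs f f'" "\<And>f. X f \<Longrightarrow> rapid_decay f"
  shows "schwartz f"
  using rderivs_coinduct[of X, OF assms(1,2)] assms(3) unfolding schwartz_altdef smooth_def by blast

lemma smooth_derivs: "smooth f \<Longrightarrow> derivs f (vd f)"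
  unfolding smooth_def by (drule spec[of _ 0]) simp

lemma smooth_vd: "smooth f \<Longrightarrow> smooth (vd f)"
  unfolding smooth_def by (simp flip: rderivs_shift del: rderivs_Suc)

lemma schwartz_derivs: "schwartz f \<Longrightarrow> derivs f (vd f)"
  by (simp add: schwartz_altdef smooth_derivs)

lemma schwartz_vd: "schwartz f \<Longrightarrow> schwartz (vd f)"
  unfolding schwartz_altdef by (simp add: smooth_vd flip: rderivs_shift del: rderivs_Suc)

lemma schwartz_rapid: "schwartz f \<Longrightarrow> rapid_decay f"
  unfolding schwartz_altdef by (drule conjunct2, drule spec[of _ 0]) simp

lemma schwartz_continuous: "schwartz f \<Longrightarrow> continuous_on A f"
  using derivs_continuous schwartz_derivs by blast

lemma rapid_decayD: "rapid_decay f \<Longrightarrow> \<exists>C\<ge>0. \<forall>x. \<bar>x\<bar> ^ m * cmod (f x) \<le> C"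
  unfolding rapid_decay_def
  by (metis abs_ge_zero mult_nonneg_nonneg norm_ge_zero order_trans zero_le_power)

lemma rapid_decay_bounded: "rapid_decay f \<Longrightarrow> \<exists>C\<ge>0. \<forall>x. cmod (f x) \<le> C"
  using rapid_decayD[of f 0] by simp

lemma rapid_decay_add:
  assumes "rapid_decay f" "rapid_decay g" shows "rapid_decay (\<lambda>x. f x + g x)"
  unfolding rapid_decay_def
proof
  fix m
  obtain C C' where "\<And>x. \<bar>x\<bar> ^ m * cmod (f x) \<le> C" "\<And>x. \<bar>x\<bar> ^ m * cmod (g x) \<le> C'"
    using assms unfolding rapid_decay_def by blast
  moreover have "\<bar>x\<bar> ^ m * cmod (f x + g x) \<le> \<bar>x\<bar> ^ m * cmod (f x) + \<bar>x\<bar> ^ m * cmod (g x)" for x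
    unfolding distrib_left[symmetric] by (intro mult_left_mono norm_triangle_ineq) simp
  ultimately have "\<bar>x\<bar> ^ m * cmod (f x + g x) \<le> C + C'" for x by (meson add_mono order_trans)
  then show "\<exists>C. \<forall>x. \<bar>x\<bar> ^ m * cmod (f x + g x) \<le> C" by blast
qed

lemma rapid_decay_bmult:
  assumes "rapid_decay f" "\<And>x. cmod (b x) \<le> B" shows "rapid_decay (\<lambda>x. b x * f x)"
  unfolding rapid_decay_def
proof
  fix m
  obtain C where C: "C \<ge> 0" "\<And>x. \<bar>x\<bar> ^ m * cmod (f x) \<le> C" using rapid_decayD[OF assms(1)] by blast
  have B: "B \<ge> 0" using assms(2) norm_ge_zero order_trans by blast
  have "\<bar>x\<bar> ^ m * cmod (b x * f x) \<le> B * C" for x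
  proof -
    have "\<bar>x\<bar> ^ m * cmod (b x * f x) = cmod (b x) * (\<bar>x\<bar> ^ m * cmod (f x))" by (simp add: norm_mult)
    also have "\<dots> \<le> B * C" using assms(2) C B by (intro mult_mono) auto
    finally show ?thesis .
  qed
  then show "\<exists>C. \<forall>x. \<bar>x\<bar> ^ m * cmod (b x * f x) \<le> C" by blast
qed

lemma rapid_decay_cmult: "rapid_decay f \<Longrightarrow> rapid_decay (\<lambda>x. c * f x)"
  using rapid_decay_bmult[of f "\<lambda>_. c" "cmod c"] by simp

lemma rapid_decay_xmult:
  assumes "rapid_decay f" shows "rapid_decay (\<lambda>x. of_real x * f x)"
  unfolding rapid_decay_def
proof
  fix m
  obtain C where "\<And>x. \<bar>x\<bar> ^ Suc m * cmod (f x) \<le> C" using assms unfolding rapid_decay_def by blast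
  then show "\<exists>C. \<forall>x. \<bar>x\<bar> ^ m * cmod (of_real x * f x) \<le> C"
    by (auto simp: norm_mult mult_ac intro!: exI[of _ C])
qed

lemma rapid_decay_affine:
  assumes "rapid_decay f" "a \<noteq> 0" shows "rapid_decay (\<lambda>x. f (a * x + b))"
  unfolding rapid_decay_def
proof
  fix m
  obtain C0 where C0: "\<And>x. cmod (f x) \<le> C0" using rapid_decay_bounded[OF assms(1)] by blast
  obtain C where Cp: "C \<ge> 0" and C: "\<And>x. \<bar>x\<bar> ^ m * cmod (f x) \<le> C" using rapid_decayD[OF assms(1)] by blast
  define K where "K = (2 / \<bar>a\<bar>) ^ m * C + (2 * \<bar>b\<bar> / \<bar>a\<bar>) ^ m * C0"
  have "\<bar>x\<bar> ^ m * cmod (f (a * x + b)) \<le> K" for x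
  proof -
    have C0p: "C0 \<ge> 0" using C0 norm_ge_zero order_trans by blast
    show ?thesis
    proof (cases "\<bar>a * x\<bar> \<le> 2 * \<bar>b\<bar>")
      case True
      then have "\<bar>x\<bar> * \<bar>a\<bar> \<le> 2 * \<bar>b\<bar>" by (simp add: abs_mult mult.commute)
      then have "\<bar>x\<bar> \<le> 2 * \<bar>b\<bar> / \<bar>a\<bar>" using assms(2) by (simp add: pos_le_divide_eq)
      then have "\<bar>x\<bar> ^ m * cmod (f (a * x + b)) \<le> (2 * \<bar>b\<bar> / \<bar>a\<bar>) ^ m * C0"
        by (intro mult_mono power_mono C0) auto
      moreover have "0 \<le> (2 / \<bar>a\<bar>) ^ m * C" using Cp by simp
      ultimately show ?thesis unfolding K_def by linarith
    next
      case False
      then have "\<bar>a * x\<bar> \<le> 2 * \<bar>a * x + b\<bar>" using abs_triangle_ineq4[of "a * x + b" b] by simp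
      then have "\<bar>x\<bar> * \<bar>a\<bar> \<le> 2 * \<bar>a * x + b\<bar>" by (simp add: abs_mult mult.commute)
      then have "\<bar>x\<bar> \<le> 2 * \<bar>a * x + b\<bar> / \<bar>a\<bar>" using assms(2) by (simp add: pos_le_divide_eq)
      then have "\<bar>x\<bar> \<le> (2 / \<bar>a\<bar>) * \<bar>a * x + b\<bar>" by simp
      then have "\<bar>x\<bar> ^ m * cmod (f (a * x + b)) \<le> ((2 / \<bar>a\<bar>) * \<bar>a * x + b\<bar>) ^ m * cmod (f (a * x + b))"
        by (intro mult_right_mono power_mono) auto
      also have "\<dots> = (2 / \<bar>a\<bar>) ^ m * (\<bar>a * x + b\<bar> ^ m * cmod (f (a * x + b)))"
        by (simp only: power_mult_distrib mult.assoc)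
      also have "\<dots> \<le> (2 / \<bar>a\<bar>) ^ m * C" by (intro mult_left_mono C) auto
      moreover have "0 \<le> (2 * \<bar>b\<bar> / \<bar>a\<bar>) ^ m * C0" using C0p by simp
      ultimately show ?thesis unfolding K_def by linarith
    qed
  qed
  then show "\<exists>C. \<forall>x. \<bar>x\<bar> ^ m * cmod (f (a * x + b)) \<le> C" by blast
qed

text \<open>The derivative of a product is a sum of products. Closing under linear combinations
  allows the invariant class of a coinduction to consist of single products.\<close>

inductive linear_comb :: "((real \<Rightarrow> complex) \<Rightarrow> bool) \<Rightarrow> (real \<Rightarrow> complex) \<Rightarrow> bool" for X where
  base: "X f \<Longrightarrow> linear_comb X f"
| add: "linear_comb X f \<Longrightarrow> linear_comb X g \<Longrightarrow> linear_comb X (\<lambda>x. f x + g x)"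
| cmult: "linear_comb X f \<Longrightarrow> linear_comb X (\<lambda>x. c * f x)"

lemma linear_comb_derivs:
  assumes "\<And>f. X f \<Longrightarrow> \<exists>f'. linear_comb X f' \<and> derivs f f'" "linear_comb X f"
  shows "\<exists>f'. linear_comb X f' \<and> derivs f f'"
  using assms(2)
proof induction
  case (add f g) then show ?case using derivs_add linear_comb.add by blast
next
  case (cmult f c) then show ?case using derivs_cmult linear_comb.cmult by blast
qed (use assms(1) in blast)

lemma linear_comb_rapid:
  assumes "\<And>f. X f \<Longrightarrow> rapid_decay f" "linear_comb X f"
  shows "rapid_decay f"
  using assms(2) by induction (auto intro: assms(1) rapid_decay_add rapid_decay_cmult)

lemma schwartz_linear_comb:
  assumes "linear_comb X f" "\<And>f. X f \<Longrightarrow> \<exists>f'. linear_comb X f' \<and> derivs f f'" "\<And>f. X f \<Longrightarrow> rapid_decay f"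
  shows "schwartz f"
  by (rule schwartz_coinduct[of "linear_comb X", OF assms(1)])
    (rule linear_comb_derivs[OF assms(2)] linear_comb_rapid[OF assms(3)], assumption, assumption)+

lemma smooth_linear_comb:
  assumes "linear_comb X f" "\<And>f. X f \<Longrightarrow> \<exists>f'. linear_comb X f' \<and> derivs f f'"
  shows "smooth f"
  by (rule smooth_coinduct[of "linear_comb X", OF assms(1)])
    (rule linear_comb_derivs[OF assms(2)], assumption, assumption)

lemma schwartz_lc:
  assumes "linear_comb schwartz f" shows "schwartz f"
  by (rule schwartz_linear_comb[OF assms])
    (blast intro: schwartz_derivs schwartz_vd linear_comb.base, rule schwartz_rapid)

lemma schwartz_add: "schwartz f \<Longrightarrow> schwartz g \<Longrightarrow> schwartz (\<lambda>x. f x + g x)"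
  by (rule schwartz_lc, rule linear_comb.add; rule linear_comb.base; assumption)

lemma schwartz_cmult: "schwartz f \<Longrightarrow> schwartz (\<lambda>x. c * f x)"
  by (rule schwartz_lc, rule linear_comb.cmult, rule linear_comb.base, assumption)

lemma schwartz_diff: "schwartz f \<Longrightarrow> schwartz g \<Longrightarrow> schwartz (\<lambda>x. f x - g x)"
  using schwartz_add[OF _ schwartz_cmult[of g "-1"], of f] by simp

lemma schwartz_zero: "schwartz (\<lambda>_. 0)"
proof (rule schwartz_coinduct[of "\<lambda>f. f = (\<lambda>_. 0)"])
  show "\<exists>f'. f' = (\<lambda>_. 0) \<and> derivs f f'" if "f = (\<lambda>_. 0)" for f
    using that by (simp add: derivs_def)
qed (auto simp: rapid_decay_def)

lemma schwartz_sum: "(\<And>j. j \<in> J \<Longrightarrow> schwartz (f j)) \<Longrightarrow> schwartz (\<lambda>x. \<Sum>j\<in>J. f j x)"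
  by (induction J rule: infinite_finite_induct) (auto simp: schwartz_zero schwartz_add)

lemma schwartz_xmult:
  assumes "schwartz f" shows "schwartz (\<lambda>x. of_real x * f x)"
proof (rule schwartz_linear_comb[of "\<lambda>h. schwartz h \<or> (\<exists>f. schwartz f \<and> h = (\<lambda>x. of_real x * f x))"])
  let ?X = "\<lambda>h. schwartz h \<or> (\<exists>f. schwartz f \<and> h = (\<lambda>x. of_real x * f x))"
  show "linear_comb ?X (\<lambda>x. of_real x * f x)" using assms by (intro linear_comb.base) blast
  fix h assume "?X h"
  then consider "schwartz h" | f where "schwartz f" "h = (\<lambda>x. of_real x * f x)" by blast
  then show "\<exists>f'. linear_comb ?X f' \<and> derivs h f'"
  proof cases
    case 1 then show ?thesis using schwartz_derivs schwartz_vd linear_comb.base[of ?X] by blast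
  next
    case 2
    have "linear_comb ?X (\<lambda>x. of_real x * vd f x + f x)"
      by (intro linear_comb.add linear_comb.base) (use 2 schwartz_vd in blast)+
    then show ?thesis using 2 derivs_xmult[OF schwartz_derivs] by blast
  qed
  show "rapid_decay h" using \<open>?X h\<close> schwartz_rapid rapid_decay_xmult by blast
qed

lemma schwartz_mult:
  assumes "schwartz f" "schwartz g" shows "schwartz (\<lambda>x. f x * g x)"
proof (rule schwartz_linear_comb[of "\<lambda>h. \<exists>f g. schwartz f \<and> schwartz g \<and> h = (\<lambda>x. f x * g x)"])
  let ?X = "\<lambda>h. \<exists>f g. schwartz f \<and> schwartz g \<and> h = (\<lambda>x. f x * g x)"
  show "linear_comb ?X (\<lambda>x. f x * g x)" using assms by (intro linear_comb.base) blast
  fix h assume "?X h"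
  then obtain f g where fg: "schwartz f" "schwartz g" "h = (\<lambda>x. f x * g x)" by blast
  have "linear_comb ?X (\<lambda>x. f x * vd g x + vd f x * g x)"
    by (intro linear_comb.add linear_comb.base) (use fg schwartz_vd in blast)+
  then show "\<exists>f'. linear_comb ?X f' \<and> derivs h f'"
    using fg derivs_mult[OF schwartz_derivs schwartz_derivs] by blast
  obtain B where "\<And>x. cmod (f x) \<le> B" using rapid_decay_bounded[OF schwartz_rapid[OF fg(1)]] by blast
  then show "rapid_decay h" using rapid_decay_bmult[OF schwartz_rapid[OF fg(2)]] fg(3) by blast
qed

lemma smooth_mult:
  assumes "smooth f" "smooth g" shows "smooth (\<lambda>x. f x * g x)"
proof (rule smooth_linear_comb[of "\<lambda>h. \<exists>f g. smooth f \<and> smooth g \<and> h = (\<lambda>x. f x * g x)"])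
  let ?X = "\<lambda>h. \<exists>f g. smooth f \<and> smooth g \<and> h = (\<lambda>x. f x * g x)"
  show "linear_comb ?X (\<lambda>x. f x * g x)" using assms by (intro linear_comb.base) blast
  fix h assume "?X h"
  then obtain f g where fg: "smooth f" "smooth g" "h = (\<lambda>x. f x * g x)" by blast
  have "linear_comb ?X (\<lambda>x. f x * vd g x + vd f x * g x)"
    by (intro linear_comb.add linear_comb.base) (use fg smooth_vd in blast)+
  then show "\<exists>f'. linear_comb ?X f' \<and> derivs h f'"
    using fg derivs_mult[OF smooth_derivs smooth_derivs] by blast
qed

lemma smooth_add_cmult:
  assumes "smooth f" "smooth g" shows "smooth (\<lambda>x. a * f x + b * g x)"
proof (rule smooth_linear_comb[of smooth])
  show "linear_comb smooth (\<lambda>x. a * f x + b * g x)"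
    by (rule linear_comb.add; rule linear_comb.cmult, rule linear_comb.base, rule assms)
qed (use smooth_derivs smooth_vd linear_comb.base in blast)

lemma smooth_affine:
  assumes "smooth f" shows "smooth (\<lambda>x. f (a * x + b))"
proof (rule smooth_linear_comb[of "\<lambda>h. \<exists>f. smooth f \<and> h = (\<lambda>x. f (a * x + b))"])
  let ?X = "\<lambda>h. \<exists>f. smooth f \<and> h = (\<lambda>x. f (a * x + b))"
  show "linear_comb ?X (\<lambda>x. f (a * x + b))" using assms by (intro linear_comb.base) blast
  fix h assume "?X h"
  then obtain f where f: "smooth f" "h = (\<lambda>x. f (a * x + b))" by blast
  have "linear_comb ?X (\<lambda>x. of_real a * vd f (a * x + b))"
    using f smooth_vd by (intro linear_comb.cmult linear_comb.base) blast
  then show "\<exists>f'. linear_comb ?X f' \<and> derivs h f'"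
    using f derivs_affine[OF smooth_derivs] by blast
qed

lemma smooth_prim: "derivs f f' \<Longrightarrow> smooth f' \<Longrightarrow> smooth f"
  by (rule smooth_coinduct[of "\<lambda>h. h = f \<or> smooth h"]) (use smooth_derivs smooth_vd in blast)+

lemma schwartz_affine:
  assumes "schwartz f" "a \<noteq> 0" shows "schwartz (\<lambda>x. f (a * x + b))"
proof (rule schwartz_linear_comb[of "\<lambda>h. \<exists>f. schwartz f \<and> h = (\<lambda>x. f (a * x + b))"])
  let ?X = "\<lambda>h. \<exists>f. schwartz f \<and> h = (\<lambda>x. f (a * x + b))"
  show "linear_comb ?X (\<lambda>x. f (a * x + b))" using assms by (intro linear_comb.base) blast
  fix h assume "?X h"
  then obtain f where f: "schwartz f" "h = (\<lambda>x. f (a * x + b))" by blast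
  have "linear_comb ?X (\<lambda>x. of_real a * vd f (a * x + b))"
    using f schwartz_vd by (intro linear_comb.cmult linear_comb.base) blast
  then show "\<exists>f'. linear_comb ?X f' \<and> derivs h f'"
    using f derivs_affine[OF schwartz_derivs] by blast
  show "rapid_decay h" using f schwartz_rapid rapid_decay_affine assms(2) by blast
qed

lemma schwartz_shift: "schwartz f \<Longrightarrow> schwartz (\<lambda>x. f (x - t))"
  using schwartz_affine[of f 1 "- t"] by simp

lemma derivs_shift: "derivs f f' \<Longrightarrow> derivs (\<lambda>x. f (x - t)) (\<lambda>x. f' (x - t))"
  using derivs_affine[of f f' 1 "- t"] by simp

lemma schwartz_cnj:
  assumes "schwartz f" shows "schwartz (\<lambda>x. cnj (f x))"
proof (rule schwartz_coinduct[of "\<lambda>h. \<exists>f. schwartz f \<and> h = (\<lambda>x. cnj (f x))"])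
  fix h assume "\<exists>f. schwartz f \<and> h = (\<lambda>x. cnj (f x))"
  then obtain f where f: "schwartz f" "h = (\<lambda>x. cnj (f x))" by blast
  have "derivs h (\<lambda>x. cnj (vd f x))" using schwartz_derivs[OF f(1)] unfolding derivs_def f(2)
    by (auto intro: has_vector_derivative_cnj)
  then show "\<exists>f'. (\<exists>f. schwartz f \<and> f' = (\<lambda>x. cnj (f x))) \<and> derivs h f'"
    using schwartz_vd[OF f(1)] by blast
  show "rapid_decay h" using schwartz_rapid[OF f(1)] f(2) by (simp add: rapid_decay_def)
qed (use assms in blast)

text \<open>Rapid decay of one solution of \<open>g' = f - \<kappa> x g\<close> suffices: the equation controls all its derivatives.\<close>
lemma schwartz_ode:
  assumes g: "rapid_decay g" and f: "schwartz f" and ode: "derivs g (\<lambda>x. f x - \<kappa> * (of_real x * g x))"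
  shows "schwartz g"
proof (rule schwartz_linear_comb[of "\<lambda>h. schwartz h \<or> (\<exists>m. h = (\<lambda>x. of_real x ^ m * g x))"])
  let ?X = "\<lambda>h. schwartz h \<or> (\<exists>m. h = (\<lambda>x. of_real x ^ m * g x))"
  have "?X (\<lambda>x. of_real x ^ 0 * g x)" by blast
  then show "linear_comb ?X g" using linear_comb.base[of ?X "\<lambda>x. of_real x ^ 0 * g x"] by simp
  fix h assume "?X h"
  then consider "schwartz h" | m where "h = (\<lambda>x. of_real x ^ m * g x)" by blast
  then show "\<exists>f'. linear_comb ?X f' \<and> derivs h f'"
  proof cases
    case 1 then show ?thesis using schwartz_derivs schwartz_vd linear_comb.base[of ?X] by blast
  next
    case 2
    have sf: "schwartz (\<lambda>x. of_real x ^ m * f x)" for m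
    proof (induction m)
      case (Suc m) then show ?case using schwartz_xmult[OF Suc] by (simp add: mult.assoc)
    qed (use f in simp)
    have lcm: "linear_comb ?X (\<lambda>x. of_real x ^ m * g x)" for m by (intro linear_comb.base) blast
    have "linear_comb ?X (\<lambda>x. of_real x ^ m * f x + ((- \<kappa>) * (of_real x ^ Suc m * g x) + of_nat m * (of_real x ^ (m - 1) * g x)))"
      by (intro linear_comb.add linear_comb.cmult lcm linear_comb.base disjI1 sf)
    moreover have "derivs (\<lambda>x. of_real x ^ m) (\<lambda>x. of_nat m * of_real x ^ (m - 1))"
      using derivs_of_real[of "\<lambda>x. x ^ m" "\<lambda>x. of_nat m * x ^ (m - 1)"] by (auto intro!: derivative_eq_intros)
    from derivs_mult[OF this ode]
    have "derivs h (\<lambda>x. of_real x ^ m * f x + ((- \<kappa>) * (of_real x ^ Suc m * g x) + of_nat m * (of_real x ^ (m - 1) * g x)))"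
      unfolding 2 by (rule derivs_cong) (auto simp: algebra_simps)
    ultimately show ?thesis by blast
  qed
  have "rapid_decay (\<lambda>x. of_real x ^ m * g x)" for m
  proof (induction m)
    case (Suc m) then show ?case using rapid_decay_xmult[OF Suc] by (simp add: mult.assoc)
  qed (use g in simp)
  then show "rapid_decay h" using \<open>?X h\<close> schwartz_rapid by blast
qed

section \<open>Primitives, and a smooth partition of unity on the line\<close>

definition prim :: "(real \<Rightarrow> complex) \<Rightarrow> real \<Rightarrow> complex" where
  "prim h = (SOME F. F 0 = 0 \<and> derivs F h)"

lemma prim_props:
  assumes h: "continuous_on UNIV h"
  shows "prim h 0 = 0" "derivs (prim h) h"
proof -
  \<comment> \<open>One of the two integrals always vanishes, so F is a primitive on both sides of
    0.\<close>
  define F where "F x = integral {0..x} h - integral {x..0} h" for x :: real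
  have int: "h integrable_on {a..b}" for a b
    using h continuous_on_subset integrable_continuous_interval by blast
  have F_eq: "F x = integral {- R..x} h - integral {- R..0} h" if "- R < x" "R > 0" for x R :: real
  proof (cases "x \<ge> 0")
    case True
    have "integral {- R..0} h + integral {0..x} h = integral {- R..x} h"
      using True that by (intro Henstock_Kurzweil_Integration.integral_combine int) auto
    moreover have "integral {x..0} h = 0" using True by (cases "x = 0") auto
    ultimately show ?thesis unfolding F_def by (simp add: algebra_simps flip: \<open>_ = integral {- R..x} h\<close>)
  next
    case False
    have "integral {- R..x} h + integral {x..0} h = integral {- R..0} h"
      using False that by (intro Henstock_Kurzweil_Integration.integral_combine int) auto
    then show ?thesis using False by (simp add: F_def algebra_simps)
  qed
  have "derivs F h" unfolding derivs_def
  proof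
    fix x :: real
    define R where "R = \<bar>x\<bar> + 1"
    have x: "x \<in> {- R<..<R}" by (auto simp: R_def)
    have "((\<lambda>u. integral {- R..u} h) has_vector_derivative h x) (at x within {- R..R})"
      using x h by (intro integral_has_vector_derivative) (auto intro: continuous_on_subset)
    then have "((\<lambda>u. integral {- R..u} h) has_vector_derivative h x) (at x)"
      using x by (simp add: at_within_Icc_at)
    then have "((\<lambda>u. integral {- R..u} h - integral {- R..0} h) has_vector_derivative h x) (at x)"
      by (auto intro!: derivative_eq_intros)
    then show "(F has_vector_derivative h x) (at x)"
      by (rule has_vector_derivative_transform_within_open[OF _ open_greaterThanLessThan x])
        (auto intro!: F_eq[symmetric])
  qed
  moreover have "F 0 = 0" by (simp add: F_def)
  ultimately have "\<exists>F. F 0 = 0 \<and> derivs F h" by blast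
  from someI_ex[OF this, folded prim_def] show "prim h 0 = 0" "derivs (prim h) h" by auto
qed

lemma prim_unique: "continuous_on UNIV h \<Longrightarrow> derivs F h \<Longrightarrow> prim h = (\<lambda>x. F x - F 0)"
  using derivs_unique[of "prim h" h "\<lambda>x. F x + (-1) * (F 0)" 0]
    derivs_add[of F h "\<lambda>_. (-1) * F 0" "\<lambda>_. 0"] prim_props[of h]
  by (simp add: derivs_def)

text \<open>Mean value inequality with a varying majorant. The Gaussian tails further on are
  estimated through it by choosing \<open>\<phi>\<close> explicitly.\<close>

lemma norm_diff_le_of_derivs:
  assumes "derivs F f" "a \<le> b" "\<And>x. a < x \<Longrightarrow> x < b \<Longrightarrow> cmod (f x) \<le> \<phi>' x"
    "\<And>x. (\<phi> has_real_derivative \<phi>' x) (at x)"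
  shows "cmod (F b - F a) \<le> \<phi> b - \<phi> a"
proof (cases "a = b")
  case False
  show ?thesis
  proof (rule differentiable_bound_general)
    show "continuous_on {a..b} \<phi>" using assms(4) by (meson DERIV_atLeastAtMost_imp_continuous_on)
    show "continuous_on {a..b} F" using assms(1) by (rule derivs_continuous)
  qed (use assms False in \<open>auto simp: derivs_def has_real_derivative_iff_has_vector_derivative\<close>)
qed simp

lemma power_div_fact_le_exp:
  assumes "(y::real) \<ge> 0" shows "y ^ n / fact n \<le> exp y"
proof -
  have "(\<Sum>k\<in>{n}. y ^ k /\<^sub>R fact k) \<le> (\<Sum>k. y ^ k /\<^sub>R fact k)"
    by (rule sum_le_suminf[OF summable_exp_generic]) (use assms in auto)
  then show ?thesis by (simp add: exp_def field_simps)
qed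

text \<open>The classical \<open>exp (- 1 / x)\<close>, cut off at 0, together with the powers of
  \<open>1 / x\<close> that differentiation produces; derivatives of members are linear combinations
  of members.\<close>

definition flat :: "nat \<Rightarrow> real \<Rightarrow> real" where
  "flat n x = (if x \<le> 0 then 0 else exp (- inverse x) * inverse x ^ n)"

text \<open>With \<open>y = 1 / x\<close>, one term of the exponential series dominates
  \<open>y ^ Suc n\<close>. The spare power of y becomes the factor x.\<close>

lemma flat_le: "flat n x \<le> fact (Suc n) * \<bar>x\<bar>"
proof (cases "x \<le> 0")
  case False
  define y where "y = inverse x"
  have y: "y > 0" using False by (simp add: y_def)
  have "y ^ Suc n / fact (Suc n) \<le> exp y" using y by (intro power_div_fact_le_exp) auto
  then have "y ^ Suc n \<le> fact (Suc n) * exp y"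
    by (simp add: pos_divide_le_eq mult.commute del: power_Suc fact_Suc)
  then have "exp (- y) * y ^ Suc n \<le> exp (- y) * (fact (Suc n) * exp y)" by (intro mult_left_mono) auto
  also have "\<dots> = fact (Suc n)" by (simp add: exp_minus)
  finally have "(exp (- y) * y ^ n) * y \<le> fact (Suc n)" by (simp add: mult_ac)
  then have "exp (- y) * y ^ n \<le> fact (Suc n) / y" using y by (simp add: pos_le_divide_eq)
  then show ?thesis using False by (simp add: flat_def y_def divide_inverse)
next
  case True
  have "0 \<le> fact (Suc n) * \<bar>x\<bar>" by (intro mult_nonneg_nonneg fact_ge_zero abs_ge_zero)
  then show ?thesis using True by (simp add: flat_def)
qed

lemma flat_deriv: "(flat n has_real_derivative flat (n + 2) x - real n * flat (n + 1) x) (at x)"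
proof (cases x "0::real" rule: linorder_cases)
  case less
  have "((\<lambda>_. 0::real) has_real_derivative 0) (at x)" by simp
  then have "(flat n has_real_derivative 0) (at x)"
    by (rule has_field_derivative_transform_within_open[where S = "{..<0}"]) (use less in \<open>auto simp: flat_def\<close>)
  then show ?thesis using less by (simp add: flat_def)
next
  case greater
  have 1: "((\<lambda>x. inverse x) has_real_derivative - (inverse x ^ 2)) (at x)"
    using greater by (auto intro!: derivative_eq_intros simp: power2_eq_square)
  have 2: "((\<lambda>x. exp (- inverse x)) has_real_derivative exp (- inverse x) * inverse x ^ 2) (at x)"
    using DERIV_chain2[OF DERIV_exp DERIV_minus[OF 1]] by simp
  have 3: "((\<lambda>x. inverse x ^ n) has_real_derivative real n * inverse x ^ (n - 1) * (- (inverse x ^ 2))) (at x)"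
    using DERIV_power[OF 1, of n] by (simp add: mult_ac)
  have "((\<lambda>x. exp (- inverse x) * inverse x ^ n) has_real_derivative
      exp (- inverse x) * inverse x ^ 2 * inverse x ^ n + real n * inverse x ^ (n - 1) * (- (inverse x ^ 2)) * exp (- inverse x)) (at x)"
    by (rule DERIV_mult[OF 2 3])
  also have "exp (- inverse x) * inverse x ^ 2 * inverse x ^ n + real n * inverse x ^ (n - 1) * (- (inverse x ^ 2)) * exp (- inverse x)
     = flat (n + 2) x - real n * flat (n + 1) x"
    using greater by (cases n) (simp_all add: flat_def power_add power2_eq_square mult_ac)
  finally show ?thesis
    by (rule has_field_derivative_transform_within_open[where S = "{0<..}"]) (use greater in \<open>auto simp: flat_def\<close>)
next
  case equal
  \<comment> \<open>The difference quotient at the origin has the next member of the family as its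
    modulus, and \<open>flat_le\<close> bounds that by a multiple of \<open>|y|\<close>.\<close>
  have bd: "\<bar>flat n y / y\<bar> \<le> fact (n + 2) * \<bar>y\<bar>" if "y \<noteq> 0" for y
  proof -
    have "\<bar>flat n y / y\<bar> = flat (n + 1) y"
      using that by (auto simp: flat_def divide_inverse abs_mult)
    then show ?thesis using flat_le[of "n + 1" y] by (simp add: numeral_2_eq_2)
  qed
  have "((\<lambda>y. flat n y / y) \<longlongrightarrow> 0) (at 0)"
  proof (rule Lim_null_comparison)
    show "\<forall>\<^sub>F y in at 0. norm (flat n y / y) \<le> fact (n + 2) * \<bar>y\<bar>"
      unfolding eventually_at_filter using bd by (intro always_eventually) simp
    show "((\<lambda>y. fact (n + 2) * \<bar>y\<bar>) \<longlongrightarrow> 0) (at (0::real))"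
      by (intro tendsto_mult_right_zero tendsto_rabs_zero tendsto_ident_at)
  qed
  moreover have "flat n 0 = 0" "flat (n+2) 0 = 0" "flat (n+1) 0 = 0" by (simp_all add: flat_def)
  ultimately show ?thesis using equal by (simp add: has_field_derivative_iff)
qed

lemma smooth_flat: "smooth (\<lambda>x. of_real (flat n x))"
proof (rule smooth_linear_comb[of "\<lambda>h. \<exists>n. h = (\<lambda>x. of_real (flat n x))"])
  let ?X = "\<lambda>h. \<exists>n. h = (\<lambda>x. complex_of_real (flat n x))"
  show "linear_comb ?X (\<lambda>x. of_real (flat n x))" by (rule linear_comb.base) blast
  fix h assume "?X h"
  then obtain n where n: "h = (\<lambda>x. complex_of_real (flat n x))" by blast
  have "linear_comb ?X (\<lambda>x. of_real (flat (n + 2) x) + (- of_nat n) * of_real (flat (n + 1) x))"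
    by (rule linear_comb.add, rule linear_comb.base, blast, rule linear_comb.cmult, rule linear_comb.base, blast)
  moreover have "derivs h (\<lambda>x. of_real (flat (n + 2) x) + (- of_nat n) * of_real (flat (n + 1) x))"
    unfolding n by (rule derivs_cong[OF derivs_of_real[OF flat_deriv]]) auto
  ultimately show "\<exists>f'. linear_comb ?X f' \<and> derivs h f'" by blast
qed

lemma schwartz_compact_support:
  assumes "smooth f" "\<And>x. \<bar>x\<bar> > R \<Longrightarrow> f x = 0"
  shows "schwartz f"
proof (rule schwartz_coinduct[of "\<lambda>f. smooth f \<and> (\<forall>x. \<bar>x\<bar> > R \<longrightarrow> f x = 0)"])
  fix f assume f: "smooth f \<and> (\<forall>x. \<bar>x\<bar> > R \<longrightarrow> f x = 0)"
  have "vd f x = 0" if "\<bar>x\<bar> > R" for x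
  proof -
    have "((\<lambda>_. 0) has_vector_derivative (0::complex)) (at x)" by simp
    moreover have "open {x::real. R < \<bar>x\<bar>}" by (intro open_Collect_less continuous_intros)
    ultimately have "(f has_vector_derivative 0) (at x)"
      by (rule has_vector_derivative_transform_within_open) (use f that in auto)
    then show ?thesis unfolding vd_def by (rule vector_derivative_at)
  qed
  then show "\<exists>f'. (smooth f' \<and> (\<forall>x. \<bar>x\<bar> > R \<longrightarrow> f' x = 0)) \<and> derivs f f'"
    using f smooth_derivs smooth_vd by blast
  show "rapid_decay f"
    unfolding rapid_decay_def
  proof
    fix m
    have "continuous_on {- \<bar>R\<bar>..\<bar>R\<bar>} (\<lambda>x. \<bar>x\<bar> ^ m * cmod (f x))"
      using f by (intro continuous_intros derivs_continuous[OF smooth_derivs]) auto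
    then have "bounded ((\<lambda>x. \<bar>x\<bar> ^ m * cmod (f x)) ` {- \<bar>R\<bar>..\<bar>R\<bar>})"
      by (intro compact_imp_bounded compact_continuous_image compact_Icc)
    then obtain B where "\<forall>y\<in>(\<lambda>x. \<bar>x\<bar> ^ m * cmod (f x)) ` {- \<bar>R\<bar>..\<bar>R\<bar>}. norm y \<le> B"
      unfolding bounded_iff by blast
    then have B: "\<bar>\<bar>x\<bar> ^ m * cmod (f x)\<bar> \<le> B" if "x \<in> {- \<bar>R\<bar>..\<bar>R\<bar>}" for x using that by auto
    have "\<bar>x\<bar> ^ m * cmod (f x) \<le> \<bar>B\<bar>" for x
    proof (cases "\<bar>x\<bar> > R")
      case True then show ?thesis using f by simp
    next
      case False
      then have "x \<in> {- \<bar>R\<bar>..\<bar>R\<bar>}" by auto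
      from B[OF this] show ?thesis by simp
    qed
    then show "\<exists>C. \<forall>x. \<bar>x\<bar> ^ m * cmod (f x) \<le> C" by blast
  qed
qed (use assms in auto)

text \<open>The last clause makes the integer translates a partition of unity; by the support
  condition at most two of them are nonzero at any point.\<close>

definition is_bump :: "(real \<Rightarrow> real) \<Rightarrow> bool" where
  "is_bump \<psi> \<longleftrightarrow> schwartz (\<lambda>x. of_real (\<psi> x)) \<and> (\<forall>x. 0 \<le> \<psi> x \<and> \<psi> x \<le> 1) \<and>
     (\<forall>x. 1 \<le> \<bar>x\<bar> \<longrightarrow> \<psi> x = 0) \<and> (\<forall>x. 0 \<le> x \<and> x \<le> 1 \<longrightarrow> \<psi> x + \<psi> (x - 1) = 1)"

text \<open>With a smooth step \<open>s\<close> from 0 to 1 on \<open>[0, 1]\<close>, take \<open>\<psi> x = s (x + 1) - s x\<close>: the integer translates telescope.\<close>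
lemma bump_exists: "\<exists>\<psi>. is_bump \<psi>"
proof -
  define b where "b x = flat 0 x * flat 0 (1 - x)" for x
  have b: "b x \<ge> 0" "x \<le> 0 \<Longrightarrow> b x = 0" "x \<ge> 1 \<Longrightarrow> b x = 0" "0 < x \<Longrightarrow> x < 1 \<Longrightarrow> b x > 0" for x
    by (auto simp: b_def flat_def)
  have sb: "smooth (\<lambda>x. of_real (b x))"
  proof -
    have "smooth (\<lambda>x. of_real (flat 0 x) * of_real (flat 0 ((-1) * x + 1)))"
      by (intro smooth_mult smooth_flat smooth_affine[OF smooth_flat])
    then show ?thesis by (simp add: b_def algebra_simps)
  qed
  note cb = derivs_continuous[OF smooth_derivs[OF sb], of UNIV]
  define F where "F x = Re (prim (\<lambda>x. of_real (b x)) x)" for x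
  have dF: "(F has_real_derivative b x) (at x)" for x
    using bounded_linear.has_vector_derivative[OF bounded_linear_Re] prim_props(2)[OF cb]
    unfolding F_def derivs_def by (fastforce simp: has_real_derivative_iff_has_vector_derivative)
  have F0: "F 0 = 0" using prim_props(1)[OF cb] by (simp add: F_def)
  have sF: "smooth (\<lambda>x. of_real (F x))" by (rule smooth_prim[OF derivs_of_real[OF dF] sb])
  have mono: "F x \<le> F y" if "x \<le> y" for x y
    by (rule DERIV_nonneg_imp_nondecreasing[OF that]) (use dF b in blast)
  have Fneg: "F x = 0" if "x \<le> 0" for x
  proof -
    have "F x \<ge> F 0" by (rule DERIV_nonpos_imp_nonincreasing[OF that]) (use dF b in force)
    then show ?thesis using mono[OF that] F0 by simp
  qed
  have Fpos: "F x = F 1" if "x \<ge> 1" for x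
  proof -
    have "F 1 \<ge> F x" by (rule DERIV_nonpos_imp_nonincreasing[OF that]) (use dF b in force)
    then show ?thesis using mono[OF that] by simp
  qed
  obtain z where "0 < z" "z < 1" "F 1 - F 0 = (1 - 0) * b z"
    using MVT2[of 0 1 F b] dF by force
  then have F1: "F 1 > 0" using b(4) F0 by simp
  define \<psi> where "\<psi> x = (F (x + 1) - F x) / F 1" for x
  have zero: "\<psi> x = 0" if "\<bar>x\<bar> \<ge> 1" for x
  proof (cases "x \<ge> 1")
    case True
    then show ?thesis using Fpos[of x] Fpos[of "x + 1"] by (simp add: \<psi>_def)
  next
    case False
    then have "x + 1 \<le> 0" using that by linarith
    then show ?thesis using Fneg[of x] Fneg[of "x + 1"] by (simp add: \<psi>_def)
  qed
  have "is_bump \<psi>" unfolding is_bump_def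
  proof (intro conjI allI impI)
    show "schwartz (\<lambda>x. of_real (\<psi> x))"
    proof (rule schwartz_compact_support[of _ 1])
      have "smooth (\<lambda>x. (1 / of_real (F 1)) * of_real (F (1 * x + 1)) + (- 1 / of_real (F 1)) * of_real (F x))"
        by (intro smooth_add_cmult sF smooth_affine[OF sF])
      then show "smooth (\<lambda>x. of_real (\<psi> x))" by (simp add: \<psi>_def diff_divide_distrib)
    qed (use zero in auto)
    fix x
    show "0 \<le> \<psi> x" using mono[of x "x + 1"] F1 by (simp add: \<psi>_def)
    have "F (x + 1) - F x \<le> F 1"
      using mono[of "x + 1" "max 1 (x + 1)"] Fpos[of "max 1 (x + 1)"] mono[of "min x 0" x] Fneg[of "min x 0"] by simp
    then show "\<psi> x \<le> 1" using F1 by (simp add: \<psi>_def)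
    show "\<psi> x = 0" if "1 \<le> \<bar>x\<bar>" using zero that by blast
    show "\<psi> x + \<psi> (x - 1) = 1" if "0 \<le> x \<and> x \<le> 1"
      using that Fpos[of "x + 1"] Fneg[of "x - 1"] F1 by (simp add: \<psi>_def flip: add_divide_distrib)
  qed
  then show ?thesis by blast
qed

definition bump :: "real \<Rightarrow> real" where "bump = (SOME \<psi>. is_bump \<psi>)"

lemma is_bump_bump: "is_bump bump"
  unfolding bump_def using bump_exists by (rule someI_ex)

lemma schwartz_bump: "schwartz (\<lambda>x. of_real (bump x))"
  and bump_nonneg: "0 \<le> bump x" and bump_le_1: "bump x \<le> 1"
  and bump_eq_0: "1 \<le> \<bar>x\<bar> \<Longrightarrow> bump x = 0"
  using is_bump_bump unfolding is_bump_def by auto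

text \<open>All other translates vanish at y, and the hypothesis on c makes a truncated sum agree
  with the full one.\<close>

lemma sum_bump_finite:
  fixes c :: "int \<Rightarrow> complex"
  assumes "finite A" "\<And>j. j \<in> {\<lfloor>y\<rfloor>, \<lfloor>y\<rfloor> + 1} \<Longrightarrow> j \<notin> A \<Longrightarrow> c j = 0"
  shows "(\<Sum>j\<in>A. c j * of_real (bump (y - of_int j))) =
    c \<lfloor>y\<rfloor> * of_real (bump (y - of_int \<lfloor>y\<rfloor>)) + c (\<lfloor>y\<rfloor> + 1) * of_real (bump (y - of_int \<lfloor>y\<rfloor> - 1))"
proof -
  let ?B = "{\<lfloor>y\<rfloor>, \<lfloor>y\<rfloor> + 1}"
  have 0: "bump (y - of_int j) = 0" if "j \<notin> ?B" for j
  proof (rule bump_eq_0)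
    have "j \<le> \<lfloor>y\<rfloor> - 1 \<or> j \<ge> \<lfloor>y\<rfloor> + 2" using that by auto
    then show "1 \<le> \<bar>y - of_int j\<bar>" by linarith
  qed
  have "(\<Sum>j\<in>A. c j * of_real (bump (y - of_int j))) = (\<Sum>j\<in>A \<union> ?B. c j * of_real (bump (y - of_int j)))"
    using assms by (intro sum.mono_neutral_left) auto
  also have "\<dots> = (\<Sum>j\<in>?B. c j * of_real (bump (y - of_int j)))"
    using assms 0 by (intro sum.mono_neutral_right) auto
  finally show ?thesis by (simp add: algebra_simps)
qed

lemma bump_partition: "bump (y - of_int \<lfloor>y\<rfloor>) + bump (y - of_int \<lfloor>y\<rfloor> - 1) = 1"
proof -
  have "0 \<le> y - of_int \<lfloor>y\<rfloor> \<and> y - of_int \<lfloor>y\<rfloor> \<le> 1" by linarith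
  then show ?thesis using is_bump_bump unfolding is_bump_def by blast
qed

section \<open>Seminorms, completeness and compactness on Schwartz space\<close>

definition supn :: "('a \<Rightarrow> complex) \<Rightarrow> real" where
  "supn f = (SUP x. cmod (f x))"

lemma supn_leI: "(\<And>x. cmod (f x) \<le> C) \<Longrightarrow> supn f \<le> C"
  unfolding supn_def by (rule cSUP_least) auto

lemma le_supn: "schwartz f \<Longrightarrow> cmod (f x) \<le> supn f"
  unfolding supn_def
proof (rule cSUP_upper)
  assume "schwartz f"
  then obtain C where "\<forall>x. cmod (f x) \<le> C" using rapid_decay_bounded schwartz_rapid by blast
  then show "bdd_above (range (\<lambda>x. cmod (f x)))" by (auto intro: bdd_aboveI2)
qed simp

text \<open>Up to multiplicities, the sum of the sup norms of \<open>w f\<close> over all words w of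
  length at most k in multiplication by x and \<open>d/dx\<close>. This recursive form is what the
  commutator inductions use.\<close>

fun sq :: "nat \<Rightarrow> (real \<Rightarrow> complex) \<Rightarrow> real" where
  "sq 0 f = supn f"
| "sq (Suc k) f = sq k f + sq k (\<lambda>x. of_real x * f x) + sq k (vd f)"

lemma vd_add: "schwartz f \<Longrightarrow> schwartz g \<Longrightarrow> vd (\<lambda>x. f x + g x) = (\<lambda>x. vd f x + vd g x)"
  by (intro derivs_vd derivs_add schwartz_derivs)

lemma vd_cmult: "schwartz f \<Longrightarrow> vd (\<lambda>x. c * f x) = (\<lambda>x. c * vd f x)"
  by (intro derivs_vd derivs_cmult schwartz_derivs)

lemma sq_nonneg: "schwartz f \<Longrightarrow> 0 \<le> sq k f"
proof (induction k arbitrary: f)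
  case 0 then show ?case using le_supn[of f 0] norm_ge_zero[of "f 0"] by (simp del: norm_ge_zero)
next
  case (Suc k) then show ?case by (simp add: schwartz_xmult schwartz_vd)
qed

lemma sq_add: "schwartz f \<Longrightarrow> schwartz g \<Longrightarrow> sq k (\<lambda>x. f x + g x) \<le> sq k f + sq k g"
proof (induction k arbitrary: f g)
  case 0
  have "cmod (f x + g x) \<le> supn f + supn g" for x
    using norm_triangle_ineq[of "f x" "g x"] le_supn[OF 0(1), of x] le_supn[OF 0(2), of x] by linarith
  then show ?case by (simp add: supn_leI)
next
  case (Suc k)
  have "sq k (\<lambda>x. of_real x * (f x + g x)) \<le> sq k (\<lambda>x. of_real x * f x) + sq k (\<lambda>x. of_real x * g x)"
    unfolding distrib_left by (intro Suc schwartz_xmult)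
  moreover have "sq k (vd (\<lambda>x. f x + g x)) \<le> sq k (vd f) + sq k (vd g)"
    unfolding vd_add[OF Suc.prems] by (intro Suc schwartz_vd)
  ultimately show ?case using Suc.IH[OF Suc.prems] by simp
qed

lemma supn_cmult: "schwartz f \<Longrightarrow> supn (\<lambda>x. c * f x) = cmod c * supn f"
proof (cases "c = 0")
  case False
  assume f: "schwartz f"
  have "supn (\<lambda>x. c * f x) \<le> cmod c * supn f"
    by (rule supn_leI) (simp add: norm_mult le_supn[OF f] mult_left_mono)
  moreover have "supn f \<le> supn (\<lambda>x. c * f x) / cmod c"
  proof (rule supn_leI)
    fix x
    have "cmod c * cmod (f x) \<le> supn (\<lambda>x. c * f x)"
      using le_supn[OF schwartz_cmult[OF f, of c], of x] by (simp add: norm_mult)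
    then show "cmod (f x) \<le> supn (\<lambda>x. c * f x) / cmod c" using False by (simp add: field_simps)
  qed
  ultimately show ?thesis using False by (simp add: field_simps antisym)
qed (simp add: supn_def)

lemma sq_cmult: "schwartz f \<Longrightarrow> sq k (\<lambda>x. c * f x) = cmod c * sq k f"
proof (induction k arbitrary: f)
  case 0 then show ?case by (simp add: supn_cmult)
next
  case (Suc k)
  have "(\<lambda>x. of_real x * (c * f x)) = (\<lambda>x. c * (of_real x * f x))" by (simp add: mult_ac)
  then show ?case using Suc by (simp add: vd_cmult schwartz_xmult schwartz_vd distrib_left)
qed

lemma sq_diff: "schwartz f \<Longrightarrow> schwartz g \<Longrightarrow> sq k (\<lambda>x. f x - g x) \<le> sq k f + sq k g"
  using sq_add[of f "\<lambda>x. (-1) * g x" k] sq_cmult[of g k "-1"] schwartz_cmult[of g "-1"] by simp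

lemma sq_mono_Suc: "schwartz f \<Longrightarrow> sq k f \<le> sq (Suc k) f"
  by (simp add: sq_nonneg schwartz_xmult schwartz_vd)

lemma sq_xmult_le: "schwartz f \<Longrightarrow> sq k (\<lambda>x. of_real x * f x) \<le> sq (Suc k) f"
  by (simp add: sq_nonneg schwartz_vd)

lemma sq_vd_le: "schwartz f \<Longrightarrow> sq k (vd f) \<le> sq (Suc k) f"
  by (simp add: sq_nonneg schwartz_xmult)

lemma schwartz_rderivs: "schwartz f \<Longrightarrow> schwartz (rderivs k f)"
  by (induction k) (simp_all add: schwartz_vd)

lemma sq_rderivs_le: "schwartz f \<Longrightarrow> sq m (rderivs k f) \<le> sq (m + k) f"
proof (induction k arbitrary: f)
  case (Suc k)
  have "sq m (rderivs (Suc k) f) \<le> sq (m + k) (vd f)"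
    unfolding rderivs_shift by (intro Suc schwartz_vd)
  also have "\<dots> \<le> sq (Suc (m + k)) f" by (rule sq_vd_le[OF Suc.prems])
  finally show ?case by simp
qed simp

lemma power_mult_le_sq: "schwartz f \<Longrightarrow> \<bar>x\<bar> ^ m * cmod (f x) \<le> sq m f"
proof (induction m arbitrary: f)
  case 0 then show ?case by (simp add: le_supn)
next
  case (Suc m)
  have "\<bar>x\<bar> ^ Suc m * cmod (f x) = \<bar>x\<bar> ^ m * cmod (of_real x * f x)" by (simp add: norm_mult mult_ac)
  also have "\<dots> \<le> sq m (\<lambda>x. of_real x * f x)" by (intro Suc schwartz_xmult)
  also have "\<dots> \<le> sq (Suc m) f" by (rule sq_xmult_le[OF Suc.prems])
  finally show ?case .
qed

lemma derivs_suminf: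
  assumes d: "\<And>n. derivs (f n) (f' n)" and b: "\<And>n x. cmod (f n x) \<le> M n" "\<And>n x. cmod (f' n x) \<le> M' n"
    and s: "summable M" "summable M'"
  shows "derivs (\<lambda>x. \<Sum>n. f n x) (\<lambda>x. \<Sum>n. f' n x)"
proof -
  have sf: "summable (\<lambda>n. f n x)" for x by (rule summable_comparison_test'[OF s(1)]) (rule b)
  have uc: "uniform_limit UNIV (\<lambda>n x. \<Sum>i<n. f' i x) (\<lambda>x. \<Sum>n. f' n x) sequentially"
    by (rule Weierstrass_m_test[OF _ s(2)]) (rule b)
  have "\<exists>g. \<forall>x\<in>UNIV. (\<lambda>n. f n x) sums g x \<and> (g has_derivative (\<lambda>h. h *\<^sub>R (\<Sum>n. f' n x))) (at x within UNIV)"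
  proof (rule has_derivative_series[where f' = "\<lambda>n x h. h *\<^sub>R f' n x" and x = 0 and l = "\<Sum>n. f n 0"])
    show "(f n has_derivative (\<lambda>h. h *\<^sub>R f' n x)) (at x within UNIV)" for n x
      using d[of n] unfolding derivs_def has_vector_derivative_def by simp
    fix e :: real assume "e > 0"
    then have "\<forall>\<^sub>F n in sequentially. \<forall>x\<in>UNIV. dist (\<Sum>i<n. f' i x) (\<Sum>n. f' n x) < e"
      using uc by (rule uniform_limitD[rotated])
    then show "\<forall>\<^sub>F n in sequentially. \<forall>x\<in>UNIV. \<forall>h. norm ((\<Sum>i<n. h *\<^sub>R f' i x) - h *\<^sub>R (\<Sum>n. f' n x)) \<le> e * norm h"
    proof (rule eventually_mono, intro ballI allI)
      fix n and x h :: real assume *: "\<forall>x\<in>UNIV. dist (\<Sum>i<n. f' i x) (\<Sum>n. f' n x) < e"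
      have "norm ((\<Sum>i<n. h *\<^sub>R f' i x) - h *\<^sub>R (\<Sum>n. f' n x)) = \<bar>h\<bar> * dist (\<Sum>i<n. f' i x) (\<Sum>n. f' n x)"
        by (simp add: dist_norm flip: scaleR_sum_right scaleR_diff_right)
      also have "\<dots> \<le> \<bar>h\<bar> * e" using * by (intro mult_left_mono) (auto intro: less_imp_le)
      finally show "norm ((\<Sum>i<n. h *\<^sub>R f' i x) - h *\<^sub>R (\<Sum>n. f' n x)) \<le> e * norm h" by (simp add: mult.commute)
    qed
  next
    show "(\<lambda>n. f n 0) sums (\<Sum>n. f n 0)" using sf by (rule summable_sums)
  qed auto
  then obtain g where g: "\<And>x. (\<lambda>n. f n x) sums g x" "\<And>x. (g has_vector_derivative (\<Sum>n. f' n x)) (at x)"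
    by (auto simp: has_vector_derivative_def)
  have "g = (\<lambda>x. \<Sum>n. f n x)" using g(1) sums_unique by blast
  then show ?thesis using g(2) by (simp add: derivs_def)
qed

text \<open>The seminorm of order \<open>m + k\<close> dominates \<open>|x| ^ m\<close> times the
  k-th derivative, so the pointwise sum may be differentiated term by term and all its derivatives
  decay rapidly.\<close>

lemma sq_complete:
  assumes u: "\<And>j. schwartz (u j)" and s: "\<And>k. summable (\<lambda>j. sq k (u j))"
  shows "\<exists>f. schwartz f \<and> (\<lambda>N. sq 0 (\<lambda>x. f x - (\<Sum>j<N. u j x))) \<longlonglongrightarrow> 0"
proof -
  define U where "U k x = (\<Sum>j. rderivs k (u j) x)" for k x
  have b: "\<bar>x\<bar> ^ m * cmod (rderivs k (u j) x) \<le> sq (m + k) (u j)" for m k j x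
    using power_mult_le_sq[OF schwartz_rderivs[OF u]] sq_rderivs_le[OF u] order_trans by blast
  have b0: "cmod (rderivs k (u j) x) \<le> sq k (u j)" for k j x using b[where m = 0] by simp
  have sn: "summable (\<lambda>j. cmod (rderivs k (u j) x))" for k x
    by (rule summable_comparison_test'[OF s[of k]]) (simp add: b0)
  have dU: "derivs (U k) (U (Suc k))" for k
    unfolding U_def
  proof (rule derivs_suminf)
    show "derivs (rderivs k (u n)) (rderivs (Suc k) (u n))" for n
      using schwartz_derivs[OF schwartz_rderivs[OF u]] by simp
    show "cmod (rderivs k (u n) x) \<le> sq k (u n)" "cmod (rderivs (Suc k) (u n) x) \<le> sq (Suc k) (u n)" for n x
      by (rule b0)+
  qed (rule s)+
  have rU: "rapid_decay (U k)" for k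
    unfolding rapid_decay_def
  proof
    fix m
    have "\<bar>x\<bar> ^ m * cmod (U k x) \<le> (\<Sum>j. sq (m + k) (u j))" for x
    proof -
      have "\<bar>x\<bar> ^ m * cmod (U k x) \<le> \<bar>x\<bar> ^ m * (\<Sum>j. cmod (rderivs k (u j) x))"
        unfolding U_def by (intro mult_left_mono summable_norm sn) simp
      also have "\<dots> = (\<Sum>j. \<bar>x\<bar> ^ m * cmod (rderivs k (u j) x))" by (rule suminf_mult[OF sn, symmetric])
      also have "\<dots> \<le> (\<Sum>j. sq (m + k) (u j))" by (intro suminf_le b summable_mult sn s)
      finally show ?thesis .
    qed
    then show "\<exists>C. \<forall>x. \<bar>x\<bar> ^ m * cmod (U k x) \<le> C" by blast
  qed
  have sU: "schwartz (U 0)"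
    by (rule schwartz_coinduct[of "\<lambda>f. \<exists>k. f = U k"]) (use dU rU in blast)+
  have "(\<lambda>N. sq 0 (\<lambda>x. U 0 x - (\<Sum>j<N. u j x))) \<longlonglongrightarrow> 0"
  proof (rule Lim_null_comparison)
    show "\<forall>\<^sub>F N in sequentially. norm (sq 0 (\<lambda>x. U 0 x - (\<Sum>j<N. u j x))) \<le> (\<Sum>j. sq 0 (u (j + N)))"
    proof (intro always_eventually allI)
      fix N
      have "sq 0 (\<lambda>x. U 0 x - (\<Sum>j<N. u j x)) \<le> (\<Sum>j. sq 0 (u (j + N)))"
        unfolding sq.simps
      proof (rule supn_leI)
        fix x
        have su: "summable (\<lambda>j. cmod (u j x))" using sn[of 0 x] by simp
        have "U 0 x = (\<Sum>j. u (j + N) x) + (\<Sum>j<N. u j x)"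
          unfolding U_def rderivs.simps by (rule suminf_split_initial_segment[OF summable_norm_cancel[OF su]])
        then have "cmod (U 0 x - (\<Sum>j<N. u j x)) = cmod (\<Sum>j. u (j + N) x)" by simp
        also have "\<dots> \<le> (\<Sum>j. cmod (u (j + N) x))"
          by (rule summable_norm) (use su summable_iff_shift[of "\<lambda>j. cmod (u j x)"] in blast)
        also have "\<dots> \<le> (\<Sum>j. supn (u (j + N)))"
          using su s[of 0] le_supn[OF u] summable_iff_shift[of "\<lambda>j. cmod (u j x)" N] summable_iff_shift[of "\<lambda>j. supn (u j)" N]
          by (intro suminf_le) simp_all
        finally show "cmod (U 0 x - (\<Sum>j<N. u j x)) \<le> (\<Sum>j. supn (u (j + N)))" .
      qed
      moreover have "0 \<le> sq 0 (\<lambda>x. U 0 x - (\<Sum>j<N. u j x))"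
        by (intro sq_nonneg schwartz_diff sU schwartz_sum u)
      ultimately show "norm (sq 0 (\<lambda>x. U 0 x - (\<Sum>j<N. u j x))) \<le> (\<Sum>j. sq 0 (u (j + N)))" by simp
    qed
    show "(\<lambda>N. \<Sum>j. sq 0 (u (j + N))) \<longlonglongrightarrow> 0" by (rule suminf_exist_split2[OF s])
  qed
  then show ?thesis using sU by blast
qed

lemma schwartz_lipschitz:
  assumes "schwartz f" shows "cmod (f x - f y) \<le> sq 1 f * \<bar>x - y\<bar>"
proof -
  have le: "cmod (f b - f a) \<le> sq 1 f * b - sq 1 f * a" if "a \<le> b" for a b
  proof (rule norm_diff_le_of_derivs[OF schwartz_derivs[OF assms] that])
    show "cmod (vd f x) \<le> sq 1 f" for x
      using le_supn[OF schwartz_vd[OF assms], of x] sq_vd_le[OF assms, of 0] by simp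
    show "((*) (sq 1 f) has_real_derivative sq 1 f) (at x)" for x by (auto intro!: derivative_eq_intros)
  qed
  show ?thesis
  proof (cases "x \<le> y")
    case True
    then show ?thesis using le[of x y] by (simp add: norm_minus_commute algebra_simps)
  next
    case False
    then show ?thesis using le[of y x] by (simp add: algebra_simps)
  qed
qed

text \<open>Sampling on a finite grid and interpolating with bumps has finite rank. Near the grid
  the error is the mesh times a Lipschitz constant, beyond it f itself is small by decay;
  \<open>sq 1\<close> controls both.\<close>

lemma sq_rellich:
  assumes "\<epsilon> > 0"
  shows "\<exists>J l r C. carrier_approx {f. schwartz f} sq J l r C \<epsilon>"
proof -
  \<comment> \<open>The mesh equals the allowed error, and the grid reaches past
    \<open>|x| = 1 / \<epsilon>\<close>, beyond which
    \<open>|f x| \<le> \<epsilon> * sq 1 f\<close>.\<close>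
  define h where "h = \<epsilon>"
  define K :: int where "K = \<lceil>1 / (\<epsilon> * h)\<rceil> + 2"
  have h: "h > 0" using assms by (simp add: h_def)
  define node where "node j = of_int j * h" for j :: int
  define r where "r j x = complex_of_real (bump (x / h - of_int j))" for j x
  show ?thesis
  proof (rule carrier_approxI[where A = "{-K..K}" and r = r and l = "\<lambda>j f. f (node j)" and C = 1])
    show "r j \<in> {f. schwartz f}" for j
      using schwartz_affine[OF schwartz_bump, of "1/h" "- of_int j"] h by (simp add: r_def[abs_def])
    show "cmod (f (node j)) \<le> 1 * sq 0 f" if "f \<in> {f. schwartz f}" for f j
      using that le_supn by simp
    fix f assume "f \<in> {f. schwartz f}"
    then have f: "schwartz f" by simp
    have q1: "sq 1 f \<ge> 0" by (rule sq_nonneg[OF f])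
    have "cmod (f x - (\<Sum>j\<in>{-K..K}. f (node j) * r j x)) \<le> \<epsilon> * sq 1 f" for x
    proof -
      let ?y = "x / h"
      let ?a = "bump (?y - of_int \<lfloor>?y\<rfloor>)" and ?b = "bump (?y - of_int \<lfloor>?y\<rfloor> - 1)"
      define c where "c j = (if j \<in> {-K..K} then f (node j) else 0)" for j
      have "(\<Sum>j\<in>{-K..K}. f (node j) * r j x) = (\<Sum>j\<in>{-K..K}. c j * of_real (bump (?y - of_int j)))"
        by (intro sum.cong) (auto simp: c_def r_def)
      also have "\<dots> = c \<lfloor>?y\<rfloor> * of_real ?a + c (\<lfloor>?y\<rfloor> + 1) * of_real ?b"
        by (rule sum_bump_finite) (auto simp: c_def)
      finally have s: "(\<Sum>j\<in>{-K..K}. f (node j) * r j x) = c \<lfloor>?y\<rfloor> * of_real ?a + c (\<lfloor>?y\<rfloor> + 1) * of_real ?b" .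
      have near: "cmod (f x - c j) \<le> \<epsilon> * sq 1 f" if j: "j = \<lfloor>?y\<rfloor> \<or> j = \<lfloor>?y\<rfloor> + 1" for j
      proof -
        have "\<bar>?y - of_int j\<bar> \<le> 1" using j by linarith
        then have "\<bar>?y - of_int j\<bar> * h \<le> 1 * h" using h by (intro mult_right_mono) auto
        moreover have "\<bar>x - node j\<bar> = \<bar>?y - of_int j\<bar> * h"
          using h by (simp add: node_def field_simps flip: abs_mult_pos)
        ultimately have d: "\<bar>x - node j\<bar> \<le> h" by simp
        show ?thesis
        proof (cases "j \<in> {-K..K}")
          case True
          have "cmod (f x - c j) \<le> sq 1 f * \<bar>x - node j\<bar>"
            using True schwartz_lipschitz[OF f] by (simp add: c_def)
          also have "\<dots> \<le> sq 1 f * h" using d q1 by (intro mult_left_mono)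
          finally show ?thesis by (simp add: h_def mult.commute)
        next
          case False
          have "j \<le> - K - 1 \<or> K + 1 \<le> j" using False by auto
          then have "of_int K - 1 \<le> \<bar>?y\<bar>" using \<open>\<bar>?y - of_int j\<bar> \<le> 1\<close> by linarith
          moreover have "1 / (\<epsilon> * h) \<le> of_int K - 1" unfolding K_def by linarith
          ultimately have "1 / (\<epsilon> * h) \<le> \<bar>x\<bar> / h" using h by simp
          then have x: "1 / \<epsilon> \<le> \<bar>x\<bar>" using h assms by (simp add: field_simps)
          have "\<bar>x\<bar> * cmod (f x) \<le> sq 1 f" using power_mult_le_sq[OF f, of x 1] by simp
          moreover have "(1 / \<epsilon>) * cmod (f x) \<le> \<bar>x\<bar> * cmod (f x)" using x by (intro mult_right_mono) auto
          ultimately have "cmod (f x) / \<epsilon> \<le> sq 1 f" by simp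
          then have "cmod (f x) \<le> sq 1 f * \<epsilon>" using assms by (simp only: pos_divide_le_eq)
          then have "cmod (f x) \<le> \<epsilon> * sq 1 f" by (simp only: mult.commute)
          moreover have "c j = 0" unfolding c_def using False by (rule if_not_P)
          ultimately show ?thesis by (simp only: diff_zero)
        qed
      qed
      have ab: "of_real ?a + of_real ?b = (1::complex)" "?a + ?b = 1"
        using bump_partition[of ?y] by (simp_all flip: of_real_add)
      have "f x - (\<Sum>j\<in>{-K..K}. f (node j) * r j x) = (f x - c \<lfloor>?y\<rfloor>) * of_real ?a + (f x - c (\<lfloor>?y\<rfloor> + 1)) * of_real ?b"
      proof -
        have "f x = f x * (of_real ?a + of_real ?b)" unfolding ab by simp
        then show ?thesis unfolding s by (simp add: algebra_simps)
      qed
      also have "cmod \<dots> \<le> cmod (f x - c \<lfloor>?y\<rfloor>) * ?a + cmod (f x - c (\<lfloor>?y\<rfloor> + 1)) * ?b"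
        by (rule norm_triangle_le) (simp add: norm_mult bump_nonneg)
      also have "\<dots> \<le> (\<epsilon> * sq 1 f) * ?a + (\<epsilon> * sq 1 f) * ?b"
        by (intro add_mono mult_right_mono near bump_nonneg) auto
      also have "\<dots> = \<epsilon> * sq 1 f" using ab(2) by (simp flip: distrib_left)
      finally show ?thesis .
    qed
    then show "sq 0 (\<lambda>x. f x - (\<Sum>j\<in>{-K..K}. f (node j) * r j x)) \<le> \<epsilon> * sq 1 f" by (simp add: supn_leI)
  qed auto
qed

section \<open>The operator with positive real part\<close>

declare sq.simps(2) [simp del]

text \<open>For \<open>\<kappa> = 2 * pi * \<i> * \<tau> * \<mu>\<close> this is the standard
  holomorphic structure with parameter \<open>z = 0\<close>.\<close>

definition dk :: "complex \<Rightarrow> (real \<Rightarrow> complex) \<Rightarrow> real \<Rightarrow> complex" where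
  "dk \<kappa> f = (\<lambda>x. vd f x + \<kappa> * (of_real x * f x))"

lemma schwartz_dk: "schwartz f \<Longrightarrow> schwartz (dk \<kappa> f)"
  unfolding dk_def by (intro schwartz_add schwartz_vd schwartz_cmult schwartz_xmult)

lemma dk_add: "schwartz f \<Longrightarrow> schwartz g \<Longrightarrow> dk \<kappa> (\<lambda>x. f x + g x) = (\<lambda>x. dk \<kappa> f x + dk \<kappa> g x)"
  by (simp add: dk_def vd_add algebra_simps)

lemma dk_cmult: "schwartz f \<Longrightarrow> dk \<kappa> (\<lambda>x. c * f x) = (\<lambda>x. c * dk \<kappa> f x)"
  by (simp add: dk_def vd_cmult algebra_simps)

text \<open>Unlike the equation \<open>dk \<kappa> g = f\<close>, in which \<open>vd\<close> is a
  total function, this asserts that g is differentiable. It is meant for solutions not yet known to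
  be Schwartz.\<close>

definition ode :: "complex \<Rightarrow> (real \<Rightarrow> complex) \<Rightarrow> (real \<Rightarrow> complex) \<Rightarrow> bool" where
  "ode \<kappa> g f \<longleftrightarrow> derivs g (\<lambda>x. f x - \<kappa> * (of_real x * g x))"

lemma ode_dk: "schwartz g \<Longrightarrow> ode \<kappa> g (dk \<kappa> g)"
  using schwartz_derivs[of g] by (simp add: ode_def dk_def)

lemma ode_imp_dk: "ode \<kappa> g f \<Longrightarrow> dk \<kappa> g = f"
  unfolding ode_def by (auto dest: derivs_vd simp: dk_def)

section \<open>A priori elliptic estimates\<close>

lemma schwartz_attains_sup:
  assumes h: "schwartz h" shows "\<exists>x0. \<forall>x. cmod (h x) \<le> cmod (h x0)"
proof (cases "\<exists>y. h y \<noteq> 0")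
  case True
  then obtain y where y: "h y \<noteq> 0" by blast
  obtain C where C: "C \<ge> 0" "\<And>x. \<bar>x\<bar> ^ 1 * cmod (h x) \<le> C" using rapid_decayD[OF schwartz_rapid[OF h]] by blast
  \<comment> \<open>Beyond R the decay \<open>|x| * |h x| \<le> C\<close> already forces
    \<open>|h x| \<le> |h y|\<close>, so the maximum over the compact interval is global.\<close>
  define R where "R = C / cmod (h y) + \<bar>y\<bar>"
  have "continuous_on {- R..R} (\<lambda>x. cmod (h x))" by (intro continuous_intros schwartz_continuous h)
  moreover have "C / cmod (h y) \<ge> 0" using C by simp
  then have "\<bar>y\<bar> \<le> R" by (simp add: R_def)
  then have yR: "y \<in> {- R..R}" by auto
  then have "{- R..R} \<noteq> {}" by blast
  ultimately obtain x0 where x0: "\<And>x. x \<in> {- R..R} \<Longrightarrow> cmod (h x) \<le> cmod (h x0)"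
    using continuous_attains_sup[of "{- R..R}" "\<lambda>x. cmod (h x)", OF compact_Icc] by blast
  have "cmod (h x) \<le> cmod (h x0)" for x
  proof (cases "x \<in> {- R..R}")
    case False
    then have "R < \<bar>x\<bar>" by auto
    then have "C / cmod (h y) \<le> \<bar>x\<bar>" unfolding R_def by linarith
    then have "C \<le> \<bar>x\<bar> * cmod (h y)" using y by (simp add: pos_divide_le_eq)
    with C(2)[of x] have "\<bar>x\<bar> * cmod (h x) \<le> \<bar>x\<bar> * cmod (h y)" by simp
    moreover have "R \<ge> 0" using yR by auto
    then have "\<bar>x\<bar> > 0" using \<open>R < \<bar>x\<bar>\<close> by linarith
    ultimately have "cmod (h x) \<le> cmod (h y)" by (simp only: mult_le_cancel_left_pos)
    then show ?thesis using x0[OF yR] by linarith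
  qed (rule x0)
  then show ?thesis by blast
qed auto

text \<open>Maximum principle: at a maximum of \<open>|x g|\<close> the derivative of \<open>|x g|\<^sup>2\<close> vanishes,
  and there the term \<open>Re \<kappa> x |x g|\<^sup>2\<close> dominates. The sign of \<open>Re \<kappa>\<close> is irrelevant.\<close>
lemma supn_xmult_le:
  assumes k: "Re \<kappa> \<noteq> 0" and g: "schwartz g"
  shows "supn (\<lambda>x. of_real x * g x) \<le> (1 + 1 / \<bar>Re \<kappa>\<bar>) * (supn (dk \<kappa> g) + supn g)"
proof -
  define h where "h x = of_real x * g x" for x :: real
  have h: "schwartz h" unfolding h_def by (rule schwartz_xmult[OF g])
  obtain x0 where x0: "\<And>x. cmod (h x) \<le> cmod (h x0)" using schwartz_attains_sup[OF h] by blast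
  define D where "D = dk \<kappa> g x0"
  have dh: "(h has_vector_derivative (of_real x0 * (D - \<kappa> * h x0) + g x0)) (at x0)"
    using derivs_xmult[OF ode_dk[OF g, of \<kappa>, unfolded ode_def]] unfolding derivs_def h_def D_def by simp
  define h' where "h' = of_real x0 * (D - \<kappa> * h x0) + g x0"
  have ri: "((\<lambda>x. Re (h x)) has_real_derivative Re h') (at x0)" "((\<lambda>x. Im (h x)) has_real_derivative Im h') (at x0)"
    using bounded_linear.has_vector_derivative[OF bounded_linear_Re dh] bounded_linear.has_vector_derivative[OF bounded_linear_Im dh]
    by (simp_all add: has_real_derivative_iff_has_vector_derivative h'_def)
  have sqd: "((\<lambda>x. (Re (h x))\<^sup>2 + (Im (h x))\<^sup>2) has_real_derivative 2 * (Re (h x0) * Re h' + Im (h x0) * Im h')) (at x0)"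
    using DERIV_add[OF DERIV_power[OF ri(1), of 2] DERIV_power[OF ri(2), of 2]] by (simp add: algebra_simps)
  have mx: "\<forall>y. \<bar>x0 - y\<bar> < 1 \<longrightarrow> (Re (h y))\<^sup>2 + (Im (h y))\<^sup>2 \<le> (Re (h x0))\<^sup>2 + (Im (h x0))\<^sup>2"
    using x0 by (simp flip: cmod_power2 add: power_mono)
  have "2 * (Re (h x0) * Re h' + Im (h x0) * Im h') = 0"
    by (rule DERIV_local_max[OF sqd zero_less_one mx])
  then have "Re (cnj (h x0) * h') = 0" by simp
  have "cnj (h x0) * h' = cnj (h x0) * (g x0 + of_real x0 * D) - of_real x0 * \<kappa> * (h x0 * cnj (h x0))"
    by (simp add: h'_def algebra_simps)
  have "Re (cnj (h x0) * (g x0 + of_real x0 * D)) = x0 * Re \<kappa> * (cmod (h x0))\<^sup>2"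
  proof -
    have "Re (of_real x0 * \<kappa> * (h x0 * cnj (h x0))) = x0 * Re \<kappa> * (cmod (h x0))\<^sup>2"
      unfolding complex_norm_square[symmetric] by (simp del: of_real_power)
    then show ?thesis using \<open>Re (cnj (h x0) * h') = 0\<close> \<open>cnj (h x0) * h' = _\<close> by simp
  qed
  then have "\<bar>x0\<bar> * \<bar>Re \<kappa>\<bar> * (cmod (h x0))\<^sup>2 = \<bar>Re (cnj (h x0) * (g x0 + of_real x0 * D))\<bar>"
    by (simp add: abs_mult)
  also have "\<dots> \<le> cmod (h x0) * cmod (g x0 + of_real x0 * D)"
    using abs_Re_le_cmod by (metis complex_mod_cnj norm_mult)
  also have "\<dots> \<le> cmod (h x0) * (cmod (g x0) + \<bar>x0\<bar> * cmod D)"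
    by (intro mult_left_mono norm_triangle_le) (auto simp: norm_mult)
  finally have main: "cmod (h x0) * (\<bar>x0\<bar> * \<bar>Re \<kappa>\<bar> * cmod (h x0)) \<le> cmod (h x0) * (cmod (g x0) + \<bar>x0\<bar> * cmod D)"
    by (simp add: power2_eq_square mult_ac)
  have gD: "cmod (g x0) \<le> supn g" "cmod D \<le> supn (dk \<kappa> g)"
    using le_supn[OF g] le_supn[OF schwartz_dk[OF g]] by (auto simp: D_def)
  have nn: "0 \<le> supn g" "0 \<le> supn (dk \<kappa> g)" using gD norm_ge_zero order_trans by blast+
  let ?C = "(1 + 1 / \<bar>Re \<kappa>\<bar>) * (supn (dk \<kappa> g) + supn g)"
  have C0: "supn (dk \<kappa> g) + supn g \<le> ?C" "(supn (dk \<kappa> g) + supn g) / \<bar>Re \<kappa>\<bar> \<le> ?C"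
    using nn by (simp_all add: distrib_right)
  \<comment> \<open>If \<open>|x0| \<ge> 1\<close>, the summand \<open>|g x0|\<close> is absorbed
    into \<open>|x0| * |g x0|\<close> and the factor \<open>|x0|\<close> cancels; if
    \<open>|x0| < 1\<close>, then \<open>|h x0| \<le> |g x0|\<close> at once.\<close>
  have "cmod (h x0) \<le> ?C"
  proof (cases "h x0 = 0 \<or> \<bar>x0\<bar> < 1")
    case True
    then have "cmod (h x0) \<le> supn g"
    proof
      assume "\<bar>x0\<bar> < 1"
      then have "\<bar>x0\<bar> * cmod (g x0) \<le> 1 * cmod (g x0)" by (intro mult_right_mono) auto
      then show ?thesis using gD by (simp add: h_def norm_mult)
    qed (use nn in simp)
    then show ?thesis using C0 nn by linarith
  next
    case False
    then have "\<bar>x0\<bar> * \<bar>Re \<kappa>\<bar> * cmod (h x0) \<le> cmod (g x0) + \<bar>x0\<bar> * cmod D"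
      using main by simp
    also have "\<dots> \<le> \<bar>x0\<bar> * cmod (g x0) + \<bar>x0\<bar> * cmod D"
      using False mult_right_mono[of 1 "\<bar>x0\<bar>" "cmod (g x0)"] by simp
    finally have "\<bar>x0\<bar> * (\<bar>Re \<kappa>\<bar> * cmod (h x0)) \<le> \<bar>x0\<bar> * (cmod (g x0) + cmod D)" by (simp add: algebra_simps)
    moreover have "\<bar>x0\<bar> > 0" using False by linarith
    ultimately have "\<bar>Re \<kappa>\<bar> * cmod (h x0) \<le> cmod (g x0) + cmod D" by (simp only: mult_le_cancel_left_pos)
    then have "cmod (h x0) * \<bar>Re \<kappa>\<bar> \<le> supn (dk \<kappa> g) + supn g" using gD by (simp add: mult.commute)
    then have "cmod (h x0) \<le> (supn (dk \<kappa> g) + supn g) / \<bar>Re \<kappa>\<bar>" using k by (simp add: pos_le_divide_eq)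
    then show ?thesis using C0 by linarith
  qed
  then show ?thesis using x0 by (intro supn_leI) (auto simp flip: h_def intro: order_trans)
qed

text \<open>The commutators \<open>[dk \<kappa>, x] = 1\<close> and
  \<open>[dk \<kappa>, d/dx] = - \<kappa>\<close> have order zero. Applying the estimate of order k
  to \<open>x f\<close> and to \<open>f'\<close> therefore costs only norms that the next order has
  on its right side.\<close>

lemma elliptic_estimate_step:
  assumes k: "Re \<kappa> \<noteq> 0"
  shows "\<exists>C\<ge>0. \<forall>f. schwartz f \<longrightarrow> sq (Suc k) f \<le> C * (sq k (dk \<kappa> f) + sq k f)"
proof (induction k)
  case 0
  define B where "B = 1 + 1 / \<bar>Re \<kappa>\<bar>"
  have B: "B \<ge> 0" by (simp add: B_def)
  have "sq (Suc 0) f \<le> (1 + B + 1 + cmod \<kappa> * B) * (sq 0 (dk \<kappa> f) + sq 0 f)" if f: "schwartz f" for f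
  proof -
    have nn: "supn f \<ge> 0" "supn (dk \<kappa> f) \<ge> 0" using sq_nonneg[of _ 0] f schwartz_dk by fastforce+
    have x: "supn (\<lambda>x. of_real x * f x) \<le> B * (supn (dk \<kappa> f) + supn f)"
      unfolding B_def by (rule supn_xmult_le[OF k f])
    have "vd f = (\<lambda>x. dk \<kappa> f x - \<kappa> * (of_real x * f x))" by (simp add: dk_def)
    then have "supn (vd f) \<le> supn (dk \<kappa> f) + cmod \<kappa> * supn (\<lambda>x. of_real x * f x)"
      using sq_diff[of "dk \<kappa> f" "\<lambda>x. \<kappa> * (of_real x * f x)" 0] f
      by (simp add: schwartz_dk schwartz_cmult schwartz_xmult supn_cmult)
    also have "\<dots> \<le> (supn (dk \<kappa> f) + supn f) + cmod \<kappa> * (B * (supn (dk \<kappa> f) + supn f))"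
      using nn by (intro add_mono mult_left_mono x) auto
    finally show ?thesis using x nn by (simp add: sq.simps(2) algebra_simps)
  qed
  then show ?case using B by (intro exI[of _ "1 + B + 1 + cmod \<kappa> * B"]) auto
next
  case (Suc k)
  then obtain C where C: "C \<ge> 0" "\<And>f. schwartz f \<Longrightarrow> sq (Suc k) f \<le> C * (sq k (dk \<kappa> f) + sq k f)" by blast
  have "sq (Suc (Suc k)) f \<le> (1 + C * 2 + C * (2 + cmod \<kappa>)) * (sq (Suc k) (dk \<kappa> f) + sq (Suc k) f)" if f: "schwartz f" for f
  proof -
    let ?a = "sq (Suc k) (dk \<kappa> f)" and ?b = "sq (Suc k) f"
    note sw = f schwartz_dk schwartz_xmult schwartz_vd schwartz_cmult
    have nn: "?a \<ge> 0" "?b \<ge> 0" using sq_nonneg f schwartz_dk by blast+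
    have "dk \<kappa> (\<lambda>x. of_real x * f x) = (\<lambda>x. of_real x * dk \<kappa> f x + f x)"
      using derivs_vd[OF derivs_xmult[OF schwartz_derivs[OF f]]] by (simp add: dk_def algebra_simps)
    then have "sq k (dk \<kappa> (\<lambda>x. of_real x * f x)) \<le> sq k (\<lambda>x. of_real x * dk \<kappa> f x) + sq k f"
      using sq_add[of "\<lambda>x. of_real x * dk \<kappa> f x" f k] sw by simp
    then have "sq k (dk \<kappa> (\<lambda>x. of_real x * f x)) \<le> ?a + ?b"
      using sq_xmult_le[of "dk \<kappa> f" k] sq_mono_Suc[OF f, of k] sw by fastforce
    moreover have "sq k (\<lambda>x. of_real x * f x) \<le> ?b" by (rule sq_xmult_le[OF f])
    ultimately have "sq k (dk \<kappa> (\<lambda>x. of_real x * f x)) + sq k (\<lambda>x. of_real x * f x) \<le> ?a + ?b + ?b" by linarith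
    then have 1: "sq (Suc k) (\<lambda>x. of_real x * f x) \<le> C * (?a + ?b + ?b)"
      by (rule order_trans[OF C(2)[OF schwartz_xmult[OF f]] mult_left_mono[OF _ C(1)]])
    have "dk \<kappa> (vd f) = (\<lambda>x. vd (dk \<kappa> f) x - \<kappa> * f x)"
    proof -
      have "derivs (dk \<kappa> f) (\<lambda>x. vd (vd f) x + \<kappa> * (of_real x * vd f x + f x))"
        unfolding dk_def by (intro derivs_add derivs_cmult derivs_xmult schwartz_derivs sw)
      from derivs_vd[OF this] show ?thesis by (simp add: dk_def algebra_simps)
    qed
    then have "sq k (dk \<kappa> (vd f)) \<le> sq k (vd (dk \<kappa> f)) + cmod \<kappa> * sq k f"
      using sq_diff[of "vd (dk \<kappa> f)" "\<lambda>x. \<kappa> * f x" k] sw by (simp add: sq_cmult)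
    also have "\<dots> \<le> ?a + cmod \<kappa> * ?b"
      using sq_vd_le[of "dk \<kappa> f" k] sq_mono_Suc[OF f, of k] sw by (intro add_mono mult_left_mono) auto
    finally have "sq k (dk \<kappa> (vd f)) \<le> ?a + cmod \<kappa> * ?b" .
    moreover have "sq k (vd f) \<le> ?b" by (rule sq_vd_le[OF f])
    ultimately have "sq k (dk \<kappa> (vd f)) + sq k (vd f) \<le> ?a + cmod \<kappa> * ?b + ?b" by linarith
    then have 2: "sq (Suc k) (vd f) \<le> C * (?a + cmod \<kappa> * ?b + ?b)"
      by (rule order_trans[OF C(2)[OF schwartz_vd[OF f]] mult_left_mono[OF _ C(1)]])
    have "sq (Suc (Suc k)) f \<le> ?b + C * (?a + ?b + ?b) + C * (?a + cmod \<kappa> * ?b + ?b)"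
      unfolding sq.simps(2)[of "Suc k" f] using 1 2 by linarith
    also have "\<dots> \<le> (?a + ?b) + C * (2 * (?a + ?b)) + C * ((2 + cmod \<kappa>) * (?a + ?b))"
    proof (intro add_mono mult_left_mono C(1))
      have "cmod \<kappa> * ?a \<ge> 0" using nn by simp
      then show "?a + cmod \<kappa> * ?b + ?b \<le> (2 + cmod \<kappa>) * (?a + ?b)" using nn by (simp add: algebra_simps)
    qed (use nn in auto)
    also have "\<dots> = (1 + C * 2 + C * (2 + cmod \<kappa>)) * (?a + ?b)" by (simp only: distrib_right mult.assoc) simp
    finally show ?thesis .
  qed
  then show ?case using C(1) by (intro exI[of _ "1 + C * 2 + C * (2 + cmod \<kappa>)"]) auto
qed

lemma sq_0_le: "schwartz f \<Longrightarrow> sq 0 f \<le> sq k f"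
  by (induction k) (use sq_mono_Suc order_trans in blast)+

text \<open>Iterating the step leaves only the weakest norm of f on the right, so that for a right
  inverse of \<open>dk \<kappa>\<close> just a sup bound remains to be found.\<close>

lemma elliptic_estimate:
  assumes k: "Re \<kappa> \<noteq> 0"
  shows "\<exists>C\<ge>0. \<forall>f. schwartz f \<longrightarrow> sq (Suc k) f \<le> C * (sq k (dk \<kappa> f) + sq 0 f)"
proof (induction k)
  case 0 then show ?case using elliptic_estimate_step[OF k, of 0] by simp
next
  case (Suc k)
  then obtain C where C: "C \<ge> 0" "\<And>f. schwartz f \<Longrightarrow> sq (Suc k) f \<le> C * (sq k (dk \<kappa> f) + sq 0 f)" by blast
  obtain C' where C': "C' \<ge> 0" "\<And>f. schwartz f \<Longrightarrow> sq (Suc (Suc k)) f \<le> C' * (sq (Suc k) (dk \<kappa> f) + sq (Suc k) f)"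
    using elliptic_estimate_step[OF k] by blast
  have "sq (Suc (Suc k)) f \<le> (C' * (1 + C)) * (sq (Suc k) (dk \<kappa> f) + sq 0 f)" if f: "schwartz f" for f
  proof -
    let ?a = "sq (Suc k) (dk \<kappa> f)"
    have nn: "sq 0 f \<ge> 0" by (rule sq_nonneg[OF f])
    have "sq (Suc k) f \<le> C * (sq k (dk \<kappa> f) + sq 0 f)" by (rule C(2)[OF f])
    also have "\<dots> \<le> C * (?a + sq 0 f)" using sq_mono_Suc[OF schwartz_dk[OF f]] by (intro mult_left_mono C(1) add_right_mono)
    finally have "?a + sq (Suc k) f \<le> (1 + C) * (?a + sq 0 f)" using nn by (simp add: algebra_simps)
    then have "C' * (?a + sq (Suc k) f) \<le> C' * ((1 + C) * (?a + sq 0 f))" by (intro mult_left_mono C'(1))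
    from order_trans[OF C'(2)[OF f] this] show ?thesis by (simp only: mult.assoc)
  qed
  then show ?case using C C' by (intro exI[of _ "C' * (1 + C)"]) auto
qed

section \<open>Gaussian integrating factors and bounds for the first order equation\<close>

text \<open>\<open>gau \<kappa>\<close> solves the homogeneous equation of
  \<open>dk \<kappa>\<close>; its reciprocal \<open>gau (- \<kappa>)\<close> is the integrating
  factor.\<close>

definition gau :: "complex \<Rightarrow> real \<Rightarrow> complex" where
  "gau \<kappa> x = exp (- \<kappa> * of_real (x\<^sup>2 / 2))"

lemma cmod_gau: "cmod (gau \<kappa> x) = exp (- (Re \<kappa> / 2) * x\<^sup>2)"
  by (simp add: gau_def del: of_real_divide of_real_power)

lemma gau_inverse: "gau \<kappa> x * gau (- \<kappa>) x = 1" "gau (- \<kappa>) x * gau \<kappa> x = 1"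
  by (simp_all add: gau_def flip: exp_add)

lemma gau_minus [simp]: "gau \<kappa> (- x) = gau \<kappa> x" and gau_zero [simp]: "gau \<kappa> 0 = 1"
  by (simp_all add: gau_def)

lemma gau_nonzero [simp]: "gau \<kappa> x \<noteq> 0"
  by (simp add: gau_def)

lemma derivs_gau: "derivs (gau \<kappa>) (\<lambda>x. - \<kappa> * (of_real x * gau \<kappa> x))"
  unfolding derivs_def
proof
  fix x
  have "((\<lambda>z. exp (- \<kappa> * (z\<^sup>2 / 2))) has_field_derivative - \<kappa> * (of_real x * gau \<kappa> x)) (at (of_real x))"
    unfolding gau_def by (auto intro!: derivative_eq_intros)
  from has_vector_derivative_real_field[OF this]
  show "(gau \<kappa> has_vector_derivative - \<kappa> * (of_real x * gau \<kappa> x)) (at x)"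
    by (simp add: gau_def[abs_def])
qed

lemma schwartz_gau:
  assumes "Re \<kappa> > 0" shows "schwartz (gau \<kappa>)"
proof (rule schwartz_ode[OF _ schwartz_zero])
  show "derivs (gau \<kappa>) (\<lambda>x. 0 - \<kappa> * (of_real x * gau \<kappa> x))" using derivs_gau by simp
  show "rapid_decay (gau \<kappa>)" unfolding rapid_decay_def
  proof
    fix m
    let ?l = "Re \<kappa> / 2"
    have "\<bar>x\<bar> ^ m * cmod (gau \<kappa> x) \<le> 1 + fact m / ?l ^ m" for x
    proof (cases "\<bar>x\<bar> \<le> 1")
      case True
      then have "\<bar>x\<bar> ^ m * cmod (gau \<kappa> x) \<le> 1 * 1"
        using assms by (intro mult_mono power_le_one) (auto simp: cmod_gau)
      moreover have "0 \<le> fact m / ?l ^ m" using assms by simp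
      ultimately show ?thesis by linarith
    next
      case False
      have "(?l * x\<^sup>2) ^ m / fact m \<le> exp (?l * x\<^sup>2)" using assms by (intro power_div_fact_le_exp) auto
      then have "(?l * x\<^sup>2) ^ m \<le> fact m * exp (?l * x\<^sup>2)" by (simp add: pos_divide_le_eq mult.commute)
      then have "exp (- ?l * x\<^sup>2) * (?l * x\<^sup>2) ^ m \<le> exp (- ?l * x\<^sup>2) * (fact m * exp (?l * x\<^sup>2))"
        by (intro mult_left_mono) auto
      also have "\<dots> = fact m" by (simp add: exp_minus)
      finally have "(x\<^sup>2) ^ m * exp (- ?l * x\<^sup>2) * ?l ^ m \<le> fact m" by (simp only: power_mult_distrib mult_ac)
      moreover have "?l ^ m > 0" using assms by simp
      ultimately have "(x\<^sup>2) ^ m * exp (- ?l * x\<^sup>2) \<le> fact m / ?l ^ m" by (simp only: pos_le_divide_eq)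
      moreover have "\<bar>x\<bar> ^ m * exp (- ?l * x\<^sup>2) \<le> (x\<^sup>2) ^ m * exp (- ?l * x\<^sup>2)"
      proof (intro mult_right_mono power_mono)
        show "\<bar>x\<bar> \<le> x\<^sup>2" using False mult_left_mono[of 1 "\<bar>x\<bar>" "\<bar>x\<bar>"] by (simp add: power2_eq_square abs_mult_self_eq)
      qed auto
      ultimately show ?thesis unfolding cmod_gau by linarith
    qed
    then show "\<exists>C. \<forall>x. \<bar>x\<bar> ^ m * cmod (gau \<kappa> x) \<le> C" by blast
  qed
qed

lemma ode_imp_derivs: "ode \<kappa> g f \<Longrightarrow> derivs (\<lambda>x. gau (- \<kappa>) x * g x) (\<lambda>x. gau (- \<kappa>) x * f x)"
  unfolding ode_def by (rule derivs_cong[OF derivs_mult[OF derivs_gau]]) (auto simp: algebra_simps)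

lemma derivs_imp_ode:
  assumes "derivs E (\<lambda>x. gau (- \<kappa>) x * f x)" shows "ode \<kappa> (\<lambda>x. gau \<kappa> x * E x) f"
proof -
  have "gau \<kappa> x * (gau (- \<kappa>) x * f x) = f x" for x by (simp add: gau_inverse flip: mult.assoc)
  then show ?thesis unfolding ode_def
    by (intro derivs_cong[OF derivs_mult[OF derivs_gau assms]]) (auto simp: algebra_simps)
qed

lemma ode_mirror: "ode \<kappa> g f \<Longrightarrow> ode \<kappa> (\<lambda>x. g (- x)) (\<lambda>x. - f (- x))"
  unfolding ode_def by (drule derivs_affine[where a = "-1" and b = 0]) (simp add: algebra_simps)

lemma ode_power:
  assumes "ode \<kappa> g f"
  shows "ode \<kappa> (\<lambda>x. of_real x ^ Suc m * g x) (\<lambda>x. of_real x ^ Suc m * f x + of_nat (Suc m) * (of_real x ^ m * g x))"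
proof -
  have "derivs (\<lambda>x. of_real x ^ Suc m) (\<lambda>x. of_nat (Suc m) * of_real x ^ m)"
  proof -
    have "((\<lambda>x. x ^ Suc m) has_real_derivative real (Suc m) * x ^ m) (at x)" for x :: real
      using DERIV_pow[of "Suc m" x] by simp
    from derivs_of_real[OF this] show ?thesis by (simp del: of_nat_Suc power_Suc)
  qed
  from derivs_mult[OF this assms[unfolded ode_def]] show ?thesis
    unfolding ode_def by (rule derivs_cong) (auto simp: algebra_simps)
qed

text \<open>With \<open>l = Re \<kappa>\<close>, the integrating factor turns g into E with
  \<open>|E'| \<le> M * exp (l * t^2 / 2)\<close>. For \<open>t \<ge> 1\<close> a factor t can be
  inserted, which makes the majorant integrable in closed form, and the decaying Gaussian then
  leaves \<open>M / l\<close>. The constant \<open>exp (l / 2)\<close> comes from the unit interval,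
  the negative half line from \<open>ode_mirror\<close>.\<close>

lemma ode_bound_pos:
  assumes l: "Re \<kappa> > 0" and g: "ode \<kappa> g f" and M: "\<And>x. cmod (f x) \<le> M"
  shows "cmod (g x) \<le> cmod (g 0) + (exp (Re \<kappa> / 2) + 1 / Re \<kappa>) * M"
proof -
  have half: "cmod (g x) \<le> cmod (g 0) + (exp (Re \<kappa> / 2) + 1 / Re \<kappa>) * M"
    if g: "ode \<kappa> g f" and M: "\<And>x. cmod (f x) \<le> M" and x: "x \<ge> 0" for f g x
  proof -
    let ?l = "Re \<kappa>"
    define E where "E x = gau (- \<kappa>) x * g x" for x
    have dE: "derivs E (\<lambda>x. gau (- \<kappa>) x * f x)" unfolding E_def by (rule ode_imp_derivs[OF g])
    have M0: "M \<ge> 0" using M norm_ge_zero order_trans by blast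
    have bE: "cmod (gau (- \<kappa>) y * f y) \<le> exp (?l / 2 * y\<^sup>2) * M" for y
      unfolding norm_mult cmod_gau using M by (simp add: mult_left_mono)
    have E1: "cmod (E y - E 0) \<le> exp (?l / 2) * M" if y: "0 \<le> y" "y \<le> 1" for y
    proof -
      have "cmod (E y - E 0) \<le> exp (?l / 2) * M * y - exp (?l / 2) * M * 0"
      proof (rule norm_diff_le_of_derivs[OF dE y(1)])
        fix t assume t: "0 < t" "t < y"
        have "?l / 2 * t\<^sup>2 \<le> ?l / 2 * 1" using l t y by (intro mult_left_mono) (auto simp: power_le_one)
        then have "exp (?l / 2 * t\<^sup>2) * M \<le> exp (?l / 2) * M" using M0 by (intro mult_right_mono) auto
        then show "cmod (gau (- \<kappa>) t * f t) \<le> exp (?l / 2) * M" using bE[of t] by linarith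
      qed (auto intro!: derivative_eq_intros)
      also have "\<dots> \<le> exp (?l / 2) * M * 1" using y M0 mult_left_mono[of y 1 "exp (?l/2) * M"] by simp
      finally show ?thesis by simp
    qed
    have gE: "cmod (g x) = exp (- ?l / 2 * x\<^sup>2) * cmod (E x)"
      unfolding E_def norm_mult cmod_gau by (simp flip: mult.assoc exp_add)
    have e1: "exp (- ?l / 2 * x\<^sup>2) \<le> 1" using l by simp
    have E0: "cmod (E 0) = cmod (g 0)" by (simp add: E_def)
    have split: "cmod (E x) \<le> cmod (g 0) + exp (?l / 2) * M + (M / ?l) * exp (?l / 2 * x\<^sup>2)"
    proof (cases "x \<le> 1")
      case True
      have "0 \<le> (M / ?l) * exp (?l / 2 * x\<^sup>2)" using M0 l by simp
      then show ?thesis using E1[OF x True] norm_triangle_sub[of "E x" "E 0"] E0 by linarith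
    next
      case False
      have "cmod (E x - E 1) \<le> (M / ?l) * exp (?l / 2 * x\<^sup>2) - (M / ?l) * exp (?l / 2 * 1\<^sup>2)"
      proof (rule norm_diff_le_of_derivs[OF dE])
        fix t assume t: "1 < t" "t < x"
        have "exp (?l / 2 * t\<^sup>2) * M * 1 \<le> exp (?l / 2 * t\<^sup>2) * M * t" using t M0 by (intro mult_left_mono) auto
        then show "cmod (gau (- \<kappa>) t * f t) \<le> M * t * exp (?l / 2 * t\<^sup>2)" using bE[of t] by (simp add: mult_ac)
      next
        show "((\<lambda>t. (M / ?l) * exp (?l / 2 * t\<^sup>2)) has_real_derivative M * t * exp (?l / 2 * t\<^sup>2)) (at t)" for t
          using l by (auto intro!: derivative_eq_intros)
      qed (use False in simp)
      moreover have "0 \<le> (M / ?l) * exp (?l / 2 * 1\<^sup>2)" using M0 l by simp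
      ultimately show ?thesis using E1[of 1] norm_triangle_sub[of "E x" "E 1"] norm_triangle_sub[of "E 1" "E 0"] E0 by linarith
    qed
    have "cmod (g x) \<le> exp (- ?l / 2 * x\<^sup>2) * (cmod (g 0) + exp (?l / 2) * M + (M / ?l) * exp (?l / 2 * x\<^sup>2))"
      unfolding gE by (intro mult_left_mono split) auto
    also have "\<dots> = exp (- ?l / 2 * x\<^sup>2) * (cmod (g 0) + exp (?l / 2) * M) + M / ?l"
      by (simp add: distrib_left mult.left_commute flip: exp_add)
    also have "\<dots> \<le> 1 * (cmod (g 0) + exp (?l / 2) * M) + M / ?l"
      using e1 M0 by (intro add_right_mono mult_right_mono) auto
    finally show ?thesis by (simp add: distrib_right)
  qed
  show ?thesis
  proof (cases "x \<ge> 0")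
    case False
    have "cmod ((\<lambda>x. g (- x)) (- x)) \<le> cmod ((\<lambda>x. g (- x)) 0) + (exp (Re \<kappa> / 2) + 1 / Re \<kappa>) * M"
      by (rule half[OF ode_mirror[OF g]]) (use M False in auto)
    then show ?thesis by simp
  qed (rule half[OF g M])
qed

text \<open>For \<open>t \<ge> 1\<close> the bound may be weakened by a factor t, and
  \<open>t * exp (- l / 2 * t^2)\<close> has an elementary primitive.\<close>

lemma gauss_tail:
  assumes l: "l > 0" and E: "derivs E h" and h: "\<And>t. cmod (h t) \<le> M * exp (- l / 2 * t\<^sup>2)"
    and xy: "1 \<le> x" "x \<le> y"
  shows "cmod (E y - E x) \<le> (M / l) * exp (- l / 2 * x\<^sup>2)"
proof -
  have M0: "M \<ge> 0" using order_trans[OF norm_ge_zero h[of 0]] by simp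
  have "cmod (E y - E x) \<le> (- (M / l) * exp (- l / 2 * y\<^sup>2)) - (- (M / l) * exp (- l / 2 * x\<^sup>2))"
  proof (rule norm_diff_le_of_derivs[OF E xy(2)])
    fix t assume t: "x < t" "t < y"
    have "M * exp (- l / 2 * t\<^sup>2) * 1 \<le> M * exp (- l / 2 * t\<^sup>2) * t" using t xy M0 by (intro mult_left_mono) auto
    then show "cmod (h t) \<le> M * t * exp (- l / 2 * t\<^sup>2)" using h[of t] by (simp add: mult_ac)
  next
    show "((\<lambda>t. - (M / l) * exp (- l / 2 * t\<^sup>2)) has_real_derivative M * t * exp (- l / 2 * t\<^sup>2)) (at t)" for t
      using l by (auto intro!: derivative_eq_intros)
  qed
  moreover have "0 \<le> (M / l) * exp (- l / 2 * y\<^sup>2)" using M0 l by simp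
  ultimately show ?thesis by linarith
qed

text \<open>Here the homogeneous solution grows, so integration has to start at infinity. The decay
  hypothesis supplies the boundary value 0 there and excludes multiples of the growing
  Gaussian.\<close>

lemma ode_bound_neg:
  assumes l: "Re \<kappa> < 0" and g: "ode \<kappa> g f" and M: "\<And>x. cmod (f x) \<le> M"
    and decay: "rapid_decay (\<lambda>x. gau (- \<kappa>) x * g x)"
  shows "cmod (g x) \<le> exp (- Re \<kappa> / 2) * (1 - 1 / Re \<kappa>) * M"
proof -
  define l where "l = - Re \<kappa>"
  have l0: "l > 0" using l by (simp add: l_def)
  have half: "cmod (g x) \<le> exp (l / 2) * (1 + 1 / l) * M"
    if g: "ode \<kappa> g f" and M: "\<And>x. cmod (f x) \<le> M" and decay: "rapid_decay (\<lambda>x. gau (- \<kappa>) x * g x)" and x: "x \<ge> 0" for f g x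
  proof -
    define E where "E x = gau (- \<kappa>) x * g x" for x
    have dE: "derivs E (\<lambda>x. gau (- \<kappa>) x * f x)" unfolding E_def by (rule ode_imp_derivs[OF g])
    have M0: "M \<ge> 0" using M norm_ge_zero order_trans by blast
    have bE: "cmod (gau (- \<kappa>) y * f y) \<le> M * exp (- l / 2 * y\<^sup>2)" for y
      unfolding norm_mult cmod_gau l_def using M by (simp add: mult.commute mult_left_mono)
    obtain C where C: "C \<ge> 0" "\<And>x. \<bar>x\<bar> ^ 1 * cmod (E x) \<le> C" using rapid_decayD[OF decay] unfolding E_def by blast
    have far: "cmod (E x) \<le> (M / l) * exp (- l / 2 * x\<^sup>2)" if x: "x \<ge> 1" for x
    proof (rule field_le_epsilon)
      fix e :: real assume e: "e > 0"
      \<comment> \<open>Far enough out for \<open>|E R| \<le> e\<close>, by the first-order decay of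
        E.\<close>
      define R where "R = max x (C / e)"
      have R: "R \<ge> x" "R \<ge> C / e" "R > 0" using x by (auto simp: R_def)
      have "R * cmod (E R) \<le> C" using C(2)[of R] R by simp
      also have "C \<le> R * e" using R e by (simp add: pos_divide_le_eq)
      finally have "cmod (E R) \<le> e" using R by simp
      then show "cmod (E x) \<le> (M / l) * exp (- l / 2 * x\<^sup>2) + e"
        using gauss_tail[OF l0 dE bE x R(1)] norm_triangle_ineq3[of "E R" "E x"] by linarith
    qed
    have gE: "cmod (g x) = exp (l / 2 * x\<^sup>2) * cmod (E x)"
      unfolding E_def norm_mult cmod_gau l_def by (simp flip: mult.assoc exp_add)
    have ge1: "exp (l / 2) \<ge> 1" using l0 by simp
    show ?thesis
    proof (cases "x \<ge> 1")
      case True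
      have "cmod (g x) \<le> exp (l / 2 * x\<^sup>2) * ((M / l) * exp (- l / 2 * x\<^sup>2))"
        unfolding gE by (intro mult_left_mono far True) auto
      also have "\<dots> = 1 * (M / l)" by (simp add: mult.left_commute flip: exp_add)
      also have "\<dots> \<le> exp (l / 2) * ((1 + 1 / l) * M)"
        using ge1 M0 l0 by (intro mult_mono) (auto simp: distrib_right)
      finally show ?thesis by (simp only: mult.assoc)
    next
      case False
      have "cmod (E 1 - E x) \<le> M * 1 - M * x"
      proof (rule norm_diff_le_of_derivs[OF dE])
        fix t
        have "M * exp (- l / 2 * t\<^sup>2) \<le> M * 1" using l0 M0 by (intro mult_left_mono) auto
        then show "cmod (gau (- \<kappa>) t * f t) \<le> M" using bE[of t] by simp
      qed (use False in \<open>auto intro!: derivative_eq_intros\<close>)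
      also have "\<dots> \<le> M" using x M0 by simp
      finally have "cmod (E x) \<le> cmod (E 1) + M" using norm_triangle_ineq3[of "E 1" "E x"] by linarith
      also have "cmod (E 1) \<le> M / l"
      proof -
        have "(M / l) * exp (- l / 2 * 1\<^sup>2) \<le> (M / l) * 1" using l0 M0 by (intro mult_left_mono) auto
        then show ?thesis using far[of 1] by simp
      qed
      finally have Ex: "cmod (E x) \<le> (1 + 1 / l) * M" by (simp add: distrib_right)
      have "x\<^sup>2 \<le> 1" using False x by (simp add: power_le_one)
      then have "exp (l / 2 * x\<^sup>2) \<le> exp (l / 2)" using l0 mult_left_mono[of "x\<^sup>2" 1 "l/2"] by simp
      then have "cmod (g x) \<le> exp (l / 2) * ((1 + 1 / l) * M)"
        unfolding gE using Ex by (intro mult_mono) auto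
      then show ?thesis by (simp only: mult.assoc)
    qed
  qed
  have "cmod (g x) \<le> exp (l / 2) * (1 + 1 / l) * M"
  proof (cases "x \<ge> 0")
    case False
    have "cmod ((\<lambda>x. g (- x)) (- x)) \<le> exp (l / 2) * (1 + 1 / l) * M"
    proof (rule half[OF ode_mirror[OF g]])
      show "rapid_decay (\<lambda>x. gau (- \<kappa>) x * g (- x))"
        using rapid_decay_affine[OF decay, of "-1" 0] by simp
    qed (use M False in auto)
    then show ?thesis by simp
  qed (rule half[OF g M decay])
  then show ?thesis by (simp add: l_def)
qed

text \<open>By \<open>ode_power\<close>, \<open>x ^ Suc m * g\<close> solves the same equation with
  a right side that contains only \<open>x ^ m * g\<close>, bounded by induction. So
  \<open>ode_bound_pos\<close> bounds one power after the other.\<close>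

lemma schwartz_ode_pos:
  assumes l: "Re \<kappa> > 0" and f: "schwartz f" and g: "ode \<kappa> g f"
  shows "schwartz g"
proof (rule schwartz_ode[OF _ f g[unfolded ode_def]])
  have "\<exists>B. \<forall>x. cmod (of_real x ^ m * g x) \<le> B" for m
  proof (induction m)
    case 0
    obtain M where "\<And>x. cmod (f x) \<le> M" using rapid_decay_bounded[OF schwartz_rapid[OF f]] by blast
    from ode_bound_pos[OF l g this] show ?case by auto
  next
    case (Suc m)
    then obtain B where B: "\<And>x. cmod (of_real x ^ m * g x) \<le> B" by blast
    obtain C where C: "\<And>x. \<bar>x\<bar> ^ Suc m * cmod (f x) \<le> C" using rapid_decayD[OF schwartz_rapid[OF f]] by blast
    have "cmod (of_real x ^ Suc m * f x + of_nat (Suc m) * (of_real x ^ m * g x)) \<le> C + real (Suc m) * B" for x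
    proof (rule norm_triangle_le, rule add_mono)
      show "cmod (of_real x ^ Suc m * f x) \<le> C" using C[of x] by (simp add: norm_mult norm_power)
      show "cmod (of_nat (Suc m) * (of_real x ^ m * g x)) \<le> real (Suc m) * B"
        unfolding norm_mult[of "of_nat (Suc m)"] norm_of_nat by (intro mult_left_mono B) simp
    qed
    from ode_bound_pos[OF l ode_power[OF g, of m] this] show ?case by blast
  qed
  then show "rapid_decay g" unfolding rapid_decay_def by (simp add: norm_mult norm_power)
qed

text \<open>The same induction on powers. The decay demanded by \<open>ode_bound_neg\<close> holds
  because \<open>x ^ m * g\<close> is already bounded and the weight is a decaying Gaussian.\<close>

lemma schwartz_ode_neg:
  assumes l: "Re \<kappa> < 0" and f: "schwartz f" and g: "ode \<kappa> g f" and b: "\<And>x. cmod (g x) \<le> B"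
  shows "schwartz g"
proof (rule schwartz_ode[OF _ f g[unfolded ode_def]])
  have w: "rapid_decay (gau (- \<kappa>))" using schwartz_rapid[OF schwartz_gau[of "- \<kappa>"]] l by simp
  have "\<exists>B. \<forall>x. cmod (of_real x ^ m * g x) \<le> B" for m
  proof (induction m)
    case 0
    then show ?case using b by auto
  next
    case (Suc m)
    then obtain B where B: "\<And>x. cmod (of_real x ^ m * g x) \<le> B" by blast
    obtain C where C: "\<And>x. \<bar>x\<bar> ^ Suc m * cmod (f x) \<le> C" using rapid_decayD[OF schwartz_rapid[OF f]] by blast
    have M: "cmod (of_real x ^ Suc m * f x + of_nat (Suc m) * (of_real x ^ m * g x)) \<le> C + real (Suc m) * B" for x
    proof (rule norm_triangle_le, rule add_mono)
      show "cmod (of_real x ^ Suc m * f x) \<le> C" using C[of x] by (simp add: norm_mult norm_power)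
      show "cmod (of_nat (Suc m) * (of_real x ^ m * g x)) \<le> real (Suc m) * B"
        unfolding norm_mult[of "of_nat (Suc m)"] norm_of_nat by (intro mult_left_mono B) simp
    qed
    have "rapid_decay (\<lambda>x. (of_real x ^ m * g x) * (of_real x * gau (- \<kappa>) x))"
      by (rule rapid_decay_bmult[OF rapid_decay_xmult[OF w] B])
    then have "rapid_decay (\<lambda>x. gau (- \<kappa>) x * (of_real x ^ Suc m * g x))" by (simp add: mult_ac)
    from ode_bound_neg[OF l ode_power[OF g, of m] M this] show ?case by blast
  qed
  then show "rapid_decay g" unfolding rapid_decay_def by (simp add: norm_mult norm_power)
qed

section \<open>Variation of constants\<close>

lemma prim_add:
  assumes "continuous_on UNIV h" "continuous_on UNIV k"
  shows "prim (\<lambda>x. h x + k x) = (\<lambda>x. prim h x + prim k x)"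
  using prim_unique[OF continuous_on_add[OF assms] derivs_add[OF prim_props(2)[OF assms(1)] prim_props(2)[OF assms(2)]]]
  by (simp add: prim_props assms)

lemma prim_cmult:
  assumes "continuous_on UNIV h" shows "prim (\<lambda>x. c * h x) = (\<lambda>x. c * prim h x)"
  using prim_unique[OF continuous_on_mult_left[OF assms] derivs_cmult[OF prim_props(2)[OF assms]]]
  by (simp add: prim_props assms)

lemma continuous_gau_mult: "schwartz f \<Longrightarrow> continuous_on A (\<lambda>x. gau \<kappa> x * f x)"
  by (rule continuous_on_mult[OF derivs_continuous[OF derivs_gau] schwartz_continuous])

definition wprim :: "complex \<Rightarrow> (real \<Rightarrow> complex) \<Rightarrow> real \<Rightarrow> complex" where
  "wprim \<kappa> f = prim (\<lambda>y. gau (- \<kappa>) y * f y)"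

lemma derivs_wprim: "schwartz f \<Longrightarrow> derivs (wprim \<kappa> f) (\<lambda>y. gau (- \<kappa>) y * f y)"
  and wprim_0: "schwartz f \<Longrightarrow> wprim \<kappa> f 0 = 0"
  unfolding wprim_def using prim_props[OF continuous_gau_mult] by auto

lemma wprim_add: "schwartz f \<Longrightarrow> schwartz h \<Longrightarrow> wprim \<kappa> (\<lambda>x. f x + h x) = (\<lambda>x. wprim \<kappa> f x + wprim \<kappa> h x)"
  unfolding wprim_def distrib_left by (intro prim_add continuous_gau_mult)

lemma wprim_cmult: "schwartz f \<Longrightarrow> wprim \<kappa> (\<lambda>x. c * f x) = (\<lambda>x. c * wprim \<kappa> f x)"
  using prim_cmult[OF continuous_gau_mult[of f UNIV "- \<kappa>"], of c] by (simp add: wprim_def mult_ac)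

text \<open>Variation of constants from 0 is an exact right inverse, whence the zero
  \<open>\<rho>\<close>; the Gaussian is Schwartz and spans the kernel. The gain of one order is
  \<open>elliptic_estimate\<close> applied to the solution, together with
  \<open>ode_bound_pos\<close>.\<close>

lemma elliptic_model_pos:
  assumes l: "Re \<kappa> > 0"
  shows "elliptic_model {f. schwartz f} sq (dk \<kappa>) (\<lambda>f x. gau \<kappa> x * wprim \<kappa> f x) (gau \<kappa>) (\<lambda>_. 0) (\<lambda>_. 0)"
proof -
  let ?g = "\<lambda>f x. gau \<kappa> x * wprim \<kappa> f x"
  have ode_g: "ode \<kappa> (?g f) f" if "schwartz f" for f by (rule derivs_imp_ode[OF derivs_wprim[OF that]])
  have sg: "schwartz (?g f)" if "schwartz f" for f by (rule schwartz_ode_pos[OF l that ode_g[OF that]])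
  have dkg: "dk \<kappa> (?g f) = f" if "schwartz f" for f by (rule ode_imp_dk[OF ode_g[OF that]])
  show ?thesis
  proof
    show "\<exists>J l r C. carrier_approx {f. schwartz f} sq J l r C \<epsilon>" if "\<epsilon> > 0" for \<epsilon> by (rule sq_rellich[OF that])
    show "\<exists>f\<in>{f. schwartz f}. (\<lambda>N. sq 0 (\<lambda>x. f x - (\<Sum>j<N. u j x))) \<longlonglongrightarrow> 0"
      if "\<And>j. u j \<in> {f. schwartz f}" "\<And>k. summable (\<lambda>j. sq k (u j))" for u
      using sq_complete[of u] that by auto
    show "\<exists>C. \<forall>f\<in>{f. schwartz f}. sq (Suc k) (?g f) \<le> C * sq k f" for k
    proof -
      obtain C where C: "C \<ge> 0" "\<And>f. schwartz f \<Longrightarrow> sq (Suc k) f \<le> C * (sq k (dk \<kappa> f) + sq 0 f)"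
        using elliptic_estimate[of \<kappa> k] l by auto
      define B where "B = exp (Re \<kappa> / 2) + 1 / Re \<kappa>"
      have "sq (Suc k) (?g f) \<le> C * (1 + B) * sq k f" if f: "schwartz f" for f
      proof -
        have "sq 0 (?g f) \<le> B * sq 0 f" unfolding sq.simps
        proof (rule supn_leI)
          show "cmod (?g f x) \<le> B * supn f" for x
            using ode_bound_pos[OF l ode_g[OF f], of "supn f" x] le_supn[OF f] wprim_0[OF f] by (simp add: B_def)
        qed
        also have "\<dots> \<le> B * sq k f" using l by (intro mult_left_mono sq_0_le f) (simp add: B_def)
        finally have "sq k f + sq 0 (?g f) \<le> (1 + B) * sq k f" by (simp add: distrib_right)
        then have "C * (sq k f + sq 0 (?g f)) \<le> C * ((1 + B) * sq k f)" by (intro mult_left_mono C(1))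
        then show ?thesis using C(2)[OF sg[OF f]] dkg[OF f] by (simp only: mult.assoc)
      qed
      then show ?thesis by blast
    qed
    show "(dk \<kappa> f = (\<lambda>_. 0)) = (\<exists>c. f = (\<lambda>x. c * gau \<kappa> x))" if "f \<in> {f. schwartz f}" for f
    proof
      assume "dk \<kappa> f = (\<lambda>_. 0)"
      then have "ode \<kappa> f (\<lambda>_. 0)" using ode_dk[of f \<kappa>] that by simp
      from ode_imp_derivs[OF this] have "derivs (\<lambda>x. gau (- \<kappa>) x * f x) (\<lambda>_. 0)" by simp
      then have c: "gau (- \<kappa>) x * f x = f 0" for x using derivs_zero_const[of "\<lambda>x. gau (- \<kappa>) x * f x" x 0] by simp
      have "f x = f 0 * gau \<kappa> x" for x
      proof -
        have "f x = gau \<kappa> x * (gau (- \<kappa>) x * f x)" by (simp add: gau_inverse flip: mult.assoc)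
        then show ?thesis by (simp add: c)
      qed
      then show "\<exists>c. f = (\<lambda>x. c * gau \<kappa> x)" by blast
    next
      assume "\<exists>c. f = (\<lambda>x. c * gau \<kappa> x)"
      moreover have "dk \<kappa> (gau \<kappa>) = (\<lambda>_. 0)" using derivs_gau[of \<kappa>] by (intro ode_imp_dk) (simp add: ode_def)
      ultimately show "dk \<kappa> f = (\<lambda>_. 0)" using dk_cmult[OF schwartz_gau[OF l]] by auto
    qed
    show "f = (\<lambda>_. 0)" if "f \<in> {f. schwartz f}" "sq 0 f = 0" for f
    proof
      fix x show "f x = 0" using le_supn[of f x] that by simp
    qed
  qed (use l in \<open>auto simp: schwartz_zero schwartz_add schwartz_cmult sq_nonneg sq_add sq_cmult schwartz_dk dk_add dk_cmult
      sg wprim_add wprim_cmult schwartz_gau dkg distrib_left mult_ac intro: sq_mono_Suc simp del: sq.simps\<close>)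
qed

section \<open>The operator with negative real part\<close>

text \<open>For \<open>Re \<kappa> < 0\<close> the equation \<open>g' + \<kappa> x g = f\<close> has a bounded solution only if
  \<open>gau (- \<kappa>) f\<close> has integral 0 over the line; \<open>wlim\<close> is its integral over the half line.\<close>
definition wlim :: "complex \<Rightarrow> (real \<Rightarrow> complex) \<Rightarrow> complex" where
  "wlim \<kappa> f = lim (\<lambda>n. wprim \<kappa> f (real n))"

definition wint :: "complex \<Rightarrow> (real \<Rightarrow> complex) \<Rightarrow> complex" where
  "wint \<kappa> f = wlim \<kappa> f - wlim \<kappa> (\<lambda>x. - f (- x))"

lemma schwartz_neg_mirror: "schwartz f \<Longrightarrow> schwartz (\<lambda>x. - f (- x))"
  using schwartz_cmult[OF schwartz_affine[of f "-1" 0], of "-1"] by simp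

text \<open>Reflection reduces the left half line to the right one, so that limits at minus infinity
  need no separate treatment.\<close>

lemma wprim_mirror: "schwartz f \<Longrightarrow> wprim \<kappa> (\<lambda>x. - f (- x)) x = wprim \<kappa> f (- x)"
proof -
  assume f: "schwartz f"
  have "derivs (\<lambda>x. wprim \<kappa> f (- x)) (\<lambda>x. gau (- \<kappa>) x * (- f (- x)))"
    using derivs_affine[OF derivs_wprim[OF f], of \<kappa> "-1" 0] by (simp add: algebra_simps)
  from derivs_unique[OF derivs_wprim[OF schwartz_neg_mirror[OF f]] this, of 0]
  show ?thesis using f by (simp add: wprim_0 schwartz_neg_mirror)
qed

locale neg_kappa =
  fixes \<kappa> :: complex assumes neg: "Re \<kappa> < 0"
begin

definition \<nu> :: real where "\<nu> = - Re \<kappa>"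

lemma \<nu>_pos: "\<nu> > 0"
  using neg by (simp add: \<nu>_def)

lemma weight_bound: "(\<And>x. cmod (f x) \<le> M) \<Longrightarrow> cmod (gau (- \<kappa>) t * f t) \<le> M * exp (- \<nu> / 2 * t\<^sup>2)"
  unfolding norm_mult cmod_gau by (simp add: \<nu>_def mult.commute mult_left_mono)

lemma wprim_tail:
  assumes f: "schwartz f" and M: "\<And>x. cmod (f x) \<le> M" and xy: "1 \<le> x" "x \<le> y"
  shows "cmod (wprim \<kappa> f y - wprim \<kappa> f x) \<le> (M / \<nu>) * exp (- \<nu> / 2 * x\<^sup>2)"
  by (rule gauss_tail[OF \<nu>_pos derivs_wprim[OF f, of \<kappa>] _ xy]) (rule weight_bound[OF M])

lemma exp_le_inverse: "\<exists>C\<ge>0. \<forall>x\<ge>1. exp (- \<nu> / 2 * x\<^sup>2) \<le> C / x"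
proof -
  have "rapid_decay (gau (- \<kappa>))" using neg by (intro schwartz_rapid schwartz_gau) simp
  then obtain C where C: "C \<ge> 0" "\<And>x. \<bar>x\<bar> ^ 1 * cmod (gau (- \<kappa>) x) \<le> C" using rapid_decayD by blast
  have "exp (- \<nu> / 2 * x\<^sup>2) \<le> C / x" if "x \<ge> 1" for x
    using C(2)[of x] that by (simp add: cmod_gau \<nu>_def pos_le_divide_eq mult.commute)
  then show ?thesis using C(1) by blast
qed

lemma wprim_LIMSEQ:
  assumes f: "schwartz f" shows "(\<lambda>n. wprim \<kappa> f (real n)) \<longlonglongrightarrow> wlim \<kappa> f"
proof -
  obtain M where M: "\<And>x. cmod (f x) \<le> M" using rapid_decay_bounded[OF schwartz_rapid[OF f]] by blast
  have M0: "M \<ge> 0" using M norm_ge_zero order_trans by blast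
  obtain C where C: "C \<ge> 0" "\<And>x. x \<ge> 1 \<Longrightarrow> exp (- \<nu> / 2 * x\<^sup>2) \<le> C / x" using exp_le_inverse by blast
  define B where "B = (M / \<nu>) * C"
  have B: "B \<ge> 0" using M0 C \<nu>_pos by (simp add: B_def)
  have tail: "cmod (wprim \<kappa> f (real n) - wprim \<kappa> f (real m)) \<le> B / real m" if "1 \<le> m" "m \<le> n" for m n
  proof -
    have "cmod (wprim \<kappa> f (real n) - wprim \<kappa> f (real m)) \<le> (M / \<nu>) * exp (- \<nu> / 2 * (real m)\<^sup>2)"
      using that by (intro wprim_tail[OF f M]) auto
    also have "\<dots> \<le> (M / \<nu>) * (C / real m)"
      using that M0 \<nu>_pos by (intro mult_left_mono C) auto
    finally show ?thesis by (simp add: B_def)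
  qed
  have "Cauchy (\<lambda>n. wprim \<kappa> f (real n))"
  proof (rule CauchyI)
    fix e :: real assume e: "e > 0"
    obtain N where N: "real N > 2 * B / e" using reals_Archimedean2 by blast
    define N' where "N' = Suc N"
    have "2 * B / e < real N'" using N by (simp add: N'_def)
    then have "2 * B < real N' * e" using e by (simp only: pos_divide_less_eq)
    then have small: "B / real N' < e / 2" by (simp add: N'_def field_simps)
    have "cmod (wprim \<kappa> f (real m) - wprim \<kappa> f (real n)) < e" if "m \<ge> N'" "n \<ge> N'" for m n
    proof -
      have "cmod (wprim \<kappa> f (real m) - wprim \<kappa> f (real N')) < e / 2"
        by (rule le_less_trans[OF tail small]) (use that N'_def in auto)
      moreover have "cmod (wprim \<kappa> f (real n) - wprim \<kappa> f (real N')) < e / 2"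
        by (rule le_less_trans[OF tail small]) (use that N'_def in auto)
      ultimately show ?thesis by (rule norm_triangle_half_l)
    qed
    then show "\<exists>N. \<forall>m\<ge>N. \<forall>n\<ge>N. cmod (wprim \<kappa> f (real m) - wprim \<kappa> f (real n)) < e" by blast
  qed
  then show ?thesis unfolding wlim_def by (simp add: Cauchy_convergent convergent_LIMSEQ_iff[symmetric])
qed

lemma wprim_wlim:
  assumes f: "schwartz f" and M: "\<And>x. cmod (f x) \<le> M" and x: "1 \<le> x"
  shows "cmod (wlim \<kappa> f - wprim \<kappa> f x) \<le> (M / \<nu>) * exp (- \<nu> / 2 * x\<^sup>2)"
proof (rule LIMSEQ_le_const2)
  show "(\<lambda>n. cmod (wprim \<kappa> f (real n) - wprim \<kappa> f x)) \<longlonglongrightarrow> cmod (wlim \<kappa> f - wprim \<kappa> f x)"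
    by (intro tendsto_intros wprim_LIMSEQ f)
  show "\<exists>N. \<forall>n\<ge>N. cmod (wprim \<kappa> f (real n) - wprim \<kappa> f x) \<le> (M / \<nu>) * exp (- \<nu> / 2 * x\<^sup>2)"
    using wprim_tail[OF f M x] by (intro exI[of _ "nat \<lceil>x\<rceil>"]) (simp add: nat_ceiling_le_eq)
qed

lemma wlim_add: "schwartz f \<Longrightarrow> schwartz h \<Longrightarrow> wlim \<kappa> (\<lambda>x. f x + h x) = wlim \<kappa> f + wlim \<kappa> h"
  using LIMSEQ_unique[OF wprim_LIMSEQ[OF schwartz_add[of f h]], of "wlim \<kappa> f + wlim \<kappa> h"]
  by (simp add: wprim_add tendsto_add wprim_LIMSEQ)

lemma wlim_cmult: "schwartz f \<Longrightarrow> wlim \<kappa> (\<lambda>x. c * f x) = c * wlim \<kappa> f"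
  using LIMSEQ_unique[OF wprim_LIMSEQ[OF schwartz_cmult[of f c]], of "c * wlim \<kappa> f"]
  by (simp add: wprim_cmult tendsto_mult_left wprim_LIMSEQ)

lemma wint_add: "schwartz f \<Longrightarrow> schwartz h \<Longrightarrow> wint \<kappa> (\<lambda>x. f x + h x) = wint \<kappa> f + wint \<kappa> h"
  using wlim_add[OF schwartz_neg_mirror schwartz_neg_mirror, of f h] by (simp add: wint_def wlim_add)

lemma wint_cmult: "schwartz f \<Longrightarrow> wint \<kappa> (\<lambda>x. c * f x) = c * wint \<kappa> f"
  using wlim_cmult[OF schwartz_neg_mirror, of f c] by (simp add: wint_def wlim_cmult right_diff_distrib)

lemma wlim_bound:
  assumes f: "schwartz f" and M: "\<And>x. cmod (f x) \<le> M"
  shows "cmod (wlim \<kappa> f) \<le> (1 + 1 / \<nu>) * M"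
proof -
  have M0: "M \<ge> 0" using M norm_ge_zero order_trans by blast
  have le1: "exp (- \<nu> / 2 * t\<^sup>2) \<le> 1" for t using \<nu>_pos by simp
  have "cmod (wprim \<kappa> f 1 - wprim \<kappa> f 0) \<le> M * 1 - M * 0"
  proof (rule norm_diff_le_of_derivs[OF derivs_wprim[OF f]])
    show "cmod (gau (- \<kappa>) t * f t) \<le> M" for t
      by (rule order_trans[OF weight_bound[OF M]]) (use mult_left_mono[OF le1[of t] M0] in simp)
  qed (auto intro!: derivative_eq_intros)
  then have "cmod (wprim \<kappa> f 1) \<le> M" by (simp add: wprim_0[OF f])
  moreover have "cmod (wlim \<kappa> f - wprim \<kappa> f 1) \<le> M / \<nu>"
    using wprim_wlim[OF f M, of 1] mult_left_mono[OF le1[of 1], of "M / \<nu>"] M0 \<nu>_pos by simp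
  ultimately have "cmod (wlim \<kappa> f) \<le> M + M / \<nu>" using norm_triangle_sub[of "wlim \<kappa> f" "wprim \<kappa> f 1"] by linarith
  then show ?thesis by (simp add: distrib_right)
qed

lemma wint_bound:
  assumes f: "schwartz f" shows "cmod (wint \<kappa> f) \<le> 2 * (1 + 1 / \<nu>) * supn f"
proof -
  have "cmod (wlim \<kappa> f) \<le> (1 + 1 / \<nu>) * supn f" by (rule wlim_bound[OF f le_supn[OF f]])
  moreover have "cmod (wlim \<kappa> (\<lambda>x. - f (- x))) \<le> (1 + 1 / \<nu>) * supn f"
    by (rule wlim_bound[OF schwartz_neg_mirror[OF f]]) (use le_supn[OF f] in auto)
  ultimately show ?thesis unfolding wint_def
    using norm_triangle_ineq4[of "wlim \<kappa> f" "wlim \<kappa> (\<lambda>x. - f (- x))"] by linarith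
qed

text \<open>\<open>gau (- \<kappa>) * f\<close> is a primitive of the weighted
  \<open>dk \<kappa> f\<close> and vanishes at infinity, so only the boundary term at 0
  remains.\<close>

lemma wlim_dk:
  assumes f: "schwartz f" shows "wlim \<kappa> (dk \<kappa> f) = - f 0"
proof -
  have "derivs (\<lambda>x. gau (- \<kappa>) x * f x + (- f 0)) (\<lambda>x. gau (- \<kappa>) x * dk \<kappa> f x + 0)"
    by (intro derivs_add ode_imp_derivs ode_dk f) (simp add: derivs_def)
  then have eq: "wprim \<kappa> (dk \<kappa> f) = (\<lambda>x. gau (- \<kappa>) x * f x + (- f 0))"
    using derivs_unique[OF derivs_wprim[OF schwartz_dk[OF f], of \<kappa> \<kappa>], of "\<lambda>x. gau (- \<kappa>) x * f x + (- f 0)" 0]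
    by (simp add: wprim_0 schwartz_dk f)
  obtain M where M: "\<And>x. cmod (f x) \<le> M" using rapid_decay_bounded[OF schwartz_rapid[OF f]] by blast
  obtain C where C: "C \<ge> 0" "\<And>x. x \<ge> 1 \<Longrightarrow> exp (- \<nu> / 2 * x\<^sup>2) \<le> C / x" using exp_le_inverse by blast
  have M0: "M \<ge> 0" using M norm_ge_zero order_trans by blast
  have "(\<lambda>n. gau (- \<kappa>) (real n) * f (real n)) \<longlonglongrightarrow> 0"
  proof (rule Lim_null_comparison)
    show "\<forall>\<^sub>F n in sequentially. cmod (gau (- \<kappa>) (real n) * f (real n)) \<le> M * C / real n"
      using eventually_ge_at_top[of 1]
    proof eventually_elim
      case (elim n)
      have "cmod (gau (- \<kappa>) (real n) * f (real n)) \<le> M * exp (- \<nu> / 2 * (real n)\<^sup>2)" by (rule weight_bound[OF M])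
      also have "\<dots> \<le> M * (C / real n)" using elim by (intro mult_left_mono C M0) simp
      finally show ?case by simp
    qed
    show "(\<lambda>n. M * C / real n) \<longlonglongrightarrow> 0" by (rule lim_const_over_n)
  qed
  then have "(\<lambda>n. wprim \<kappa> (dk \<kappa> f) (real n)) \<longlonglongrightarrow> 0 + (- f 0)"
    unfolding eq by (intro tendsto_intros)
  from LIMSEQ_unique[OF wprim_LIMSEQ[OF schwartz_dk[OF f]] this] show ?thesis by simp
qed

text \<open>The boundary terms at 0 from the two half lines cancel. Hence \<open>wint\<close>
  annihilates the image and is the obstruction to solvability.\<close>

lemma wint_dk:
  assumes f: "schwartz f" shows "wint \<kappa> (dk \<kappa> f) = 0"
proof -
  have s: "schwartz (\<lambda>x. f (- x))" using schwartz_affine[OF f, of "-1" 0] by simp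
  have "dk \<kappa> (\<lambda>x. f (- x)) = (\<lambda>x. - dk \<kappa> f (- x))" by (rule ode_imp_dk[OF ode_mirror[OF ode_dk[OF f]]])
  then show ?thesis using wlim_dk[OF f] wlim_dk[OF s] by (simp add: wint_def)
qed

text \<open>The conjugate Gaussian spans the kernel of the formal adjoint. Its product with the
  weight is \<open>exp (Re \<kappa> * x^2)\<close>, so positivity shows that its weighted integral
  is nonzero.\<close>

definition \<rho>0 :: "real \<Rightarrow> complex" where "\<rho>0 = gau (- cnj \<kappa>)"

lemma schwartz_\<rho>0: "schwartz \<rho>0"
  unfolding \<rho>0_def using neg by (intro schwartz_gau) simp

lemma wint_\<rho>0: "wint \<kappa> \<rho>0 \<noteq> 0"
proof -
  have pos: "gau (- \<kappa>) x * \<rho>0 x = of_real (exp (Re \<kappa> * x\<^sup>2))" for x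
  proof -
    have "gau (- \<kappa>) x * \<rho>0 x = exp ((\<kappa> + cnj \<kappa>) * of_real (x\<^sup>2 / 2))"
      unfolding gau_def \<rho>0_def by (simp only: minus_minus distrib_right exp_add)
    also have "(\<kappa> + cnj \<kappa>) * of_real (x\<^sup>2 / 2) = of_real (Re \<kappa> * x\<^sup>2)" by (simp add: complex_add_cnj)
    finally show ?thesis by (simp only: exp_of_real)
  qed
  define F where "F x = Re (wprim \<kappa> \<rho>0 x)" for x
  have dF: "(F has_real_derivative exp (Re \<kappa> * x\<^sup>2)) (at x)" for x
  proof -
    have "(wprim \<kappa> \<rho>0 has_vector_derivative of_real (exp (Re \<kappa> * x\<^sup>2))) (at x)"
      using derivs_wprim[OF schwartz_\<rho>0, of \<kappa>] unfolding derivs_def pos by blast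
    from bounded_linear.has_vector_derivative[OF bounded_linear_Re this] show ?thesis
      unfolding F_def has_real_derivative_iff_has_vector_derivative by simp
  qed
  have F0: "F 0 = 0" by (simp add: F_def wprim_0 schwartz_\<rho>0)
  have "F 0 < F 1" by (rule DERIV_pos_imp_increasing[OF zero_less_one]) (use dF exp_gt_zero in blast)
  moreover have "F 1 \<le> F x" if "1 \<le> x" for x
    by (rule DERIV_nonneg_imp_nondecreasing[OF that]) (use dF exp_ge_zero in blast)
  moreover have "(\<lambda>n. F (real n)) \<longlonglongrightarrow> Re (wlim \<kappa> \<rho>0)"
    unfolding F_def by (intro tendsto_Re wprim_LIMSEQ schwartz_\<rho>0)
  ultimately have "Re (wlim \<kappa> \<rho>0) \<ge> F 1"
    by (intro LIMSEQ_le_const) (auto intro!: exI[of _ 1])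
  then have "wlim \<kappa> \<rho>0 \<noteq> 0" using \<open>F 0 < F 1\<close> F0 by auto
  moreover have "wlim \<kappa> (\<lambda>x. - \<rho>0 (- x)) = - wlim \<kappa> \<rho>0"
    using wlim_cmult[OF schwartz_\<rho>0, of "-1"] by (simp add: \<rho>0_def)
  ultimately show ?thesis by (simp add: wint_def)
qed

definition \<rho> :: "real \<Rightarrow> complex" where "\<rho> x = (1 / wint \<kappa> \<rho>0) * \<rho>0 x"

lemma schwartz_\<rho>: "schwartz \<rho>" and wint_\<rho>: "wint \<kappa> \<rho> = 1"
proof -
  show "schwartz \<rho>" unfolding \<rho>_def[abs_def] by (rule schwartz_cmult[OF schwartz_\<rho>0])
  show "wint \<kappa> \<rho> = 1"
    unfolding \<rho>_def[abs_def] wint_cmult[OF schwartz_\<rho>0] using wint_\<rho>0 by simp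
qed

definition corr :: "(real \<Rightarrow> complex) \<Rightarrow> real \<Rightarrow> complex" where
  "corr f = (\<lambda>x. f x - wint \<kappa> f * \<rho> x)"

text \<open>Subtracting the limit amounts to integrating from infinity. Since \<open>corr f\<close>
  has total weighted integral 0, it also amounts to integrating from minus infinity, and the growing
  Gaussian meets a Gaussian tail at both ends.\<close>

definition solve :: "(real \<Rightarrow> complex) \<Rightarrow> real \<Rightarrow> complex" where
  "solve f = (\<lambda>x. gau \<kappa> x * (wprim \<kappa> (corr f) x - wlim \<kappa> (corr f)))"

lemma schwartz_corr: "schwartz f \<Longrightarrow> schwartz (corr f)"
  unfolding corr_def by (intro schwartz_diff schwartz_cmult schwartz_\<rho>)

lemma wint_corr:
  assumes f: "schwartz f" shows "wint \<kappa> (corr f) = 0"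
  using wint_add[OF f schwartz_cmult[OF schwartz_\<rho>, of "- wint \<kappa> f"]] wint_cmult[OF schwartz_\<rho>, of "- wint \<kappa> f"]
  by (simp add: corr_def wint_\<rho>)

lemma ode_solve:
  assumes f: "schwartz f" shows "ode \<kappa> (solve f) (corr f)"
  unfolding solve_def
proof (rule derivs_imp_ode)
  show "derivs (\<lambda>x. wprim \<kappa> (corr f) x - wlim \<kappa> (corr f)) (\<lambda>x. gau (- \<kappa>) x * corr f x)"
    using derivs_add[OF derivs_wprim[OF schwartz_corr[OF f]], of "\<lambda>_. - wlim \<kappa> (corr f)" "\<lambda>_. 0"] by (simp add: derivs_def)
qed

lemma solve_bounded:
  assumes f: "schwartz f" shows "\<exists>B. \<forall>x. cmod (solve f x) \<le> B"
proof -
  note c = schwartz_corr[OF f]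
  define M where "M = supn (corr f)"
  have M: "cmod (corr f x) \<le> M" for x unfolding M_def by (rule le_supn[OF c])
  have M0: "M \<ge> 0" using M norm_ge_zero order_trans by blast
  \<comment> \<open>The vanishing of the total integral says that the two half-line integrals agree,
    so one constant serves at both ends.\<close>
  have eq: "wlim \<kappa> (\<lambda>x. - corr f (- x)) = wlim \<kappa> (corr f)" using wint_corr[OF f] by (simp add: wint_def)
  have cancel: "cmod (gau \<kappa> x) * ((M / \<nu>) * exp (- \<nu> / 2 * x\<^sup>2)) = M / \<nu>" for x
    unfolding cmod_gau by (simp add: \<nu>_def mult.left_commute flip: exp_add)
  have far: "cmod (solve f x) \<le> M / \<nu>" if x: "\<bar>x\<bar> \<ge> 1" for x
  proof -
    have "cmod (wprim \<kappa> (corr f) x - wlim \<kappa> (corr f)) \<le> (M / \<nu>) * exp (- \<nu> / 2 * x\<^sup>2)"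
    proof (cases "x \<ge> 1")
      case True
      then show ?thesis using wprim_wlim[OF c M True] by (simp add: norm_minus_commute)
    next
      case False
      then have "1 \<le> - x" using x by linarith
      from wprim_wlim[OF schwartz_neg_mirror[OF c] _ this, of M] show ?thesis
        using M by (simp add: eq wprim_mirror c norm_minus_commute)
    qed
    then have "cmod (gau \<kappa> x) * cmod (wprim \<kappa> (corr f) x - wlim \<kappa> (corr f)) \<le>
        cmod (gau \<kappa> x) * ((M / \<nu>) * exp (- \<nu> / 2 * x\<^sup>2))" by (intro mult_left_mono) auto
    then show ?thesis by (simp only: solve_def norm_mult cancel)
  qed
  have "continuous_on {-1..1} (solve f)" using ode_solve[OF f] unfolding ode_def by (rule derivs_continuous)
  then have "bounded (solve f ` {-1..1})" by (intro compact_imp_bounded compact_continuous_image compact_Icc)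
  then obtain B where B: "\<forall>y\<in>solve f ` {-1..1}. cmod y \<le> B" unfolding bounded_iff by blast
  have "cmod (solve f x) \<le> max B (M / \<nu>)" for x
  proof (cases "\<bar>x\<bar> \<ge> 1")
    case True then show ?thesis using far[of x] by linarith
  next
    case False
    then have "x \<in> {-1..1}" by auto
    then have "cmod (solve f x) \<le> B" using B by blast
    then show ?thesis by linarith
  qed
  then show ?thesis by blast
qed

lemma schwartz_solve: "schwartz f \<Longrightarrow> schwartz (solve f)"
  using solve_bounded schwartz_ode_neg[OF neg schwartz_corr ode_solve] by blast

lemma dk_solve: "schwartz f \<Longrightarrow> dk \<kappa> (solve f) = corr f"
  by (rule ode_imp_dk[OF ode_solve])

lemma rapid_decay_weighted: "schwartz g \<Longrightarrow> rapid_decay (\<lambda>x. gau (- \<kappa>) x * g x)"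
  using neg by (intro schwartz_rapid schwartz_mult schwartz_gau) auto

text \<open>The bound in \<open>solve_bounded\<close> depends on f but suffices to show that
  \<open>solve f\<close> is Schwartz. This makes the decay hypothesis of
  \<open>ode_bound_neg\<close> available, which gives a constant uniform in f.\<close>

lemma solve_bound: "\<exists>C\<ge>0. \<forall>f. schwartz f \<longrightarrow> sq 0 (solve f) \<le> C * sq 0 f"
proof -
  define A where "A = exp (- Re \<kappa> / 2) * (1 - 1 / Re \<kappa>)"
  define B where "B = 2 * (1 + 1 / \<nu>) * supn \<rho>"
  have "1 / Re \<kappa> < 0" using neg by simp
  then have p: "1 - 1 / Re \<kappa> \<ge> 0" by linarith
  have A: "A \<ge> 0" using p by (simp add: A_def)
  have B: "B \<ge> 0" using \<nu>_pos sq_nonneg[OF schwartz_\<rho>, of 0] by (simp add: B_def)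
  have "sq 0 (solve f) \<le> (A * (1 + B)) * sq 0 f" if f: "schwartz f" for f
  proof -
    have "supn (corr f) \<le> supn f + cmod (wint \<kappa> f) * supn \<rho>"
      using sq_diff[OF f schwartz_cmult[OF schwartz_\<rho>, of "wint \<kappa> f"], of 0] by (simp add: corr_def supn_cmult schwartz_\<rho>)
    also have "\<dots> \<le> supn f + (2 * (1 + 1 / \<nu>) * supn f) * supn \<rho>"
      using sq_nonneg[OF schwartz_\<rho>, of 0] by (intro add_left_mono mult_right_mono wint_bound f) simp
    also have "\<dots> = (1 + B) * supn f" by (simp add: B_def algebra_simps)
    finally have 1: "supn (corr f) \<le> (1 + B) * supn f" .
    have "cmod (solve f x) \<le> A * supn (corr f)" for x
      unfolding A_def
      by (rule ode_bound_neg[OF neg ode_solve[OF f] le_supn[OF schwartz_corr[OF f]] rapid_decay_weighted[OF schwartz_solve[OF f]]])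
    then have "supn (solve f) \<le> A * supn (corr f)" by (rule supn_leI)
    also have "\<dots> \<le> A * ((1 + B) * supn f)" by (intro mult_left_mono 1 A)
    finally show ?thesis by (simp add: mult.assoc)
  qed
  then show ?thesis using A B by (intro exI[of _ "A * (1 + B)"]) auto
qed

lemma corr_add: "schwartz f \<Longrightarrow> schwartz h \<Longrightarrow> corr (\<lambda>x. f x + h x) = (\<lambda>x. corr f x + corr h x)"
  by (simp add: corr_def wint_add algebra_simps)

lemma corr_cmult: "schwartz f \<Longrightarrow> corr (\<lambda>x. c * f x) = (\<lambda>x. c * corr f x)"
  by (simp add: corr_def wint_cmult algebra_simps)

lemma elliptic_model: "elliptic_model {f. schwartz f} sq (dk \<kappa>) solve (\<lambda>_. 0) \<rho> (wint \<kappa>)"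
proof
  show "\<exists>J l r C. carrier_approx {f. schwartz f} sq J l r C \<epsilon>" if "\<epsilon> > 0" for \<epsilon> by (rule sq_rellich[OF that])
  show "\<exists>f\<in>{f. schwartz f}. (\<lambda>N. sq 0 (\<lambda>x. f x - (\<Sum>j<N. u j x))) \<longlonglongrightarrow> 0"
    if "\<And>j. u j \<in> {f. schwartz f}" "\<And>k. summable (\<lambda>j. sq k (u j))" for u
    using sq_complete[of u] that by auto
  show "\<exists>C. \<forall>f\<in>{f. schwartz f}. sq (Suc k) (solve f) \<le> C * sq k f" for k
  proof -
    obtain C where C: "C \<ge> 0" "\<And>f. schwartz f \<Longrightarrow> sq (Suc k) f \<le> C * (sq k (dk \<kappa> f) + sq 0 f)"
      using elliptic_estimate[of \<kappa> k] neg by auto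
    obtain B where B: "B \<ge> 0" "\<And>f. schwartz f \<Longrightarrow> sq 0 (solve f) \<le> B * sq 0 f" using solve_bound by blast
    define A where "A = 2 * (1 + 1 / \<nu>) * sq k \<rho>"
    have A0: "2 * (1 + 1 / \<nu>) \<ge> 0" using \<nu>_pos by simp
    have "sq (Suc k) (solve f) \<le> C * (1 + A + B) * sq k f" if f: "schwartz f" for f
    proof -
      have "sq k (corr f) \<le> sq k f + cmod (wint \<kappa> f) * sq k \<rho>"
        using sq_diff[OF f schwartz_cmult[OF schwartz_\<rho>, of "wint \<kappa> f"], of k] by (simp add: corr_def sq_cmult schwartz_\<rho>)
      also have "\<dots> \<le> sq k f + (2 * (1 + 1 / \<nu>) * sq k f) * sq k \<rho>"
      proof (intro add_left_mono mult_right_mono sq_nonneg schwartz_\<rho>)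
        have "2 * (1 + 1 / \<nu>) * supn f \<le> 2 * (1 + 1 / \<nu>) * sq k f"
          using sq_0_le[OF f, of k] A0 by (intro mult_left_mono) auto
        then show "cmod (wint \<kappa> f) \<le> 2 * (1 + 1 / \<nu>) * sq k f" using wint_bound[OF f] by linarith
      qed
      finally have 1: "sq k (corr f) \<le> sq k f + A * sq k f" by (simp add: A_def algebra_simps)
      have "sq 0 (solve f) \<le> B * sq k f" using B(2)[OF f] mult_left_mono[OF sq_0_le[OF f, of k] B(1)] by linarith
      with 1 have "sq k (corr f) + sq 0 (solve f) \<le> (1 + A + B) * sq k f" by (simp add: algebra_simps)
      then have "C * (sq k (corr f) + sq 0 (solve f)) \<le> C * ((1 + A + B) * sq k f)" by (intro mult_left_mono C(1))
      then show ?thesis using C(2)[OF schwartz_solve[OF f]] dk_solve[OF f] by (simp only: mult.assoc)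
    qed
    then show ?thesis by blast
  qed
  show "(dk \<kappa> f = (\<lambda>_. 0)) = (\<exists>c. f = (\<lambda>x. c * 0))" if "f \<in> {f. schwartz f}" for f
  proof
    assume 0: "dk \<kappa> f = (\<lambda>_. 0)"
    have f: "schwartz f" using that by simp
    have "cmod (f x) \<le> exp (- Re \<kappa> / 2) * (1 - 1 / Re \<kappa>) * 0" for x
      by (rule ode_bound_neg[OF neg ode_dk[OF f] _ rapid_decay_weighted[OF f]]) (simp add: 0)
    then show "\<exists>c. f = (\<lambda>x. c * 0)" by (auto simp: fun_eq_iff)
  next
    assume "\<exists>c. f = (\<lambda>x. c * 0)"
    then show "dk \<kappa> f = (\<lambda>_. 0)" using dk_cmult[OF schwartz_zero, of \<kappa> 0] by simp
  qed
  show "f = (\<lambda>_. 0)" if "f \<in> {f. schwartz f}" "sq 0 f = 0" for f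
  proof
    fix x show "f x = 0" using le_supn[of f x] that by simp
  qed
  show "dk \<kappa> f = (\<lambda>_. 0)" if "f \<in> {f. schwartz f}" "dk \<kappa> f = (\<lambda>x. c * \<rho> x)" for f c
  proof -
    \<comment> \<open>\<open>wint\<close> is 1 on \<open>\<rho>\<close> and 0 on the image, so it
      reads off c.\<close>
    have "wint \<kappa> (dk \<kappa> f) = c" unfolding that(2) by (simp add: wint_cmult schwartz_\<rho> wint_\<rho>)
    then have "c = 0" using wint_dk that(1) by simp
    then show ?thesis using that(2) by simp
  qed
  show "solve (\<lambda>x. f x + h x) = (\<lambda>x. solve f x + solve h x)" if "f \<in> {f. schwartz f}" "h \<in> {f. schwartz f}" for f h
    using that by (simp add: solve_def corr_add wprim_add wlim_add schwartz_corr algebra_simps)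
  show "solve (\<lambda>x. c * f x) = (\<lambda>x. c * solve f x)" if "f \<in> {f. schwartz f}" for f c
    using that by (simp add: solve_def corr_cmult wprim_cmult wlim_cmult schwartz_corr algebra_simps)
  show "dk \<kappa> (solve f) = (\<lambda>x. f x - wint \<kappa> f * \<rho> x)" if "f \<in> {f. schwartz f}" for f
    using dk_solve[of f] that by (simp add: corr_def)
qed (auto simp: schwartz_zero schwartz_add schwartz_cmult sq_nonneg sq_add sq_cmult schwartz_dk dk_add dk_cmult
      schwartz_solve schwartz_\<rho> wint_add wint_cmult intro: sq_mono_Suc simp del: sq.simps)

lemma \<rho>_nonzero: "\<rho> \<noteq> (\<lambda>_. 0)"
  using wint_\<rho> wint_cmult[OF schwartz_zero, of 0] by auto

end

section \<open>Fourier series\<close>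

lemma summable_on_int_inverse_square: "(\<lambda>n::int. 1 / (1 + \<bar>real_of_int n\<bar>)\<^sup>2) summable_on UNIV"
proof -
  have s: "(\<lambda>n::nat. 1 / (1 + real n)\<^sup>2) summable_on UNIV"
  proof (subst summable_on_UNIV_nonneg_real_iff)
    have "summable (\<lambda>n. inverse ((real (Suc n)) ^ 2))"
      using inverse_power_summable[of 2, where 'a = real] by (subst summable_Suc_iff) (simp add: o_def)
    then show "summable (\<lambda>n. 1 / (1 + real n)\<^sup>2)" by (simp add: divide_inverse)
  qed simp
  have "(\<lambda>n::int. 1 / (1 + \<bar>real_of_int n\<bar>)\<^sup>2) summable_on range int"
    by (subst summable_on_reindex) (auto simp: o_def s)
  moreover have "(\<lambda>n::int. 1 / (1 + \<bar>real_of_int n\<bar>)\<^sup>2) summable_on range (\<lambda>n. - int (Suc n))"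
  proof (subst summable_on_reindex)
    show "inj (\<lambda>n. - int (Suc n))" by (auto intro: injI)
    have "(\<lambda>n::nat. 1 / (1 + real (Suc n))\<^sup>2) summable_on UNIV"
      by (rule summable_on_comparison_test[OF s]) (auto simp: frac_le)
    then show "((\<lambda>n::int. 1 / (1 + \<bar>real_of_int n\<bar>)\<^sup>2) \<circ> (\<lambda>n. - int (Suc n))) summable_on UNIV"
      by (simp add: o_def add_ac)
  qed
  ultimately have "(\<lambda>n::int. 1 / (1 + \<bar>real_of_int n\<bar>)\<^sup>2) summable_on (range int \<union> range (\<lambda>n. - int (Suc n)))"
    by (rule summable_on_Un_disjoint) auto
  moreover have "range int \<union> range (\<lambda>n. - int (Suc n)) = UNIV"
  proof -
    have "n \<in> range int \<union> range (\<lambda>n. - int (Suc n))" for n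
    proof (cases "n \<ge> 0")
      case True then show ?thesis by (metis UnI1 int_nat_eq rangeI)
    next
      case False
      then have "n = - int (Suc (nat (- n - 1)))" by simp
      then show ?thesis by blast
    qed
    then show ?thesis by blast
  qed
  ultimately show ?thesis by simp
qed

definition ee :: "real \<Rightarrow> complex" where
  "ee t = exp (2 * pi * \<i> * of_real t)"

lemma ee_add: "ee (s + t) = ee s * ee t" and ee_0 [simp]: "ee 0 = 1"
  by (simp_all add: ee_def distrib_left flip: exp_add)

lemma norm_ee [simp]: "cmod (ee t) = 1"
  by (simp add: ee_def)

lemma ee_of_int [simp]: "ee (of_int n) = 1"
  by (auto simp: ee_def exp_eq_1)

lemma ee_nonzero [simp]: "ee t \<noteq> 0"
  by (simp add: ee_def)

lemma ee_minus: "ee (- t) = inverse (ee t)" and cnj_ee: "cnj (ee t) = ee (- t)"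
  by (simp_all add: ee_def exp_minus exp_cnj)

lemma ee_mult_minus [simp]: "ee t * ee (- t) = 1" "ee (- t) * ee t = 1"
  by (simp_all add: ee_minus)

lemma ee_power_int: "ee (of_int n * (t + of_int k)) = ee (of_int n * t)"
  by (simp add: distrib_left ee_add flip: of_int_mult)

lemma ee_eq_iff: "ee s = ee t \<longleftrightarrow> (\<exists>k::int. s = t + of_int k)"
proof -
  have "ee s = ee t \<longleftrightarrow> exp (2 * pi * \<i> * of_real s - 2 * pi * \<i> * of_real t) = 1"
    by (simp add: ee_def exp_diff)
  also have "\<dots> \<longleftrightarrow> (\<exists>k::int. s = t + of_int k)"
  proof
    assume "exp (2 * pi * \<i> * of_real s - 2 * pi * \<i> * of_real t) = 1"
    then obtain n :: int where "2 * pi * s - 2 * pi * t = of_int (2 * n) * pi" by (auto simp: exp_eq_1)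
    then have "(2 * pi) * (s - t) = (2 * pi) * of_int n" by (simp add: algebra_simps)
    then have "s - t = of_int n" by simp
    then show "\<exists>k::int. s = t + of_int k" by (intro exI[of _ n]) simp
  next
    assume "\<exists>k::int. s = t + of_int k"
    then obtain k :: int where "s = t + of_int k" by blast
    then show "exp (2 * pi * \<i> * of_real s - 2 * pi * \<i> * of_real t) = 1"
      by (auto simp: exp_eq_1 algebra_simps intro!: exI[of _ k])
  qed
  finally show ?thesis .
qed

lemma derivs_ee: "derivs (\<lambda>x. ee (a * x)) (\<lambda>x. 2 * pi * \<i> * of_real a * ee (a * x))"
  unfolding derivs_def
proof
  fix x
  have "((\<lambda>z. exp (2 * pi * \<i> * (of_real a * z))) has_field_derivative 2 * pi * \<i> * of_real a * ee (a * x)) (at (of_real x))"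
    unfolding ee_def by (auto intro!: derivative_eq_intros)
  from has_vector_derivative_real_field[OF this]
  show "((\<lambda>x. ee (a * x)) has_vector_derivative 2 * pi * \<i> * of_real a * ee (a * x)) (at x)"
    by (simp add: ee_def[abs_def])
qed

lemma continuous_ee [continuous_intros]: "continuous_on A g \<Longrightarrow> continuous_on A (\<lambda>x. ee (g x))"
  unfolding ee_def by (intro continuous_intros)

lemma integral_derivs:
  assumes "derivs F f" "a \<le> b" shows "(f has_integral F b - F a) {a..b}"
  by (rule fundamental_theorem_of_calculus[OF assms(2)])
    (use assms(1) in \<open>auto simp: derivs_def intro: has_vector_derivative_at_within\<close>)

lemma integral_ee:
  "integral {a..a + 1} (\<lambda>x. ee (of_int k * x)) = (if k = 0 then 1 else 0)"
proof (cases "k = 0")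
  case False
  let ?c = "2 * pi * \<i> * of_int k"
  have c: "?c \<noteq> 0" using False by simp
  have "derivs (\<lambda>x. (1 / ?c) * ee (of_int k * x)) (\<lambda>x. ee (of_int k * x))"
    using derivs_cmult[OF derivs_ee[of "of_int k"], of "1 / ?c"] c by (simp add: field_simps)
  from integral_derivs[OF this, of a "a + 1"]
  have "integral {a..a + 1} (\<lambda>x. ee (of_int k * x)) = (1 / ?c) * ee (of_int k * (a + 1)) - (1 / ?c) * ee (of_int k * a)"
    by (intro integral_unique) auto
  then show ?thesis using False by (simp add: distrib_left ee_add)
qed simp

definition fcoef :: "real \<Rightarrow> (real \<Rightarrow> complex) \<Rightarrow> int \<Rightarrow> complex" where
  "fcoef a q n = integral {a..a + 1} (\<lambda>x. q x * ee (- of_int n * x))"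

text \<open>By orthogonality the remainder \<open>r F\<close> has the same m-th coefficient as q for
  every m outside F, so removing that mode lowers the square integral by exactly the squared modulus
  of the coefficient.\<close>

lemma bessel_identity:
  assumes q: "continuous_on {a..a + 1} q" and F: "finite F"
  defines "r \<equiv> \<lambda>F x. q x - (\<Sum>n\<in>F. fcoef a q n * ee (of_int n * x))"
  shows "integral {a..a + 1} (\<lambda>x. r F x * cnj (r F x)) =
     integral {a..a + 1} (\<lambda>x. q x * cnj (q x)) - (\<Sum>n\<in>F. of_real ((cmod (fcoef a q n))\<^sup>2))"
  using F
proof (induction F)
  case empty then show ?case by (simp add: r_def)
next
  case (insert m F)
  let ?I = "{a..a + 1}" and ?c = "fcoef a q m"
  let ?e = "\<lambda>n x. ee (of_int n * x)"
  have cr: "continuous_on ?I (r F)" unfolding r_def by (intro continuous_intros q)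
  have ccnj: "continuous_on ?I (\<lambda>x. cnj (r F x))" by (intro continuous_intros cr)
  have ce: "continuous_on ?I (?e n)" for n by (intro continuous_intros)
  have rm: "integral ?I (\<lambda>x. r F x * ee (- of_int m * x)) = ?c"
  proof -
    have "(\<lambda>x. r F x * ee (- of_int m * x)) = (\<lambda>x. q x * ee (- of_int m * x) - (\<Sum>n\<in>F. fcoef a q n * ?e (n - m) x))"
    proof
      fix x
      have "?e n x * ee (- of_int m * x) = ?e (n - m) x" for n by (simp add: algebra_simps flip: ee_add)
      then show "r F x * ee (- of_int m * x) = q x * ee (- of_int m * x) - (\<Sum>n\<in>F. fcoef a q n * ?e (n - m) x)"
        unfolding r_def left_diff_distrib sum_distrib_right mult.assoc by simp
    qed
    moreover have "integral ?I (\<lambda>x. q x * ee (- of_int m * x) - (\<Sum>n\<in>F. fcoef a q n * ?e (n - m) x)) =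
       ?c - (\<Sum>n\<in>F. fcoef a q n * integral ?I (?e (n - m)))"
      unfolding fcoef_def
      by (subst integral_diff, (intro integrable_continuous_real continuous_intros q)+, subst integral_sum)
        (auto intro!: insert.hyps integrable_continuous_real continuous_intros)
    moreover have "(\<Sum>n\<in>F. fcoef a q n * integral ?I (?e (n - m))) = 0"
      unfolding integral_ee using insert.hyps by (intro sum.neutral ballI) auto
    ultimately show ?thesis by simp
  qed
  have rm': "integral ?I (\<lambda>x. cnj (r F x) * ?e m x) = cnj ?c"
  proof -
    have "integral ?I (\<lambda>x. cnj (r F x * ee (- of_int m * x))) = cnj (integral ?I (\<lambda>x. r F x * ee (- of_int m * x)))"
      by (rule integral_cnj[symmetric])
    moreover have "cnj (ee (- of_int m * x)) = ?e m x" for x by (simp add: cnj_ee)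
    ultimately show ?thesis by (simp only: rm complex_cnj_mult)
  qed
  have ins: "r (insert m F) x = r F x - ?c * ?e m x" for x
    using insert.hyps by (simp add: r_def)
  have "r (insert m F) x * cnj (r (insert m F) x) =
     ((r F x * cnj (r F x) - cnj ?c * (r F x * ee (- of_int m * x))) - ?c * (cnj (r F x) * ?e m x)) + ?c * cnj ?c" for x
  proof -
    have "?e m x * cnj (?e m x) = 1" by (simp add: cnj_ee)
    then have "?c * cnj ?c * (?e m x * cnj (?e m x)) = ?c * cnj ?c" by simp
    moreover have "cnj (?e m x) = ee (- of_int m * x)" by (simp add: cnj_ee)
    ultimately show ?thesis unfolding ins by (simp add: algebra_simps)
  qed
  then have "integral ?I (\<lambda>x. r (insert m F) x * cnj (r (insert m F) x)) =
    integral ?I (\<lambda>x. ((r F x * cnj (r F x) - cnj ?c * (r F x * ee (- of_int m * x))) - ?c * (cnj (r F x) * ?e m x)) + ?c * cnj ?c)"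
    by simp
  also have "\<dots> = ((integral ?I (\<lambda>x. r F x * cnj (r F x)) - cnj ?c * integral ?I (\<lambda>x. r F x * ee (- of_int m * x)))
      - ?c * integral ?I (\<lambda>x. cnj (r F x) * ?e m x)) + integral ?I (\<lambda>x. ?c * cnj ?c)"
  proof -
    have i1: "(\<lambda>x. r F x * cnj (r F x)) integrable_on ?I" "(\<lambda>x. r F x * ee (- of_int m * x)) integrable_on ?I"
      "(\<lambda>x. cnj (r F x) * ?e m x) integrable_on ?I" "(\<lambda>x. ?c * cnj ?c) integrable_on ?I"
      by (intro integrable_continuous_real continuous_intros cr)+
    have i2: "(\<lambda>x. cnj ?c * (r F x * ee (- of_int m * x))) integrable_on ?I" "(\<lambda>x. ?c * (cnj (r F x) * ?e m x)) integrable_on ?I"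
      by (intro integrable_continuous_real continuous_intros cr)+
    show ?thesis
      by (simp only: integral_add[OF integrable_diff[OF integrable_diff[OF i1(1) i2(1)] i2(2)] i1(4)]
          integral_diff[OF integrable_diff[OF i1(1) i2(1)] i2(2)] integral_diff[OF i1(1) i2(1)] integral_mult_right)
  qed
  also have "\<dots> = integral ?I (\<lambda>x. r F x * cnj (r F x)) - ?c * cnj ?c"
    unfolding rm rm' by simp
  finally show ?case
    unfolding insert.IH sum.insert[OF insert.hyps] complex_norm_square by (simp add: algebra_simps)
qed

text \<open>Riemann-Lebesgue for continuous functions: Bessel's inequality makes the squared
  coefficients summable along any sequence of distinct frequencies.\<close>

lemma fcoef_tendsto_0:
  assumes q: "continuous_on {a..a + 1} q" and inj: "inj g"
  shows "(\<lambda>N::nat. fcoef a q (g N)) \<longlonglongrightarrow> 0"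
proof -
  let ?I = "{a..a + 1}"
  define M where "M = Re (integral ?I (\<lambda>x. q x * cnj (q x)))"
  have le: "(\<Sum>n\<in>F. (cmod (fcoef a q n))\<^sup>2) \<le> M" if F: "finite F" for F
  proof -
    define r where "r x = q x - (\<Sum>n\<in>F. fcoef a q n * ee (of_int n * x))" for x
    have c: "continuous_on ?I r" unfolding r_def by (intro continuous_intros q)
    have "integral ?I (\<lambda>x. r x * cnj (r x)) = integral ?I (\<lambda>x. of_real ((cmod (r x))\<^sup>2))"
      by (simp only: complex_norm_square)
    also have "\<dots> = of_real (integral ?I (\<lambda>x. (cmod (r x))\<^sup>2))"
      using integral_linear[OF integrable_continuous_real bounded_linear_of_real, of a "a + 1" "\<lambda>x. (cmod (r x))\<^sup>2"] c
      by (simp add: o_def continuous_intros)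
    finally have "Re (integral ?I (\<lambda>x. r x * cnj (r x))) \<ge> 0" by (simp add: Henstock_Kurzweil_Integration.integral_nonneg integrable_continuous_real continuous_intros c)
    then show ?thesis using bessel_identity[OF q F] unfolding M_def r_def by simp
  qed
  have "summable (\<lambda>N. (cmod (fcoef a q (g N)))\<^sup>2)"
  proof (rule summableI_nonneg_bounded)
    fix N
    have "(\<Sum>i<N. (cmod (fcoef a q (g i)))\<^sup>2) = (\<Sum>n\<in>g ` {..<N}. (cmod (fcoef a q n))\<^sup>2)"
      using inj by (subst sum.reindex) (auto intro: inj_on_subset)
    then show "(\<Sum>i<N. (cmod (fcoef a q (g i)))\<^sup>2) \<le> M" using le by simp
  qed simp
  from summable_LIMSEQ_zero[OF this] have "(\<lambda>N. sqrt ((cmod (fcoef a q (g N)))\<^sup>2)) \<longlonglongrightarrow> sqrt 0"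
    by (rule tendsto_real_sqrt)
  then show ?thesis by (simp add: tendsto_norm_zero_iff)
qed

lemma derivs_quotient:
  assumes "derivs f f'" shows "((\<lambda>y. (f y - f x) / of_real (y - x)) \<longlongrightarrow> f' x) (at x)"
proof -
  have lim: "((\<lambda>y. norm ((f y - f x) - (y - x) *\<^sub>R f' x) / norm (y - x)) \<longlongrightarrow> 0) (at x)"
    using assms unfolding derivs_def has_vector_derivative_def has_derivative_iff_norm by blast
  have eq: "norm ((f y - f x) - (y - x) *\<^sub>R f' x) / norm (y - x) = cmod ((f y - f x) / of_real (y - x) - f' x)"
    if "y \<noteq> x" for y
  proof -
    have "(f y - f x) / of_real (y - x) - f' x = ((f y - f x) - (y - x) *\<^sub>R f' x) / of_real (y - x)"
      using that by (simp add: scaleR_conv_of_real field_simps)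
    then show ?thesis by (simp only: norm_divide norm_of_real real_norm_def)
  qed
  have ev: "\<forall>\<^sub>F y in at x. norm ((f y - f x) - (y - x) *\<^sub>R f' x) / norm (y - x) = cmod ((f y - f x) / of_real (y - x) - f' x)"
    unfolding eventually_at_filter by (intro always_eventually allI impI eq)
  have "((\<lambda>y. cmod ((f y - f x) / of_real (y - x) - f' x)) \<longlongrightarrow> 0) (at x)"
    by (rule Lim_transform_eventually[OF lim ev])
  then show ?thesis by (simp add: tendsto_norm_zero_iff Lim_null[symmetric])
qed

text \<open>With \<open>H - H x0 = (ee - ee x0) q\<close> the coefficients of \<open>H - H x0\<close>, weighted by \<open>ee (n x0)\<close>, telescope
  to two coefficients of the continuous function \<open>q\<close>, and these vanish in the limit by Bessel.\<close>
lemma fourier_pointwise: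
  assumes H: "derivs H H'" and x0: "a < x0" "x0 < a + 1"
  shows "(\<lambda>N. \<Sum>n\<in>{- int N..int N}. fcoef a H n * ee (of_int n * x0)) \<longlonglongrightarrow> H x0"
proof -
  let ?I = "{a..a + 1}"
  \<comment> \<open>The value at x0 is the limit of the quotient. As x0 is interior to an interval
    of length 1, it is the only zero of \<open>ee x - ee x0\<close> there, and q is
    continuous.\<close>
  define q where "q x = (if x = x0 then H' x0 / (2 * pi * \<i> * ee x0) else (H x - H x0) / (ee x - ee x0))" for x
  have dee: "derivs ee (\<lambda>x. 2 * pi * \<i> * ee x)" using derivs_ee[of 1] by simp
  have nz: "ee x \<noteq> ee x0" if x: "x \<in> ?I" "x \<noteq> x0" for x
  proof
    assume "ee x = ee x0"
    then obtain k :: int where k: "x = x0 + of_int k" by (auto simp: ee_eq_iff)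
    have "- 1 < real_of_int k" "real_of_int k < 1" using k x(1) x0 by auto
    then have "k = 0" by linarith
    then show False using k x(2) by simp
  qed
  have qH: "(ee x - ee x0) * q x = H x - H x0" if "x \<in> ?I" for x
    using nz[OF that] by (auto simp: q_def)
  have cq: "continuous_on ?I q"
    unfolding continuous_on_def
  proof
    fix x assume x: "x \<in> ?I"
    show "(q \<longlongrightarrow> q x) (at x within ?I)"
    proof (cases "x = x0")
      case True
      have "((\<lambda>y. ((H y - H x0) / of_real (y - x0)) / ((ee y - ee x0) / of_real (y - x0))) \<longlongrightarrow> H' x0 / (2 * pi * \<i> * ee x0)) (at x0 within ?I)"
        by (intro tendsto_divide tendsto_within_subset[OF derivs_quotient[OF H]] tendsto_within_subset[OF derivs_quotient[OF dee]]) auto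
      moreover have "\<forall>\<^sub>F y in at x0 within ?I. ((H y - H x0) / of_real (y - x0)) / ((ee y - ee x0) / of_real (y - x0)) = q y"
        unfolding eventually_at_filter by (intro always_eventually) (auto simp: q_def)
      ultimately show ?thesis unfolding True by (simp add: q_def[of x0] Lim_transform_eventually)
    next
      case False
      have "((\<lambda>y. (H y - H x0) / (ee y - ee x0)) \<longlongrightarrow> (H x - H x0) / (ee x - ee x0)) (at x within ?I)"
        using nz[OF x False] derivs_continuous[OF H, of ?I] derivs_continuous[OF dee, of ?I] x
        by (intro tendsto_intros) (auto simp: continuous_on_def)
      moreover have "\<forall>\<^sub>F y in at x within ?I. (H y - H x0) / (ee y - ee x0) = q y"
      proof -
        have "\<forall>\<^sub>F y in nhds x. y \<in> - {x0}" using False by (intro eventually_nhds_in_open) auto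
        then show ?thesis unfolding eventually_at_filter by eventually_elim (simp add: q_def)
      qed
      ultimately show ?thesis using False by (simp add: q_def[of x] Lim_transform_eventually)
    qed
  qed
  have cH: "continuous_on ?I H" by (rule derivs_continuous[OF H])
  have coef: "fcoef a H n = (if n = 0 then H x0 else 0) + (fcoef a q (n - 1) - ee x0 * fcoef a q n)" for n
  proof -
    have "integral ?I (\<lambda>x. H x * ee (- of_int n * x)) =
       integral ?I (\<lambda>x. H x0 * ee (of_int (- n) * x) + (q x * ee (- of_int (n - 1) * x) - ee x0 * (q x * ee (- of_int n * x))))"
    proof (rule Henstock_Kurzweil_Integration.integral_cong)
      fix x assume x: "x \<in> ?I"
      have e1: "ee (- of_int (n - 1) * x) = ee x * ee (- of_int n * x)"
        by (simp add: algebra_simps flip: ee_add)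
      have e2: "ee (of_int (- n) * x) = ee (- of_int n * x)" by simp
      have h: "H x = H x0 + (ee x - ee x0) * q x" using qH[OF x] by simp
      show "H x * ee (- of_int n * x) =
         H x0 * ee (of_int (- n) * x) + (q x * ee (- of_int (n - 1) * x) - ee x0 * (q x * ee (- of_int n * x)))"
      proof -
        have "(a + (b - c) * d) * e = a * e + (d * (b * e) - c * (d * e))" for a b c d e :: complex
          by (simp add: algebra_simps)
        then show ?thesis unfolding e1 e2 h .
      qed
    qed
    also have "\<dots> = H x0 * integral ?I (\<lambda>x. ee (of_int (- n) * x)) + (fcoef a q (n - 1) - ee x0 * fcoef a q n)"
    proof -
      have i: "(\<lambda>x. H x0 * ee (of_int (- n) * x)) integrable_on ?I" "(\<lambda>x. q x * ee (- of_int m * x)) integrable_on ?I"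
        "(\<lambda>x. ee x0 * (q x * ee (- of_int m * x))) integrable_on ?I" for m
        by (intro integrable_continuous_real continuous_intros cq)+
      show ?thesis unfolding fcoef_def
        by (simp only: integral_add[OF i(1) integrable_diff[OF i(2) i(3)]] integral_diff[OF i(2) i(3)] integral_mult_right)
    qed
    finally show ?thesis unfolding integral_ee fcoef_def by simp
  qed
  \<comment> \<open>The n-th term is \<open>fcoef a q (n - 1) * ee (n * x0) - fcoef a q n * ee ((n +
    1) * x0)\<close>, with \<open>H x0\<close> added for \<open>n = 0\<close>; consecutive terms
    cancel and only the two ends survive.\<close>
  have tele: "(\<Sum>n\<in>{- int N..int N}. fcoef a H n * ee (of_int n * x0)) =
      H x0 + (fcoef a q (- int N - 1) * ee (- of_int (int N) * x0) - fcoef a q (int N) * ee (of_int (int N + 1) * x0))" for N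
  proof (induction N)
    case 0
    have "ee (of_int (int 0 + 1) * x0) = ee x0" by simp
    then show ?case by (simp add: coef algebra_simps)
  next
    case (Suc N)
    have set: "{- int (Suc N)..int (Suc N)} = insert (- int (Suc N)) (insert (int (Suc N)) {- int N..int N})" by auto
    have e1: "ee x0 * ee (of_int (int N + 1) * x0) = ee (of_int (int (Suc N) + 1) * x0)"
      by (simp add: algebra_simps flip: ee_add)
    have e2: "ee x0 * ee (- of_int (int (Suc N)) * x0) = ee (- of_int (int N) * x0)"
      by (simp add: algebra_simps flip: ee_add)
    have c1: "fcoef a H (int (Suc N)) * ee (of_int (int (Suc N)) * x0) =
        fcoef a q (int N) * ee (of_int (int N + 1) * x0) - fcoef a q (int (Suc N)) * ee (of_int (int (Suc N) + 1) * x0)"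
      unfolding coef e1[symmetric] by (simp add: algebra_simps)
    have c2: "fcoef a H (- int (Suc N)) * ee (of_int (- int (Suc N)) * x0) =
        fcoef a q (- int (Suc N) - 1) * ee (- of_int (int (Suc N)) * x0) - fcoef a q (- int N - 1) * ee (- of_int (int N) * x0)"
    proof -
      have ix: "- int (Suc N) = - int N - 1" by simp
      have c: "fcoef a H (- int (Suc N)) = fcoef a q (- int (Suc N) - 1) - ee x0 * fcoef a q (- int N - 1)"
        unfolding coef ix by simp
      have e3: "ee (of_int (- int (Suc N)) * x0) = ee (- of_int (int (Suc N)) * x0)" by simp
      have "(a - e * b) * x = a * x - b * (e * x)" for a b e x :: complex by (simp add: algebra_simps)
      then show ?thesis unfolding c e3 e2[symmetric] .
    qed
    have "(\<Sum>n\<in>{- int (Suc N)..int (Suc N)}. fcoef a H n * ee (of_int n * x0)) =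
       fcoef a H (- int (Suc N)) * ee (of_int (- int (Suc N)) * x0) + (fcoef a H (int (Suc N)) * ee (of_int (int (Suc N)) * x0) +
       (\<Sum>n\<in>{- int N..int N}. fcoef a H n * ee (of_int n * x0)))"
      unfolding set by (subst sum.insert, simp, simp, subst sum.insert) auto
    then show ?case unfolding c1 c2 Suc.IH by simp
  qed
  have z: "(\<lambda>N. c N * ee (g N)) \<longlonglongrightarrow> 0" if "c \<longlonglongrightarrow> 0" for c :: "nat \<Rightarrow> complex" and g
    by (rule Lim_null_comparison[OF _ tendsto_norm_zero[OF that]]) (simp add: norm_mult)
  have "(\<lambda>N. H x0 + (fcoef a q (- int N - 1) * ee (- of_int (int N) * x0) - fcoef a q (int N) * ee (of_int (int N + 1) * x0))) \<longlonglongrightarrow> H x0 + (0 - 0)"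
    by (intro tendsto_intros z fcoef_tendsto_0[OF cq]) (auto intro: injI)
  then show ?thesis unfolding tele by simp
qed

lemma has_sum_int_LIMSEQ:
  assumes "(f has_sum s) (UNIV :: int set)"
  shows "(\<lambda>N. \<Sum>n\<in>{- int N..int N}. f n) \<longlonglongrightarrow> s"
proof (rule filterlim_compose[OF assms[unfolded has_sum_def]])
  show "filterlim (\<lambda>N. {- int N..int N}) (finite_subsets_at_top UNIV) sequentially"
    unfolding filterlim_finite_subsets_at_top
  proof (intro allI impI)
    fix X :: "int set" assume X: "finite X \<and> X \<subseteq> UNIV"
    define B where "B = Max (insert 0 (abs ` X))"
    have B: "\<bar>x\<bar> \<le> B" if "x \<in> X" for x using X that by (auto simp: B_def)
    have "\<forall>\<^sub>F N in sequentially. nat B \<le> N" by (rule eventually_ge_at_top)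
    then show "\<forall>\<^sub>F N in sequentially. finite {- int N..int N} \<and> X \<subseteq> {- int N..int N} \<and> {- int N..int N} \<subseteq> UNIV"
    proof eventually_elim
      case (elim N)
      have "x \<in> {- int N..int N}" if "x \<in> X" for x using B[OF that] elim by auto
      then show ?case by auto
    qed
  qed
qed

section \<open>Windowed Fourier coefficients\<close>

text \<open>The radius 1/4 leaves half a period of slack: an interval of length 1 can cover the
  support around t and still have any given y with \<open>|y - t| \<le> 1/2\<close> in its
  interior.\<close>

definition csupp :: "(real \<Rightarrow> complex) \<Rightarrow> bool" where
  "csupp u \<longleftrightarrow> schwartz u \<and> (\<forall>x. \<bar>x\<bar> > 1/4 \<longrightarrow> u x = 0)"

lemma csupp_vd: "csupp u \<Longrightarrow> csupp (vd u)"
proof -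
  assume u: "csupp u"
  have "vd u x = 0" if x: "\<bar>x\<bar> > 1/4" for x
  proof -
    have "((\<lambda>_. 0) has_vector_derivative (0::complex)) (at x)" by simp
    moreover have "open {x::real. 1/4 < \<bar>x\<bar>}" by (intro open_Collect_less continuous_intros)
    ultimately have "(u has_vector_derivative 0) (at x)"
      by (rule has_vector_derivative_transform_within_open) (use u x in \<open>auto simp: csupp_def\<close>)
    then show ?thesis unfolding vd_def by (rule vector_derivative_at)
  qed
  then show ?thesis using u by (simp add: csupp_def schwartz_vd)
qed

lemma csupp_xmult: "csupp u \<Longrightarrow> csupp (\<lambda>x. of_real x * u x)"
  by (simp add: csupp_def schwartz_xmult)

text \<open>The Fourier coefficients of \<open>u (x - t) f x\<close>, supported in an interval of length at most \<open>1/2\<close> around \<open>t\<close>.\<close>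
definition wcoef :: "(real \<Rightarrow> complex) \<Rightarrow> (real \<Rightarrow> complex) \<Rightarrow> real \<Rightarrow> int \<Rightarrow> complex" where
  "wcoef u f t n = fcoef (t - 1/2) (\<lambda>x. u (x - t) * f x) n"

lemma wcoef_interval:
  assumes u: "csupp u" and a: "a \<le> t - 1/4" "t + 1/4 \<le> a + 1"
  shows "wcoef u f t n = fcoef a (\<lambda>x. u (x - t) * f x) n"
proof -
  let ?h = "\<lambda>x. u (x - t) * f x * ee (- of_int n * x)"
  have "integral {b..b + 1} ?h = integral UNIV ?h" if b: "b \<le> t - 1/4" "t + 1/4 \<le> b + 1" for b
  proof -
    have "(\<lambda>x. if x \<in> {b..b + 1} then ?h x else 0) = ?h"
    proof
      fix x
      have "u (x - t) = 0" if "x \<notin> {b..b + 1}"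
      proof -
        have "\<bar>x - t\<bar> > 1/4" using that b by auto
        then show ?thesis using u by (simp add: csupp_def)
      qed
      then show "(if x \<in> {b..b + 1} then ?h x else 0) = ?h x" by auto
    qed
    then show ?thesis using integral_restrict_UNIV[of "{b..b + 1}" ?h] by simp
  qed
  from this[of a] this[of "t - 1/2"] a show ?thesis by (simp add: wcoef_def fcoef_def)
qed

lemma continuous_wcoef:
  "csupp u \<Longrightarrow> schwartz f \<Longrightarrow> continuous_on A (\<lambda>x. u (x - t) * f x * ee (- of_int n * x))"
  unfolding csupp_def
  by (intro continuous_intros schwartz_continuous continuous_on_mult schwartz_shift) auto

lemma wcoef_bound:
  assumes "csupp u" "schwartz f" shows "cmod (wcoef u f t n) \<le> supn u * supn f"
proof -
  have "cmod (wcoef u f t n) \<le> supn u * supn f * (t - 1/2 + 1 - (t - 1/2))"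
    unfolding wcoef_def fcoef_def
  proof (rule integral_bound[OF _ continuous_wcoef[OF assms]])
    show "cmod (u (x - t) * f x * ee (- of_int n * x)) \<le> supn u * supn f" for x
      unfolding norm_mult norm_ee mult_1_right
      using assms le_supn[of u] le_supn[of f] sq_nonneg[of u 0] by (intro mult_mono) (auto simp: csupp_def)
  qed simp
  then show ?thesis by simp
qed

lemma wcoef_by_parts:
  assumes u: "csupp u" and f: "schwartz f"
  shows "2 * pi * \<i> * of_int n * wcoef u f t n = wcoef (vd u) f t n + wcoef u (vd f) t n"
proof -
  let ?I = "{t - 1/2..t - 1/2 + 1}" and ?e = "\<lambda>x. ee (- of_int n * x)"
  have su: "schwartz u" and z: "u (1/2) = 0" "u (- 1/2) = 0" using u by (auto simp: csupp_def)
  have d: "derivs (\<lambda>x. u (x - t) * f x * ?e x)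
     (\<lambda>x. ((vd u (x - t) * f x * ?e x) + u (x - t) * vd f x * ?e x) - 2 * pi * \<i> * of_int n * (u (x - t) * f x * ?e x))"
    by (rule derivs_cong[OF derivs_mult[OF derivs_mult[OF derivs_shift[OF schwartz_derivs[OF su]] schwartz_derivs[OF f]] derivs_ee]])
      (simp add: algebra_simps)
  have i: "(\<lambda>x. vd u (x - t) * f x * ?e x) integrable_on ?I" "(\<lambda>x. u (x - t) * vd f x * ?e x) integrable_on ?I"
     "(\<lambda>x. 2 * pi * \<i> * of_int n * (u (x - t) * f x * ?e x)) integrable_on ?I"
    by (intro integrable_continuous_real continuous_wcoef continuous_on_mult_left u csupp_vd schwartz_vd f)+
  have "integral ?I (\<lambda>x. ((vd u (x - t) * f x * ?e x) + u (x - t) * vd f x * ?e x) - 2 * pi * \<i> * of_int n * (u (x - t) * f x * ?e x)) = 0"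
    using integral_unique[OF integral_derivs[OF d, of "t - 1/2" "t - 1/2 + 1"]] z by simp
  then show ?thesis
    unfolding integral_diff[OF integrable_add[OF i(1,2)] i(3)] integral_add[OF i(1,2)] wcoef_def fcoef_def
      integral_mult_right right_minus_eq by (rule sym)
qed

text \<open>Writing t as \<open>x - (x - t)\<close> trades a factor t for a factor x on f or on the
  window. This yields decay in t, as integration by parts yields decay in n.\<close>

lemma wcoef_shift:
  assumes u: "csupp u" and f: "schwartz f"
  shows "of_real t * wcoef u f t n = wcoef u (\<lambda>x. of_real x * f x) t n - wcoef (\<lambda>x. of_real x * u x) f t n"
proof -
  let ?I = "{t - 1/2..t - 1/2 + 1}" and ?e = "\<lambda>x. ee (- of_int n * x)"
  have i: "(\<lambda>x. u (x - t) * (of_real x * f x) * ?e x) integrable_on ?I" "(\<lambda>x. (of_real (x - t) * u (x - t)) * f x * ?e x) integrable_on ?I"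
    using continuous_wcoef[OF u schwartz_xmult[OF f]] continuous_wcoef[OF csupp_xmult[OF u] f]
    by (auto intro!: integrable_continuous_real)
  have "of_real t * integral ?I (\<lambda>x. u (x - t) * f x * ?e x) = integral ?I (\<lambda>x. of_real t * (u (x - t) * f x * ?e x))"
    by (rule integral_mult_right[symmetric])
  also have "\<dots> = integral ?I (\<lambda>x. u (x - t) * (of_real x * f x) * ?e x - (of_real (x - t) * u (x - t)) * f x * ?e x)"
    by (simp add: algebra_simps)
  also have "\<dots> = integral ?I (\<lambda>x. u (x - t) * (of_real x * f x) * ?e x) - integral ?I (\<lambda>x. (of_real (x - t) * u (x - t)) * f x * ?e x)"
    by (rule integral_diff[OF i])
  finally show ?thesis by (simp add: wcoef_def fcoef_def)
qed

text \<open>Each factor n is traded for a derivative of the window or of f. The base case is a sup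
  bound, so the constants do not depend on t.\<close>

lemma wcoef_decay_freq:
  "csupp u \<Longrightarrow> schwartz f \<Longrightarrow> \<exists>C. \<forall>t n. \<bar>of_int n\<bar> ^ k * cmod (wcoef u f t n) \<le> C"
proof (induction k arbitrary: u f)
  case 0 then show ?case by (intro exI[of _ "supn u * supn f"]) (simp add: wcoef_bound)
next
  case (Suc k)
  obtain C1 where C1: "\<And>t n. \<bar>of_int n\<bar> ^ k * cmod (wcoef (vd u) f t n) \<le> C1" using Suc csupp_vd by blast
  obtain C2 where C2: "\<And>t n. \<bar>of_int n\<bar> ^ k * cmod (wcoef u (vd f) t n) \<le> C2" using Suc schwartz_vd by blast
  have "\<bar>of_int n\<bar> ^ Suc k * cmod (wcoef u f t n) \<le> C1 + C2" for t n
  proof -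
    have "\<bar>of_int n\<bar> * cmod (wcoef u f t n) \<le> 2 * pi * (\<bar>of_int n\<bar> * cmod (wcoef u f t n))"
    proof -
      have "1 * (\<bar>of_int n\<bar> * cmod (wcoef u f t n)) \<le> 2 * pi * (\<bar>of_int n\<bar> * cmod (wcoef u f t n))"
        using pi_ge_two by (intro mult_right_mono) auto
      then show ?thesis by simp
    qed
    also have "\<dots> = cmod (wcoef (vd u) f t n + wcoef u (vd f) t n)"
      unfolding wcoef_by_parts[OF Suc.prems, symmetric] by (simp add: norm_mult)
    also have "\<dots> \<le> cmod (wcoef (vd u) f t n) + cmod (wcoef u (vd f) t n)" by (rule norm_triangle_ineq)
    finally have "\<bar>of_int n\<bar> ^ k * (\<bar>of_int n\<bar> * cmod (wcoef u f t n)) \<le>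
        \<bar>of_int n\<bar> ^ k * (cmod (wcoef (vd u) f t n) + cmod (wcoef u (vd f) t n))" by (intro mult_left_mono) auto
    also have "\<dots> \<le> C1 + C2" using add_mono[OF C1[where t = t and n = n] C2[where t = t and n = n]] by (simp add: distrib_left)
    finally show ?thesis by (simp add: mult_ac)
  qed
  then show ?case by blast
qed

lemma wcoef_decay_shift:
  "csupp u \<Longrightarrow> schwartz f \<Longrightarrow> \<exists>C. \<forall>t n. \<bar>t\<bar> ^ k * cmod (wcoef u f t n) \<le> C"
proof (induction k arbitrary: u f)
  case 0 then show ?case by (intro exI[of _ "supn u * supn f"]) (simp add: wcoef_bound)
next
  case (Suc k)
  obtain C1 where C1: "\<And>t n. \<bar>t\<bar> ^ k * cmod (wcoef u (\<lambda>x. of_real x * f x) t n) \<le> C1"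
    using Suc.IH[OF Suc.prems(1) schwartz_xmult[OF Suc.prems(2)]] by blast
  obtain C2 where C2: "\<And>t n. \<bar>t\<bar> ^ k * cmod (wcoef (\<lambda>x. of_real x * u x) f t n) \<le> C2"
    using Suc.IH[OF csupp_xmult[OF Suc.prems(1)] Suc.prems(2)] by blast
  have "\<bar>t\<bar> ^ Suc k * cmod (wcoef u f t n) \<le> C1 + C2" for t n
  proof -
    have "\<bar>t\<bar> * cmod (wcoef u f t n) = cmod (of_real t * wcoef u f t n)" by (simp add: norm_mult)
    also have "\<dots> \<le> cmod (wcoef u (\<lambda>x. of_real x * f x) t n) + cmod (wcoef (\<lambda>x. of_real x * u x) f t n)"
      unfolding wcoef_shift[OF Suc.prems] by (rule norm_triangle_ineq4)
    finally have "\<bar>t\<bar> ^ k * (\<bar>t\<bar> * cmod (wcoef u f t n)) \<le>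
        \<bar>t\<bar> ^ k * (cmod (wcoef u (\<lambda>x. of_real x * f x) t n) + cmod (wcoef (\<lambda>x. of_real x * u x) f t n))"
      by (intro mult_left_mono) auto
    also have "\<dots> \<le> C1 + C2" using add_mono[OF C1[where t = t and n = n] C2[where t = t and n = n]] by (simp add: distrib_left)
    finally show ?thesis by (simp add: mult_ac)
  qed
  then show ?case by blast
qed

lemma wcoef_summable:
  assumes u: "csupp u" and f: "schwartz f"
  shows "(\<lambda>n. cmod (wcoef u f t n * ee (of_int n * y))) summable_on UNIV"
proof -
  obtain C0 where C0: "\<And>t n. \<bar>of_int n\<bar> ^ 0 * cmod (wcoef u f t n) \<le> C0" using wcoef_decay_freq[OF u f] by blast
  obtain C2 where C2: "\<And>t n. \<bar>of_int n\<bar> ^ 2 * cmod (wcoef u f t n) \<le> C2" using wcoef_decay_freq[OF u f] by blast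
  have "norm (wcoef u f t n * ee (of_int n * y)) \<le> (2 * C0 + 2 * C2) * (1 / (1 + \<bar>real_of_int n\<bar>)\<^sup>2)" for n
  proof -
    have "(1 + \<bar>real_of_int n\<bar>)\<^sup>2 \<le> 2 * 1 + 2 * \<bar>of_int n\<bar> ^ 2"
      using sum_squares_ge_zero[of "1 - \<bar>real_of_int n\<bar>" 0] by (simp add: power2_eq_square algebra_simps)
    then have "(1 + \<bar>real_of_int n\<bar>)\<^sup>2 * cmod (wcoef u f t n) \<le> (2 * 1 + 2 * \<bar>of_int n\<bar> ^ 2) * cmod (wcoef u f t n)"
      by (intro mult_right_mono) auto
    also have "\<dots> \<le> 2 * C0 + 2 * C2" using C0[of n t] C2[of n t] by (simp add: distrib_right)
    finally have "cmod (wcoef u f t n) * (1 + \<bar>real_of_int n\<bar>)\<^sup>2 \<le> 2 * C0 + 2 * C2" by (simp add: mult.commute)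
    moreover have "(1 + \<bar>real_of_int n\<bar>)\<^sup>2 > 0" by (intro zero_less_power) linarith
    ultimately show ?thesis by (simp add: norm_mult pos_le_divide_eq)
  qed
  then show ?thesis
    by (intro summable_on_comparison_test[OF summable_on_cmult_right[OF summable_on_int_inverse_square, of "2 * C0 + 2 * C2"]]) auto
qed

lemma wcoef_inversion_near:
  assumes u: "csupp u" and f: "schwartz f" and y: "\<bar>y - t\<bar> \<le> 1/2"
  shows "infsum (\<lambda>n. wcoef u f t n * ee (of_int n * y)) UNIV = u (y - t) * f y"
proof -
  \<comment> \<open>The left end is placed so that y is interior to \<open>{a..a + 1}\<close>, as
    \<open>fourier_pointwise\<close> requires, while the support around t remains covered.\<close>
  define a where "a = (if y < t then t - 3/4 else t - 1/4)"
  have a: "a \<le> t - 1/4" "t + 1/4 \<le> a + 1" "a < y" "y < a + 1" using y by (auto simp: a_def)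
  have d: "derivs (\<lambda>x. u (x - t) * f x) (\<lambda>x. u (x - t) * vd f x + vd u (x - t) * f x)"
    using u f by (intro derivs_mult derivs_shift schwartz_derivs) (auto simp: csupp_def)
  have "(\<lambda>N. \<Sum>n\<in>{- int N..int N}. wcoef u f t n * ee (of_int n * y)) \<longlonglongrightarrow> u (y - t) * f y"
    unfolding wcoef_interval[OF u a(1,2)] by (rule fourier_pointwise[OF d a(3,4)])
  moreover have "((\<lambda>n. wcoef u f t n * ee (of_int n * y)) has_sum infsum (\<lambda>n. wcoef u f t n * ee (of_int n * y)) UNIV) UNIV"
    by (rule has_sum_infsum[OF abs_summable_summable[OF wcoef_summable[OF u f]]])
  from has_sum_int_LIMSEQ[OF this]
  have "(\<lambda>N. \<Sum>n\<in>{- int N..int N}. wcoef u f t n * ee (of_int n * y)) \<longlonglongrightarrow> infsum (\<lambda>n. wcoef u f t n * ee (of_int n * y)) UNIV" .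
  ultimately show ?thesis using LIMSEQ_unique by blast
qed

text \<open>The series has period 1 in y, so y can be moved within distance 1/2 of t, where the sum
  is \<open>u * f\<close>. This bounds it by sup norms alone, which summing the moduli of the
  coefficients would not do.\<close>

lemma wcoef_series_bound:
  assumes u: "csupp u" and f: "schwartz f"
  shows "cmod (infsum (\<lambda>n. wcoef u f t n * ee (of_int n * y)) UNIV) \<le> supn u * supn f"
proof -
  define k where "k = round (y - t)"
  have near: "\<bar>(y - of_int k) - t\<bar> \<le> 1/2"
    using of_int_round_abs_le[of "y - t"] by (simp add: k_def abs_minus_commute algebra_simps)
  have "ee (of_int n * y) = ee (of_int n * (y - of_int k))" for n
    using ee_power_int[of n "y - of_int k" k] by simp
  then have "infsum (\<lambda>n. wcoef u f t n * ee (of_int n * y)) UNIV = u (y - of_int k - t) * f (y - of_int k)"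
    using wcoef_inversion_near[OF u f near] by simp
  also have "cmod \<dots> \<le> supn u * supn f"
    unfolding norm_mult using u f le_supn[of u] le_supn[of f] sq_nonneg[of u 0]
    by (intro mult_mono) (auto simp: csupp_def)
  finally show ?thesis .
qed

section \<open>Schwartz functions as modules over the algebra\<close>

definition wt :: "int \<times> int \<Rightarrow> real" where
  "wt p = 1 + \<bar>real_of_int (fst p)\<bar> + \<bar>real_of_int (snd p)\<bar>"

lemma wt_ge_1: "1 \<le> wt p" and wt_nonneg [simp]: "0 \<le> wt p" and wt_pos [simp]: "0 < wt p"
  by (auto simp: wt_def)

lemma rapid_wt: "rapid a \<longleftrightarrow> (\<forall>k. \<exists>C. \<forall>p. wt p ^ k * cmod (a p) \<le> C)"
  unfolding rapid_def wt_def by (simp add: split_paired_All)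

lemma rapidD: "rapid a \<Longrightarrow> \<exists>C\<ge>0. \<forall>p. wt p ^ k * cmod (a p) \<le> C"
proof -
  assume "rapid a"
  then obtain C where C: "\<And>p. wt p ^ k * cmod (a p) \<le> C" unfolding rapid_wt by blast
  have "0 \<le> wt (0,0) ^ k * cmod (a (0,0))" by simp
  then have "C \<ge> 0" using C[of "(0,0)"] by linarith
  then show ?thesis using C by blast
qed

lemma rapid_dominated:
  assumes a: "rapid a" and b: "\<And>p. cmod (b p) \<le> C * wt p ^ j * cmod (a p)" shows "rapid b"
  unfolding rapid_wt
proof
  fix k
  obtain B where B: "\<And>p. wt p ^ (k + j) * cmod (a p) \<le> B" using rapidD[OF a] by blast
  have "wt p ^ k * cmod (b p) \<le> \<bar>C\<bar> * B" for p
  proof -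
    have "wt p ^ k * cmod (b p) \<le> wt p ^ k * (C * wt p ^ j * cmod (a p))" by (intro mult_left_mono b) simp
    also have "\<dots> = C * (wt p ^ (k + j) * cmod (a p))" by (simp add: power_add mult_ac)
    also have "\<dots> \<le> \<bar>C\<bar> * (wt p ^ (k + j) * cmod (a p))" by (intro mult_right_mono) auto
    also have "\<dots> \<le> \<bar>C\<bar> * B" by (intro mult_left_mono B) auto
    finally show ?thesis .
  qed
  then show "\<exists>C. \<forall>p. wt p ^ k * cmod (b p) \<le> C" by blast
qed

lemma wt_fst_le: "\<bar>real_of_int (fst p)\<bar> \<le> wt p" and wt_snd_le: "\<bar>real_of_int (snd p)\<bar> \<le> wt p"
  by (auto simp: wt_def)

lemma rapid_fst: "rapid a \<Longrightarrow> rapid (\<lambda>p. of_int (fst p) * a p)"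
  by (rule rapid_dominated[where C = 1 and j = 1], assumption) (simp add: norm_mult mult_right_mono wt_fst_le)

lemma rapid_snd: "rapid a \<Longrightarrow> rapid (\<lambda>p. of_int (snd p) * a p)"
  by (rule rapid_dominated[where C = 1 and j = 1], assumption) (simp add: norm_mult mult_right_mono wt_snd_le)

lemma rapid_cmult: "rapid a \<Longrightarrow> rapid (\<lambda>p. z * a p)"
  by (rule rapid_dominated[where C = "cmod z" and j = 0], assumption) (simp add: norm_mult)

lemma rapid_add:
  assumes "rapid a" "rapid b" shows "rapid (\<lambda>p. a p + b p)"
  unfolding rapid_wt
proof
  fix k
  obtain C C' where C: "\<And>p. wt p ^ k * cmod (a p) \<le> C" "\<And>p. wt p ^ k * cmod (b p) \<le> C'"
    using rapidD[OF assms(1)] rapidD[OF assms(2)] by blast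
  have "wt p ^ k * cmod (a p + b p) \<le> C + C'" for p
  proof -
    have "wt p ^ k * cmod (a p + b p) \<le> wt p ^ k * (cmod (a p) + cmod (b p))"
      by (intro mult_left_mono norm_triangle_ineq) simp
    then show ?thesis using C[of p] by (simp add: distrib_left)
  qed
  then show "\<exists>C. \<forall>p. wt p ^ k * cmod (a p + b p) \<le> C" by blast
qed

lemma rapid_aconst: "rapid (aconst z)"
  unfolding rapid_wt
proof
  fix k
  have "wt p ^ k * cmod (aconst z p) \<le> cmod z" for p
    by (cases "p = (0, 0)") (auto simp: aconst_def wt_def)
  then show "\<exists>C. \<forall>p. wt p ^ k * cmod (aconst z p) \<le> C" by blast
qed

lemma adelta_eq: "adelta \<tau> a = (\<lambda>p. 2 * pi * \<i> * (of_int (fst p) * \<tau> + of_int (snd p)) * a p)"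
  by (auto simp: adelta_def)

lemma rapid_adelta: "rapid a \<Longrightarrow> rapid (adelta \<tau> a)"
proof -
  assume a: "rapid a"
  have "rapid (\<lambda>p. (2 * pi * \<i> * \<tau>) * (of_int (fst p) * a p) + (2 * pi * \<i>) * (of_int (snd p) * a p))"
    by (intro rapid_add rapid_cmult rapid_fst rapid_snd a)
  then show ?thesis by (simp add: adelta_eq algebra_simps)
qed

lemma rapid_astar:
  assumes a: "rapid a" shows "rapid (astar \<theta> a)"
  unfolding rapid_wt
proof
  fix k
  obtain C where C: "\<And>p. wt p ^ k * cmod (a p) \<le> C" using rapidD[OF a] by blast
  have "wt p ^ k * cmod (astar \<theta> a p) \<le> C" for p
  proof -
    have "cmod (exp (- 2 * pi * \<i> * complex_of_real \<theta> * of_int (fst p) * of_int (snd p))) = 1"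
      by (simp add: norm_exp_eq_Re)
    then have "cmod (astar \<theta> a p) = cmod (a (- fst p, - snd p))" by (simp add: astar_def case_prod_beta norm_mult)
    moreover have "wt (- fst p, - snd p) = wt p" by (simp add: wt_def)
    ultimately show ?thesis using C[of "(- fst p, - snd p)"] by simp
  qed
  then show "\<exists>C. \<forall>p. wt p ^ k * cmod (astar \<theta> a p) \<le> C" by blast
qed

lemma summable_on_wt: "(\<lambda>p. 1 / wt p ^ 4) summable_on UNIV"
proof -
  let ?g = "\<lambda>n::int. 1 / (1 + \<bar>real_of_int n\<bar>)\<^sup>2"
  have "(\<lambda>p. ?g (fst p) * ?g (snd p)) summable_on (UNIV \<times> UNIV)"
  proof (rule summable_on_SigmaI)
    show "((\<lambda>y. ?g (fst (x, y)) * ?g (snd (x, y))) has_sum ?g x * infsum ?g UNIV) UNIV" for x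
      using has_sum_cmult_right[OF has_sum_infsum[OF summable_on_int_inverse_square], of "?g x"] by simp
    show "(\<lambda>x. ?g x * infsum ?g UNIV) summable_on UNIV"
      by (rule summable_on_cmult_left[OF summable_on_int_inverse_square])
  qed simp
  then have "(\<lambda>p. ?g (fst p) * ?g (snd p)) summable_on UNIV" by simp
  moreover have "1 / wt p ^ 4 \<le> ?g (fst p) * ?g (snd p)" for p
  proof -
    have "(1 + \<bar>real_of_int (fst p)\<bar>)\<^sup>2 * (1 + \<bar>real_of_int (snd p)\<bar>)\<^sup>2 \<le> wt p ^ 2 * wt p ^ 2"
      by (intro mult_mono power_mono) (auto simp: wt_def)
    also have "\<dots> = wt p ^ 4" by (simp flip: power_add)
    finally have le: "(1 + \<bar>real_of_int (fst p)\<bar>)\<^sup>2 * (1 + \<bar>real_of_int (snd p)\<bar>)\<^sup>2 \<le> wt p ^ 4" .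
    have "(1 + \<bar>real_of_int (fst p)\<bar>)\<^sup>2 * (1 + \<bar>real_of_int (snd p)\<bar>)\<^sup>2 > 0"
      by (intro mult_pos_pos zero_less_power) linarith+
    from frac_le[OF _ _ this le, of 1 1] show ?thesis by simp
  qed
  ultimately show ?thesis by (rule summable_on_comparison_test) simp
qed

lemma rapid_summable: "rapid a \<Longrightarrow> (\<lambda>p. wt p ^ k * cmod (a p)) summable_on UNIV"
proof -
  assume "rapid a"
  then obtain C where C: "\<And>p. wt p ^ (k + 4) * cmod (a p) \<le> C" using rapidD by blast
  have "wt p ^ k * cmod (a p) \<le> C * (1 / wt p ^ 4)" for p
  proof -
    have "(wt p ^ k * cmod (a p)) * wt p ^ 4 \<le> C" using C[of p] by (simp add: power_add mult_ac)
    then have "wt p ^ k * cmod (a p) \<le> C / wt p ^ 4" by (simp only: pos_le_divide_eq[OF zero_less_power[OF wt_pos]])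
    then show ?thesis by simp
  qed
  then show ?thesis
    by (intro summable_on_comparison_test[OF summable_on_cmult_right[OF summable_on_wt, of C]]) auto
qed

lemma rapid_abs_summable: "rapid a \<Longrightarrow> (\<lambda>p. cmod (a p)) summable_on UNIV"
  using rapid_summable[of a 0] by simp

text \<open>Along an enumeration of the lattice an absolutely convergent sum becomes an ordinary
  series, so that the theorems on termwise differentiation and integration apply.\<close>

lemma infsum_as_suminf:
  fixes F :: "int \<times> int \<Rightarrow> 'a :: banach"
  assumes "(\<lambda>p. norm (F p)) summable_on UNIV"
  defines "b \<equiv> from_nat_into (UNIV :: (int \<times> int) set)"
  shows "infsum F UNIV = (\<Sum>n. F (b n))" "summable (\<lambda>n. norm (F (b n)))"
proof -
  have bij: "bij_betw b UNIV UNIV" unfolding b_def by (rule bij_betw_from_nat_into) (auto simp: finite_prod)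
  have s: "(\<lambda>n. norm (F (b n))) summable_on UNIV"
    using assms(1) summable_on_reindex_bij_betw[OF bij, of "\<lambda>p. norm (F p)"] by simp
  then show "summable (\<lambda>n. norm (F (b n)))" by (rule summable_on_imp_summable)
  have "((\<lambda>n. F (b n)) has_sum infsum (\<lambda>n. F (b n)) UNIV) UNIV"
    by (rule has_sum_infsum[OF abs_summable_summable[OF s]])
  from has_sum_imp_sums[OF this] show "infsum F UNIV = (\<Sum>n. F (b n))"
    unfolding infsum_reindex_bij_betw[OF bij] by (simp add: sums_iff)
qed

lemma derivs_infsum:
  fixes g g' :: "int \<times> int \<Rightarrow> real \<Rightarrow> complex"
  assumes d: "\<And>p. derivs (g p) (g' p)" and b: "\<And>p x. cmod (g p x) \<le> M p" "\<And>p x. cmod (g' p x) \<le> M' p"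
    and s: "M summable_on UNIV" "M' summable_on UNIV"
  shows "derivs (\<lambda>x. infsum (\<lambda>p. g p x) UNIV) (\<lambda>x. infsum (\<lambda>p. g' p x) UNIV)"
proof -
  have M: "M p \<ge> 0" "M' p \<ge> 0" for p using b[of p 0] norm_ge_zero order_trans by blast+
  have s1: "(\<lambda>p. norm (g p x)) summable_on UNIV" for x by (rule summable_on_comparison_test[OF s(1)]) (auto simp: b)
  have s2: "(\<lambda>p. norm (g' p x)) summable_on UNIV" for x by (rule summable_on_comparison_test[OF s(2)]) (auto simp: b)
  have sM: "summable (\<lambda>n. M (from_nat_into UNIV n))" "summable (\<lambda>n. M' (from_nat_into UNIV n))"
    using infsum_as_suminf(2)[of M] infsum_as_suminf(2)[of M'] M s by simp_all
  show ?thesis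
    unfolding infsum_as_suminf(1)[OF s1] infsum_as_suminf(1)[OF s2]
    by (rule derivs_suminf[OF d b sM])
qed

section \<open>Integrals of Schwartz functions\<close>

lemma integrable_inverse_square: "integrable lborel (\<lambda>x::real. 1 / (1 + x\<^sup>2))"
proof -
  let ?f = "\<lambda>x::real. 1 / (1 + x\<^sup>2)"
  have nz: "1 + x\<^sup>2 > 0" for x :: real by (simp add: add_pos_nonneg)
  have "(\<integral>\<^sup>+x. ennreal (?f x) * indicator {0 ..} x \<partial>lborel) = ennreal (pi / 2 - arctan 0)"
  proof (rule nn_integral_FTC_atLeast)
    show "(arctan has_real_derivative ?f x) (at x)" for x
      using DERIV_arctan[of x] by (simp add: inverse_eq_divide)
    show "(arctan \<longlongrightarrow> pi / 2) at_top" by (rule tendsto_arctan_at_top)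
  qed (auto simp: nz less_imp_le)
  moreover have "ennreal (norm (indicator {0 ..} x * ?f x)) = ennreal (?f x) * indicator {0 ..} x" for x
    using nz[of x] by (cases "x \<ge> 0") (auto simp: indicator_def less_imp_le abs_of_pos)
  ultimately have "(\<integral>\<^sup>+x. ennreal (norm (indicator {0 ..} x * ?f x)) \<partial>lborel) < \<infinity>"
    by (simp only:) simp
  then have 1: "integrable lborel (\<lambda>x. indicator {0 ..} x * ?f x)" by (intro integrableI_bounded) auto
  have 2: "integrable lborel (\<lambda>x. indicator {0 ..} (- x) * ?f (- x))"
    using lborel_integrable_real_affine[OF 1, of "-1" 0] by simp
  show ?thesis
  proof (rule Bochner_Integration.integrable_bound[OF Bochner_Integration.integrable_add[OF 1 2]])
    show "AE x in lborel. norm (?f x) \<le> norm (indicator {0 ..} x * ?f x + indicator {0 ..} (- x) * ?f (- x))"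
      using nz by (intro AE_I2) (auto simp: indicator_def less_imp_le abs_of_pos)
  qed auto
qed

lemma borel_schwartz: "schwartz f \<Longrightarrow> f \<in> borel_measurable borel"
  using schwartz_continuous[of f UNIV] by (rule borel_measurable_continuous_onI)

lemma schwartz_le_inverse_square:
  assumes "schwartz f" shows "\<exists>C\<ge>0. \<forall>x. cmod (f x) \<le> C * (1 / (1 + x\<^sup>2))"
proof -
  obtain C0 C2 where C: "C0 \<ge> 0" "\<And>x. \<bar>x\<bar> ^ 0 * cmod (f x) \<le> C0" "C2 \<ge> 0" "\<And>x. \<bar>x\<bar> ^ 2 * cmod (f x) \<le> C2"
    using rapid_decayD[OF schwartz_rapid[OF assms]] by metis
  have "cmod (f x) \<le> (C0 + C2) * (1 / (1 + x\<^sup>2))" for x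
  proof -
    have "cmod (f x) * (1 + x\<^sup>2) \<le> C0 + C2" using C(2,4)[of x] by (simp add: algebra_simps)
    moreover have "1 + x\<^sup>2 > 0" by (simp add: add_pos_nonneg)
    ultimately show ?thesis by (simp add: pos_le_divide_eq)
  qed
  then show ?thesis using C by (intro exI[of _ "C0 + C2"]) auto
qed

lemma integrable_schwartz:
  assumes "schwartz f" shows "integrable lborel f"
proof -
  obtain C where C: "\<And>x. cmod (f x) \<le> C * (1 / (1 + x\<^sup>2))" using schwartz_le_inverse_square[OF assms] by blast
  show ?thesis
    by (rule Bochner_Integration.integrable_bound[OF integrable_mult_right[OF integrable_inverse_square, of C]])
      (use C borel_schwartz[OF assms] order_trans[OF C abs_ge_self] in auto)
qed

lemma LINT_infsum:
  fixes F :: "int \<times> int \<Rightarrow> real \<Rightarrow> complex"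
  assumes m: "\<And>p. F p \<in> borel_measurable borel" and b: "\<And>p x. cmod (F p x) \<le> M p * w x"
    and w: "integrable lborel w" and s: "M summable_on UNIV" and nn: "\<And>p. M p \<ge> 0" "\<And>x. w x \<ge> 0"
  shows "(LINT x|lborel. infsum (\<lambda>p. F p x) UNIV) = infsum (\<lambda>p. LINT x|lborel. F p x) UNIV"
    "(\<lambda>p. cmod (LINT x|lborel. F p x)) summable_on UNIV"
proof -
  define b where "b = from_nat_into (UNIV :: (int \<times> int) set)"
  have i: "integrable lborel (F p)" for p
    by (rule Bochner_Integration.integrable_bound[OF integrable_mult_right[OF w, of "M p"]])
      (use m b nn in \<open>auto simp: abs_mult\<close>)
  have ib: "(LINT x|lborel. cmod (F p x)) \<le> M p * (LINT x|lborel. w x)" for p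
    unfolding Bochner_Integration.integral_mult_right_zero[symmetric]
    by (rule integral_mono[OF integrable_norm[OF i] integrable_mult_right[OF w] b])
  have s1: "(\<lambda>p. norm (F p x)) summable_on UNIV" for x
    by (rule summable_on_comparison_test[OF summable_on_cmult_left[OF s, of "w x"]]) (auto simp: b)
  have s2: "(\<lambda>p. norm (LINT x|lborel. cmod (F p x))) summable_on UNIV"
    by (rule summable_on_comparison_test[OF summable_on_cmult_left[OF s, of "LINT x|lborel. w x"]])
      (use ib in \<open>auto simp: abs_of_nonneg\<close>)
  show s3: "(\<lambda>p. cmod (LINT x|lborel. F p x)) summable_on UNIV"
    by (rule summable_on_comparison_test[OF s2]) (use integral_norm_bound in \<open>auto simp: abs_of_nonneg\<close>)
  have "(LINT x|lborel. infsum (\<lambda>p. F p x) UNIV) = (LINT x|lborel. (\<Sum>n. F (b n) x))"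
    unfolding infsum_as_suminf(1)[OF s1] b_def ..
  also have "\<dots> = (\<Sum>n. LINT x|lborel. F (b n) x)"
  proof (rule integral_suminf)
    show "AE x in lborel. summable (\<lambda>n. norm (F (b n) x))"
      using infsum_as_suminf(2)[OF s1] unfolding b_def by simp
    show "summable (\<lambda>n. LINT x|lborel. norm (F (b n) x))"
      using infsum_as_suminf(2)[OF s2] unfolding b_def by (simp add: abs_of_nonneg)
  qed (rule i)
  also have "\<dots> = infsum (\<lambda>p. LINT x|lborel. F p x) UNIV"
    unfolding infsum_as_suminf(1)[OF s3] b_def ..
  finally show "(LINT x|lborel. infsum (\<lambda>p. F p x) UNIV) = infsum (\<lambda>p. LINT x|lborel. F p x) UNIV" .
qed

text \<open>The squared modulus vanishes almost everywhere; continuity turns this into vanishing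
  everywhere, by way of its integral over a unit interval.\<close>

lemma schwartz_LINT_eq_0:
  assumes f: "schwartz f" and 0: "(LINT x|lborel. f x * cnj (f x)) = 0"
  shows "f = (\<lambda>_. 0)"
proof
  fix x0
  let ?g = "\<lambda>x. (cmod (f x))\<^sup>2"
  have i: "integrable lborel ?g"
  proof -
    have "integrable lborel (\<lambda>x. f x * cnj (f x))" by (intro integrable_schwartz schwartz_mult schwartz_cnj f)
    then have "integrable lborel (\<lambda>x. Re (f x * cnj (f x)))" by (rule integrable_Re)
    then show ?thesis by (simp only: complex_norm_square[symmetric] Re_complex_of_real)
  qed
  have "(LINT x|lborel. complex_of_real (?g x)) = 0" using 0 by (simp only: complex_norm_square)
  then have "(LINT x|lborel. ?g x) = 0" unfolding integral_complex_of_real by simp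
  then have ae: "AE x in lborel. ?g x = 0" by (subst (asm) integral_nonneg_eq_0_iff_AE[OF i]) auto
  have "integral {x0..x0 + 1} ?g = 0"
  proof -
    have "AE x in lborel. indicator {x0..x0 + 1} x *\<^sub>R ?g x = 0" using ae by eventually_elim simp
    then have "(LINT x:{x0..x0 + 1}|lborel. ?g x) = 0"
      unfolding set_lebesgue_integral_def by (rule integral_eq_zero_AE)
    moreover have "set_integrable lborel {x0..x0 + 1} ?g"
      unfolding set_integrable_def using i by (intro integrable_mult_indicator) auto
    ultimately show ?thesis using set_borel_integral_eq_integral(2) by metis
  qed
  moreover have "continuous_on {x0..x0 + 1} ?g" by (intro continuous_intros schwartz_continuous f)
  ultimately have "\<forall>x\<in>{x0..x0 + 1}. ?g x = 0" by (subst (asm) integral_eq_0_iff) auto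
  then show "f x0 = 0" by simp
qed

section \<open>The action and the Hermitian form on one standard module\<close>

lemma Edc_periodic:
  assumes f: "f \<in> Edc_carrier c" shows "f x (\<alpha> + c * k) = f x \<alpha>"
proof -
  have nat: "f x (\<alpha> + c * int n) = f x \<alpha>" for n \<alpha>
  proof (induction n)
    case (Suc n)
    have "f x (\<alpha> + c * int (Suc n)) = f x ((\<alpha> + c * int n) + c)" by (simp add: algebra_simps)
    also have "\<dots> = f x (\<alpha> + c * int n)" using f by (simp add: Edc_carrier_def)
    finally show ?case using Suc by simp
  qed simp
  show ?thesis
  proof (cases "k \<ge> 0")
    case True then show ?thesis using nat[of \<alpha> "nat k"] by simp
  next
    case False
    have "f x ((\<alpha> + c * k) + c * int (nat (- k))) = f x (\<alpha> + c * k)" by (rule nat)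
    then show ?thesis using False by simp
  qed
qed

lemma Edc_mod: "f \<in> Edc_carrier c \<Longrightarrow> f x (\<alpha> mod \<bar>c\<bar>) = f x \<alpha>"
proof -
  assume f: "f \<in> Edc_carrier c"
  have "\<alpha> = \<alpha> mod \<bar>c\<bar> + c * (sgn c * (\<alpha> div \<bar>c\<bar>))"
    using mod_mult_div_eq[of \<alpha> "\<bar>c\<bar>"] by (metis abs_sgn mult.assoc)
  then show ?thesis using Edc_periodic[OF f, of x "\<alpha> mod \<bar>c\<bar>"] by metis
qed

lemma Edc_schwartz: "f \<in> Edc_carrier c \<Longrightarrow> schwartz (\<lambda>x. f x \<alpha>)"
  by (simp add: Edc_carrier_def)

text \<open>There are only \<open>|c|\<close> residue classes, so the sum of their constants works
  for all \<open>\<alpha>\<close>. Q and w are left abstract because the estimate is used for decay,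
  for boundedness and for Fourier coefficients.\<close>

lemma Edc_uniform:
  assumes f: "f \<in> Edc_carrier c" and c: "c \<noteq> 0" and P: "\<And>h. schwartz h \<Longrightarrow> \<exists>C\<ge>0. \<forall>x. Q h x \<le> (C :: real) * w x"
    and w: "\<And>x. w x \<ge> 0"
  shows "\<exists>C\<ge>0. \<forall>\<alpha> x. Q (\<lambda>x. f x \<alpha>) x \<le> C * w x"
proof -
  have "\<forall>\<alpha>. \<exists>C\<ge>0. \<forall>x. Q (\<lambda>x. f x \<alpha>) x \<le> C * w x" using P Edc_schwartz[OF f] by blast
  then obtain C where C: "\<And>\<alpha>. C \<alpha> \<ge> 0" "\<And>\<alpha> x. Q (\<lambda>x. f x \<alpha>) x \<le> C \<alpha> * w x" by metis
  define B where "B = (\<Sum>\<alpha>\<in>{0..<\<bar>c\<bar>}. C \<alpha>)"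
  have "Q (\<lambda>x. f x \<alpha>) x \<le> B * w x" for \<alpha> x
  proof -
    have m: "\<alpha> mod \<bar>c\<bar> \<in> {0..<\<bar>c\<bar>}" using c by simp
    have "Q (\<lambda>x. f x \<alpha>) x = Q (\<lambda>x. f x (\<alpha> mod \<bar>c\<bar>)) x" by (simp add: Edc_mod[OF f])
    also have "\<dots> \<le> C (\<alpha> mod \<bar>c\<bar>) * w x" by (rule C)
    also have "\<dots> \<le> B * w x" unfolding B_def using m C(1) by (intro mult_right_mono member_le_sum w) auto
    finally show ?thesis .
  qed
  moreover have "B \<ge> 0" unfolding B_def by (intro sum_nonneg C)
  ultimately show ?thesis by blast
qed

lemma Edc_bounded: "f \<in> Edc_carrier c \<Longrightarrow> c \<noteq> 0 \<Longrightarrow> \<exists>B\<ge>0. \<forall>\<alpha> x. cmod (f x \<alpha>) \<le> B"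
  using Edc_uniform[of f c "\<lambda>h x. cmod (h x)" "\<lambda>_. 1"] rapid_decay_bounded[OF schwartz_rapid] by auto

definition tm :: "real \<Rightarrow> int \<Rightarrow> int \<Rightarrow> (real \<Rightarrow> int \<Rightarrow> complex) \<Rightarrow> aelt \<Rightarrow> real \<Rightarrow> int \<Rightarrow> int \<times> int \<Rightarrow> complex" where
  "tm \<theta> d c f a x \<alpha> p = a p * ee (of_int (snd p) * (x - of_int \<alpha> * of_int d / of_int c)) *
     f (x - of_int (fst p) / mu \<theta> d c) (\<alpha> - fst p)"

lemma Edc_act_tm: "Edc_act \<theta> d c f a x \<alpha> = infsum (tm \<theta> d c f a x \<alpha>) UNIV"
proof -
  have "exp (2 * pi * \<i> * of_int n * complex_of_real y) = ee (of_int n * y)" for n :: int and y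
    by (simp add: ee_def mult.assoc)
  then show ?thesis unfolding Edc_act_def tm_def case_prod_beta by (simp only: prod.collapse)
qed

lemma tm_bound: "(\<And>\<alpha> x. cmod (f x \<alpha>) \<le> B) \<Longrightarrow> cmod (tm \<theta> d c f a x \<alpha> p) \<le> B * cmod (a p)"
proof -
  assume B: "\<And>\<alpha> x. cmod (f x \<alpha>) \<le> B"
  show ?thesis
    using mult_left_mono[OF B[of "x - of_int (fst p) / mu \<theta> d c" "\<alpha> - fst p"] norm_ge_zero[of "a p"]]
    by (simp add: tm_def norm_mult mult.commute)
qed

lemma tm_summable:
  assumes "f \<in> Edc_carrier c" "c \<noteq> 0" "rapid a"
  shows "(\<lambda>p. cmod (tm \<theta> d c f a x \<alpha> p)) summable_on UNIV"
proof -
  obtain B where "\<And>\<alpha> x. cmod (f x \<alpha>) \<le> B" using Edc_bounded[OF assms(1,2)] by blast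
  note b = tm_bound[where f = f, OF this]
  show ?thesis
    by (rule summable_on_comparison_test[OF summable_on_cmult_right[OF rapid_abs_summable[OF assms(3)], of B]]) (auto intro: b)
qed

text \<open>In the m-th summand x splits as \<open>(x - m / \<mu>) + m / \<mu>\<close>. The second
  part is the action of a modified coefficient function, so multiplication by x obeys a Leibniz rule
  over the algebra.\<close>

lemma Edc_act_xmult:
  assumes f: "f \<in> Edc_carrier c" and c: "c \<noteq> 0" and a: "rapid a"
  shows "of_real x * Edc_act \<theta> d c f a x \<alpha> = Edc_act \<theta> d c (\<lambda>x \<alpha>. of_real x * f x \<alpha>) a x \<alpha> +
     Edc_act \<theta> d c f (\<lambda>p. of_real (1 / mu \<theta> d c) * (of_int (fst p) * a p)) x \<alpha>"
proof -
  have xf: "(\<lambda>x \<alpha>. of_real x * f x \<alpha>) \<in> Edc_carrier c"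
    using f by (auto simp: Edc_carrier_def schwartz_xmult)
  have ra: "rapid (\<lambda>p. of_real (1 / mu \<theta> d c) * (of_int (fst p) * a p))" by (intro rapid_cmult rapid_fst a)
  note s = abs_summable_summable[OF tm_summable[OF f c a, of \<theta> d x \<alpha>]] abs_summable_summable[OF tm_summable[OF xf c a, of \<theta> d x \<alpha>]]
    abs_summable_summable[OF tm_summable[OF f c ra, of \<theta> d x \<alpha>]]
  show ?thesis unfolding Edc_act_tm infsum_add[OF s(2,3), symmetric] infsum_cmult_right[OF s(1), symmetric]
    by (intro infsum_cong) (simp add: tm_def algebra_simps)
qed

lemma Edc_act_add:
  assumes f: "f \<in> Edc_carrier c" "g \<in> Edc_carrier c" and c: "c \<noteq> 0" and a: "rapid a"
  shows "Edc_act \<theta> d c (\<lambda>x \<alpha>. f x \<alpha> + g x \<alpha>) a x \<alpha> = Edc_act \<theta> d c f a x \<alpha> + Edc_act \<theta> d c g a x \<alpha>"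
proof -
  note s = abs_summable_summable[OF tm_summable[OF f(1) c a, of \<theta> d x \<alpha>]] abs_summable_summable[OF tm_summable[OF f(2) c a, of \<theta> d x \<alpha>]]
  show ?thesis unfolding Edc_act_tm infsum_add[OF s, symmetric]
    by (intro infsum_cong) (simp add: tm_def algebra_simps)
qed

lemma Edc_act_add_right:
  assumes f: "f \<in> Edc_carrier c" and c: "c \<noteq> 0" and a: "rapid a" "rapid b"
  shows "Edc_act \<theta> d c f (\<lambda>p. a p + b p) x \<alpha> = Edc_act \<theta> d c f a x \<alpha> + Edc_act \<theta> d c f b x \<alpha>"
proof -
  note s = abs_summable_summable[OF tm_summable[OF f c a(1), of \<theta> d x \<alpha>]] abs_summable_summable[OF tm_summable[OF f c a(2), of \<theta> d x \<alpha>]]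
  show ?thesis unfolding Edc_act_tm infsum_add[OF s, symmetric]
    by (intro infsum_cong) (simp add: tm_def algebra_simps)
qed

lemma Edc_act_cmult:
  assumes f: "f \<in> Edc_carrier c" and c: "c \<noteq> 0" and a: "rapid a"
  shows "Edc_act \<theta> d c (\<lambda>x \<alpha>. z * f x \<alpha>) a x \<alpha> = z * Edc_act \<theta> d c f a x \<alpha>"
    "Edc_act \<theta> d c f (\<lambda>p. z * a p) x \<alpha> = z * Edc_act \<theta> d c f a x \<alpha>"
proof -
  note s = abs_summable_summable[OF tm_summable[OF f(1) c a, of \<theta> d x \<alpha>]]
  show "Edc_act \<theta> d c (\<lambda>x \<alpha>. z * f x \<alpha>) a x \<alpha> = z * Edc_act \<theta> d c f a x \<alpha>"
    "Edc_act \<theta> d c f (\<lambda>p. z * a p) x \<alpha> = z * Edc_act \<theta> d c f a x \<alpha>"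
    unfolding Edc_act_tm infsum_cmult_right[OF s, symmetric]
    by (intro infsum_cong, simp add: tm_def algebra_simps)+
qed

lemma Edc_act_aconst: "Edc_act \<theta> d c f (aconst z) x \<alpha> = z * f x \<alpha>"
proof -
  have "infsum (tm \<theta> d c f (aconst z) x \<alpha>) UNIV = infsum (tm \<theta> d c f (aconst z) x \<alpha>) {(0, 0)}"
    by (rule infsum_cong_neutral) (auto simp: tm_def aconst_def)
  then show ?thesis by (simp add: Edc_act_tm tm_def aconst_def)
qed

text \<open>Differentiation obeys a Leibniz rule too, the factor n coming from the exponential.
  Together with the rule for x it accounts for every \<open>adelta\<close>.\<close>

lemma Edc_act_derivs:
  assumes f: "f \<in> Edc_carrier c" and c: "c \<noteq> 0" and a: "rapid a"
  shows "derivs (\<lambda>x. Edc_act \<theta> d c f a x \<alpha>) (\<lambda>x. Edc_act \<theta> d c (\<lambda>x \<alpha>. vd (\<lambda>x. f x \<alpha>) x) a x \<alpha> +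
     Edc_act \<theta> d c f (\<lambda>p. (2 * pi * \<i>) * (of_int (snd p) * a p)) x \<alpha>)"
proof -
  let ?f' = "\<lambda>x \<alpha>. vd (\<lambda>x. f x \<alpha>) x" and ?b = "\<lambda>p :: int \<times> int. (2 * pi * \<i>) * (of_int (snd p) * a p)"
  have f': "?f' \<in> Edc_carrier c" using f by (auto simp: Edc_carrier_def schwartz_vd)
  have rb: "rapid ?b" by (intro rapid_cmult rapid_snd a)
  obtain B where B: "\<And>\<alpha> x. cmod (f x \<alpha>) \<le> B" using Edc_bounded[OF f c] by blast
  obtain B' where B': "\<And>\<alpha> x. cmod (?f' x \<alpha>) \<le> B'" using Edc_bounded[OF f' c] by blast
  note s = abs_summable_summable[OF tm_summable[OF f' c a, of \<theta> d _ \<alpha>]] abs_summable_summable[OF tm_summable[OF f c rb, of \<theta> d _ \<alpha>]]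
  have "derivs (\<lambda>x. infsum (\<lambda>p. tm \<theta> d c f a x \<alpha> p) UNIV) (\<lambda>x. infsum (\<lambda>p. tm \<theta> d c ?f' a x \<alpha> p + tm \<theta> d c f ?b x \<alpha> p) UNIV)"
  proof (rule derivs_infsum)
    fix p :: "int \<times> int"
    define n where "n = real_of_int (snd p)"
    define \<beta> where "\<beta> = of_int \<alpha> * of_int d / real_of_int c"
    have d1: "derivs (\<lambda>x. ee (n * (x - \<beta>))) (\<lambda>x. 2 * pi * \<i> * of_real n * ee (n * (x - \<beta>)))"
      using derivs_shift[OF derivs_ee[of n], of \<beta>] by simp
    have d2: "derivs (\<lambda>x. f (x - of_int (fst p) / mu \<theta> d c) (\<alpha> - fst p)) (\<lambda>x. ?f' (x - of_int (fst p) / mu \<theta> d c) (\<alpha> - fst p))"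
      by (rule derivs_shift[OF schwartz_derivs[OF Edc_schwartz[OF f]]])
    show "derivs (\<lambda>x. tm \<theta> d c f a x \<alpha> p) (\<lambda>x. tm \<theta> d c ?f' a x \<alpha> p + tm \<theta> d c f ?b x \<alpha> p)"
      unfolding tm_def n_def[symmetric] \<beta>_def[symmetric]
      by (rule derivs_cong[OF derivs_mult[OF derivs_cmult[OF d1] d2]]) (simp add: n_def algebra_simps)
    fix x
    show "cmod (tm \<theta> d c f a x \<alpha> p) \<le> B * cmod (a p)" by (rule tm_bound[where f = f, OF B])
    show "cmod (tm \<theta> d c ?f' a x \<alpha> p + tm \<theta> d c f ?b x \<alpha> p) \<le> B' * cmod (a p) + B * cmod (?b p)"
      by (rule norm_triangle_le[OF add_mono[OF tm_bound[where f = ?f', OF B'] tm_bound[where f = f, OF B]]])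
  next
    show "(\<lambda>p. B * cmod (a p)) summable_on UNIV" by (intro summable_on_cmult_right rapid_abs_summable a)
    show "(\<lambda>p. B' * cmod (a p) + B * cmod (?b p)) summable_on UNIV"
      by (intro summable_on_add summable_on_cmult_right rapid_abs_summable a rb)
  qed
  then show ?thesis unfolding Edc_act_tm infsum_add[OF s] .
qed

lemma sum_periodic_shift:
  fixes h :: "int \<Rightarrow> 'a::comm_monoid_add"
  assumes c: "c \<noteq> 0" and h: "\<And>\<alpha> \<beta>. \<alpha> mod \<bar>c\<bar> = \<beta> mod \<bar>c\<bar> \<Longrightarrow> h \<alpha> = h \<beta>"
  shows "(\<Sum>\<alpha>\<in>{0..<\<bar>c\<bar>}. h (\<alpha> + m)) = (\<Sum>\<alpha>\<in>{0..<\<bar>c\<bar>}. h \<alpha>)"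
proof -
  let ?R = "{0..<\<bar>c\<bar>}"
  have "(\<Sum>\<alpha>\<in>?R. h \<alpha>) = (\<Sum>\<alpha>\<in>?R. h ((\<alpha> + m) mod \<bar>c\<bar>))"
  proof (rule sum.reindex_bij_witness[of _ "\<lambda>\<alpha>. (\<alpha> + m) mod \<bar>c\<bar>" "\<lambda>\<alpha>. (\<alpha> - m) mod \<bar>c\<bar>"])
    show "((\<alpha> - m) mod \<bar>c\<bar> + m) mod \<bar>c\<bar> = \<alpha>" if "\<alpha> \<in> ?R" for \<alpha>
    proof -
      have "((\<alpha> - m) mod \<bar>c\<bar> + m) mod \<bar>c\<bar> = \<alpha> mod \<bar>c\<bar>" unfolding mod_add_left_eq by simp
      then show ?thesis using that by simp
    qed
    show "((\<alpha> + m) mod \<bar>c\<bar> - m) mod \<bar>c\<bar> = \<alpha>" if "\<alpha> \<in> ?R" for \<alpha>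
    proof -
      have "((\<alpha> + m) mod \<bar>c\<bar> - m) mod \<bar>c\<bar> = \<alpha> mod \<bar>c\<bar>" unfolding mod_diff_left_eq by simp
      then show ?thesis using that by simp
    qed
    show "h (((\<alpha> - m) mod \<bar>c\<bar> + m) mod \<bar>c\<bar>) = h \<alpha>" if "\<alpha> \<in> ?R" for \<alpha>
      by (rule h) (simp add: mod_add_left_eq)
  qed (use c in auto)
  also have "\<dots> = (\<Sum>\<alpha>\<in>?R. h (\<alpha> + m))" by (intro sum.cong refl h) simp
  finally show ?thesis ..
qed

lemma infsum_finite_sum:
  fixes f :: "'a \<Rightarrow> 'b \<Rightarrow> complex"
  assumes "finite A" "\<And>a. a \<in> A \<Longrightarrow> f a summable_on B"
  shows "infsum (\<lambda>p. \<Sum>a\<in>A. f a p) B = (\<Sum>a\<in>A. infsum (f a) B) \<and> (\<lambda>p. \<Sum>a\<in>A. f a p) summable_on B"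
  using assms
proof (induction A rule: finite_induct)
  case (insert a A)
  then have IH: "infsum (\<lambda>p. \<Sum>a\<in>A. f a p) B = (\<Sum>a\<in>A. infsum (f a) B)" "(\<lambda>p. \<Sum>a\<in>A. f a p) summable_on B" by auto
  have fa: "f a summable_on B" using insert by simp
  have "infsum (\<lambda>p. f a p + (\<Sum>a\<in>A. f a p)) B = infsum (f a) B + (\<Sum>a\<in>A. infsum (f a) B)"
    unfolding IH(1)[symmetric] by (rule infsum_add[OF fa IH(2)])
  moreover have "(\<lambda>p. f a p + (\<Sum>a\<in>A. f a p)) summable_on B" by (rule summable_on_add[OF fa IH(2)])
  ultimately show ?case using insert by simp
qed simp

lemma Edc_form_act_left:
  assumes f: "f \<in> Edc_carrier c" and g: "g \<in> Edc_carrier c" and c: "c \<noteq> 0" and a: "rapid a"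
  shows "Edc_form c (Edc_act \<theta> d c f a) g =
    infsum (\<lambda>p. \<Sum>\<alpha>\<in>{0..<\<bar>c\<bar>}. LINT x|lborel. tm \<theta> d c f a x \<alpha> p * cnj (g x \<alpha>)) UNIV"
proof -
  obtain B where B0: "B \<ge> 0" and B: "\<And>\<alpha> x. cmod (f x \<alpha>) \<le> B" using Edc_bounded[OF f c] by blast
  have key: "(LINT x|lborel. infsum (\<lambda>p. tm \<theta> d c f a x \<alpha> p * cnj (g x \<alpha>)) UNIV) =
      infsum (\<lambda>p. LINT x|lborel. tm \<theta> d c f a x \<alpha> p * cnj (g x \<alpha>)) UNIV \<and>
     (\<lambda>p. cmod (LINT x|lborel. tm \<theta> d c f a x \<alpha> p * cnj (g x \<alpha>))) summable_on UNIV" for \<alpha>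
  proof -
    have m: "(\<lambda>x. tm \<theta> d c f a x \<alpha> p * cnj (g x \<alpha>)) \<in> borel_measurable borel" for p
    proof (rule borel_measurable_continuous_onI)
      show "continuous_on UNIV (\<lambda>x. tm \<theta> d c f a x \<alpha> p * cnj (g x \<alpha>))"
        unfolding tm_def using c
        by (intro continuous_intros schwartz_continuous[OF Edc_schwartz[OF g]] schwartz_continuous[OF schwartz_shift[OF Edc_schwartz[OF f]]]) auto
    qed
    have b: "cmod (tm \<theta> d c f a x \<alpha> p * cnj (g x \<alpha>)) \<le> (B * cmod (a p)) * cmod (g x \<alpha>)" for p x
      unfolding norm_mult complex_mod_cnj by (intro mult_right_mono tm_bound[where f = f, OF B]) auto
    have i: "integrable lborel (\<lambda>x. cmod (g x \<alpha>))" by (intro integrable_norm integrable_schwartz Edc_schwartz[OF g])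
    have s: "(\<lambda>p. B * cmod (a p)) summable_on UNIV" by (intro summable_on_cmult_right rapid_abs_summable a)
    show ?thesis using LINT_infsum[of "\<lambda>p x. tm \<theta> d c f a x \<alpha> p * cnj (g x \<alpha>)", OF m b i s] B0 by simp
  qed
  have "Edc_form c (Edc_act \<theta> d c f a) g = (\<Sum>\<alpha>\<in>{0..<\<bar>c\<bar>}. infsum (\<lambda>p. LINT x|lborel. tm \<theta> d c f a x \<alpha> p * cnj (g x \<alpha>)) UNIV)"
    unfolding Edc_form_def
  proof (rule sum.cong[OF refl])
    fix \<alpha>
    have "Edc_act \<theta> d c f a x \<alpha> * cnj (g x \<alpha>) = infsum (\<lambda>p. tm \<theta> d c f a x \<alpha> p * cnj (g x \<alpha>)) UNIV" for x
      unfolding Edc_act_tm by (rule infsum_cmult_left[symmetric]) (rule abs_summable_summable[OF tm_summable[OF f c a]])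
    then show "(LINT x|lborel. Edc_act \<theta> d c f a x \<alpha> * cnj (g x \<alpha>)) = infsum (\<lambda>p. LINT x|lborel. tm \<theta> d c f a x \<alpha> p * cnj (g x \<alpha>)) UNIV"
      using key by simp
  qed
  also have "\<dots> = infsum (\<lambda>p. \<Sum>\<alpha>\<in>{0..<\<bar>c\<bar>}. LINT x|lborel. tm \<theta> d c f a x \<alpha> p * cnj (g x \<alpha>)) UNIV"
    using infsum_finite_sum[where f = "\<lambda>\<alpha> p. LINT x|lborel. tm \<theta> d c f a x \<alpha> p * cnj (g x \<alpha>)",
        OF finite_atLeastLessThan_int abs_summable_summable[OF conjunct2[OF key]]] by simp
  finally show ?thesis .
qed

lemma Edc_form_cnj: "Edc_form c g f = cnj (Edc_form c f g)"
proof -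
  have "(LINT x|lborel. g x \<alpha> * cnj (f x \<alpha>)) = cnj (LINT x|lborel. f x \<alpha> * cnj (g x \<alpha>))" for \<alpha>
    unfolding Bochner_Integration.integral_cnj[symmetric] by (simp add: mult.commute)
  then show ?thesis by (simp add: Edc_form_def)
qed

text \<open>It is checked monomial by monomial, substituting \<open>x + m / \<mu>\<close> and
  \<open>\<alpha> + m\<close>. As \<open>m / \<mu> = m * \<theta> + m * d / c\<close>, the term with
  d cancels against the shift of \<open>\<alpha>\<close>, and what remains is the phase
  \<open>ee (m * n * \<theta>)\<close> built into \<open>astar\<close>.\<close>

lemma Edc_form_adjoint:
  assumes f: "f \<in> Edc_carrier c" and g: "g \<in> Edc_carrier c" and c: "c \<noteq> 0" and a: "rapid a"
    and s: "real_of_int c * \<theta> + real_of_int d \<noteq> 0"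
  shows "Edc_form c (Edc_act \<theta> d c f a) g = Edc_form c f (Edc_act \<theta> d c g (astar \<theta> a))"
proof -
  let ?\<mu> = "mu \<theta> d c"
  have mm: "of_int m / ?\<mu> = of_int m * \<theta> + of_int m * of_int d / of_int c" for m :: int
    using c s by (simp add: mu_def field_simps)
  have "(\<Sum>\<alpha>\<in>{0..<\<bar>c\<bar>}. LINT x|lborel. tm \<theta> d c f a x \<alpha> p * cnj (g x \<alpha>)) =
     cnj (\<Sum>\<alpha>\<in>{0..<\<bar>c\<bar>}. LINT x|lborel. tm \<theta> d c g (astar \<theta> a) x \<alpha> (- fst p, - snd p) * cnj (f x \<alpha>))" for p :: "int \<times> int"
  proof -
    define m n where "m = fst p" and "n = snd p"
    have st: "cnj (astar \<theta> a (- m, - n)) = a (m, n) * ee (of_int n * of_int m * \<theta>)"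
      by (simp add: astar_def ee_def exp_cnj mult_ac)
    have shift: "(LINT x|lborel. tm \<theta> d c f a x \<alpha> (m, n) * cnj (g x \<alpha>)) =
       (LINT x|lborel. tm \<theta> d c f a (of_int m / ?\<mu> + 1 * x) \<alpha> (m, n) * cnj (g (of_int m / ?\<mu> + 1 * x) \<alpha>))" for \<alpha>
      using lborel_integral_real_affine[of 1 "\<lambda>x. tm \<theta> d c f a x \<alpha> (m, n) * cnj (g x \<alpha>)" "of_int m / ?\<mu>"] by simp
    have "(\<Sum>\<alpha>\<in>{0..<\<bar>c\<bar>}. LINT x|lborel. tm \<theta> d c f a x \<alpha> (m, n) * cnj (g x \<alpha>)) =
       (\<Sum>\<alpha>\<in>{0..<\<bar>c\<bar>}. LINT x|lborel. tm \<theta> d c f a (of_int m / ?\<mu> + 1 * x) (\<alpha> + m) (m, n) * cnj (g (of_int m / ?\<mu> + 1 * x) (\<alpha> + m)))"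
      unfolding shift
    proof (rule sum_periodic_shift[OF c, symmetric])
      fix \<alpha> \<beta> assume ab: "\<alpha> mod \<bar>c\<bar> = \<beta> mod \<bar>c\<bar>"
      then obtain k where k: "\<alpha> = \<beta> + c * k" by (metis abs_dvd_iff dvdE mod_eq_dvd_iff add.commute diff_add_cancel)
      have g': "g y \<alpha> = g y \<beta>" for y unfolding k by (rule Edc_periodic[OF g])
      have f': "f y (\<alpha> - m) = f y (\<beta> - m)" for y
        using Edc_periodic[OF f, of y "\<beta> - m" k] by (simp add: k algebra_simps)
      have "ee (of_int n * (y - of_int \<alpha> * of_int d / of_int c)) = ee (of_int n * (y - of_int \<beta> * of_int d / of_int c))" for y
      proof -
        have "of_int n * (y - of_int \<alpha> * of_int d / of_int c) = of_int n * ((y - of_int \<beta> * of_int d / of_int c) + of_int (- k * d))"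
          using c by (simp add: k field_simps)
        then show ?thesis by (simp only: ee_power_int)
      qed
      then show "(LINT x|lborel. tm \<theta> d c f a (of_int m / ?\<mu> + 1 * x) \<alpha> (m, n) * cnj (g (of_int m / ?\<mu> + 1 * x) \<alpha>)) =
         (LINT x|lborel. tm \<theta> d c f a (of_int m / ?\<mu> + 1 * x) \<beta> (m, n) * cnj (g (of_int m / ?\<mu> + 1 * x) \<beta>))"
        unfolding tm_def using f' g' by simp
    qed
    also have "\<dots> = (\<Sum>\<alpha>\<in>{0..<\<bar>c\<bar>}. LINT x|lborel. cnj (tm \<theta> d c g (astar \<theta> a) x \<alpha> (- m, - n) * cnj (f x \<alpha>)))"
    proof (intro sum.cong refl Bochner_Integration.integral_cong)
      fix \<alpha> and x :: real
      define y where "y = x - of_int \<alpha> * of_int d / of_int c"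
      have arg: "of_int n * (of_int m / ?\<mu> + 1 * x - of_int (\<alpha> + m) * of_int d / of_int c) = of_int n * of_int m * \<theta> + of_int n * y"
        unfolding mm y_def by (simp add: algebra_simps add_divide_distrib)
      have e: "ee (of_int n * (of_int m / ?\<mu> + 1 * x - of_int (\<alpha> + m) * of_int d / of_int c)) = ee (of_int n * of_int m * \<theta>) * ee (of_int n * y)"
        unfolding arg ee_add ..
      have "cnj (ee (of_int (- n) * y)) = ee (of_int n * y)" by (simp add: cnj_ee)
      then show "tm \<theta> d c f a (of_int m / ?\<mu> + 1 * x) (\<alpha> + m) (m, n) * cnj (g (of_int m / ?\<mu> + 1 * x) (\<alpha> + m)) =
          cnj (tm \<theta> d c g (astar \<theta> a) x \<alpha> (- m, - n) * cnj (f x \<alpha>))"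
        unfolding tm_def fst_conv snd_conv e y_def[symmetric] complex_cnj_mult st
        by (simp add: add.commute mult_ac)
    qed
    finally show ?thesis unfolding Bochner_Integration.integral_cnj cnj_sum m_def n_def by simp
  qed
  then have "Edc_form c (Edc_act \<theta> d c f a) g =
     infsum (\<lambda>p :: int \<times> int. cnj (\<Sum>\<alpha>\<in>{0..<\<bar>c\<bar>}. LINT x|lborel. tm \<theta> d c g (astar \<theta> a) x \<alpha> (- fst p, - snd p) * cnj (f x \<alpha>))) UNIV"
    unfolding Edc_form_act_left[OF f g c a] by simp
  also have "\<dots> = infsum (\<lambda>p. cnj (\<Sum>\<alpha>\<in>{0..<\<bar>c\<bar>}. LINT x|lborel. tm \<theta> d c g (astar \<theta> a) x \<alpha> p * cnj (f x \<alpha>))) UNIV"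
  proof (rule infsum_reindex_bij_betw)
    show "bij_betw (\<lambda>p :: int \<times> int. (- fst p, - snd p)) UNIV (UNIV :: (int \<times> int) set)"
      by (rule bij_betw_byWitness[of _ "\<lambda>p. (- fst p, - snd p)"]) auto
  qed
  also have "\<dots> = cnj (Edc_form c (Edc_act \<theta> d c g (astar \<theta> a)) f)"
    unfolding Edc_form_act_left[OF g f c rapid_astar[OF a]] by (rule infsum_cnj)
  finally show ?thesis unfolding Edc_form_cnj[of c f] .
qed

section \<open>A finite frame from windows and Fourier series\<close>

lemma power_sum3_le:
  assumes "(a::real) \<ge> 0" "b \<ge> 0" "e \<ge> 0"
  shows "(a + b + e) ^ k \<le> 3 ^ k * (a ^ k + b ^ k + e ^ k)"
proof -
  define m where "m = max a (max b e)"
  have "(a + b + e) ^ k \<le> (3 * m) ^ k" using assms by (intro power_mono) (auto simp: m_def)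
  also have "\<dots> = 3 ^ k * m ^ k" by (rule power_mult_distrib)
  also have "m ^ k \<le> a ^ k + b ^ k + e ^ k"
  proof -
    have "m = a \<or> m = b \<or> m = e" by (auto simp: m_def max_def)
    moreover have "0 \<le> a ^ k" "0 \<le> b ^ k" "0 \<le> e ^ k" using assms by auto
    ultimately show ?thesis by (elim disjE) simp_all
  qed
  finally show ?thesis by simp
qed

text \<open>Recentring the sum at \<open>round (x / r)\<close> compares the translates with inverse
  squares, and this makes the bound uniform in x.\<close>

lemma Edc_translates_summable:
  assumes W: "W \<in> Edc_carrier c" and c: "c \<noteq> 0" and r: "(r :: real) \<noteq> 0"
  shows "\<exists>D\<ge>0. \<forall>x \<alpha>. (\<lambda>m. cmod (W (x - of_int m * r) (\<alpha> - m))) summable_on UNIV \<and>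
     infsum (\<lambda>m. cmod (W (x - of_int m * r) (\<alpha> - m))) UNIV \<le> D"
proof -
  let ?g = "\<lambda>n::int. 1 / (1 + \<bar>real_of_int n\<bar>)\<^sup>2"
  obtain C where C: "C \<ge> 0" "\<And>\<alpha> x. cmod (W x \<alpha>) \<le> C * (1 / (1 + x\<^sup>2))"
    using Edc_uniform[OF W c, of "\<lambda>h x. cmod (h x)" "\<lambda>x. 1 / (1 + x\<^sup>2)"] schwartz_le_inverse_square by auto
  define K where "K = 2 * (2 + 1 / \<bar>r\<bar>)\<^sup>2"
  have K: "K \<ge> 0" by (simp add: K_def)
  have b: "cmod (W (x - of_int m * r) (\<alpha> - m)) \<le> C * K * ?g (m - round (x / r))" for x \<alpha> m
  proof -
    define y where "y = x - of_int m * r"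
    define k where "k = m - round (x / r)"
    have "\<bar>of_int k\<bar> \<le> \<bar>y\<bar> / \<bar>r\<bar> + 1 / 2"
    proof -
      have "\<bar>of_int (round (x / r)) - x / r\<bar> \<le> 1 / 2" by (rule of_int_round_abs_le)
      moreover have "y / r = x / r - of_int m" using r by (simp add: y_def field_simps)
      ultimately have "\<bar>of_int k\<bar> \<le> \<bar>y / r\<bar> + 1 / 2" unfolding k_def of_int_diff by linarith
      then show ?thesis by (simp add: abs_divide)
    qed
    moreover define q where "q = 1 / \<bar>r\<bar>"
    ultimately have "\<bar>of_int k\<bar> \<le> q * \<bar>y\<bar> + 1 / 2" by simp
    moreover have "0 \<le> q" by (simp add: q_def)
    moreover have "(2 + q) * (1 + \<bar>y\<bar>) = 2 + q + 2 * \<bar>y\<bar> + q * \<bar>y\<bar>" by (simp add: algebra_simps)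
    ultimately have "1 + \<bar>of_int k\<bar> \<le> (2 + q) * (1 + \<bar>y\<bar>)" using abs_ge_zero[of y] by linarith
    then have "1 + \<bar>of_int k\<bar> \<le> (2 + 1 / \<bar>r\<bar>) * (1 + \<bar>y\<bar>)" by (simp only: q_def)
    then have "(1 + \<bar>real_of_int k\<bar>)\<^sup>2 \<le> ((2 + 1 / \<bar>r\<bar>) * (1 + \<bar>y\<bar>))\<^sup>2" by (intro power_mono) auto
    also have "\<dots> = (2 + 1 / \<bar>r\<bar>)\<^sup>2 * (1 + \<bar>y\<bar>)\<^sup>2" by (rule power_mult_distrib)
    also have "\<dots> \<le> (2 + 1 / \<bar>r\<bar>)\<^sup>2 * (2 * (1 + y\<^sup>2))"
      using zero_le_power2[of "1 - \<bar>y\<bar>"]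
      by (intro mult_left_mono) (simp_all add: power2_eq_square algebra_simps abs_mult_self_eq)
    also have "\<dots> = K * (1 + y\<^sup>2)" by (simp only: K_def mult_ac)
    finally have "(1 + \<bar>real_of_int k\<bar>)\<^sup>2 \<le> K * (1 + y\<^sup>2)" .
    moreover have "1 + y\<^sup>2 > 0" by (simp add: add_pos_nonneg)
    moreover have "(1 + \<bar>real_of_int k\<bar>)\<^sup>2 > 0" by (intro zero_less_power) linarith
    ultimately have "1 / (1 + y\<^sup>2) \<le> K * ?g k" by (simp add: divide_simps mult.commute)
    then have "C * (1 / (1 + y\<^sup>2)) \<le> C * (K * ?g k)" using C(1) by (intro mult_left_mono)
    from order_trans[OF C(2)[of y "\<alpha> - m"] this] show ?thesis unfolding y_def k_def mult.assoc .
  qed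
  have bij: "bij_betw (\<lambda>m. m - j) UNIV UNIV" for j :: int
    by (rule bij_betw_byWitness[of _ "\<lambda>m. m + j"]) auto
  have sg: "(\<lambda>m. C * K * ?g (m - j)) summable_on UNIV" for j
    by (intro summable_on_cmult_right) (use summable_on_reindex_bij_betw[OF bij[of j], of ?g] summable_on_int_inverse_square in simp)
  have ig: "infsum (\<lambda>m. C * K * ?g (m - j)) UNIV = C * K * infsum ?g UNIV" for j
    using infsum_cmult_right'[of "C * K" "\<lambda>m. ?g (m - j)" UNIV] infsum_reindex_bij_betw[OF bij[of j], of ?g] by simp
  show ?thesis
  proof (intro exI[of _ "C * K * infsum ?g UNIV"] conjI allI)
    show "0 \<le> C * K * infsum ?g UNIV" using C(1) K by (intro mult_nonneg_nonneg infsum_nonneg) auto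
    fix x \<alpha>
    show s: "(\<lambda>m. cmod (W (x - of_int m * r) (\<alpha> - m))) summable_on UNIV"
      by (rule summable_on_comparison_test[OF sg b norm_ge_zero])
    show "infsum (\<lambda>m. cmod (W (x - of_int m * r) (\<alpha> - m))) UNIV \<le> C * K * infsum ?g UNIV"
      unfolding ig[of "round (x / r)", symmetric] by (rule infsum_mono[OF s sg b])
  qed
qed

locale Edc_frame =
  fixes \<theta> :: real and d c :: int
  assumes c0: "c \<noteq> 0" and s_pos: "real_of_int c * \<theta> + real_of_int d > 0"
begin

definition r :: real where "r = 1 / mu \<theta> d c"

lemma r_nonzero: "r \<noteq> 0"
  using c0 s_pos by (simp add: r_def mu_def)

lemma div_mu: "x / mu \<theta> d c = x * r"
  by (simp add: r_def)

lemma c_r: "of_int c * r = of_int c * \<theta> + of_int d"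
  using c0 by (simp add: r_def mu_def)

text \<open>N steps of length h make up \<open>c * r\<close>, the displacement after which a
  translate returns to the same residue class. The factor 4 forces \<open>h \<le> 1/4\<close>, so
  the windows meet the support condition of \<open>csupp\<close>.\<close>

definition N :: nat where "N = nat \<lceil>4 * (of_int c * r)\<rceil>"
definition h :: real where "h = of_int c * r / of_nat N"

lemma N_pos: "N > 0" and h_pos: "h > 0" and h_le: "h \<le> 1/4" and N_h: "of_nat N * h = of_int c * r"
proof -
  have s: "of_int c * r > 0" using s_pos by (simp add: c_r)
  show N: "N > 0" using s by (simp add: N_def)
  show "h > 0" "of_nat N * h = of_int c * r" using s N by (simp_all add: h_def)
  have "4 * (of_int c * r) \<le> of_nat N" unfolding N_def by (rule real_nat_ceiling_ge)
  then show "h \<le> 1/4" using N by (simp add: h_def field_simps)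
qed

definition uu :: "real \<Rightarrow> complex" where "uu x = of_real (bump (x / h))"
text \<open>Three neighbouring bumps add up to 1 on the support of \<open>uu\<close>, so
  \<open>vv\<close> can be multiplied in freely. Its own support stays within distance 1/2 of 0,
  which is what singles out one period.\<close>

definition vv :: "real \<Rightarrow> complex" where "vv x = of_real (bump (x / h - 1) + bump (x / h) + bump (x / h + 1))"

lemma csupp_uu: "csupp uu"
  unfolding csupp_def
proof (intro conjI allI impI)
  show "schwartz uu" using schwartz_affine[OF schwartz_bump, of "1/h" 0] h_pos by (simp add: uu_def[abs_def])
  fix x :: real assume "1/4 < \<bar>x\<bar>"
  then have "1 \<le> \<bar>x / h\<bar>" using h_pos h_le by (simp add: abs_divide pos_le_divide_eq)
  then show "uu x = 0" by (simp add: uu_def bump_eq_0)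
qed

lemma schwartz_vv: "schwartz vv"
proof -
  have "schwartz (\<lambda>x. of_real (bump (1/h * x + -1)) + of_real (bump (1/h * x + 0)) + of_real (bump (1/h * x + 1)))"
    using h_pos by (intro schwartz_add schwartz_affine[OF schwartz_bump]) auto
  then show ?thesis by (simp add: vv_def[abs_def])
qed

lemma vv_eq_0: "1/2 \<le> \<bar>x\<bar> \<Longrightarrow> vv x = 0"
proof -
  assume x: "1/2 \<le> \<bar>x\<bar>"
  then have "2 \<le> \<bar>x / h\<bar>" using h_pos h_le by (simp add: abs_divide pos_le_divide_eq)
  then have "1 \<le> \<bar>x / h - 1\<bar>" "1 \<le> \<bar>x / h\<bar>" "1 \<le> \<bar>x / h + 1\<bar>" by linarith+
  then show ?thesis by (simp add: vv_def bump_eq_0)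
qed

lemma vv_uu: "vv x * uu x = uu x"
proof (cases "1 \<le> \<bar>x / h\<bar>")
  case True then show ?thesis by (simp add: uu_def bump_eq_0)
next
  case False
  have p: "bump y + bump (y - 1) = 1" if "0 \<le> y" "y \<le> 1" for y
    using that is_bump_bump unfolding is_bump_def by blast
  have "bump (x / h - 1) + bump (x / h) + bump (x / h + 1) = 1"
  proof (cases "x / h \<ge> 0")
    case True
    have "bump (x / h + 1) = 0" by (rule bump_eq_0) (use True in linarith)
    moreover have "x / h \<le> 1" using False by linarith
    ultimately show ?thesis using p[of "x / h"] True by linarith
  next
    case F: False
    have "bump (x / h - 1) = 0" by (rule bump_eq_0) (use F in linarith)
    moreover have "0 \<le> x / h + 1" "x / h + 1 \<le> 1" using False F by linarith+
    ultimately show ?thesis using p[of "x / h + 1"] by simp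
  qed
  then show ?thesis by (simp add: vv_def)
qed

definition pt :: "nat \<Rightarrow> int \<Rightarrow> real" where "pt i m = of_int m * r + of_nat i * h"

text \<open>The phase turns the argument \<open>x - \<alpha> * d / c\<close> in the action of U2
  into \<open>x - (\<alpha> - m) * d / c\<close>, which differs from x by an integer when c divides
  \<open>\<alpha> - m\<close>.\<close>

definition coefA :: "nat \<Rightarrow> (real \<Rightarrow> int \<Rightarrow> complex) \<Rightarrow> aelt" where
  "coefA i f p = ee (of_int (snd p) * (of_int (fst p) * of_int d / of_int c)) * wcoef uu (\<lambda>x. f x (fst p)) (pt i (fst p)) (snd p)"

text \<open>Smoothness of f and the window gives decay in the frequency n. Decay in m follows from
  decay in the window position, because \<open>pt i m\<close> grows linearly in m.\<close>

lemma rapid_coefA: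
  assumes f: "f \<in> Edc_carrier c" shows "rapid (coefA i f)"
  unfolding rapid_wt
proof
  fix k
  have u1: "\<exists>C\<ge>0. \<forall>\<alpha> x. \<bar>of_int (snd x)\<bar> ^ k * cmod (wcoef uu (\<lambda>x. f x \<alpha>) (fst x) (snd x)) \<le> C * (\<lambda>_. 1) x" for k
  proof (rule Edc_uniform[OF f c0])
    fix g assume "schwartz g"
    then obtain C where C: "\<And>t n. \<bar>of_int n\<bar> ^ k * cmod (wcoef uu g t n) \<le> C" using wcoef_decay_freq[OF csupp_uu] by blast
    then show "\<exists>C\<ge>0. \<forall>x. \<bar>of_int (snd x)\<bar> ^ k * cmod (wcoef uu g (fst x) (snd x)) \<le> C * 1"
      using order_trans[OF C abs_ge_self] by (intro exI[of _ "\<bar>C\<bar>"]) auto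
  qed simp
  have u2: "\<exists>C\<ge>0. \<forall>\<alpha> x. \<bar>fst x\<bar> ^ k * cmod (wcoef uu (\<lambda>x. f x \<alpha>) (fst x) (snd x)) \<le> C * (\<lambda>_. 1) x"
  proof (rule Edc_uniform[OF f c0])
    fix g assume "schwartz g"
    then obtain C where C: "\<And>t n. \<bar>t\<bar> ^ k * cmod (wcoef uu g t n) \<le> C" using wcoef_decay_shift[OF csupp_uu] by blast
    then show "\<exists>C\<ge>0. \<forall>x. \<bar>fst x\<bar> ^ k * cmod (wcoef uu g (fst x) (snd x)) \<le> C * 1"
      using order_trans[OF C abs_ge_self] by (intro exI[of _ "\<bar>C\<bar>"]) auto
  qed simp
  obtain C0 where C0: "\<And>\<alpha> t n. cmod (wcoef uu (\<lambda>x. f x \<alpha>) t n) \<le> C0" using u1[of 0] by auto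
  obtain C1 where C1: "\<And>\<alpha> t n. \<bar>of_int n\<bar> ^ k * cmod (wcoef uu (\<lambda>x. f x \<alpha>) t n) \<le> C1" using u1[of k] by auto
  obtain C2 where C2: "\<And>\<alpha> t n. \<bar>t\<bar> ^ k * cmod (wcoef uu (\<lambda>x. f x \<alpha>) t n) \<le> C2" using u2 by auto
  define A where "A = 1 + of_nat i * h / \<bar>r\<bar>"
  have A: "A \<ge> 0" using h_pos by (simp add: A_def)
  have "wt p ^ k * cmod (coefA i f p) \<le> 3 ^ k * (A ^ k * C0 + (1 / \<bar>r\<bar>) ^ k * C2 + C1)" for p
  proof -
    define m n where "m = fst p" and "n = snd p"
    let ?w = "cmod (wcoef uu (\<lambda>x. f x m) (pt i m) n)"
    have "of_int m = (pt i m - of_nat i * h) / r" using r_nonzero by (simp add: pt_def)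
    then have "\<bar>of_int m\<bar> = \<bar>pt i m - of_nat i * h\<bar> / \<bar>r\<bar>" by (simp add: abs_divide)
    also have "\<dots> \<le> (\<bar>pt i m\<bar> + of_nat i * h) / \<bar>r\<bar>"
      using abs_triangle_ineq4[of "pt i m" "of_nat i * h"] h_pos by (intro divide_right_mono) auto
    finally have "wt p \<le> A + 1 / \<bar>r\<bar> * \<bar>pt i m\<bar> + \<bar>of_int n\<bar>"
      by (simp add: wt_def A_def m_def n_def add_divide_distrib)
    then have "wt p ^ k \<le> (A + 1 / \<bar>r\<bar> * \<bar>pt i m\<bar> + \<bar>of_int n\<bar>) ^ k" by (intro power_mono) auto
    also have "\<dots> \<le> 3 ^ k * (A ^ k + (1 / \<bar>r\<bar> * \<bar>pt i m\<bar>) ^ k + \<bar>of_int n\<bar> ^ k)"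
      using A by (intro power_sum3_le) auto
    finally have "wt p ^ k * ?w \<le> 3 ^ k * (A ^ k + (1 / \<bar>r\<bar> * \<bar>pt i m\<bar>) ^ k + \<bar>of_int n\<bar> ^ k) * ?w"
      by (intro mult_right_mono) auto
    also have "\<dots> = 3 ^ k * (A ^ k * ?w + (1 / \<bar>r\<bar>) ^ k * (\<bar>pt i m\<bar> ^ k * ?w) + \<bar>of_int n\<bar> ^ k * ?w)"
      by (simp only: power_mult_distrib mult.assoc distrib_right)
    also have "\<dots> \<le> 3 ^ k * (A ^ k * C0 + (1 / \<bar>r\<bar>) ^ k * C2 + C1)"
      using A by (intro mult_left_mono add_mono C0 C1 C2) auto
    finally show ?thesis by (simp add: coefA_def norm_mult m_def n_def)
  qed
  then show "\<exists>C. \<forall>p. wt p ^ k * cmod (coefA i f p) \<le> C" by blast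
qed

definition ser :: "nat \<Rightarrow> (real \<Rightarrow> int \<Rightarrow> complex) \<Rightarrow> int \<Rightarrow> real \<Rightarrow> complex" where
  "ser i f m y = infsum (\<lambda>n. wcoef uu (\<lambda>x. f x m) (pt i m) n * ee (of_int n * y)) UNIV"

lemma Edc_act_coefA:
  assumes W: "W \<in> Edc_carrier c" and f: "f \<in> Edc_carrier c"
  shows "Edc_act \<theta> d c W (coefA i f) x \<alpha> =
    infsum (\<lambda>m. W (x - of_int m * r) (\<alpha> - m) * ser i f m (x - of_int (\<alpha> - m) * of_int d / of_int c)) UNIV"
proof -
  have s: "tm \<theta> d c W (coefA i f) x \<alpha> summable_on (UNIV \<times> UNIV)"
    using abs_summable_summable[OF tm_summable[OF W c0 rapid_coefA[OF f]]] by simp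
  have "infsum (tm \<theta> d c W (coefA i f) x \<alpha>) (UNIV \<times> UNIV) = infsum (\<lambda>m. infsum (\<lambda>n. tm \<theta> d c W (coefA i f) x \<alpha> (m, n)) UNIV) UNIV"
    by (rule infsum_Sigma_banach[OF s, symmetric])
  moreover have "tm \<theta> d c W (coefA i f) x \<alpha> (m, n) = W (x - of_int m * r) (\<alpha> - m) *
     (wcoef uu (\<lambda>x. f x m) (pt i m) n * ee (of_int n * (x - of_int (\<alpha> - m) * of_int d / of_int c)))" for m n
  proof -
    have "of_int n * (x - of_int (\<alpha> - m) * of_int d / of_int c) =
       of_int n * (of_int m * of_int d / of_int c) + of_int n * (x - of_int \<alpha> * of_int d / of_int c)"
      by (simp add: algebra_simps diff_divide_distrib)
    then have "ee (of_int n * (x - of_int (\<alpha> - m) * of_int d / of_int c)) =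
       ee (of_int n * (of_int m * of_int d / of_int c)) * ee (of_int n * (x - of_int \<alpha> * of_int d / of_int c))"
      by (simp only: ee_add)
    then show ?thesis unfolding tm_def coefA_def fst_conv snd_conv div_mu by (simp only: mult_ac)
  qed
  ultimately show ?thesis unfolding Edc_act_tm ser_def by (simp add: infsum_cmult_right')
qed

text \<open>The sum over n is first resummed to a function bounded by \<open>supn uu * B\<close>,
  and only then are moduli taken. The remaining sum over m converges by the decay of W, so nothing
  but the sup of f enters.\<close>

lemma Edc_act_coefA_bound:
  assumes W: "W \<in> Edc_carrier c"
  shows "\<exists>D\<ge>0. \<forall>f\<in>Edc_carrier c. \<forall>B. (\<forall>x \<alpha>. cmod (f x \<alpha>) \<le> B) \<longrightarrow>
     (\<forall>x \<alpha>. cmod (Edc_act \<theta> d c W (coefA i f) x \<alpha>) \<le> D * B)"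
proof -
  obtain D where D: "D \<ge> 0" "\<And>x \<alpha>. (\<lambda>m. cmod (W (x - of_int m * r) (\<alpha> - m))) summable_on UNIV"
     "\<And>x \<alpha>. infsum (\<lambda>m. cmod (W (x - of_int m * r) (\<alpha> - m))) UNIV \<le> D"
    using Edc_translates_summable[OF W c0 r_nonzero] by auto
  have U: "supn uu \<ge> 0" using sq_nonneg[of uu 0] csupp_uu by (simp add: csupp_def)
  have "cmod (Edc_act \<theta> d c W (coefA i f) x \<alpha>) \<le> (D * supn uu) * B" if f: "f \<in> Edc_carrier c" and B: "\<forall>x \<alpha>. cmod (f x \<alpha>) \<le> B" for f B x \<alpha>
  proof -
    let ?F = "\<lambda>m. W (x - of_int m * r) (\<alpha> - m) * ser i f m (x - of_int (\<alpha> - m) * of_int d / of_int c)"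
    let ?W = "\<lambda>m. cmod (W (x - of_int m * r) (\<alpha> - m))"
    have B0: "B \<ge> 0" using B norm_ge_zero order_trans by blast
    have ser: "cmod (ser i f m y) \<le> supn uu * B" for m y
    proof -
      have "cmod (ser i f m y) \<le> supn uu * supn (\<lambda>x. f x m)"
        unfolding ser_def by (rule wcoef_series_bound[OF csupp_uu Edc_schwartz[OF f]])
      also have "\<dots> \<le> supn uu * B" using B by (intro mult_left_mono U supn_leI) auto
      finally show ?thesis .
    qed
    have b: "norm (?F m) \<le> (supn uu * B) * ?W m" for m
      unfolding norm_mult mult.commute[of "?W m"] by (rule mult_right_mono[OF ser norm_ge_zero])
    have s1: "(\<lambda>m. (supn uu * B) * ?W m) summable_on UNIV" by (intro summable_on_cmult_right D)
    have s2: "(\<lambda>m. norm (?F m)) summable_on UNIV"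
      by (rule summable_on_comparison_test[OF s1 b norm_ge_zero])
    have "cmod (infsum ?F UNIV) \<le> infsum (\<lambda>m. norm (?F m)) UNIV" by (rule norm_infsum_bound[OF s2])
    also have "\<dots> \<le> infsum (\<lambda>m. (supn uu * B) * ?W m) UNIV" by (rule infsum_mono[OF s2 s1 b])
    also have "\<dots> = (supn uu * B) * infsum ?W UNIV" by (rule infsum_cmult_right')
    also have "\<dots> \<le> (supn uu * B) * D" using U B0 by (intro mult_left_mono D) auto
    finally show ?thesis unfolding Edc_act_coefA[OF W f] by (simp add: mult_ac)
  qed
  then show ?thesis using D(1) U by (intro exI[of _ "D * supn uu"]) auto
qed

definition VV :: "nat \<Rightarrow> real \<Rightarrow> int \<Rightarrow> complex" where
  "VV i x \<alpha> = (if c dvd \<alpha> then vv (x - of_nat i * h) else 0)"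

lemma VV_carrier: "VV i \<in> Edc_carrier c"
proof -
  have "schwartz (\<lambda>x. VV i x \<alpha>)" for \<alpha>
    by (cases "c dvd \<alpha>") (simp_all add: VV_def schwartz_zero schwartz_shift[OF schwartz_vv])
  then show ?thesis by (simp add: Edc_carrier_def VV_def)
qed

text \<open>The contributing indices are \<open>m = \<alpha> + c * j\<close>, with window centres
  \<open>\<alpha> * r + (j * N + i) * h\<close>. As i and j vary, \<open>k = j * N + i\<close> runs
  once through all integers, and the double sum is the partition of unity at the rescaled point
  y.\<close>

lemma bump_partition_frame:
  "(\<Sum>i<N. infsum (\<lambda>m. if c dvd \<alpha> - m then uu (x - pt i m) else 0) UNIV) = 1"
proof -
  define y where "y = (x - of_int \<alpha> * r) / h"
  define g where "g k = complex_of_real (bump (y - of_int k))" for k :: int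
  let ?B = "{\<lfloor>y\<rfloor>, \<lfloor>y\<rfloor> + 1}"
  have g0: "g k = 0" if "k \<notin> ?B" for k
  proof -
    have "k \<le> \<lfloor>y\<rfloor> - 1 \<or> k \<ge> \<lfloor>y\<rfloor> + 2" using that by auto
    then have "1 \<le> \<bar>y - of_int k\<bar>" by linarith
    then show ?thesis by (simp add: g_def bump_eq_0)
  qed
  have each: "infsum (\<lambda>m. if c dvd \<alpha> - m then uu (x - pt i m) else 0) UNIV = (\<Sum>k\<in>?B. if k mod int N = int i then g k else 0)"
    if i: "i < N" for i
  proof -
    have bij1: "bij_betw (\<lambda>j. \<alpha> + c * j) UNIV {m. c dvd \<alpha> - m}"
    proof (rule bij_betw_byWitness[of _ "\<lambda>m. (m - \<alpha>) div c"])
      show "\<forall>m\<in>{m. c dvd \<alpha> - m}. \<alpha> + c * ((m - \<alpha>) div c) = m"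
        by (simp add: dvd_diff_commute)
    qed (use c0 in auto)
    have bij2: "bij_betw (\<lambda>j. j * int N + int i) UNIV {k. k mod int N = int i}"
    proof (rule bij_betw_byWitness[of _ "\<lambda>k. k div int N"])
      show "\<forall>k\<in>{k. k mod int N = int i}. k div int N * int N + int i = k"
        by (metis div_mult_mod_eq mem_Collect_eq)
      show "\<forall>j\<in>UNIV. (j * int N + int i) div int N = j" using i by auto
      show "range (\<lambda>j. j * int N + int i) \<subseteq> {k. k mod int N = int i}" using i by auto
    qed auto
    have "infsum (\<lambda>m. if c dvd \<alpha> - m then uu (x - pt i m) else 0) UNIV = infsum (\<lambda>m. uu (x - pt i m)) {m. c dvd \<alpha> - m}"
      by (rule infsum_cong_neutral) auto
    also have "\<dots> = infsum (\<lambda>j. uu (x - pt i (\<alpha> + c * j))) UNIV"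
      by (rule infsum_reindex_bij_betw[OF bij1, symmetric])
    also have "\<dots> = infsum (\<lambda>j. g (j * int N + int i)) UNIV"
    proof (rule infsum_cong)
      fix j :: int
      have "pt i (\<alpha> + c * j) = of_int \<alpha> * r + of_int j * (of_int c * r) + of_nat i * h"
        by (simp add: pt_def algebra_simps)
      then have "(x - pt i (\<alpha> + c * j)) / h = y - of_int (j * int N + int i)"
        using h_pos by (simp add: y_def N_h[symmetric] field_simps)
      then show "uu (x - pt i (\<alpha> + c * j)) = g (j * int N + int i)" by (simp only: uu_def g_def)
    qed
    also have "\<dots> = infsum g {k. k mod int N = int i}" by (rule infsum_reindex_bij_betw[OF bij2])
    also have "\<dots> = infsum (\<lambda>k. if k mod int N = int i then g k else 0) ?B"
      by (rule infsum_cong_neutral) (use g0 in auto)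
    also have "\<dots> = (\<Sum>k\<in>?B. if k mod int N = int i then g k else 0)" by (rule infsum_finite) simp
    finally show ?thesis .
  qed
  have "(\<Sum>i<N. infsum (\<lambda>m. if c dvd \<alpha> - m then uu (x - pt i m) else 0) UNIV) = (\<Sum>i<N. \<Sum>k\<in>?B. if k mod int N = int i then g k else 0)"
    by (intro sum.cong refl each) simp
  also have "\<dots> = (\<Sum>k\<in>?B. \<Sum>i<N. if k mod int N = int i then g k else 0)" by (rule sum.swap)
  also have "\<dots> = (\<Sum>k\<in>?B. g k)"
  proof (rule sum.cong[OF refl])
    fix k
    have k: "0 \<le> k mod int N" "k mod int N < int N" using N_pos by auto
    have "(\<Sum>i<N. if k mod int N = int i then g k else 0) = (\<Sum>i<N. if i = nat (k mod int N) then g k else 0)"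
      using k by (intro sum.cong) auto
    also have "\<dots> = g k" using k by (simp add: sum.delta nat_less_iff)
    finally show "(\<Sum>i<N. if k mod int N = int i then g k else 0) = g k" .
  qed
  also have "\<dots> = of_real (bump (y - of_int \<lfloor>y\<rfloor>) + bump (y - of_int \<lfloor>y\<rfloor> - 1))"
    by (simp add: g_def algebra_simps)
  finally show ?thesis unfolding bump_partition by simp
qed

text \<open>A finite frame: \<open>f = \<Sum>i<N. VV i \<cdot> coefA i f\<close>. Since \<open>VV i\<close> has support of length at most 1,
  multiplying by it selects one term of the periodization computed by the Fourier series.\<close>
lemma frame_reconstruction:
  assumes f: "f \<in> Edc_carrier c"
  shows "(\<Sum>i<N. Edc_act \<theta> d c (VV i) (coefA i f) x \<alpha>) = f x \<alpha>"
proof -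
  have each: "Edc_act \<theta> d c (VV i) (coefA i f) x \<alpha> = infsum (\<lambda>m. if c dvd \<alpha> - m then uu (x - pt i m) else 0) UNIV * f x \<alpha>" for i
  proof -
    have "VV i (x - of_int m * r) (\<alpha> - m) * ser i f m (x - of_int (\<alpha> - m) * of_int d / of_int c) =
       (if c dvd \<alpha> - m then uu (x - pt i m) else 0) * f x \<alpha>" for m
    proof (cases "c dvd \<alpha> - m")
      case True
      then obtain k where k: "\<alpha> - m = c * k" by blast
      have fm: "f x m = f x \<alpha>" using Edc_periodic[OF f, of x m k] k by (simp add: algebra_simps)
      \<comment> \<open>On this residue class the argument differs from x by an integer, invisible
        to a Fourier series of period 1.\<close>
      have e: "x - of_int (\<alpha> - m) * of_int d / of_int c = x + of_int (- k * d)" using c0 by (simp add: k)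
      have ser: "ser i f m (x - of_int (\<alpha> - m) * of_int d / of_int c) = ser i f m x"
        unfolding ser_def e ee_power_int ..
      have arg: "x - of_int m * r - of_nat i * h = x - pt i m" by (simp add: pt_def)
      show ?thesis
      proof (cases "\<bar>x - pt i m\<bar> \<le> 1/2")
        case near: True
        have "ser i f m x = uu (x - pt i m) * f x m"
          unfolding ser_def by (rule wcoef_inversion_near[OF csupp_uu Edc_schwartz[OF f] near])
        moreover have "VV i (x - of_int m * r) (\<alpha> - m) = vv (x - pt i m)" unfolding VV_def arg using True by (rule if_P)
        ultimately have "VV i (x - of_int m * r) (\<alpha> - m) * ser i f m (x - of_int (\<alpha> - m) * of_int d / of_int c) =
            (vv (x - pt i m) * uu (x - pt i m)) * f x \<alpha>" unfolding ser fm by (simp only: mult.assoc)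
        then show ?thesis using True by (simp add: vv_uu)
      next
        case False
        then have "vv (x - pt i m) = 0" by (intro vv_eq_0) simp
        moreover from this have "uu (x - pt i m) = 0" using vv_uu[of "x - pt i m"] by simp
        ultimately show ?thesis by (simp add: VV_def arg)
      qed
    qed (simp add: VV_def)
    then show ?thesis unfolding Edc_act_coefA[OF VV_carrier f] by (simp add: infsum_cmult_left')
  qed
  show ?thesis unfolding each sum_distrib_right[symmetric] bump_partition_frame by simp
qed

end

section \<open>Holomorphic structures on the Schwartz modules\<close>

definition a_linear :: "('e::ab_group_add \<Rightarrow> aelt \<Rightarrow> 'e) \<Rightarrow> ('e \<Rightarrow> 'e) \<Rightarrow> bool" where
  "a_linear act T \<longleftrightarrow> (\<forall>x y. T (x + y) = T x + T y) \<and> (\<forall>e a. rapid a \<longrightarrow> T (act e a) = act (T e) a)"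

lemma a_linear_add: "a_linear act T \<Longrightarrow> T (x + y) = T x + T y"
  and a_linear_act: "a_linear act T \<Longrightarrow> rapid a \<Longrightarrow> T (act e a) = act (T e) a"
  by (simp_all add: a_linear_def)

lemma a_linear_sum:
  assumes "a_linear act T" shows "T (\<Sum>j\<in>J. f j) = (\<Sum>j\<in>J. T (f j))"
proof -
  have 0: "T 0 = 0" using a_linear_add[OF assms, of 0 0] by simp
  show ?thesis by (induction J rule: infinite_finite_induct) (simp_all add: 0 a_linear_add[OF assms])
qed

locale EN_module = Edc_frame \<theta> d c for \<theta> d c +
  fixes n :: nat and act :: "'e::ab_group_add \<Rightarrow> aelt \<Rightarrow> 'e" and \<phi> :: "'e \<Rightarrow> nat \<Rightarrow> real \<Rightarrow> int \<Rightarrow> complex"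
  assumes iso: "mod_iso act (EN_carrier c n) EN_add (EN_act \<theta> d c) \<phi>"
begin

abbreviation sc :: "complex \<Rightarrow> 'e \<Rightarrow> 'e" where "sc \<equiv> \<lambda>z e. act e (aconst z)"

lemma \<phi>_carrier: "\<phi> e \<in> EN_carrier c n"
  using iso unfolding mod_iso_def bij_betw_def by blast

lemma \<phi>_Edc: "i < n \<Longrightarrow> \<phi> e i \<in> Edc_carrier c" and \<phi>_out: "\<not> i < n \<Longrightarrow> \<phi> e i = (\<lambda>_ _. 0)"
  using \<phi>_carrier[of e] by (auto simp: EN_carrier_def)

lemma \<phi>_inj: "(\<And>i x \<alpha>. i < n \<Longrightarrow> \<phi> e i x \<alpha> = \<phi> e' i x \<alpha>) \<Longrightarrow> e = e'"
proof -
  assume *: "\<And>i x \<alpha>. i < n \<Longrightarrow> \<phi> e i x \<alpha> = \<phi> e' i x \<alpha>"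
  have "\<phi> e i = \<phi> e' i" for i by (cases "i < n") (use * \<phi>_out in \<open>auto simp: fun_eq_iff\<close>)
  then have "\<phi> e = \<phi> e'" by blast
  then show ?thesis using iso unfolding mod_iso_def bij_betw_def by (auto dest: injD)
qed

lemma \<phi>_surj: "F \<in> EN_carrier c n \<Longrightarrow> \<exists>e. \<phi> e = F"
proof -
  have "range \<phi> = EN_carrier c n" using iso unfolding mod_iso_def bij_betw_def by blast
  then show "F \<in> EN_carrier c n \<Longrightarrow> \<exists>e. \<phi> e = F" by (metis imageE)
qed

lemma \<phi>_add: "\<phi> (x + y) i t \<alpha> = \<phi> x i t \<alpha> + \<phi> y i t \<alpha>"
  using iso by (simp add: mod_iso_def EN_add_def)

lemma \<phi>_act: "rapid a \<Longrightarrow> \<phi> (act e a) i = Edc_act \<theta> d c (\<phi> e i) a"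
  using iso by (simp add: mod_iso_def EN_act_def Atheta_def)

lemma \<phi>_sc: "\<phi> (sc z e) i t \<alpha> = z * \<phi> e i t \<alpha>"
  by (simp add: \<phi>_act rapid_aconst Edc_act_aconst)

lemma \<phi>_0: "\<phi> 0 i t \<alpha> = 0"
  using \<phi>_add[of 0 0] by simp

lemma \<phi>_sum: "\<phi> (\<Sum>j\<in>J. f j) i t \<alpha> = (\<Sum>j\<in>J. \<phi> (f j) i t \<alpha>)"
  by (induction J rule: infinite_finite_induct) (simp_all add: \<phi>_0 \<phi>_add)

lemma vspace_sc: "vspace sc"
  unfolding vspace_def
  by unfold_locales (rule \<phi>_inj, simp add: \<phi>_add \<phi>_sc algebra_simps)+

lemma act_add: "rapid a \<Longrightarrow> act (x + y) a = act x a + act y a"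
proof (rule \<phi>_inj)
  fix i t \<alpha> assume i: "i < n" and a: "rapid a"
  have "\<phi> (x + y) i = (\<lambda>t \<alpha>. \<phi> x i t \<alpha> + \<phi> y i t \<alpha>)" by (simp add: fun_eq_iff \<phi>_add)
  then show "\<phi> (act (x + y) a) i t \<alpha> = \<phi> (act x a + act y a) i t \<alpha>"
    using Edc_act_add[OF \<phi>_Edc[OF i] \<phi>_Edc[OF i] c0 a] by (simp add: \<phi>_add \<phi>_act a)
qed

lemma act_add_right: "rapid a \<Longrightarrow> rapid b \<Longrightarrow> act x (\<lambda>p. a p + b p) = act x a + act x b"
  by (rule \<phi>_inj) (simp add: \<phi>_add \<phi>_act rapid_add Edc_act_add_right[OF \<phi>_Edc c0])

lemma act_diff: "rapid a \<Longrightarrow> act (x - y) a = act x a - act y a"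
  using act_add[of a "x - y" y] by simp

definition comp :: "'e \<Rightarrow> nat \<times> int \<Rightarrow> real \<Rightarrow> complex" where
  "comp e ia = (\<lambda>x. \<phi> e (fst ia) x (snd ia))"

definition Ind :: "(nat \<times> int) set" where "Ind = {..<n} \<times> {0..<\<bar>c\<bar>}"

text \<open>A function on R x Z/cZ is a tuple of \<open>|c|\<close> Schwartz functions, so n
  summands provide \<open>n * |c|\<close> coordinates; representatives are taken in
  \<open>{0..<|c|}\<close>.\<close>

lemma elliptic_sum_EN:
  assumes "elliptic_model {f. schwartz f} sq D g \<gamma> \<rho> l"
  shows "elliptic_sum {f. schwartz f} sq D g \<gamma> \<rho> l sc Ind comp"
proof -
  interpret m: elliptic_model "{f. schwartz f}" sq D g \<gamma> \<rho> l by fact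
  interpret v: vspace sc by (rule vspace_sc)
  show ?thesis
  proof unfold_locales
    show "finite Ind" by (simp add: Ind_def)
    show "comp e ia \<in> {f. schwartz f}" if "ia \<in> Ind" for ia e
      using that Edc_schwartz[OF \<phi>_Edc] by (auto simp: Ind_def comp_def)
    show "comp (e + e') ia = (\<lambda>x. comp e ia x + comp e' ia x)" for ia e e' by (simp add: comp_def \<phi>_add)
    show "comp (sc z e) ia = (\<lambda>x. z * comp e ia x)" for ia e z by (simp add: comp_def \<phi>_sc)
    show "e = e'" if *: "\<And>ia. ia \<in> Ind \<Longrightarrow> comp e ia = comp e' ia" for e e'
    proof (rule \<phi>_inj)
      fix i x \<alpha> assume i: "i < n"
      have "(i, \<alpha> mod \<bar>c\<bar>) \<in> Ind" using i c0 by (simp add: Ind_def)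
      from fun_cong[OF *[OF this], of x] show "\<phi> e i x \<alpha> = \<phi> e' i x \<alpha>"
        by (simp add: comp_def Edc_mod[OF \<phi>_Edc[OF i]])
    qed
    show "\<exists>e. \<forall>ia\<in>Ind. comp e ia = f ia" if *: "\<And>ia. ia \<in> Ind \<Longrightarrow> f ia \<in> {f. schwartz f}" for f
    proof -
      define F where "F i = (if i < n then (\<lambda>x \<alpha>. f (i, \<alpha> mod \<bar>c\<bar>) x) else (\<lambda>_ _. 0))" for i
      have "F \<in> EN_carrier c n"
      proof -
        have "(\<alpha> + c) mod \<bar>c\<bar> = \<alpha> mod \<bar>c\<bar>" for \<alpha>
          using minus_mod_self2[of \<alpha> "- c"] by (simp add: abs_if)
        moreover have "schwartz (\<lambda>x. f (i, \<alpha> mod \<bar>c\<bar>) x)" if "i < n" for i \<alpha>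
          using *[of "(i, \<alpha> mod \<bar>c\<bar>)"] that c0 by (simp add: Ind_def)
        ultimately show ?thesis by (simp add: EN_carrier_def Edc_carrier_def F_def)
      qed
      then obtain e where e: "\<phi> e = F" using \<phi>_surj by blast
      have "comp e ia = f ia" if "ia \<in> Ind" for ia
        using that by (auto simp: Ind_def comp_def e F_def)
      then show ?thesis by blast
    qed
  qed
qed

end

locale EN_model = EN_module \<theta> d c n act \<phi> + elliptic_model "{f. schwartz f}" sq "dk \<kappa>" g \<gamma> \<rho> l
  for \<theta> d c n and act :: "'e::ab_group_add \<Rightarrow> aelt \<Rightarrow> 'e" and \<phi> \<kappa> g \<gamma> \<rho> l
begin

sublocale elliptic_sum "{f. schwartz f}" sq "dk \<kappa>" g \<gamma> \<rho> l sc Ind comp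
  by (rule elliptic_sum_EN) unfold_locales

lemma \<phi>_lift:
  assumes H: "\<And>f. schwartz f \<Longrightarrow> schwartz (H f)" and i: "i < n"
  shows "\<phi> (lift H e) i x \<alpha> = H (\<lambda>x. \<phi> e i x \<alpha>) x"
proof -
  have m: "(i, \<alpha> mod \<bar>c\<bar>) \<in> Ind" using i c0 by (simp add: Ind_def)
  have "comp (lift H e) (i, \<alpha> mod \<bar>c\<bar>) = H (comp e (i, \<alpha> mod \<bar>c\<bar>))" using comp_lift[of H] H m by simp
  from fun_cong[OF this, of x] show ?thesis by (simp add: comp_def Edc_mod[OF \<phi>_Edc[OF i]])
qed

definition X :: "'e \<Rightarrow> 'e" where "X = lift (\<lambda>f x. of_real x * f x)"
definition DX :: "'e \<Rightarrow> 'e" where "DX = lift vd"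

lemma \<phi>_X: "i < n \<Longrightarrow> \<phi> (X e) i x \<alpha> = of_real x * \<phi> e i x \<alpha>"
  unfolding X_def by (subst \<phi>_lift) (auto intro: schwartz_xmult)

lemma \<phi>_DX: "i < n \<Longrightarrow> \<phi> (DX e) i x \<alpha> = vd (\<lambda>x. \<phi> e i x \<alpha>) x"
  unfolding DX_def by (subst \<phi>_lift) (auto intro: schwartz_vd)

lemma X_add: "X (x + y) = X x + X y"
  by (rule \<phi>_inj) (simp add: \<phi>_X \<phi>_add distrib_left)

lemma DX_add: "DX (x + y) = DX x + DX y"
  by (rule \<phi>_inj) (simp add: \<phi>_DX \<phi>_add vd_add Edc_schwartz[OF \<phi>_Edc])

text \<open>\<open>bX\<close> and \<open>bD\<close> are derivations proportional to m and n. They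
  are what X and \<open>DX\<close> induce on the algebra through their Leibniz rules.\<close>

definition bX :: "aelt \<Rightarrow> aelt" where "bX a = (\<lambda>p. of_real (1 / mu \<theta> d c) * (of_int (fst p) * a p))"
definition bD :: "aelt \<Rightarrow> aelt" where "bD a = (\<lambda>p. (2 * pi * \<i>) * (of_int (snd p) * a p))"

lemma rapid_bX: "rapid a \<Longrightarrow> rapid (bX a)" and rapid_bD: "rapid a \<Longrightarrow> rapid (bD a)"
  unfolding bX_def bD_def by (intro rapid_cmult rapid_fst rapid_snd, assumption)+

lemma X_act: "rapid a \<Longrightarrow> X (act e a) = act (X e) a + act e (bX a)"
proof (rule \<phi>_inj)
  fix i x \<alpha> assume a: "rapid a" and i: "i < n"
  have eq: "\<phi> (X e) i = (\<lambda>x \<alpha>. of_real x * \<phi> e i x \<alpha>)" by (simp add: fun_eq_iff \<phi>_X i)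
  have "\<phi> (X (act e a)) i x \<alpha> = of_real x * Edc_act \<theta> d c (\<phi> e i) a x \<alpha>" by (simp add: \<phi>_X i \<phi>_act a)
  also have "\<dots> = Edc_act \<theta> d c (\<phi> (X e) i) a x \<alpha> + Edc_act \<theta> d c (\<phi> e i) (bX a) x \<alpha>"
    unfolding eq bX_def by (rule Edc_act_xmult[OF \<phi>_Edc[OF i] c0 a])
  also have "\<dots> = \<phi> (act (X e) a + act e (bX a)) i x \<alpha>" by (simp add: \<phi>_add \<phi>_act a rapid_bX)
  finally show "\<phi> (X (act e a)) i x \<alpha> = \<phi> (act (X e) a + act e (bX a)) i x \<alpha>" .
qed

lemma DX_act: "rapid a \<Longrightarrow> DX (act e a) = act (DX e) a + act e (bD a)"
proof (rule \<phi>_inj)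
  fix i x \<alpha> assume a: "rapid a" and i: "i < n"
  have eq: "\<phi> (DX e) i = (\<lambda>x \<alpha>. vd (\<lambda>x. \<phi> e i x \<alpha>) x)" by (simp add: fun_eq_iff \<phi>_DX i)
  have "\<phi> (DX (act e a)) i x \<alpha> = vd (\<lambda>x. Edc_act \<theta> d c (\<phi> e i) a x \<alpha>) x" by (simp add: \<phi>_DX i \<phi>_act a)
  also have "\<dots> = Edc_act \<theta> d c (\<phi> (DX e) i) a x \<alpha> + Edc_act \<theta> d c (\<phi> e i) (bD a) x \<alpha>"
    unfolding eq bD_def by (rule fun_cong[OF derivs_vd[OF Edc_act_derivs[OF \<phi>_Edc[OF i] c0 a]]])
  also have "\<dots> = \<phi> (act (DX e) a + act e (bD a)) i x \<alpha>" by (simp add: \<phi>_add \<phi>_act a rapid_bD)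
  finally show "\<phi> (DX (act e a)) i x \<alpha> = \<phi> (act (DX e) a + act e (bD a)) i x \<alpha>" .
qed

lemma P_Suc_eq: "P (Suc k) e = P k e + P k (X e) + P k (DX e)"
proof -
  have "comp (X e) ia = (\<lambda>x. of_real x * comp e ia x)" "comp (DX e) ia = vd (comp e ia)" if "ia \<in> Ind" for ia
    using that by (auto simp: comp_def \<phi>_X \<phi>_DX Ind_def)
  then show ?thesis unfolding P_def sum.distrib[symmetric]
    by (intro sum.cong) (simp_all add: sq.simps(2))
qed

lemma a_linear_comm_X:
  assumes T: "a_linear act T" shows "a_linear act (\<lambda>e. X (T e) - T (X e))"
  unfolding a_linear_def
proof (intro conjI allI impI)
  show "X (T (x + y)) - T (X (x + y)) = X (T x) - T (X x) + (X (T y) - T (X y))" for x y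
    by (simp add: a_linear_add[OF T] X_add)
  show "X (T (act e a)) - T (X (act e a)) = act (X (T e) - T (X e)) a" if a: "rapid a" for e a
    by (simp add: a_linear_act[OF T] a_linear_add[OF T] X_act act_diff rapid_bX a)
qed

lemma a_linear_comm_DX:
  assumes T: "a_linear act T" shows "a_linear act (\<lambda>e. DX (T e) - T (DX e))"
  unfolding a_linear_def
proof (intro conjI allI impI)
  show "DX (T (x + y)) - T (DX (x + y)) = DX (T x) - T (DX x) + (DX (T y) - T (DX y))" for x y
    by (simp add: a_linear_add[OF T] DX_add)
  show "DX (T (act e a)) - T (DX (act e a)) = act (DX (T e) - T (DX e)) a" if a: "rapid a" for e a
    by (simp add: a_linear_act[OF T] a_linear_add[OF T] DX_act act_diff rapid_bD a)
qed

lemma \<phi>_le_P0: "cmod (\<phi> e i x \<alpha>) \<le> P 0 e"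
proof (cases "i < n")
  case True
  have m: "(i, \<alpha> mod \<bar>c\<bar>) \<in> Ind" using True c0 by (simp add: Ind_def)
  have "cmod (comp e (i, \<alpha> mod \<bar>c\<bar>) x) \<le> supn (comp e (i, \<alpha> mod \<bar>c\<bar>))" using comp_S[OF m] by (intro le_supn) simp
  also have "\<dots> \<le> P 0 e" using q_le_P[OF m, of 0 e] by simp
  finally show ?thesis by (simp add: comp_def Edc_mod[OF \<phi>_Edc[OF True]])
next
  case False then show ?thesis by (simp add: \<phi>_out p_nonneg)
qed

definition gen :: "nat \<Rightarrow> nat \<Rightarrow> 'e" where
  "gen j k = (SOME e. \<phi> e = (\<lambda>i. if i = j then VV k else (\<lambda>_ _. 0)))"

lemma \<phi>_gen: "j < n \<Longrightarrow> \<phi> (gen j k) = (\<lambda>i. if i = j then VV k else (\<lambda>_ _. 0))"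
proof -
  assume j: "j < n"
  have "(\<lambda>_ _. 0) \<in> Edc_carrier c" by (simp add: Edc_carrier_def schwartz_zero)
  then have "(\<lambda>i. if i = j then VV k else (\<lambda>_ _. 0)) \<in> EN_carrier c n"
    using j VV_carrier by (auto simp: EN_carrier_def)
  from someI_ex[OF \<phi>_surj[OF this]] show ?thesis unfolding gen_def .
qed

lemma reconstruction: "e = (\<Sum>j<n. \<Sum>k<N. act (gen j k) (coefA k (\<phi> e j)))"
proof (rule \<phi>_inj)
  fix i x \<alpha> assume i: "i < n"
  have z: "Edc_act \<theta> d c (\<lambda>_ _. 0) a x \<alpha> = 0" for a by (simp add: Edc_act_tm tm_def[abs_def])
  have "\<phi> (\<Sum>j<n. \<Sum>k<N. act (gen j k) (coefA k (\<phi> e j))) i x \<alpha> =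
     (\<Sum>j<n. if j = i then \<Sum>k<N. Edc_act \<theta> d c (VV k) (coefA k (\<phi> e j)) x \<alpha> else 0)"
    unfolding \<phi>_sum by (intro sum.cong refl) (simp add: \<phi>_act rapid_coefA[OF \<phi>_Edc] \<phi>_gen z)
  also have "\<dots> = \<phi> e i x \<alpha>" using i by (simp add: frame_reconstruction[OF \<phi>_Edc[OF i]])
  finally show "\<phi> e i x \<alpha> = \<phi> (\<Sum>j<n. \<Sum>k<N. act (gen j k) (coefA k (\<phi> e j))) i x \<alpha>" ..
qed

text \<open>Through the frame, T enters only by its values on the finitely many
  \<open>gen j k\<close>, on which the frame coefficients of e then act;
  \<open>Edc_act_coefA_bound\<close> estimates this action by the sup of e.\<close>

lemma a_linear_P0_bound:
  assumes T: "a_linear act T" shows "\<exists>C. \<forall>e. P 0 (T e) \<le> C * P 0 e"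
proof -
  have "\<forall>j k i. \<exists>D. j < n \<longrightarrow> i < n \<longrightarrow> (\<forall>f\<in>Edc_carrier c. \<forall>B. (\<forall>x \<alpha>. cmod (f x \<alpha>) \<le> B) \<longrightarrow>
     (\<forall>x \<alpha>. cmod (Edc_act \<theta> d c (\<phi> (T (gen j k)) i) (coefA k f) x \<alpha>) \<le> D * B))"
    using Edc_act_coefA_bound[OF \<phi>_Edc] by metis
  then obtain D where D: "\<And>j k i f B x \<alpha>. j < n \<Longrightarrow> i < n \<Longrightarrow> f \<in> Edc_carrier c \<Longrightarrow> (\<And>x \<alpha>. cmod (f x \<alpha>) \<le> B) \<Longrightarrow>
     cmod (Edc_act \<theta> d c (\<phi> (T (gen j k)) i) (coefA k f) x \<alpha>) \<le> D j k i * B" by metis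
  define K where "K i = (\<Sum>j<n. \<Sum>k<N. D j k i)" for i
  have b: "cmod (\<phi> (T e) i x \<alpha>) \<le> K i * P 0 e" if i: "i < n" for e i x \<alpha>
  proof -
    have "T e = T (\<Sum>j<n. \<Sum>k<N. act (gen j k) (coefA k (\<phi> e j)))" using reconstruction[of e] by simp
    also have "\<dots> = (\<Sum>j<n. \<Sum>k<N. act (T (gen j k)) (coefA k (\<phi> e j)))"
      unfolding a_linear_sum[OF T] by (intro sum.cong refl a_linear_act[OF T] rapid_coefA \<phi>_Edc) simp
    finally have "\<phi> (T e) i x \<alpha> = (\<Sum>j<n. \<Sum>k<N. Edc_act \<theta> d c (\<phi> (T (gen j k)) i) (coefA k (\<phi> e j)) x \<alpha>)"
      by (simp add: \<phi>_sum \<phi>_act rapid_coefA[OF \<phi>_Edc])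
    also have "cmod \<dots> \<le> (\<Sum>j<n. \<Sum>k<N. D j k i * P 0 e)"
      by (intro sum_norm_le D[OF _ i] \<phi>_Edc \<phi>_le_P0) auto
    also have "\<dots> = K i * P 0 e" by (simp add: K_def sum_distrib_right)
    finally show ?thesis .
  qed
  have "P 0 (T e) \<le> (\<Sum>ia\<in>Ind. K (fst ia)) * P 0 e" for e
    unfolding P_def[of 0 "T e"] sum_distrib_right
  proof (rule sum_mono)
    fix ia assume "ia \<in> Ind"
    then have "cmod (comp (T e) ia x) \<le> K (fst ia) * P 0 e" for x
      using b[of "fst ia"] by (auto simp: comp_def Ind_def)
    then show "sq 0 (comp (T e) ia) \<le> K (fst ia) * P 0 e" by (simp add: supn_leI)
  qed
  then show ?thesis by blast
qed

text \<open>Commutators of an \<open>A\<close>-linear map with \<open>X\<close> and \<open>DX\<close> are again \<open>A\<close>-linear,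
  so boundedness in the sup norm gives boundedness in all the seminorms.\<close>
lemma a_linear_P_bound:
  "a_linear act T \<Longrightarrow> \<exists>C\<ge>0. \<forall>e. P k (T e) \<le> C * P k e"
proof (induction k arbitrary: T)
  case 0
  then obtain C where C: "\<And>e. P 0 (T e) \<le> C * P 0 e" using a_linear_P0_bound by blast
  have "P 0 (T e) \<le> \<bar>C\<bar> * P 0 e" for e using C[of e] mult_right_mono[OF abs_ge_self[of C] p_nonneg[of 0 e]] by linarith
  then show ?case by (intro exI[of _ "\<bar>C\<bar>"]) auto
next
  case (Suc k)
  obtain C0 where C0: "C0 \<ge> 0" "\<And>e. P k (T e) \<le> C0 * P k e" using Suc.IH[OF Suc.prems] by blast
  obtain C1 where C1: "C1 \<ge> 0" "\<And>e. P k (X (T e) - T (X e)) \<le> C1 * P k e" using Suc.IH[OF a_linear_comm_X[OF Suc.prems]] by blast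
  obtain C2 where C2: "C2 \<ge> 0" "\<And>e. P k (DX (T e) - T (DX e)) \<le> C2 * P k e" using Suc.IH[OF a_linear_comm_DX[OF Suc.prems]] by blast
  have "P (Suc k) (T e) \<le> (C0 + C1 + C2) * P (Suc k) e" for e
  proof -
    have "P k (X (T e)) \<le> P k (T (X e)) + P k (X (T e) - T (X e))" using p_add[of k "T (X e)" "X (T e) - T (X e)"] by simp
    moreover have "P k (DX (T e)) \<le> P k (T (DX e)) + P k (DX (T e) - T (DX e))" using p_add[of k "T (DX e)" "DX (T e) - T (DX e)"] by simp
    moreover have "(C0 + C1 + C2) * P (Suc k) e = C0 * P k e + C0 * P k (X e) + C0 * P k (DX e) + C1 * P k e + C1 * P k (X e) + C1 * P k (DX e)
        + C2 * P k e + C2 * P k (X e) + C2 * P k (DX e)"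
      unfolding P_Suc_eq by (simp only: distrib_left distrib_right add_ac)
    moreover have "0 \<le> C1 * P k (X e)" "0 \<le> C1 * P k (DX e)" "0 \<le> C2 * P k (X e)" "0 \<le> C2 * P k (DX e)"
      using C1 C2 p_nonneg by auto
    ultimately show ?thesis
      unfolding P_Suc_eq[of k "T e"] using C0(2)[of e] C0(2)[of "X e"] C0(2)[of "DX e"] C1(2)[of e] C2(2)[of e] by linarith
  qed
  then show ?case using C0(1) C1(1) C2(1) by (intro exI[of _ "C0 + C1 + C2"]) auto
qed

lemma \<phi>_dk:
  assumes i: "i < n" shows "\<phi> (lift (dk \<kappa>) e) i x \<alpha> = \<phi> (DX e + sc \<kappa> (X e)) i x \<alpha>"
  using \<phi>_lift[of "dk \<kappa>", OF schwartz_dk i] by (simp add: i \<phi>_add \<phi>_sc \<phi>_DX \<phi>_X dk_def)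

lemma lift_dk_eq: "lift (dk \<kappa>) e = DX e + sc \<kappa> (X e)"
  by (rule \<phi>_inj) (rule \<phi>_dk)

lemma act_sc: "rapid a \<Longrightarrow> act (sc z e) a = sc z (act e a)" and act_cmult: "rapid a \<Longrightarrow> act e (\<lambda>p. z * a p) = sc z (act e a)"
proof -
  assume a: "rapid a"
  show "act (sc z e) a = sc z (act e a)"
  proof (rule \<phi>_inj)
    fix i x \<alpha> assume i: "i < n"
    have "\<phi> (sc z e) i = (\<lambda>x \<alpha>. z * \<phi> e i x \<alpha>)" by (simp add: fun_eq_iff \<phi>_sc)
    then show "\<phi> (act (sc z e) a) i x \<alpha> = \<phi> (sc z (act e a)) i x \<alpha>"
      using Edc_act_cmult(1)[OF \<phi>_Edc[OF i] c0 a] by (simp add: \<phi>_sc \<phi>_act[OF a])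
  qed
  show "act e (\<lambda>p. z * a p) = sc z (act e a)"
    by (rule \<phi>_inj) (simp add: \<phi>_sc \<phi>_act a rapid_cmult Edc_act_cmult(2)[OF \<phi>_Edc c0 a])
qed

lemma fred_hol_struct:
  assumes \<kappa>: "\<kappa> = 2 * pi * \<i> * \<tau> * of_real (mu \<theta> d c)" and nb: "hol_struct \<tau> act nb"
  shows "fred_on nb UNIV (int (card Ind) * index)"
proof -
  define T where "T e = nb e - lift (dk \<kappa>) e" for e
  have \<mu>: "mu \<theta> d c \<noteq> 0" using r_nonzero by (auto simp: r_def)
  have add: "nb (x + y) = nb x + nb y" and leib: "rapid a \<Longrightarrow> nb (act e a) = act (nb e) a + act e (adelta \<tau> a)" for x y e a
    using nb by (simp_all add: hol_struct_def Atheta_def)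
  have lin: "a_linear act T"
    unfolding a_linear_def
  proof (intro conjI allI impI)
    show "T (x + y) = T x + T y" for x y
      by (simp add: T_def lift_dk_eq add X_add DX_add scale_right_distrib)
    fix e a assume a: "rapid a"
    \<comment> \<open>Since \<open>\<kappa> / \<mu> = 2 * pi * \<i> * \<tau>\<close>, the lift of
      \<open>dk \<kappa>\<close> satisfies the Leibniz rule for the same derivation as
      \<open>nb\<close>, and their difference T is A-linear.\<close>
    have ad: "adelta \<tau> a = (\<lambda>p. bD a p + \<kappa> * bX a p)"
      using \<mu> by (simp add: adelta_eq bD_def bX_def \<kappa> fun_eq_iff algebra_simps)
    have "act e (adelta \<tau> a) = act e (bD a) + sc \<kappa> (act e (bX a))"
      unfolding ad by (simp add: act_add_right act_cmult rapid_cmult rapid_bD rapid_bX a)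
    then have "lift (dk \<kappa>) (act e a) = act (lift (dk \<kappa>) e) a + act e (adelta \<tau> a)"
      by (simp add: lift_dk_eq X_act DX_act act_add act_sc scale_right_distrib a)
    then show "T (act e a) = act (T e) a" by (simp add: T_def leib[OF a] act_diff[OF a])
  qed
  show ?thesis
  proof (rule fred_index)
    show "module_hom sc sc T"
      by unfold_locales (simp_all add: a_linear_add[OF lin] a_linear_act[OF lin] rapid_aconst)
    show "\<exists>C. \<forall>x. P k (T x) \<le> C * P k x" for k using a_linear_P_bound[OF lin] by blast
    show "comp (nb e) ia = (\<lambda>x. dk \<kappa> (comp e ia) x + comp (T e) ia x)" if "ia \<in> Ind" for e ia
      using that comp_lift[of "dk \<kappa>", OF d_S that] by (simp add: T_def comp_diff)
  qed
qed

end

section \<open>Formal adjoints\<close>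

lemma astar_eq: "astar \<theta> a p = cnj (a (- p)) * ee (- \<theta> * of_int (fst p) * of_int (snd p))"
  by (cases p) (simp add: astar_def ee_def mult_ac)

lemma astar_astar: "astar \<theta> (astar \<theta> a) = a"
proof
  fix p
  show "astar \<theta> (astar \<theta> a) p = a p" by (simp add: astar_eq cnj_ee)
qed

lemma astar_aconst: "astar \<theta> (aconst z) = aconst (cnj z)"
proof
  fix p :: "int \<times> int"
  show "astar \<theta> (aconst z) p = aconst (cnj z) p"
    by (cases p) (auto simp: astar_eq aconst_def)
qed

text \<open>The star negates the indices and conjugates the factor \<open>2 * pi * \<i>\<close>; the
  two signs cancel, and only the conjugation of \<open>\<tau>\<close> is left.\<close>

lemma astar_adelta: "astar \<theta> (adelta \<tau> (astar \<theta> a)) = adelta (cnj \<tau>) a"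
proof
  fix p
  let ?c = "2 * pi * \<i> * (of_int (fst p) * cnj \<tau> + of_int (snd p))"
  have "adelta \<tau> (astar \<theta> a) (- p) = cnj ?c * astar \<theta> a (- p)"
    by (simp add: adelta_eq algebra_simps)
  then have "astar \<theta> (adelta \<tau> (astar \<theta> a)) p = ?c * astar \<theta> (astar \<theta> a) p"
    unfolding astar_eq[of \<theta> "adelta \<tau> (astar \<theta> a)"] astar_eq[of \<theta> "astar \<theta> a"] by (simp only: complex_cnj_mult complex_cnj_cnj mult.assoc)
  then show "astar \<theta> (adelta \<tau> (astar \<theta> a)) p = adelta (cnj \<tau>) a p" by (simp add: astar_astar adelta_eq)
qed

text \<open>Common interface of the Schwartz modules and the free modules. The index is required for
  every \<open>\<tau>\<close> off the real line, since it is used for \<open>\<tau>\<close> and its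
  conjugate on the same module.\<close>

locale hol_module = vspace "\<lambda>z e. act e (aconst z)" for act :: "'e::ab_group_add \<Rightarrow> aelt \<Rightarrow> 'e" +
  fixes \<theta> :: real and H :: "'e \<Rightarrow> 'e \<Rightarrow> complex" and K :: int
  assumes act_add: "rapid a \<Longrightarrow> act (x + y) a = act x a + act y a"
    and H_add: "H (x + y) z = H x z + H y z"
    and H_cnj: "H y x = cnj (H x y)"
    and H_definite: "H x x = 0 \<Longrightarrow> x = 0"
    and H_act: "rapid a \<Longrightarrow> H (act x a) y = H x (act y (astar \<theta> a))"
    and index: "Im \<tau> \<noteq> 0 \<Longrightarrow> hol_struct \<tau> act nb \<Longrightarrow> fred_on nb UNIV (if Im \<tau> < 0 then K else - K)"
begin

abbreviation sc :: "complex \<Rightarrow> 'e \<Rightarrow> 'e" where "sc \<equiv> \<lambda>z e. act e (aconst z)"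

lemma H_add_right: "H x (y + z) = H x y + H x z"
proof -
  have "H x (y + z) = cnj (H (y + z) x)" by (rule H_cnj)
  also have "\<dots> = cnj (H y x) + cnj (H z x)" by (simp only: H_add complex_cnj_add)
  finally show ?thesis by (simp only: H_cnj[symmetric])
qed

lemma H_0: "H 0 y = 0" "H y 0 = 0"
  using H_add[of 0 0 y] H_add_right[of y 0 0] by simp_all

lemma H_diff_right: "H x (y - z) = H x y - H x z"
  using H_add_right[of x "y - z" z] by simp

lemma H_diff: "H (y - z) x = H y x - H z x"
  using H_add[of "y - z" z x] by simp

lemma H_eqI: "(\<And>x. H x y = H x z) \<Longrightarrow> y = z"
  using H_definite[of "y - z"] H_diff_right[of "y - z" y z] by simp

lemma H_act_right: "rapid a \<Longrightarrow> H x (act y a) = H (act x (astar \<theta> a)) y"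
  using H_act[where a = "astar \<theta> a" and x = x and y = y] by (simp add: astar_astar rapid_astar)

lemma act_minus: "rapid a \<Longrightarrow> act (- x) a = - act x a"
proof -
  assume a: "rapid a"
  have "act 0 a = 0" using act_add[OF a, of 0 0] by simp
  then show ?thesis using act_add[OF a, of "- x" x] by (simp add: eq_neg_iff_add_eq_0)
qed

lemma hol_struct_hom: "hol_struct \<tau> act nb \<Longrightarrow> module_hom sc sc nb"
  unfolding hol_struct_def by unfold_locales auto

text \<open>Additivity and linearity of the adjoint follow from definiteness of the form. In the
  Leibniz rule the algebra element is moved across the form and back, which conjugates
  \<open>\<tau>\<close> by \<open>astar_adelta\<close>; the derivative term changes sides and hence
  sign, which explains the minus.\<close>

lemma hol_struct_adjoint:
  assumes nb: "hol_struct \<tau> act nb" and adj: "\<And>x y. H (nb x) y = H x (nbs y)"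
  shows "hol_struct (cnj \<tau>) act (\<lambda>e. - nbs e)"
proof -
  have add: "nb (x + y) = nb x + nb y" and nsc: "nb (sc z x) = sc z (nb x)"
    and leib: "rapid a \<Longrightarrow> nb (act x a) = act (nb x) a + act x (adelta \<tau> a)" for x y z a
    using nb by (simp_all add: hol_struct_def Atheta_def)
  have s_add: "nbs (x + y) = nbs x + nbs y" for x y
    by (rule H_eqI) (simp add: adj[symmetric] H_add_right)
  have s_sc: "nbs (sc z x) = sc z (nbs x)" for z x
  proof (rule H_eqI)
    fix u
    have "H u (nbs (sc z x)) = H (sc (cnj z) (nb u)) x"
      unfolding adj[symmetric] by (subst H_act_right[OF rapid_aconst]) (simp add: astar_aconst)
    also have "\<dots> = H (sc (cnj z) u) (nbs x)" unfolding nsc[symmetric] adj ..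
    also have "\<dots> = H u (sc z (nbs x))" by (subst H_act_right[OF rapid_aconst]) (simp add: astar_aconst)
    finally show "H u (nbs (sc z x)) = H u (sc z (nbs x))" .
  qed
  have s_leib: "nbs (act x a) = act (nbs x) a - act x (adelta (cnj \<tau>) a)" if a: "rapid a" for x a
  proof (rule H_eqI)
    fix u
    have ra: "rapid (astar \<theta> a)" by (rule rapid_astar[OF a])
    have "H u (nbs (act x a)) = H (act (nb u) (astar \<theta> a)) x"
      unfolding adj[symmetric] by (rule H_act_right[OF a])
    also have "act (nb u) (astar \<theta> a) = nb (act u (astar \<theta> a)) - act u (adelta \<tau> (astar \<theta> a))"
      using leib[OF ra, of u] by simp
    also have "H (nb (act u (astar \<theta> a)) - act u (adelta \<tau> (astar \<theta> a))) x =
        H (act u (astar \<theta> a)) (nbs x) - H u (act x (adelta (cnj \<tau>) a))"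
      unfolding H_diff adj by (subst H_act[OF rapid_adelta[OF ra]]) (simp add: astar_adelta)
    also have "\<dots> = H u (act (nbs x) a - act x (adelta (cnj \<tau>) a))"
      unfolding H_diff_right by (subst H_act_right[OF a]) simp
    finally show "H u (nbs (act x a)) = H u (act (nbs x) a - act x (adelta (cnj \<tau>) a))" .
  qed
  show ?thesis unfolding hol_struct_def Atheta_def
    by (simp add: s_add s_sc s_leib act_minus rapid_aconst)
qed

theorem riemann_roch_hodge:
  assumes \<tau>: "Im \<tau> \<noteq> 0" and nb: "hol_struct \<tau> act nb"
  shows "fin_dim act {e. nb e = 0} \<and> fin_codim act (range nb) \<and>
     (Im \<tau> < 0 \<longrightarrow> int (fdim act {e. nb e = 0}) - int (codim act (range nb)) = K) \<and>
     (\<forall>nbs. (\<forall>e1 e2. H (nb e1) e2 = H e1 (nbs e2)) \<longrightarrow>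
        orth_decomp H {e. nb e = 0} (range nbs) \<and> orth_decomp H {e. nbs e = 0} (range nb))"
proof -
  let ?k = "if Im \<tau> < 0 then K else - K"
  have hom: "module_hom sc sc nb" by (rule hol_struct_hom[OF nb])
  have F: "fred_on nb UNIV ?k" by (rule index[OF \<tau> nb])
  note ind = fred_on_imp_index[OF vspace_axioms hom F]
  have "orth_decomp H {e. nb e = 0} (range nbs) \<and> orth_decomp H {e. nbs e = 0} (range nb)"
    if adj: "\<forall>e1 e2. H (nb e1) e2 = H e1 (nbs e2)" for nbs
  proof -
    let ?M = "\<lambda>e. - nbs e"
    have M: "hol_struct (cnj \<tau>) act ?M" by (rule hol_struct_adjoint[OF nb]) (use adj in blast)
    have Mhom: "module_hom sc sc ?M" by (rule hol_struct_hom[OF M])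
    interpret M: module_hom sc sc ?M by (rule Mhom)
    have Im': "Im (cnj \<tau>) \<noteq> 0" using \<tau> by simp
    have "(if Im (cnj \<tau>) < 0 then K else - K) = - ?k" using \<tau> by auto
    with index[OF Im' M] have FM: "fred_on ?M UNIV (- ?k)" by simp
    have neg: "module_hom sc sc uminus" by unfold_locales (simp_all add: act_minus rapid_aconst)
    \<comment> \<open>The sign is absorbed into the automorphism \<open>- e\<close> of the domain,
      under which the index is invariant.\<close>
    have "nbs e = ?M (- e)" for e using M.neg[of e] by simp
    then have eq: "nbs = (\<lambda>e. ?M (- e))" by blast
    have Fs: "fred_on nbs UNIV (- ?k)"
      by (subst eq) (rule fred_comp_bij[OF FM neg bij_uminus])
    have shom: "module_hom sc sc nbs"
      by (subst eq) (rule module_hom_compose[OF neg Mhom, unfolded o_def])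
    show ?thesis
      using orthogonal_complements[OF hom shom F Fs, of H] adj H_definite H_0 H_cnj by blast
  qed
  then show ?thesis using ind by auto
qed

end

section \<open>The Schwartz modules: definiteness of the form, and the index\<close>

lemma LINT_norm_square_nonneg:
  assumes "schwartz f"
  shows "\<exists>t\<ge>0. (LINT x|lborel. f x * cnj (f x)) = complex_of_real t"
proof -
  have "(LINT x|lborel. f x * cnj (f x)) = of_real (LINT x|lborel. (cmod (f x))\<^sup>2)"
    unfolding complex_norm_square[symmetric] by (rule integral_complex_of_real)
  moreover have "(LINT x|lborel. (cmod (f x))\<^sup>2) \<ge> 0" by (rule Bochner_Integration.integral_nonneg) simp
  ultimately show ?thesis by blast
qed

lemma Edc_form_definite:
  assumes f: "f \<in> Edc_carrier c" and c: "c \<noteq> 0"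
  shows "\<exists>t\<ge>0. Edc_form c f f = complex_of_real t" "Edc_form c f f = 0 \<Longrightarrow> f x \<alpha> = 0"
proof -
  have "\<forall>\<alpha>. \<exists>t\<ge>0. (LINT x|lborel. f x \<alpha> * cnj (f x \<alpha>)) = complex_of_real t"
    using LINT_norm_square_nonneg[OF Edc_schwartz[OF f]] by blast
  then obtain t where t: "\<And>\<alpha>. t \<alpha> \<ge> 0" "\<And>\<alpha>. (LINT x|lborel. f x \<alpha> * cnj (f x \<alpha>)) = complex_of_real (t \<alpha>)" by metis
  have form: "Edc_form c f f = complex_of_real (\<Sum>\<alpha>\<in>{0..<\<bar>c\<bar>}. t \<alpha>)" by (simp add: Edc_form_def t)
  then show "\<exists>t\<ge>0. Edc_form c f f = complex_of_real t" using t(1) by (meson sum_nonneg)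
  assume 0: "Edc_form c f f = 0"
  have "\<alpha> mod \<bar>c\<bar> \<in> {0..<\<bar>c\<bar>}" using c by simp
  moreover have "(\<Sum>\<alpha>\<in>{0..<\<bar>c\<bar>}. t \<alpha>) = 0" using 0 unfolding form by (simp only: of_real_eq_0_iff)
  ultimately have "t (\<alpha> mod \<bar>c\<bar>) = 0" using t(1) by (subst (asm) sum_nonneg_eq_0_iff) auto
  then have "(\<lambda>x. f x (\<alpha> mod \<bar>c\<bar>)) = (\<lambda>_. 0)"
    using t(2)[of "\<alpha> mod \<bar>c\<bar>"] by (intro schwartz_LINT_eq_0 Edc_schwartz[OF f]) simp
  from fun_cong[OF this, of x] show "f x \<alpha> = 0" by (simp add: Edc_mod[OF f])
qed

lemma Edc_form_add:
  assumes "f \<in> Edc_carrier c" "f' \<in> Edc_carrier c" "g \<in> Edc_carrier c"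
  shows "Edc_form c (\<lambda>x \<alpha>. f x \<alpha> + f' x \<alpha>) g = Edc_form c f g + Edc_form c f' g"
proof -
  have i: "integrable lborel (\<lambda>x. h x \<alpha> * cnj (g x \<alpha>))" if "h \<in> Edc_carrier c" for h \<alpha>
    by (intro integrable_schwartz schwartz_mult schwartz_cnj Edc_schwartz[OF that] Edc_schwartz[OF assms(3)])
  have "(LINT x|lborel. (f x \<alpha> + f' x \<alpha>) * cnj (g x \<alpha>)) =
     (LINT x|lborel. f x \<alpha> * cnj (g x \<alpha>)) + (LINT x|lborel. f' x \<alpha> * cnj (g x \<alpha>))" for \<alpha>
    unfolding distrib_right
    by (rule Bochner_Integration.integral_add[OF i[OF assms(1)] i[OF assms(2)]])
  then show ?thesis by (simp add: Edc_form_def sum.distrib)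
qed

context EN_module
begin

text \<open>\<open>mu\<close> has the sign of c and
  \<open>Re \<kappa> = - 2 * pi * Im \<tau> * mu\<close>. So each of the \<open>n * |c|\<close>
  copies contributes the sign of c when \<open>Im \<tau> < 0\<close> and its opposite when
  \<open>Im \<tau> > 0\<close>.\<close>

lemma index_EN:
  assumes \<tau>: "Im \<tau> \<noteq> 0" and nb: "hol_struct \<tau> act nb"
  shows "vspace.fred_on sc nb UNIV (if Im \<tau> < 0 then int n * c else - (int n * c))"
proof -
  define \<kappa> where "\<kappa> = 2 * pi * \<i> * \<tau> * of_real (mu \<theta> d c)"
  have Re: "Re \<kappa> = - (2 * pi * Im \<tau> * mu \<theta> d c)" by (simp add: \<kappa>_def)
  have mu: "mu \<theta> d c > 0 \<longleftrightarrow> c > 0" "mu \<theta> d c < 0 \<longleftrightarrow> c < 0"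
    using s_pos c0 by (auto simp: mu_def zero_less_divide_iff divide_less_0_iff)
  have card: "int (card Ind) = int n * \<bar>c\<bar>" by (simp add: Ind_def card_cartesian_product)
  have "mu \<theta> d c \<noteq> 0" using mu c0 by auto
  then have "Re \<kappa> \<noteq> 0" using Re \<tau> by simp
  then consider "Re \<kappa> > 0" | "Re \<kappa> < 0" by linarith
  then show ?thesis
  proof cases
    case 1
    interpret m: elliptic_model "{f. schwartz f}" sq "dk \<kappa>" "\<lambda>f x. gau \<kappa> x * wprim \<kappa> f x" "gau \<kappa>" "\<lambda>_. 0" "\<lambda>_. 0"
      by (rule elliptic_model_pos[OF 1])
    interpret EN_model \<theta> d c n act \<phi> \<kappa> "\<lambda>f x. gau \<kappa> x * wprim \<kappa> f x" "gau \<kappa>" "\<lambda>_. 0" "\<lambda>_. 0" by unfold_locales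
    have "gau \<kappa> \<noteq> (\<lambda>_. 0)" by (metis gau_nonzero)
    then have "m.index = 1" by (simp add: m.index_def)
    then have "fred_on nb UNIV (int n * \<bar>c\<bar>)" using fred_hol_struct[OF \<kappa>_def nb] card by simp
    moreover have "int n * \<bar>c\<bar> = (if Im \<tau> < 0 then int n * c else - (int n * c))"
      using 1 mu c0 \<tau> unfolding Re by (cases "Im \<tau> < 0"; cases "c > 0") (auto simp: zero_less_mult_iff mult_less_0_iff abs_if)
    ultimately show ?thesis by simp
  next
    case 2
    interpret k: neg_kappa \<kappa> by unfold_locales (rule 2)
    interpret m: elliptic_model "{f. schwartz f}" sq "dk \<kappa>" k.solve "\<lambda>_. 0" k.\<rho> "wint \<kappa>"
      by (rule k.elliptic_model)
    interpret EN_model \<theta> d c n act \<phi> \<kappa> k.solve "\<lambda>_. 0" k.\<rho> "wint \<kappa>" by unfold_locales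
    have "m.index = - 1" using k.\<rho>_nonzero by (simp add: m.index_def)
    then have "fred_on nb UNIV (- (int n * \<bar>c\<bar>))" using fred_hol_struct[OF \<kappa>_def nb] card by simp
    moreover have "- (int n * \<bar>c\<bar>) = (if Im \<tau> < 0 then int n * c else - (int n * c))"
      using 2 mu c0 \<tau> unfolding Re by (cases "Im \<tau> < 0"; cases "c > 0") (auto simp: zero_less_mult_iff mult_less_0_iff abs_if)
    ultimately show ?thesis by simp
  qed
qed

lemma hol_module_EN: "hol_module act \<theta> (\<lambda>x y. EN_form c n (\<phi> x) (\<phi> y)) (int n * c)"
proof -
  interpret vspace sc by (rule vspace_sc)
  show ?thesis
  proof unfold_locales
    show "EN_form c n (\<phi> (x + y)) (\<phi> z) = EN_form c n (\<phi> x) (\<phi> z) + EN_form c n (\<phi> y) (\<phi> z)" for x y z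
    proof -
      have "\<phi> (x + y) i = (\<lambda>t \<alpha>. \<phi> x i t \<alpha> + \<phi> y i t \<alpha>)" for i by (simp add: fun_eq_iff \<phi>_add)
      then show ?thesis unfolding EN_form_def sum.distrib[symmetric] by (simp add: Edc_form_add \<phi>_Edc)
    qed
    show "EN_form c n (\<phi> y) (\<phi> x) = cnj (EN_form c n (\<phi> x) (\<phi> y))" for x y
      by (simp add: EN_form_def Edc_form_cnj[of c "\<phi> y _"])
    show "EN_form c n (\<phi> (act x a)) (\<phi> y) = EN_form c n (\<phi> x) (\<phi> (act y (astar \<theta> a)))" if a: "rapid a" for x y a
      unfolding EN_form_def using s_pos
      by (intro sum.cong refl) (simp add: \<phi>_act a rapid_astar Edc_form_adjoint[OF \<phi>_Edc \<phi>_Edc c0 a])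
    show "x = 0" if 0: "EN_form c n (\<phi> x) (\<phi> x) = 0" for x
    proof (rule \<phi>_inj)
      fix i t \<alpha> assume i: "i < n"
      have "\<forall>i\<in>{..<n}. \<exists>u\<ge>0. Edc_form c (\<phi> x i) (\<phi> x i) = complex_of_real u" using Edc_form_definite(1)[OF \<phi>_Edc c0] by blast
      then obtain u where u: "\<And>i. i < n \<Longrightarrow> u i \<ge> 0" "\<And>i. i < n \<Longrightarrow> Edc_form c (\<phi> x i) (\<phi> x i) = complex_of_real (u i)"
        by (metis lessThan_iff)
      have "EN_form c n (\<phi> x) (\<phi> x) = complex_of_real (\<Sum>i<n. u i)" by (simp add: EN_form_def u)
      with 0 have "(\<Sum>i<n. u i) = 0" by (simp only: of_real_eq_0_iff)
      then have "u i = 0" using u(1) i by (subst (asm) sum_nonneg_eq_0_iff) auto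
      then show "\<phi> x i t \<alpha> = \<phi> 0 i t \<alpha>" using Edc_form_definite(2)[OF \<phi>_Edc[OF i] c0] u(2)[OF i] by (simp add: \<phi>_0)
    qed
    show "fred_on nb UNIV (if Im \<tau> < 0 then int n * c else - (int n * c))" if "Im \<tau> \<noteq> 0" "hol_struct \<tau> act nb" for \<tau> nb
      by (rule index_EN[OF that])
  qed (simp add: act_add)
qed

end

section \<open>The free modules\<close>

text \<open>Weighted sum norms are submultiplicative for the twisted product, so right
  multiplication is bounded in every order at once and the free modules need no commutator
  argument.\<close>

definition wnorm :: "nat \<Rightarrow> aelt \<Rightarrow> real" where
  "wnorm k a = infsum (\<lambda>p. wt p ^ k * cmod (a p)) UNIV"

lemma infsum_singleton_support:
  fixes f :: "'a \<Rightarrow> 'b :: {comm_monoid_add, t2_space}"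
  assumes "\<And>p. p \<noteq> p0 \<Longrightarrow> f p = 0" shows "infsum f UNIV = f p0"
proof -
  have "infsum f UNIV = infsum f {p0}" by (rule infsum_cong_neutral) (use assms in auto)
  then show ?thesis by simp
qed

lemma le_wnorm: "rapid a \<Longrightarrow> wt p ^ k * cmod (a p) \<le> wnorm k a"
  using finite_sum_le_infsum[OF rapid_summable, of a "{p}" k] by (simp add: wnorm_def)

lemma wnorm_mono:
  assumes "rapid a" "rapid b" "\<And>p. wt p ^ k * cmod (a p) \<le> C * (wt p ^ j * cmod (b p))"
  shows "wnorm k a \<le> C * wnorm j b"
  unfolding wnorm_def infsum_cmult_right'[symmetric]
  by (rule infsum_mono) (intro rapid_summable summable_on_cmult_right assms)+

lemma wnorm_nonneg: "0 \<le> wnorm k a"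
  unfolding wnorm_def by (rule infsum_nonneg) simp

lemma wnorm_add:
  assumes "rapid a" "rapid b" shows "wnorm k (\<lambda>p. a p + b p) \<le> wnorm k a + wnorm k b"
proof -
  have "wnorm k a + wnorm k b = infsum (\<lambda>p. wt p ^ k * cmod (a p) + wt p ^ k * cmod (b p)) UNIV"
    unfolding wnorm_def by (rule infsum_add[symmetric]) (intro rapid_summable assms)+
  moreover have "wnorm k (\<lambda>p. a p + b p) \<le> \<dots>"
    unfolding wnorm_def
  proof (rule infsum_mono)
    show "wt p ^ k * cmod (a p + b p) \<le> wt p ^ k * cmod (a p) + wt p ^ k * cmod (b p)" for p
      unfolding distrib_left[symmetric] by (intro mult_left_mono norm_triangle_ineq) simp
  qed (intro rapid_summable rapid_add summable_on_add assms)+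
  ultimately show ?thesis by simp
qed

lemma wnorm_cmult: "wnorm k (\<lambda>p. z * a p) = cmod z * wnorm k a"
  unfolding wnorm_def infsum_cmult_right'[symmetric] by (simp add: norm_mult mult_ac)

lemma wnorm_Suc: "rapid a \<Longrightarrow> wnorm k a \<le> wnorm (Suc k) a"
  using wnorm_mono[of a a k 1 "Suc k"] mult_right_mono[OF power_increasing[of k "Suc k" "wt _"]] wt_ge_1 by simp

lemma wnorm_0_eq_0: "rapid a \<Longrightarrow> wnorm 0 a = 0 \<Longrightarrow> a = (\<lambda>_. 0)"
  using le_wnorm[of a _ 0] by (auto simp: fun_eq_iff)

lemma wnorm_complete:
  assumes u: "\<And>j. rapid (u j)" and s: "\<And>k. summable (\<lambda>j. wnorm k (u j))"
  shows "\<exists>f. rapid f \<and> (\<lambda>N. wnorm 0 (\<lambda>p. f p - (\<Sum>j<N. u j p))) \<longlonglongrightarrow> 0"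
proof -
  define f where "f p = (\<Sum>j. u j p)" for p
  have sn: "summable (\<lambda>j. wt p ^ k * cmod (u j p))" for p k
    by (rule summable_comparison_test'[OF s[of k], of 0]) (simp add: le_wnorm u)
  then have sa: "summable (\<lambda>j. cmod (u j p))" for p using sn[of p 0] by simp
  have "rapid f" unfolding rapid_wt
  proof
    fix k
    have "wt p ^ k * cmod (f p) \<le> (\<Sum>j. wnorm k (u j))" for p
    proof -
      have "wt p ^ k * cmod (f p) \<le> wt p ^ k * (\<Sum>j. cmod (u j p))"
        unfolding f_def by (intro mult_left_mono summable_norm sa) simp
      also have "\<dots> = (\<Sum>j. wt p ^ k * cmod (u j p))" by (rule suminf_mult[OF sa, symmetric])
      also have "\<dots> \<le> (\<Sum>j. wnorm k (u j))" by (intro suminf_le le_wnorm u sn s)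
      finally show ?thesis .
    qed
    then show "\<exists>C. \<forall>p. wt p ^ k * cmod (f p) \<le> C" by blast
  qed
  have rs: "rapid (\<lambda>p. \<Sum>j<N. u j p)" for N
    by (induction N) (use rapid_aconst[of 0] in \<open>auto simp: aconst_def rapid_add u\<close>)
  have r: "rapid (\<lambda>p. f p - (\<Sum>j<N. u j p))" for N
    using rapid_add[OF \<open>rapid f\<close> rapid_cmult[OF rs[of N], of "-1"]] by simp
  have tail: "wnorm 0 (\<lambda>p. f p - (\<Sum>j<N. u j p)) \<le> (\<Sum>j. wnorm 0 (u j)) - (\<Sum>j<N. wnorm 0 (u j))" for N
  proof -
    have sh: "summable (\<lambda>j. wnorm 0 (u (j + N)))" by (rule summable_ignore_initial_segment[OF s])
    have sh': "summable (\<lambda>j. cmod (u (j + N) p))" for p by (rule summable_ignore_initial_segment[OF sa])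
    have "wnorm 0 (\<lambda>p. f p - (\<Sum>j<N. u j p)) \<le> (\<Sum>j. wnorm 0 (u (j + N)))"
      unfolding wnorm_def[of 0 "\<lambda>p. f p - _ p"]
    proof (rule infsum_le_finite_sums[OF rapid_summable[OF r]])
      fix F :: "(int \<times> int) set" assume F: "finite F"
      have "(\<Sum>p\<in>F. wt p ^ 0 * cmod (f p - (\<Sum>j<N. u j p))) \<le> (\<Sum>p\<in>F. \<Sum>j. cmod (u (j + N) p))"
      proof (rule sum_mono)
        fix p
        have "f p - (\<Sum>j<N. u j p) = (\<Sum>j. u (j + N) p)"
          unfolding f_def by (rule suminf_minus_initial_segment[symmetric]) (rule summable_norm_cancel[OF sa])
        then show "wt p ^ 0 * cmod (f p - (\<Sum>j<N. u j p)) \<le> (\<Sum>j. cmod (u (j + N) p))"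
          using summable_norm[OF sh'[of p]] by simp
      qed
      also have "\<dots> = (\<Sum>j. \<Sum>p\<in>F. cmod (u (j + N) p))" by (rule suminf_sum[symmetric]) (rule sh')
      also have "\<dots> \<le> (\<Sum>j. wnorm 0 (u (j + N)))"
      proof (rule suminf_le)
        show "(\<Sum>p\<in>F. cmod (u (j + N) p)) \<le> wnorm 0 (u (j + N))" for j
          using finite_sum_le_infsum[OF rapid_summable[OF u, of 0] F, of "j + N"] by (simp add: wnorm_def)
      qed (intro summable_sum sh sh')+
      finally show "(\<Sum>p\<in>F. wt p ^ 0 * cmod (f p - (\<Sum>j<N. u j p))) \<le> (\<Sum>j. wnorm 0 (u (j + N)))" .
    qed
    also have "\<dots> = (\<Sum>j. wnorm 0 (u j)) - (\<Sum>j<N. wnorm 0 (u j))"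
      by (rule suminf_minus_initial_segment[OF s])
    finally show ?thesis .
  qed
  have "(\<lambda>N. wnorm 0 (\<lambda>p. f p - (\<Sum>j<N. u j p))) \<longlonglongrightarrow> 0"
  proof (rule tendsto_sandwich[OF _ _ tendsto_const])
    have "(\<lambda>N. (\<Sum>j. wnorm 0 (u j)) - (\<Sum>j<N. wnorm 0 (u j))) \<longlonglongrightarrow> (\<Sum>j. wnorm 0 (u j)) - (\<Sum>j. wnorm 0 (u j))"
      by (intro tendsto_intros summable_LIMSEQ s)
    then show "(\<lambda>N. (\<Sum>j. wnorm 0 (u j)) - (\<Sum>j<N. wnorm 0 (u j))) \<longlonglongrightarrow> 0" by simp
  qed (auto simp: wnorm_nonneg tail)
  then show ?thesis using \<open>rapid f\<close> by blast
qed

text \<open>Truncation to the finitely many indices of weight at most \<open>1 / \<epsilon>\<close>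
  has finite rank; on the others the additional weight in \<open>wnorm 1\<close> gains the factor
  \<open>\<epsilon>\<close>.\<close>

lemma wnorm_rellich:
  assumes \<epsilon>: "\<epsilon> > 0" shows "\<exists>J l r C. carrier_approx {a. rapid a} wnorm J l r C \<epsilon>"
proof -
  define B where "B = {p. wt p \<le> 1 / \<epsilon>}"
  define r :: "int \<times> int \<Rightarrow> aelt" where "r p = (\<lambda>x. if x = p then 1 else 0)" for p
  have fB: "finite B"
  proof (rule finite_subset)
    let ?R = "\<lceil>1 / \<epsilon>\<rceil>"
    show "B \<subseteq> {- ?R..?R} \<times> {- ?R..?R}"
    proof
      fix p assume "p \<in> B"
      then have "\<bar>real_of_int (fst p)\<bar> \<le> of_int ?R" "\<bar>real_of_int (snd p)\<bar> \<le> of_int ?R"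
        using order_trans[OF wt_fst_le[of p]] order_trans[OF wt_snd_le[of p]] le_of_int_ceiling[of "1 / \<epsilon>"]
        unfolding B_def by (blast intro: order_trans)+
      then have "\<bar>fst p\<bar> \<le> ?R" "\<bar>snd p\<bar> \<le> ?R" by linarith+
      then show "p \<in> {- ?R..?R} \<times> {- ?R..?R}" by (cases p) auto
    qed
  qed simp
  show ?thesis
  proof (rule carrier_approxI[where A = B and l = "\<lambda>p f. f p" and r = r and C = 1])
    show "r p \<in> {a. rapid a}" for p
      unfolding mem_Collect_eq rapid_wt
    proof
      fix k
      have "wt x ^ k * cmod (r p x) \<le> wt p ^ k" for x by (simp add: r_def)
      then show "\<exists>C. \<forall>x. wt x ^ k * cmod (r p x) \<le> C" by blast
    qed
    show "cmod (f p) \<le> 1 * wnorm 0 f" if "f \<in> {a. rapid a}" for p f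
      using le_wnorm[of f p 0] that by simp
    fix f :: aelt assume "f \<in> {a. rapid a}"
    then have f: "rapid f" by simp
    have eq: "f x - (\<Sum>p\<in>B. f p * r p x) = (if x \<in> B then 0 else f x)" for x
      using fB by (simp add: r_def if_distrib cong: if_cong)
    have "rapid (\<lambda>x. if x \<in> B then 0 else f x)"
      by (rule rapid_dominated[OF f, where C = 1 and j = 0]) simp
    then have "wnorm 0 (\<lambda>x. if x \<in> B then 0 else f x) \<le> \<epsilon> * wnorm 1 f"
    proof (rule wnorm_mono[OF _ f])
      fix x
      have "1 * cmod (f x) \<le> (\<epsilon> * wt x) * cmod (f x)" if "x \<notin> B"
        using that \<epsilon> by (intro mult_right_mono) (auto simp: B_def field_simps)
      then show "wt x ^ 0 * cmod (if x \<in> B then 0 else f x) \<le> \<epsilon> * (wt x ^ 1 * cmod (f x))"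
        using \<epsilon> by (auto simp: mult.assoc)
    qed
    then show "wnorm 0 (\<lambda>x. f x - (\<Sum>p\<in>B. f p * r p x)) \<le> \<epsilon> * wnorm 1 f" by (simp only: eq)
  qed (use fB in auto)
qed

section \<open>The derivation of the algebra as a Fourier multiplier\<close>

definition symb :: "complex \<Rightarrow> int \<times> int \<Rightarrow> complex" where
  "symb \<tau> p = of_int (fst p) * \<tau> + of_int (snd p)"

definition tsolve :: "complex \<Rightarrow> aelt \<Rightarrow> aelt" where
  "tsolve \<tau> a = (\<lambda>p. if p = (0, 0) then 0 else a p / (2 * pi * \<i> * symb \<tau> p))"

lemma adelta_symb: "adelta \<tau> a = (\<lambda>p. 2 * pi * \<i> * symb \<tau> p * a p)"
  by (simp add: adelta_eq symb_def)

text \<open>The imaginary part \<open>m * Im \<tau>\<close> of the symbol controls m, and then n.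
  The factor 2 absorbs the summand 1 of the weight, since \<open>|m| + |n| \<ge> 1\<close> away from
  the origin.\<close>

lemma wt_le_symb:
  assumes \<tau>: "Im \<tau> \<noteq> 0" and p: "p \<noteq> (0, 0)"
  shows "wt p \<le> 2 * (1 / \<bar>Im \<tau>\<bar> + 1 + cmod \<tau> / \<bar>Im \<tau>\<bar>) * cmod (symb \<tau> p)"
proof -
  let ?m = "\<bar>real_of_int (fst p)\<bar>" and ?n = "\<bar>real_of_int (snd p)\<bar>" and ?L = "cmod (symb \<tau> p)"
  have t: "\<bar>Im \<tau>\<bar> > 0" using \<tau> by simp
  have "?m * \<bar>Im \<tau>\<bar> \<le> ?L" using abs_Im_le_cmod[of "symb \<tau> p"] by (simp add: symb_def abs_mult)
  then have m: "?m \<le> ?L / \<bar>Im \<tau>\<bar>" using t by (simp add: pos_le_divide_eq)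
  have "?n = cmod (symb \<tau> p - of_int (fst p) * \<tau>)" by (simp add: symb_def)
  also have "\<dots> \<le> ?L + ?m * cmod \<tau>" using norm_triangle_ineq4[of "symb \<tau> p" "of_int (fst p) * \<tau>"] by (simp add: norm_mult)
  also have "\<dots> \<le> ?L + ?L / \<bar>Im \<tau>\<bar> * cmod \<tau>" by (intro add_left_mono mult_right_mono m) simp
  finally have n: "?n \<le> ?L + ?L / \<bar>Im \<tau>\<bar> * cmod \<tau>" .
  have "fst p \<noteq> 0 \<or> snd p \<noteq> 0" using p by (cases p) auto
  then have "1 \<le> \<bar>fst p\<bar> + \<bar>snd p\<bar>" by linarith
  then have "1 \<le> ?m + ?n" by linarith
  moreover have "1 + x + y \<le> 2 * (x + y)" if "1 \<le> x + y" for x y :: real using that by simp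
  ultimately have "wt p \<le> 2 * (?m + ?n)" unfolding wt_def by blast
  also have "\<dots> \<le> 2 * (?L / \<bar>Im \<tau>\<bar> + (?L + ?L / \<bar>Im \<tau>\<bar> * cmod \<tau>))" by (intro mult_left_mono add_mono m n) simp
  finally have "wt p \<le> 2 * (?L / \<bar>Im \<tau>\<bar> + (?L + ?L / \<bar>Im \<tau>\<bar> * cmod \<tau>))" .
  then show ?thesis by (simp add: algebra_simps)
qed

lemma symb_nonzero: "Im \<tau> \<noteq> 0 \<Longrightarrow> p \<noteq> (0, 0) \<Longrightarrow> symb \<tau> p \<noteq> 0"
  using wt_le_symb[of \<tau> p] wt_pos[of p] by (metis less_le_not_le mult_zero_right norm_zero)

lemma tsolve_bound:
  assumes \<tau>: "Im \<tau> \<noteq> 0"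
  shows "wt p * cmod (tsolve \<tau> a p) \<le> 2 * (1 / \<bar>Im \<tau>\<bar> + 1 + cmod \<tau> / \<bar>Im \<tau>\<bar>) * cmod (a p)" (is "_ \<le> ?A * _")
proof (cases "p = (0, 0)")
  case False
  have L: "cmod (symb \<tau> p) > 0" using symb_nonzero[OF \<tau> False] by simp
  have A: "?A \<ge> 0" by simp
  have "1 \<le> 2 * pi" using pi_ge_two by linarith
  then have "1 * cmod (symb \<tau> p) \<le> 2 * pi * cmod (symb \<tau> p)" by (intro mult_right_mono) auto
  then have "?A * cmod (symb \<tau> p) \<le> ?A * (2 * pi * cmod (symb \<tau> p))" using A by (intro mult_left_mono) auto
  then have "wt p \<le> ?A * (2 * pi * cmod (symb \<tau> p))" using wt_le_symb[OF \<tau> False] by linarith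
  then have "wt p / (2 * pi * cmod (symb \<tau> p)) \<le> ?A" using L by (subst pos_divide_le_eq) auto
  then have "wt p / (2 * pi * cmod (symb \<tau> p)) * cmod (a p) \<le> ?A * cmod (a p)" by (rule mult_right_mono) simp
  then show ?thesis using False by (simp add: tsolve_def norm_divide norm_mult)
qed (simp add: tsolve_def)

lemma rapid_tsolve: "Im \<tau> \<noteq> 0 \<Longrightarrow> rapid a \<Longrightarrow> rapid (tsolve \<tau> a)"
proof -
  assume \<tau>: "Im \<tau> \<noteq> 0" and a: "rapid a"
  have "cmod (tsolve \<tau> a p) \<le> 2 * (1 / \<bar>Im \<tau>\<bar> + 1 + cmod \<tau> / \<bar>Im \<tau>\<bar>) * wt p ^ 0 * cmod (a p)" for p
  proof -
    have "1 * cmod (tsolve \<tau> a p) \<le> wt p * cmod (tsolve \<tau> a p)" by (intro mult_right_mono wt_ge_1) simp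
    then show ?thesis using tsolve_bound[OF \<tau>, of p a] by simp
  qed
  then show ?thesis by (rule rapid_dominated[OF a])
qed

text \<open>The symbol vanishes only at the zero mode, so the constants span both the kernel and a
  complement of the image, and the index is 0.\<close>

lemma elliptic_model_torus:
  assumes \<tau>: "Im \<tau> \<noteq> 0"
  shows "elliptic_model {a. rapid a} wnorm (adelta \<tau>) (tsolve \<tau>) (aconst 1) (aconst 1) (\<lambda>a. a (0, 0))"
proof unfold_locales
  note s0 = symb_nonzero[OF \<tau>]
  have s00: "symb \<tau> (0, 0) = 0" by (simp add: symb_def)
  show "(\<lambda>_. 0) \<in> {a. rapid a}" using rapid_aconst[of 0] by (simp add: aconst_def)
  show "\<exists>f\<in>{a. rapid a}. (\<lambda>N. wnorm 0 (\<lambda>x. f x - (\<Sum>j<N. u j x))) \<longlonglongrightarrow> 0"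
    if "\<And>j. u j \<in> {a. rapid a}" "\<And>k. summable (\<lambda>j. wnorm k (u j))" for u
    using wnorm_complete[of u] that by auto
  show "\<exists>C. \<forall>f\<in>{a. rapid a}. wnorm (Suc k) (tsolve \<tau> f) \<le> C * wnorm k f" for k
  proof (intro exI ballI)
    fix f assume "f \<in> {a. rapid a}"
    then have f: "rapid f" by simp
    show "wnorm (Suc k) (tsolve \<tau> f) \<le> 2 * (1 / \<bar>Im \<tau>\<bar> + 1 + cmod \<tau> / \<bar>Im \<tau>\<bar>) * wnorm k f"
    proof (rule wnorm_mono[OF rapid_tsolve[OF \<tau> f] f])
      fix p
      show "wt p ^ Suc k * cmod (tsolve \<tau> f p) \<le> 2 * (1 / \<bar>Im \<tau>\<bar> + 1 + cmod \<tau> / \<bar>Im \<tau>\<bar>) * (wt p ^ k * cmod (f p))"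
        using mult_left_mono[OF tsolve_bound[OF \<tau>, of p f], of "wt p ^ k"] by (simp add: mult_ac)
    qed
  qed
  show "adelta \<tau> (tsolve \<tau> f) = (\<lambda>p. f p - f (0, 0) * aconst 1 p)" for f
    using s0 s00 by (auto simp: adelta_symb tsolve_def aconst_def fun_eq_iff)
  show "adelta \<tau> f = (\<lambda>_. 0) \<longleftrightarrow> (\<exists>c. f = (\<lambda>p. c * aconst 1 p))" for f
  proof
    assume *: "adelta \<tau> f = (\<lambda>_. 0)"
    have "f p = 0" if "p \<noteq> (0, 0)" for p using s0[OF that] fun_cong[OF *, of p] by (simp add: adelta_symb)
    then have "f = (\<lambda>p. f (0, 0) * aconst 1 p)" by (auto simp: aconst_def fun_eq_iff)
    then show "\<exists>c. f = (\<lambda>p. c * aconst 1 p)" by blast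
  next
    assume "\<exists>c. f = (\<lambda>p. c * aconst 1 p)"
    then obtain c where c: "f = (\<lambda>p. c * aconst 1 p)" ..
    show "adelta \<tau> f = (\<lambda>_. 0)"
    proof
      show "adelta \<tau> f p = 0" for p by (cases "p = (0, 0)") (simp_all add: c adelta_symb aconst_def s00)
    qed
  qed
  show "adelta \<tau> f = (\<lambda>_. 0)" if "adelta \<tau> f = (\<lambda>p. c * aconst 1 p)" for f c
  proof -
    from fun_cong[OF that, of "(0, 0)"] have "c = 0" by (simp add: adelta_symb s00 aconst_def)
    then show ?thesis using that by simp
  qed
  show "f = (\<lambda>_. 0)" if "f \<in> {a. rapid a}" "wnorm 0 f = 0" for f using wnorm_0_eq_0 that by blast
  show "adelta \<tau> f \<in> {a. rapid a}" "tsolve \<tau> f \<in> {a. rapid a}" if "f \<in> {a. rapid a}" for f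
    using that rapid_adelta rapid_tsolve[OF \<tau>] by blast+
qed (auto simp: rapid_add rapid_cmult rapid_aconst wnorm_nonneg wnorm_add wnorm_cmult
    wnorm_Suc wnorm_rellich adelta_eq tsolve_def fun_eq_iff algebra_simps add_divide_distrib)

section \<open>The product and the trace form on the algebra\<close>

lemma wt_add_le: "wt (p + q) \<le> wt p * wt q"
proof -
  let ?x = "\<bar>real_of_int (fst p)\<bar> + \<bar>real_of_int (snd p)\<bar>" and ?y = "\<bar>real_of_int (fst q)\<bar> + \<bar>real_of_int (snd q)\<bar>"
  have "wt (p + q) \<le> 1 + (?x + ?y)"
    using abs_triangle_ineq[of "real_of_int (fst p)" "real_of_int (fst q)"]
      abs_triangle_ineq[of "real_of_int (snd p)" "real_of_int (snd q)"] unfolding wt_def by simp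
  also have "\<dots> \<le> (1 + ?x) * (1 + ?y)" by (simp add: distrib_left distrib_right)
  finally show ?thesis by (simp add: wt_def add.assoc)
qed

text \<open>The phase acquired when the U2-power of the first monomial is moved past the U1-power of
  the second.\<close>

definition ph :: "real \<Rightarrow> int \<times> int \<Rightarrow> int \<times> int \<Rightarrow> complex" where
  "ph \<theta> p q = ee (- \<theta> * of_int (snd p) * of_int (fst q))"

lemma norm_ph [simp]: "cmod (ph \<theta> p q) = 1"
  by (simp add: ph_def)

lemma amult_eq: "amult \<theta> a b r = infsum (\<lambda>p. a p * b (r - p) * ph \<theta> p (r - p)) UNIV"
proof (cases r)
  case (Pair u v)
  show ?thesis unfolding amult_def Pair prod.case
  proof (rule infsum_cong)
    fix p :: "int \<times> int"
    show "(case p of (m, n) \<Rightarrow> a (m, n) * b (u - m, v - n) *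
        exp (- 2 * pi * \<i> * complex_of_real \<theta> * of_int n * of_int (u - m))) = a p * b ((u, v) - p) * ph \<theta> p ((u, v) - p)"
      by (cases p) (simp add: ph_def ee_def mult_ac)
  qed
qed

text \<open>The change of variables from \<open>(r, p)\<close> to \<open>(p, r - p)\<close> reduces
  it to a product of two sums, with \<open>wt_add_le\<close> distributing the weight.\<close>

lemma convolution_summable:
  assumes a: "rapid a" and b: "rapid b"
  shows "(\<lambda>(r, p). wt r ^ k * (cmod (a p) * cmod (b (r - p)))) summable_on UNIV"
    "infsum (\<lambda>(r, p). wt r ^ k * (cmod (a p) * cmod (b (r - p)))) UNIV \<le> wnorm k a * wnorm k b"
proof -
  let ?G = "\<lambda>(p, q). (wt p ^ k * cmod (a p)) * (wt q ^ k * cmod (b q))"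
  let ?h = "\<lambda>(r :: int \<times> int, p). (p, r - p)"
  have hs: "((\<lambda>q. ?G (p, q)) has_sum wt p ^ k * cmod (a p) * wnorm k b) UNIV" for p
    using has_sum_cmult_right[OF has_sum_infsum[OF rapid_summable[OF b, of k]], of "wt p ^ k * cmod (a p)"]
    by (simp add: wnorm_def)
  have sG: "?G summable_on UNIV \<times> UNIV"
  proof (rule summable_on_SigmaI[OF hs])
    show "(\<lambda>p. wt p ^ k * cmod (a p) * wnorm k b) summable_on UNIV"
      by (rule summable_on_cmult_left[OF rapid_summable[OF a]])
  qed auto
  have "infsum ?G (UNIV \<times> UNIV) = infsum (\<lambda>p. infsum (\<lambda>q. ?G (p, q)) UNIV) UNIV"
    by (rule infsum_Sigma_banach[OF sG, symmetric])
  also have "\<dots> = wnorm k a * wnorm k b"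
    unfolding infsumI[OF hs] by (subst infsum_cmult_left') (simp add: wnorm_def)
  finally have iG: "infsum ?G UNIV = wnorm k a * wnorm k b" by simp
  have bij: "bij_betw ?h UNIV UNIV"
    by (rule bij_betw_byWitness[where f' = "\<lambda>(p, q). (p + q, p)"]) auto
  have s: "(\<lambda>rp. ?G (?h rp)) summable_on UNIV" using sG summable_on_reindex_bij_betw[OF bij, of ?G] by simp
  have le: "(case rp of (r, p) \<Rightarrow> wt r ^ k * (cmod (a p) * cmod (b (r - p)))) \<le> ?G (?h rp)" for rp
  proof -
    obtain r p where Pair: "rp = (r, p)" by (rule prod.exhaust)
    have "wt r ^ k \<le> (wt p * wt (r - p)) ^ k" using wt_add_le[of p "r - p"] by (intro power_mono) auto
    then have "wt r ^ k * (cmod (a p) * cmod (b (r - p))) \<le> (wt p * wt (r - p)) ^ k * (cmod (a p) * cmod (b (r - p)))"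
      by (rule mult_right_mono) simp
    then show ?thesis by (simp add: Pair power_mult_distrib mult_ac)
  qed
  show S: "(\<lambda>(r, p). wt r ^ k * (cmod (a p) * cmod (b (r - p)))) summable_on UNIV"
    by (rule summable_on_comparison_test[OF s]) (use le in \<open>auto simp: case_prod_beta\<close>)
  have "infsum (\<lambda>(r, p). wt r ^ k * (cmod (a p) * cmod (b (r - p)))) UNIV \<le> infsum (\<lambda>rp. ?G (?h rp)) UNIV"
    by (rule infsum_mono[OF S s le])
  also have "\<dots> = wnorm k a * wnorm k b" using infsum_reindex_bij_betw[OF bij, of ?G] iG by simp
  finally show "infsum (\<lambda>(r, p). wt r ^ k * (cmod (a p) * cmod (b (r - p)))) UNIV \<le> wnorm k a * wnorm k b" .
qed

lemma amult_abs_summable: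
  assumes "rapid a" "rapid b"
  shows "(\<lambda>p. cmod (a p * b (r - p) * ph \<theta> p (r - p))) summable_on UNIV"
  using summable_on_SigmaD1[of "\<lambda>r p. wt r ^ 0 * (cmod (a p) * cmod (b (r - p)))" UNIV "\<lambda>_. UNIV" r]
    convolution_summable(1)[OF assms, of 0] by (simp add: norm_mult)

lemma amult_summable:
  assumes "rapid a" "rapid b" shows "(\<lambda>p. a p * b (r - p) * ph \<theta> p (r - p)) summable_on UNIV"
  by (rule abs_summable_summable[OF amult_abs_summable[OF assms]])

text \<open>The phases have modulus 1, so the estimate for the untwisted convolution carries
  over.\<close>

lemma
  assumes a: "rapid a" and b: "rapid b"
  shows rapid_amult: "rapid (amult \<theta> a b)" and wnorm_amult: "wnorm k (amult \<theta> a b) \<le> wnorm k a * wnorm k b"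
proof -
  define s where "s k r = infsum (\<lambda>p. wt r ^ k * (cmod (a p) * cmod (b (r - p)))) UNIV" for k r
  have S: "(\<lambda>(r, p). wt r ^ k * (cmod (a p) * cmod (b (r - p)))) summable_on (UNIV \<times> UNIV)" for k
    using convolution_summable(1)[OF a b, of k] by simp
  have ss: "s k summable_on UNIV" for k using summable_on_Sigma_banach[OF S[of k]] by (simp add: s_def[abs_def])
  have si: "infsum (s k) UNIV \<le> wnorm k a * wnorm k b" for k
    using infsum_Sigma_banach[OF S[of k]] convolution_summable(2)[OF a b, of k] by (simp add: s_def[abs_def])
  have le: "wt r ^ k * cmod (amult \<theta> a b r) \<le> s k r" for k r
  proof -
    have "cmod (amult \<theta> a b r) \<le> infsum (\<lambda>p. cmod (a p * b (r - p) * ph \<theta> p (r - p))) UNIV"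
      unfolding amult_eq by (rule norm_infsum_bound[OF amult_abs_summable[OF a b]])
    also have "\<dots> = infsum (\<lambda>p. cmod (a p) * cmod (b (r - p))) UNIV" by (simp add: norm_mult)
    finally have "wt r ^ k * cmod (amult \<theta> a b r) \<le> wt r ^ k * infsum (\<lambda>p. cmod (a p) * cmod (b (r - p))) UNIV"
      by (rule mult_left_mono) simp
    then show ?thesis unfolding s_def infsum_cmult_right' .
  qed
  have snn: "s k r \<ge> 0" for k r unfolding s_def by (rule infsum_nonneg) simp
  show R: "rapid (amult \<theta> a b)" unfolding rapid_wt
  proof
    fix k
    have "wt r ^ k * cmod (amult \<theta> a b r) \<le> infsum (s k) UNIV" for r
      using le[of r k] finite_sum_le_infsum[OF ss[of k], of "{r}"] snn by (fastforce intro: order_trans)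
    then show "\<exists>C. \<forall>p. wt p ^ k * cmod (amult \<theta> a b p) \<le> C" by blast
  qed
  have "wnorm k (amult \<theta> a b) \<le> infsum (s k) UNIV"
    unfolding wnorm_def by (rule infsum_mono[OF rapid_summable[OF R] ss le])
  then show "wnorm k (amult \<theta> a b) \<le> wnorm k a * wnorm k b" using si[of k] by linarith
qed

lemma adelta_amult:
  assumes a: "rapid a" and b: "rapid b"
  shows "adelta \<tau> (amult \<theta> a b) = (\<lambda>r. amult \<theta> (adelta \<tau> a) b r + amult \<theta> a (adelta \<tau> b) r)"
proof
  fix r
  have L: "symb \<tau> r = symb \<tau> p + symb \<tau> (r - p)" for p by (simp add: symb_def algebra_simps)
  have "adelta \<tau> (amult \<theta> a b) r = infsum (\<lambda>p. (2 * pi * \<i> * symb \<tau> r) * (a p * b (r - p) * ph \<theta> p (r - p))) UNIV"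
    unfolding adelta_symb amult_eq by (rule infsum_cmult_right'[symmetric])
  also have "\<dots> = infsum (\<lambda>p. adelta \<tau> a p * b (r - p) * ph \<theta> p (r - p) + a p * adelta \<tau> b (r - p) * ph \<theta> p (r - p)) UNIV"
  proof (rule infsum_cong)
    fix p
    show "(2 * pi * \<i> * symb \<tau> r) * (a p * b (r - p) * ph \<theta> p (r - p)) =
      adelta \<tau> a p * b (r - p) * ph \<theta> p (r - p) + a p * adelta \<tau> b (r - p) * ph \<theta> p (r - p)"
      unfolding adelta_symb L[of p] by (simp add: algebra_simps)
  qed
  also have "\<dots> = amult \<theta> (adelta \<tau> a) b r + amult \<theta> a (adelta \<tau> b) r"
    unfolding amult_eq by (rule infsum_add) (intro amult_summable rapid_adelta a b)+
  finally show "adelta \<tau> (amult \<theta> a b) r = amult \<theta> (adelta \<tau> a) b r + amult \<theta> a (adelta \<tau> b) r" .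
qed

lemma amult_aconst: "amult \<theta> (aconst z) b = (\<lambda>r. z * b r)" "amult \<theta> a (aconst z) = (\<lambda>r. z * a r)"
proof -
  have c: "aconst z p = (if p = 0 then z else 0)" for p by (simp add: aconst_def zero_prod_def)
  have "amult \<theta> (aconst z) b r = aconst z 0 * b (r - 0) * ph \<theta> 0 (r - 0)" for r
    unfolding amult_eq by (rule infsum_singleton_support) (simp add: c)
  then show "amult \<theta> (aconst z) b = (\<lambda>r. z * b r)" by (simp add: c ph_def fun_eq_iff)
  have "amult \<theta> a (aconst z) r = a r * aconst z (r - r) * ph \<theta> r (r - r)" for r
    unfolding amult_eq by (rule infsum_singleton_support) (simp add: c)
  then show "amult \<theta> a (aconst z) = (\<lambda>r. z * a r)" by (simp add: c ph_def fun_eq_iff)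
qed

lemma amult_add:
  assumes "rapid a" "rapid a'" "rapid b"
  shows "amult \<theta> (\<lambda>p. a p + a' p) b r = amult \<theta> a b r + amult \<theta> a' b r"
  unfolding amult_eq distrib_right by (rule infsum_add) (intro amult_summable assms)+

lemma amult_0: "amult \<theta> (\<lambda>_. 0) b = (\<lambda>_. 0)"
  by (simp add: amult_eq fun_eq_iff)

definition aform :: "aelt \<Rightarrow> aelt \<Rightarrow> complex" where
  "aform a b = infsum (\<lambda>p. a p * cnj (b p)) UNIV"

text \<open>The phase of the star cancels that of the product, so the trace form is the plain
  square-summable inner product of coefficients.\<close>

lemma atr_amult_astar: "atr (amult \<theta> a (astar \<theta> b)) = aform a b"
proof -
  have "ee (- \<theta> * of_int (fst (- p)) * of_int (snd (- p))) * ph \<theta> p (- p) = 1" for p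
    unfolding ph_def ee_add[symmetric] by (simp add: algebra_simps)
  then have "astar \<theta> b (- p) * ph \<theta> p (- p) = cnj (b p)" for p
    unfolding astar_eq mult.assoc by simp
  then show ?thesis
    unfolding atr_def amult_eq aform_def by (simp add: mult.assoc flip: zero_prod_def)
qed

lemma aform_summable:
  assumes "rapid a" "rapid b" shows "(\<lambda>p. a p * cnj (b p)) summable_on UNIV"
proof (rule abs_summable_summable, rule summable_on_comparison_test)
  show "(\<lambda>p. cmod (a p) * wnorm 0 b) summable_on UNIV"
    by (rule summable_on_cmult_left[OF rapid_abs_summable[OF assms(1)]])
  show "norm (a p * cnj (b p)) \<le> cmod (a p) * wnorm 0 b" for p
    using mult_left_mono[OF le_wnorm[OF assms(2), of p 0], of "cmod (a p)"] by (simp add: norm_mult)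
qed simp

lemma aform_add: "rapid a \<Longrightarrow> rapid a' \<Longrightarrow> rapid b \<Longrightarrow> aform (\<lambda>p. a p + a' p) b = aform a b + aform a' b"
  unfolding aform_def distrib_right by (rule infsum_add) (intro aform_summable, assumption+)+

lemma aform_cnj: "aform b a = cnj (aform a b)"
  unfolding aform_def infsum_cnj[symmetric] by (simp add: mult.commute)

lemma aform_definite:
  assumes a: "rapid a"
  shows "\<exists>t\<ge>0. aform a a = complex_of_real t" "aform a a = 0 \<Longrightarrow> a = (\<lambda>_. 0)"
proof -
  have nn: "Re (a p * cnj (a p)) = (cmod (a p))\<^sup>2" "Im (a p * cnj (a p)) = 0" for p
    by (simp_all flip: complex_norm_square)
  note s = aform_summable[OF a a]
  have Re: "Re (aform a a) = infsum (\<lambda>p. (cmod (a p))\<^sup>2) UNIV"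
    unfolding aform_def infsum_Re[OF s, symmetric] nn ..
  have Im: "Im (aform a a) = 0" unfolding aform_def infsum_Im[OF s, symmetric] nn by simp
  have "aform a a = complex_of_real (infsum (\<lambda>p. (cmod (a p))\<^sup>2) UNIV)"
    using Re Im by (simp add: complex_eq_iff)
  moreover have "infsum (\<lambda>p. (cmod (a p))\<^sup>2) UNIV \<ge> 0" by (rule infsum_nonneg) simp
  ultimately show "\<exists>t\<ge>0. aform a a = complex_of_real t" by blast
  assume 0: "aform a a = 0"
  have sq: "(\<lambda>p. (cmod (a p))\<^sup>2) summable_on UNIV" using summable_on_Re[OF s] unfolding nn .
  have "(cmod (a p))\<^sup>2 = 0" for p
    by (rule nonneg_infsum_le_0D[OF _ sq]) (use Re 0 in auto)
  then show "a = (\<lambda>_. 0)" by (simp add: fun_eq_iff)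
qed

text \<open>Both sides are double sums over r and p that differ by the order of summation, once the
  phase of the product is identified with that of the star.\<close>

lemma aform_amult:
  assumes x: "rapid x" and y: "rapid y" and a: "rapid a"
  shows "aform (amult \<theta> x a) y = aform x (amult \<theta> y (astar \<theta> a))"
proof -
  let ?F = "\<lambda>r p. x p * a (r - p) * ph \<theta> p (r - p) * cnj (y r)"
  have phase: "ph \<theta> p (r - p) * cnj (y r) * a (r - p) = cnj (y r * astar \<theta> a (p - r) * ph \<theta> r (p - r))" for p r
  proof -
    have "cnj (astar \<theta> a (p - r)) = a (r - p) * ee (\<theta> * of_int (fst (p - r)) * of_int (snd (p - r)))"
      by (simp add: astar_eq cnj_ee)
    moreover have "ee (\<theta> * of_int (fst (p - r)) * of_int (snd (p - r))) * cnj (ph \<theta> r (p - r)) = ph \<theta> p (r - p)"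
      unfolding ph_def cnj_ee ee_add[symmetric] by (simp add: algebra_simps)
    ultimately show ?thesis by (simp add: mult_ac)
  qed
  have S: "(\<lambda>(r, p). ?F r p) summable_on (UNIV \<times> UNIV)"
  proof (rule abs_summable_summable, rule summable_on_comparison_test)
    show "(\<lambda>rp. (case rp of (r, p) \<Rightarrow> wt r ^ 0 * (cmod (x p) * cmod (a (r - p)))) * wnorm 0 y) summable_on (UNIV \<times> UNIV)"
      using summable_on_cmult_left[OF convolution_summable(1)[OF x a, of 0]] by simp
    show "norm (case rp of (r, p) \<Rightarrow> ?F r p) \<le> (case rp of (r, p) \<Rightarrow> wt r ^ 0 * (cmod (x p) * cmod (a (r - p)))) * wnorm 0 y" for rp
      using le_wnorm[OF y, of "fst rp" 0] by (auto simp: case_prod_beta norm_mult intro!: mult_left_mono)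
  qed simp
  have "aform (amult \<theta> x a) y = infsum (\<lambda>r. infsum (\<lambda>p. ?F r p) UNIV) UNIV"
    unfolding aform_def amult_eq by (simp only: infsum_cmult_left')
  also have "\<dots> = infsum (\<lambda>p. infsum (\<lambda>r. ?F r p) UNIV) UNIV" by (rule infsum_swap_banach[OF S])
  also have "\<dots> = infsum (\<lambda>p. x p * infsum (\<lambda>r. cnj (y r * astar \<theta> a (p - r) * ph \<theta> r (p - r))) UNIV) UNIV"
    unfolding infsum_cmult_right'[symmetric] phase[symmetric] by (simp add: mult_ac)
  also have "\<dots> = aform x (amult \<theta> y (astar \<theta> a))" unfolding aform_def amult_eq infsum_cnj ..
  finally show ?thesis .
qed

section \<open>Index and Hermitian form of the free modules\<close>

locale AN_module =
  fixes \<theta> :: real and n :: nat and act :: "'e::ab_group_add \<Rightarrow> aelt \<Rightarrow> 'e" and \<phi> :: "'e \<Rightarrow> nat \<Rightarrow> aelt"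
  assumes iso: "mod_iso act (AN_carrier n) AN_add (AN_act \<theta>) \<phi>"
begin

abbreviation sc :: "complex \<Rightarrow> 'e \<Rightarrow> 'e" where "sc \<equiv> \<lambda>z e. act e (aconst z)"

lemma \<phi>_carrier: "\<phi> e \<in> AN_carrier n"
  using iso unfolding mod_iso_def bij_betw_def by blast

lemma \<phi>_rapid: "i < n \<Longrightarrow> rapid (\<phi> e i)" and \<phi>_out: "\<not> i < n \<Longrightarrow> \<phi> e i = (\<lambda>_. 0)"
  using \<phi>_carrier[of e] by (auto simp: AN_carrier_def Atheta_def)

lemma \<phi>_inj: "(\<And>i. i < n \<Longrightarrow> \<phi> e i = \<phi> e' i) \<Longrightarrow> e = e'"
proof -
  assume *: "\<And>i. i < n \<Longrightarrow> \<phi> e i = \<phi> e' i"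
  have "\<phi> e i = \<phi> e' i" for i by (cases "i < n") (simp_all add: * \<phi>_out)
  then have "\<phi> e = \<phi> e'" by blast
  then show ?thesis using iso unfolding mod_iso_def bij_betw_def by (auto dest: injD)
qed

lemma \<phi>_surj: "F \<in> AN_carrier n \<Longrightarrow> \<exists>e. \<phi> e = F"
proof -
  have "range \<phi> = AN_carrier n" using iso unfolding mod_iso_def bij_betw_def by blast
  then show "F \<in> AN_carrier n \<Longrightarrow> \<exists>e. \<phi> e = F" by (metis imageE)
qed

lemma \<phi>_add: "\<phi> (x + y) i = (\<lambda>p. \<phi> x i p + \<phi> y i p)"
  using iso by (simp add: mod_iso_def AN_add_def)

lemma \<phi>_act: "rapid a \<Longrightarrow> \<phi> (act e a) i = amult \<theta> (\<phi> e i) a"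
  using iso by (simp add: mod_iso_def AN_act_def Atheta_def)

lemma \<phi>_sc: "\<phi> (sc z e) i = (\<lambda>p. z * \<phi> e i p)"
  by (simp add: \<phi>_act rapid_aconst amult_aconst)

lemma \<phi>_0: "\<phi> 0 i = (\<lambda>_. 0)"
  using \<phi>_add[of 0 0 i] by (simp add: fun_eq_iff)

lemma \<phi>_sum: "\<phi> (\<Sum>j\<in>J. f j) i p = (\<Sum>j\<in>J. \<phi> (f j) i p)"
  by (induction J rule: infinite_finite_induct) (simp_all add: \<phi>_0 \<phi>_add)

lemma vspace_sc: "vspace sc"
  unfolding vspace_def
  by unfold_locales (rule \<phi>_inj, simp add: \<phi>_add \<phi>_sc algebra_simps)+

lemma act_add: "rapid a \<Longrightarrow> act (x + y) a = act x a + act y a"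
  by (rule \<phi>_inj) (simp add: \<phi>_add \<phi>_act amult_add[OF \<phi>_rapid \<phi>_rapid] fun_eq_iff)

lemma act_diff: "rapid a \<Longrightarrow> act (x - y) a = act x a - act y a"
  using act_add[of a "x - y" y] by simp

definition gen :: "nat \<Rightarrow> 'e" where
  "gen j = (SOME e. \<phi> e = (\<lambda>i. if i < n \<and> i = j then aconst 1 else (\<lambda>_. 0)))"

lemma \<phi>_gen: "\<phi> (gen j) = (\<lambda>i. if i < n \<and> i = j then aconst 1 else (\<lambda>_. 0))"
proof -
  have "rapid (\<lambda>_. 0)" using rapid_aconst[of 0] by (simp add: aconst_def)
  then have "(\<lambda>i. if i < n \<and> i = j then aconst 1 else (\<lambda>_. 0)) \<in> AN_carrier n"
    by (auto simp: AN_carrier_def Atheta_def rapid_aconst)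
  from someI_ex[OF \<phi>_surj[OF this]] show ?thesis unfolding gen_def .
qed

lemma reconstruction: "e = (\<Sum>j<n. act (gen j) (\<phi> e j))"
proof (rule \<phi>_inj)
  fix i assume i: "i < n"
  show "\<phi> e i = \<phi> (\<Sum>j<n. act (gen j) (\<phi> e j)) i"
  proof
    fix p
    have "\<phi> (\<Sum>j<n. act (gen j) (\<phi> e j)) i p = (\<Sum>j<n. if j = i then \<phi> e j p else 0)"
      unfolding \<phi>_sum using i
      by (intro sum.cong refl) (auto simp: \<phi>_act \<phi>_rapid \<phi>_gen amult_aconst amult_0)
    then show "\<phi> e i p = \<phi> (\<Sum>j<n. act (gen j) (\<phi> e j)) i p" using i by simp
  qed
qed

text \<open>The unit vectors \<open>gen j\<close> give an exact finite basis with the coordinates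
  themselves as coefficients. Submultiplicativity of \<open>wnorm\<close> then bounds the A-linear
  difference T in each order directly.\<close>

lemma index_AN:
  assumes \<tau>: "Im \<tau> \<noteq> 0" and nb: "hol_struct \<tau> act nb"
  shows "vspace.fred_on sc nb UNIV 0"
proof -
  interpret m: elliptic_model "{a. rapid a}" wnorm "adelta \<tau>" "tsolve \<tau>" "aconst 1" "aconst 1" "\<lambda>a. a (0, 0)"
    by (rule elliptic_model_torus[OF \<tau>])
  interpret v: vspace sc by (rule vspace_sc)
  interpret elliptic_sum "{a. rapid a}" wnorm "adelta \<tau>" "tsolve \<tau>" "aconst 1" "aconst 1" "\<lambda>a. a (0, 0)" sc "{..<n}" \<phi>
  proof unfold_locales
    show "\<exists>e. \<forall>i\<in>{..<n}. \<phi> e i = f i" if *: "\<And>i. i \<in> {..<n} \<Longrightarrow> f i \<in> {a. rapid a}" for f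
    proof -
      have "(\<lambda>i. if i < n then f i else (\<lambda>_. 0)) \<in> AN_carrier n"
        using * by (auto simp: AN_carrier_def Atheta_def)
      then obtain e where "\<phi> e = (\<lambda>i. if i < n then f i else (\<lambda>_. 0))" using \<phi>_surj by blast
      then show ?thesis by (intro exI[of _ e]) simp
    qed
  qed (auto simp: \<phi>_rapid \<phi>_add \<phi>_sc intro: \<phi>_inj)
  define T where "T e = nb e - lift (adelta \<tau>) e" for e
  have \<phi>_lift: "\<phi> (lift (adelta \<tau>) e) i = adelta \<tau> (\<phi> e i)" if "i < n" for e i
    using that by (intro comp_lift) (auto intro: rapid_adelta)
  have add: "nb (x + y) = nb x + nb y" and leib: "rapid a \<Longrightarrow> nb (act e a) = act (nb e) a + act e (adelta \<tau> a)" for x y e a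
    using nb by (simp_all add: hol_struct_def Atheta_def)
  have lin: "a_linear act T"
    unfolding a_linear_def
  proof (intro conjI allI impI)
    have "lift (adelta \<tau>) (x + y) = lift (adelta \<tau>) x + lift (adelta \<tau>) y" for x y
      by (rule \<phi>_inj) (simp add: \<phi>_lift \<phi>_add adelta_eq algebra_simps)
    then show "T (x + y) = T x + T y" for x y by (simp add: T_def add)
    fix e a assume a: "rapid a"
    have "lift (adelta \<tau>) (act e a) = act (lift (adelta \<tau>) e) a + act e (adelta \<tau> a)"
      by (rule \<phi>_inj) (simp add: \<phi>_lift \<phi>_act \<phi>_add a rapid_adelta adelta_amult[OF \<phi>_rapid a])
    then show "T (act e a) = act (T e) a" by (simp add: T_def leib[OF a] act_diff[OF a])
  qed
  have P_act: "P k (act x a) \<le> P k x * wnorm k a" if "rapid a" for k x a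
    unfolding P_def sum_distrib_right using that
    by (intro sum_mono) (simp add: \<phi>_act wnorm_amult \<phi>_rapid)
  have "v.fred_on nb UNIV (int (card {..<n}) * m.index)"
  proof (rule fred_index)
    show "module_hom sc sc T"
      by unfold_locales (simp_all add: a_linear_add[OF lin] a_linear_act[OF lin] rapid_aconst)
    show "\<exists>C. \<forall>x. P k (T x) \<le> C * P k x" for k
    proof (intro exI allI)
      fix x
      have "T x = T (\<Sum>j<n. act (gen j) (\<phi> x j))" using reconstruction[of x] by simp
      also have "\<dots> = (\<Sum>j<n. act (T (gen j)) (\<phi> x j))"
        unfolding a_linear_sum[OF lin] by (intro sum.cong refl a_linear_act[OF lin] \<phi>_rapid) simp
      finally have "P k (T x) \<le> (\<Sum>j<n. P k (act (T (gen j)) (\<phi> x j)))" using p_sum by simp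
      also have "\<dots> \<le> (\<Sum>j<n. P k (T (gen j)) * P k x)"
      proof (rule sum_mono)
        fix j assume j: "j \<in> {..<n}"
        have "P k (act (T (gen j)) (\<phi> x j)) \<le> P k (T (gen j)) * wnorm k (\<phi> x j)" using j by (intro P_act \<phi>_rapid) simp
        also have "\<dots> \<le> P k (T (gen j)) * P k x" by (intro mult_left_mono q_le_P j p_nonneg)
        finally show "P k (act (T (gen j)) (\<phi> x j)) \<le> P k (T (gen j)) * P k x" .
      qed
      finally show "P k (T x) \<le> (\<Sum>j<n. P k (T (gen j))) * P k x" by (simp add: sum_distrib_right)
    qed
    show "\<phi> (nb e) i = (\<lambda>x. adelta \<tau> (\<phi> e i) x + \<phi> (T e) i x)" if "i \<in> {..<n}" for e i
    proof -
      have "nb e = lift (adelta \<tau>) e + T e" by (simp add: T_def)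
      then show ?thesis using \<phi>_lift[of i e] that \<phi>_add[of "lift (adelta \<tau>) e" "T e" i] by simp
    qed
  qed
  then show ?thesis by (simp add: m.index_def)
qed

lemma hol_module_AN: "hol_module act \<theta> (\<lambda>x y. AN_form \<theta> n (\<phi> x) (\<phi> y)) 0"
proof -
  interpret vspace sc by (rule vspace_sc)
  have form: "AN_form \<theta> n F G = (\<Sum>i<n. aform (F i) (G i))" for F G
    by (simp add: AN_form_def atr_amult_astar)
  show ?thesis
  proof unfold_locales
    show "AN_form \<theta> n (\<phi> (x + y)) (\<phi> z) = AN_form \<theta> n (\<phi> x) (\<phi> z) + AN_form \<theta> n (\<phi> y) (\<phi> z)" for x y z
      unfolding form sum.distrib[symmetric] by (simp add: \<phi>_add aform_add \<phi>_rapid)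
    show "AN_form \<theta> n (\<phi> y) (\<phi> x) = cnj (AN_form \<theta> n (\<phi> x) (\<phi> y))" for x y
      unfolding form cnj_sum by (intro sum.cong refl aform_cnj)
    show "AN_form \<theta> n (\<phi> (act x a)) (\<phi> y) = AN_form \<theta> n (\<phi> x) (\<phi> (act y (astar \<theta> a)))" if a: "rapid a" for x y a
      unfolding form by (intro sum.cong refl) (simp add: \<phi>_act a rapid_astar aform_amult \<phi>_rapid)
    show "x = 0" if 0: "AN_form \<theta> n (\<phi> x) (\<phi> x) = 0" for x
    proof (rule \<phi>_inj)
      fix i assume i: "i < n"
      have "\<forall>i\<in>{..<n}. \<exists>u\<ge>0. aform (\<phi> x i) (\<phi> x i) = complex_of_real u" using aform_definite(1)[OF \<phi>_rapid] by blast
      then obtain u where u: "\<And>i. i < n \<Longrightarrow> u i \<ge> 0" "\<And>i. i < n \<Longrightarrow> aform (\<phi> x i) (\<phi> x i) = complex_of_real (u i)"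
        by (metis lessThan_iff)
      have "AN_form \<theta> n (\<phi> x) (\<phi> x) = complex_of_real (\<Sum>i<n. u i)" by (simp add: form u)
      with 0 have "(\<Sum>i<n. u i) = 0" by (simp only: of_real_eq_0_iff)
      then have "u i = 0" using u(1) i by (subst (asm) sum_nonneg_eq_0_iff) auto
      then show "\<phi> x i = \<phi> 0 i" using aform_definite(2)[OF \<phi>_rapid[OF i]] u(2)[OF i] by (simp add: \<phi>_0)
    qed
    show "fred_on nb UNIV (if Im \<tau> < 0 then 0 else - 0)" if "Im \<tau> \<noteq> 0" "hol_struct \<tau> act nb" for \<tau> nb
      using index_AN[OF that] by simp
  qed (simp add: act_add)
qed

end

theorem theorem2p7:
  fixes \<theta> :: real and \<tau> :: complex
    and act :: "'e::ab_group_add \<Rightarrow> aelt \<Rightarrow> 'e" and nb :: "'e \<Rightarrow> 'e"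
  assumes "\<theta> \<notin> \<rat>" and "Im \<tau> \<noteq> 0"
    and "hol_struct \<tau> act nb"
  shows "(\<forall>d c n \<phi>. c \<noteq> 0 \<and> coprime c d \<and> real_of_int c * \<theta> + real_of_int d > 0 \<and>
           mod_iso act (EN_carrier c n) EN_add (EN_act \<theta> d c) \<phi> \<longrightarrow>
         fin_dim act {e. nb e = 0} \<and> fin_codim act (range nb) \<and>
         (Im \<tau> < 0 \<longrightarrow> int (fdim act {e. nb e = 0}) - int (codim act (range nb)) = int n * c) \<and>
         (\<forall>nbs. (\<forall>e1 e2. EN_form c n (\<phi> (nb e1)) (\<phi> e2) = EN_form c n (\<phi> e1) (\<phi> (nbs e2))) \<longrightarrow>
            orth_decomp (\<lambda>x y. EN_form c n (\<phi> x) (\<phi> y)) {e. nb e = 0} (range nbs) \<and>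
            orth_decomp (\<lambda>x y. EN_form c n (\<phi> x) (\<phi> y)) {e. nbs e = 0} (range nb))) \<and>
       (\<forall>n \<phi>. mod_iso act (AN_carrier n) AN_add (AN_act \<theta>) \<phi> \<longrightarrow>
         fin_dim act {e. nb e = 0} \<and> fin_codim act (range nb) \<and>
         (Im \<tau> < 0 \<longrightarrow> int (fdim act {e. nb e = 0}) - int (codim act (range nb)) = 0) \<and>
         (\<forall>nbs. (\<forall>e1 e2. AN_form \<theta> n (\<phi> (nb e1)) (\<phi> e2) = AN_form \<theta> n (\<phi> e1) (\<phi> (nbs e2))) \<longrightarrow>
            orth_decomp (\<lambda>x y. AN_form \<theta> n (\<phi> x) (\<phi> y)) {e. nb e = 0} (range nbs) \<and>
            orth_decomp (\<lambda>x y. AN_form \<theta> n (\<phi> x) (\<phi> y)) {e. nbs e = 0} (range nb)))"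

proof (intro conjI[of "\<forall>d c n \<phi>. _ d c n \<phi>"] allI impI)
  fix d c n \<phi>
  assume *: "c \<noteq> 0 \<and> coprime c d \<and> real_of_int c * \<theta> + real_of_int d > 0 \<and> mod_iso act (EN_carrier c n) EN_add (EN_act \<theta> d c) \<phi>"
  then interpret EN_module \<theta> d c n act \<phi> by unfold_locales auto
  show "fin_dim act {e. nb e = 0} \<and> fin_codim act (range nb) \<and>
         (Im \<tau> < 0 \<longrightarrow> int (fdim act {e. nb e = 0}) - int (codim act (range nb)) = int n * c) \<and>
         (\<forall>nbs. (\<forall>e1 e2. EN_form c n (\<phi> (nb e1)) (\<phi> e2) = EN_form c n (\<phi> e1) (\<phi> (nbs e2))) \<longrightarrow>
            orth_decomp (\<lambda>x y. EN_form c n (\<phi> x) (\<phi> y)) {e. nb e = 0} (range nbs) \<and>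
            orth_decomp (\<lambda>x y. EN_form c n (\<phi> x) (\<phi> y)) {e. nbs e = 0} (range nb))"
    by (rule hol_module.riemann_roch_hodge[OF hol_module_EN assms(2,3)])
next
  fix n \<phi>
  assume "mod_iso act (AN_carrier n) AN_add (AN_act \<theta>) \<phi>"
  then interpret AN_module \<theta> n act \<phi> by unfold_locales
  show "fin_dim act {e. nb e = 0} \<and> fin_codim act (range nb) \<and>
         (Im \<tau> < 0 \<longrightarrow> int (fdim act {e. nb e = 0}) - int (codim act (range nb)) = 0) \<and>
         (\<forall>nbs. (\<forall>e1 e2. AN_form \<theta> n (\<phi> (nb e1)) (\<phi> e2) = AN_form \<theta> n (\<phi> e1) (\<phi> (nbs e2))) \<longrightarrow>
            orth_decomp (\<lambda>x y. AN_form \<theta> n (\<phi> x) (\<phi> y)) {e. nb e = 0} (range nbs) \<and>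
            orth_decomp (\<lambda>x y. AN_form \<theta> n (\<phi> x) (\<phi> y)) {e. nbs e = 0} (range nb))"
    by (rule hol_module.riemann_roch_hodge[OF hol_module_AN assms(2,3)])
qed

end
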